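(* Let $d,d'$ be positive integers, let $\mu\in M(\mathbb{R}_+,\mathbb{R}^{d\times d})$, and let $\alpha^*,\alpha,\Lambda'',n,N,(\lambda_j)_{j=1}^N,(\beta_j)_{j=1}^N,P_j^*,Q_j^*$ be defined from $\mu$ as in the context. Suppose that $\alpha^*<\alpha$. Let $f\in C([0,\infty);\mathbb{R}^d)$ satisfy $$\int_0^\infty e^{-\alpha t}|f(t)|\,dt<+\infty$$ and let $\Sigma\in C([0,\infty);\mathbb{R}^{d\times d'})$ satisfy $$\int_0^\infty e^{-2\alpha t}\|\Sigma(t)\|^2\,dt<+\infty .$$ Let $X_0$ be an $\mathbb{R}^d$-valued $\mathcal{F}_0$-measurable random variable with $\mathbb{E}|X_0|^2<\infty$, and let $X$ be the unique continuous adapted solution of $$dX(t)=\Big(f(t)+\int_{[0,t]}\mu(ds)\,X(t-s)\Big)dt+\Sigma(t)\,dB(t),\quad t\ge 0,\qquad X(0)=X_0 .$$ Then $$\lim_{t\to\infty}\left(\frac{X(t)}{t^n e^{\alpha t}}-\sum_{j=1}^N\big\{(Q_j^*X_0+M_{1,j})\sin(\beta_j t)+(P_j^*X_0+M_{2,j})\cos(\beta_j t)\big\}\right)=0\quad\text{almost surely,}$$ where $$M_{1,j}=\int_0^\infty e^{-\alpha s}\{P_j^*\sin(\beta_j s)+Q_j^*\cos(\beta_j s)\}\Sigma(s)\,dB(s)+\int_0^\infty e^{-\alpha s}\{P_j^*\sin(\beta_j s)+Q_j^*\cos(\beta_j s)\}f(s)\,ds,$$ $$M_{2,j}=\int_0^\infty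 e^{-\alpha s}\{P_j^*\cos(\beta_j s)-Q_j^*\sin(\beta_j s)\}\Sigma(s)\,dB(s)+\int_0^\infty e^{-\alpha s}\{P_j^*\cos(\beta_j s)-Q_j^*\sin(\beta_j s)\}f(s)\,ds.$$
   Context: $\mathbb{R}_+=[0,\infty)$; $M(\mathbb{R}_+,\mathbb{R}^{d\times d})$ is the space of finite Borel measures on $\mathbb{R}_+$ with values in $\mathbb{R}^{d\times d}$; $|\mu|$ is the (scalar) total variation measure of $\mu$; $|\cdot|$, $\|\cdot\|$ are norms on finite-dimensional spaces (Euclidean / Frobenius); $I_d$ is the identity matrix. $(\Omega,\mathcal{F},P)$ is a complete probability space with filtration $(\mathcal{F}_t)_{t\ge0}$ and $B$ is a standard $d'$-dimensional Brownian motion (with respect to this filtration). Define $\alpha^*=\inf\{a\in\mathbb{R}:\int_{[0,\infty)}e^{-as}|\mu|(ds)<\infty\}$ and, for $\Re(\lambda)>\alpha^*$, $h_\mu(\lambda)=\det\big(\lambda I_d-\int_{[0,\infty)}e^{-\lambda s}\mu(ds)\big)$. Let $\Lambda=\{\lambda\in\mathbb{C}:\Re(\lambda)>\alpha^*,\ h_\mu(\lambda)=0\}$ and $\alpha=\sup\{\Re(\lambda):\lambda\in\Lambda\}$. When $\alpha^*<\alpha$, the set $\Lambda'=\{\lambda\in\Lambda:\Re(\lambda)=\alpha\}$ is finite and nonempty. Let $\Lambda''=\{\lambda\in\Lambda:\Re(\lambda)=\alpha,\ \Im(\lambda)\ge0\}$. The order of $\lambda_0\in\Lambda''$ is its order as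 a pole of the matrix-valued function $\lambda\mapsto\big[\lambda I_d-\int_{[0,\infty)}e^{-\lambda s}\mu(ds)\big]^{-1}$. Let $n\ge 0$ be the integer such that $n+1$ is the highest order of all elements of $\Lambda''$, let $\lambda_1,\dots,\lambda_N$ be the finitely many elements of $\Lambda''$ having this order, and let $\beta_j=\Im(\lambda_j)$. For each $j$, the Laurent expansion about $\lambda_j$ is $$\Big[\lambda I_d-\int_{[0,\infty)}e^{-\lambda s}\mu(ds)\Big]^{-1}=\sum_{m=0}^n\frac{m!\,K_{j,m}}{(\lambda-\lambda_j)^{m+1}}+\hat q_j(\lambda),$$ with $\hat q_j$ analytic at $\lambda_j$. If $\lambda_j$ is real, put $P_j^*=K_{j,n}$ (and $Q_j^*=0$; its value is immaterial since $\beta_j=0$); otherwise put $P_j^*=2\Re(K_{j,n})$ and $Q_j^*=-2\Im(K_{j,n})$ (real and imaginary parts entrywise). *)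

theory Defs
  imports "HOL-Probability.Probability" "HOL-Complex_Analysis.Complex_Analysis"
begin

section \<open>Matrix-valued measures on the half-line\<close>

text \<open>A matrix-valued measure is a countably additive set function on the Borel subsets of
  \<open>[0,\<infinity>)\<close>; its values on other sets are never used.\<close>

abbreviation halfline_sets :: "real set set" where
  "halfline_sets \<equiv> sets (restrict_space borel {0..})"

definition matrix_measure :: "(real set \<Rightarrow> real^'n^'m) \<Rightarrow> bool" where
  "matrix_measure \<mu> \<longleftrightarrow>
     (\<forall>A :: nat \<Rightarrow> real set. range A \<subseteq> halfline_sets \<and> disjoint_family A \<longrightarrow>
        (\<lambda>i. \<mu> (A i)) sums \<mu> (\<Union>i. A i))"

text \<open>The norm of the type \<open>real^'n^'m\<close> is the Frobenius norm.\<close>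

definition total_variation :: "(real set \<Rightarrow> real^'n^'m) \<Rightarrow> real measure" where
  "total_variation \<mu> = measure_of {0..} halfline_sets
     (\<lambda>E. \<Squnion>P \<in> {P. finite P \<and> disjoint P \<and> P \<subseteq> halfline_sets \<and> \<Union>P = E}.
            \<Sum>A\<in>P. ennreal (norm (\<mu> A)))"

text \<open>Upper variation of a scalar signed measure (the positive part of its Jordan
  decomposition); \<open>ennreal\<close> maps negative values to \<open>0\<close>.\<close>

definition upper_variation :: "(real set \<Rightarrow> real) \<Rightarrow> real measure" where
  "upper_variation \<nu> = measure_of {0..} halfline_sets
     (\<lambda>E. \<Squnion>A \<in> {A \<in> halfline_sets. A \<subseteq> E}. ennreal (\<nu> A))"

definition signed_integral ::
    "(real set \<Rightarrow> real) \<Rightarrow> (real \<Rightarrow> 'b::{banach, second_countable_topology}) \<Rightarrow> 'b" where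
  "signed_integral \<nu> g =
     (LINT s|upper_variation \<nu>. g s) - (LINT s|upper_variation (\<lambda>E. - \<nu> E). g s)"

text \<open>\<open>\<integral>\<^bsub>[0,t]\<^esub> \<mu>(ds) x(t - s)\<close>\<close>

definition delay_term ::
    "(real set \<Rightarrow> real^'n^'m) \<Rightarrow> (real \<Rightarrow> real^'n) \<Rightarrow> real \<Rightarrow> real^'m" where
  "delay_term \<mu> x t =
     (\<chi> i. \<Sum>j\<in>UNIV. signed_integral (\<lambda>E. \<mu> E $ i $ j) (\<lambda>s. indicator {0..t} s *\<^sub>R (x (t - s) $ j)))"

section \<open>The characteristic equation\<close>

definition laplace_abscissa :: "(real set \<Rightarrow> real^'d^'d) \<Rightarrow> ereal" where
  "laplace_abscissa \<mu> =
     Inf (ereal ` {a. (\<integral>\<^sup>+ s. ennreal (exp (- a * s)) \<partial>total_variation \<mu>) < \<infinity>})"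

definition char_matrix :: "(real set \<Rightarrow> real^'d^'d) \<Rightarrow> complex \<Rightarrow> complex^'d^'d" where
  "char_matrix \<mu> z =
     mat z - (\<chi> i j. signed_integral (\<lambda>E. \<mu> E $ i $ j) (\<lambda>s. exp (- z * complex_of_real s)))"

definition char_roots :: "(real set \<Rightarrow> real^'d^'d) \<Rightarrow> complex set" where
  "char_roots \<mu> = {z. laplace_abscissa \<mu> < ereal (Re z) \<and> det (char_matrix \<mu> z) = 0}"

definition spectral_abscissa :: "(real set \<Rightarrow> real^'d^'d) \<Rightarrow> ereal" where
  "spectral_abscissa \<mu> = Sup ((\<lambda>z. ereal (Re z)) ` char_roots \<mu>)"

definition upper_dominant_roots :: "(real set \<Rightarrow> real^'d^'d) \<Rightarrow> complex set" where
  "upper_dominant_roots \<mu> =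
     {z \<in> char_roots \<mu>. ereal (Re z) = spectral_abscissa \<mu> \<and> 0 \<le> Im z}"

definition matrix_pole_order :: "(complex \<Rightarrow> complex^'n^'m) \<Rightarrow> complex \<Rightarrow> nat" where
  "matrix_pole_order G z0 =
     (LEAST k. \<forall>i j. \<exists>g. g analytic_on {z0} \<and>
        (\<forall>\<^sub>F z in at z0. G z $ i $ j = g z / (z - z0) ^ k))"

definition root_order :: "(real set \<Rightarrow> real^'d^'d) \<Rightarrow> complex \<Rightarrow> nat" where
  "root_order \<mu> = matrix_pole_order (\<lambda>z. matrix_inv (char_matrix \<mu> z))"

definition max_root_order :: "(real set \<Rightarrow> real^'d^'d) \<Rightarrow> nat" where
  "max_root_order \<mu> = Max (root_order \<mu> ` upper_dominant_roots \<mu>)"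

definition leading_roots :: "(real set \<Rightarrow> real^'d^'d) \<Rightarrow> complex set" where
  "leading_roots \<mu> = {z \<in> upper_dominant_roots \<mu>. root_order \<mu> z = max_root_order \<mu>}"

text \<open>The matrix \<open>K\<close> such that \<open>m! K\<close> is the coefficient of \<open>(z - z0)\<^bsup>-(m+1)\<^esup>\<close> in the Laurent
  expansion of the inverse characteristic matrix about \<open>z0\<close>.\<close>

definition laurent_matrix :: "(real set \<Rightarrow> real^'d^'d) \<Rightarrow> complex \<Rightarrow> nat \<Rightarrow> complex^'d^'d" where
  "laurent_matrix \<mu> z0 m =
     (\<chi> i j. fls_nth (laurent_expansion (\<lambda>z. matrix_inv (char_matrix \<mu> z) $ i $ j) z0) (- int (m + 1))
              / fact m)"

text \<open>At a real root the matrix \<open>K\<close> is itself real, so taking \<open>Re\<close> there only changes the type.\<close>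

definition P_star :: "(real set \<Rightarrow> real^'d^'d) \<Rightarrow> nat \<Rightarrow> complex \<Rightarrow> real^'d^'d" where
  "P_star \<mu> n z =
     (if Im z = 0 then (\<chi> i j. Re (laurent_matrix \<mu> z n $ i $ j))
      else (\<chi> i j. 2 * Re (laurent_matrix \<mu> z n $ i $ j)))"

definition Q_star :: "(real set \<Rightarrow> real^'d^'d) \<Rightarrow> nat \<Rightarrow> complex \<Rightarrow> real^'d^'d" where
  "Q_star \<mu> n z =
     (if Im z = 0 then 0 else (\<chi> i j. - 2 * Im (laurent_matrix \<mu> z n $ i $ j)))"

section \<open>Brownian motion and the Ito integral\<close>

text \<open>Time is \<open>[0,\<infinity>)\<close>; processes and filtrations are indexed by \<open>real\<close>, and negative indices
  are ignored.\<close>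

definition time_filtration :: "'a measure \<Rightarrow> (real \<Rightarrow> 'a measure) \<Rightarrow> bool" where
  "time_filtration M F \<longleftrightarrow>
     (\<forall>t\<ge>0. subalgebra M (F t)) \<and> (\<forall>s t. 0 \<le> s \<and> s \<le> t \<longrightarrow> subalgebra (F t) (F s))"

definition brownian_motion ::
    "'a measure \<Rightarrow> (real \<Rightarrow> 'a measure) \<Rightarrow> (real \<Rightarrow> 'a \<Rightarrow> real^'e) \<Rightarrow> bool" where
  "brownian_motion M F B \<longleftrightarrow>
     (\<forall>t\<ge>0. B t \<in> borel_measurable (F t)) \<and>
     (AE \<omega> in M. B 0 \<omega> = 0) \<and>
     (AE \<omega> in M. continuous_on {0..} (\<lambda>t. B t \<omega>)) \<and>
     (\<forall>s t. 0 \<le> s \<and> s < t \<longrightarrow>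
        prob_space.indep_set M (sets (F s))
          (sets (vimage_algebra (space M) (\<lambda>\<omega>. B t \<omega> - B s \<omega>) borel)) \<and>
        prob_space.indep_vars M (\<lambda>_. borel) (\<lambda>k \<omega>. (B t \<omega> - B s \<omega>) $ k) UNIV \<and>
        (\<forall>k. distributed M lborel (\<lambda>\<omega>. (B t \<omega> - B s \<omega>) $ k) (normal_density 0 (sqrt (t - s)))))"

text \<open>A simple process is given by grid points \<open>\<tau> 0 \<le> \<dots> \<le> \<tau> N\<close> in the time interval \<open>T\<close> and
  bounded matrices \<open>\<xi> i\<close> known at time \<open>\<tau> i\<close>; it equals \<open>\<xi> i\<close> on \<open>(\<tau> i, \<tau> (i+1)]\<close>.\<close>

definition simple_process ::
    "'a measure \<Rightarrow> (real \<Rightarrow> 'a measure) \<Rightarrow> real set \<Rightarrow> nat \<Rightarrow> (nat \<Rightarrow> real) \<Rightarrow>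
     (nat \<Rightarrow> 'a \<Rightarrow> real^'e^'d) \<Rightarrow> bool" where
  "simple_process M F T N \<tau> \<xi> \<longleftrightarrow>
     (\<forall>i\<le>N. \<tau> i \<in> T) \<and>
     (\<forall>i<N. \<tau> i \<le> \<tau> (Suc i) \<and> \<xi> i \<in> borel_measurable (F (\<tau> i)) \<and> bounded (\<xi> i ` space M))"

definition simple_value ::
    "nat \<Rightarrow> (nat \<Rightarrow> real) \<Rightarrow> (nat \<Rightarrow> 'a \<Rightarrow> real^'e^'d) \<Rightarrow> real \<Rightarrow> 'a \<Rightarrow> real^'e^'d" where
  "simple_value N \<tau> \<xi> s \<omega> = (\<Sum>i<N. indicator {\<tau> i<..\<tau> (Suc i)} s *\<^sub>R \<xi> i \<omega>)"

definition simple_ito ::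
    "(real \<Rightarrow> 'a \<Rightarrow> real^'e) \<Rightarrow> nat \<Rightarrow> (nat \<Rightarrow> real) \<Rightarrow> (nat \<Rightarrow> 'a \<Rightarrow> real^'e^'d) \<Rightarrow> 'a \<Rightarrow> real^'d" where
  "simple_ito B N \<tau> \<xi> \<omega> = (\<Sum>i<N. \<xi> i \<omega> *v (B (\<tau> (Suc i)) \<omega> - B (\<tau> i) \<omega>))"

definition ito_integrand ::
    "'a measure \<Rightarrow> (real \<Rightarrow> 'a measure) \<Rightarrow> real set \<Rightarrow> (real \<Rightarrow> 'a \<Rightarrow> real^'e^'d) \<Rightarrow> bool" where
  "ito_integrand M F T H \<longleftrightarrow>
     (\<lambda>(s, \<omega>). indicator T s *\<^sub>R H s \<omega>) \<in> borel_measurable (borel \<Otimes>\<^sub>M M) \<and>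
     (\<forall>s\<in>T. H s \<in> borel_measurable (F s)) \<and>
     (\<integral>\<^sup>+ \<omega>. (\<integral>\<^sup>+ s\<in>T. ennreal ((norm (H s \<omega>))\<^sup>2) \<partial>lborel) \<partial>M) < \<infinity>"

text \<open>\<open>T\<close> is meant to be an interval contained in \<open>[0,\<infinity>)\<close>: \<open>{0..t}\<close> for \<open>\<integral>\<^sub>0\<^sup>t H dB\<close>, and
  \<open>{0..}\<close> for \<open>\<integral>\<^sub>0\<^sup>\<infinity> H dB\<close>.\<close>

definition has_ito_integral ::
    "'a measure \<Rightarrow> (real \<Rightarrow> 'a measure) \<Rightarrow> (real \<Rightarrow> 'a \<Rightarrow> real^'e) \<Rightarrow> real set \<Rightarrow>
     (real \<Rightarrow> 'a \<Rightarrow> real^'e^'d) \<Rightarrow> ('a \<Rightarrow> real^'d) \<Rightarrow> bool" where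
  "has_ito_integral M F B T H I \<longleftrightarrow>
     ito_integrand M F T H \<and> I \<in> borel_measurable M \<and>
     (\<exists>N \<tau> \<xi>. (\<forall>k::nat. simple_process M F T (N k) (\<tau> k) (\<xi> k)) \<and>
        ((\<lambda>k. \<integral>\<^sup>+ \<omega>. (\<integral>\<^sup>+ s\<in>T. ennreal ((norm (simple_value (N k) (\<tau> k) (\<xi> k) s \<omega> - H s \<omega>))\<^sup>2)
                 \<partial>lborel) \<partial>M) \<longlonglongrightarrow> 0) \<and>
        ((\<lambda>k. \<integral>\<^sup>+ \<omega>. ennreal ((norm (simple_ito B (N k) (\<tau> k) (\<xi> k) \<omega> - I \<omega>))\<^sup>2) \<partial>M) \<longlonglongrightarrow> 0))"

text \<open>By the Ito isometry the integral exists for every \<open>ito_integrand\<close> and is determined up to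
  almost sure equality; the following picks one version.\<close>

definition ito_integral ::
    "'a measure \<Rightarrow> (real \<Rightarrow> 'a measure) \<Rightarrow> (real \<Rightarrow> 'a \<Rightarrow> real^'e) \<Rightarrow> real set \<Rightarrow>
     (real \<Rightarrow> 'a \<Rightarrow> real^'e^'d) \<Rightarrow> 'a \<Rightarrow> real^'d" where
  "ito_integral M F B T H = (SOME I. has_ito_integral M F B T H I)"

section \<open>The stochastic functional differential equation\<close>

text \<open>The integral equation is required almost surely for each \<open>t\<close>, since \<open>ito_integral\<close> selects
  its version separately for each \<open>t\<close>.\<close>

definition sfde_solution ::
    "'a measure \<Rightarrow> (real \<Rightarrow> 'a measure) \<Rightarrow> (real \<Rightarrow> 'a \<Rightarrow> real^'e) \<Rightarrow> (real set \<Rightarrow> real^'d^'d) \<Rightarrow>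
     (real \<Rightarrow> real^'d) \<Rightarrow> (real \<Rightarrow> real^'e^'d) \<Rightarrow> ('a \<Rightarrow> real^'d) \<Rightarrow> (real \<Rightarrow> 'a \<Rightarrow> real^'d) \<Rightarrow> bool" where
  "sfde_solution M F B \<mu> f \<Sigma> X0 X \<longleftrightarrow>
     (\<forall>t\<ge>0. X t \<in> borel_measurable (F t)) \<and>
     (AE \<omega> in M. continuous_on {0..} (\<lambda>t. X t \<omega>)) \<and>
     (AE \<omega> in M. X 0 \<omega> = X0 \<omega>) \<and>
     (\<forall>t\<ge>0. AE \<omega> in M.
        X t \<omega> = X0 \<omega> + (LINT u:{0..t}|lborel. f u + delay_term \<mu> (\<lambda>s. X s \<omega>) u)
                + ito_integral M F B {0..t} (\<lambda>s _. \<Sigma> s) \<omega>)"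

end

theory Submission
  imports Defs
begin

text \<open>Subtracting the drift from the path leaves a continuous version \<open>Y\<close> of \<open>\<integral> \<Sigma> dB\<close>, and the
  equation becomes a Volterra equation for each path, forced by \<open>g = X0 + \<integral> f + Y\<close>. For
  \<open>Re l = \<alpha>\<close> the weighted forcing \<open>exp (-l t) g(t) + l \<integral>\<^sub>0\<^sup>t exp (-l s) g(s) ds\<close> converges almost
  surely: integration by parts turns its stochastic part into \<open>\<integral>\<^sub>0\<^sup>t exp (-l s) \<Sigma>(s) dB(s)\<close>, which
  converges by Kolmogorov's inequality. The inverse characteristic matrix is the sum of its
  principal parts at the dominant roots and a function that is holomorphic in a larger half-plane
  and decays there; smoothing by \<open>exp (p t)\<close> with \<open>p < \<alpha>\<close> makes the inverse Laplace transform
  of the remainder absolutely convergent. Uniqueness of Laplace transforms then expresses the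
  solution by convolutions of the weighted forcings, and only the principal parts of order
  \<open>n + 1\<close> survive division by \<open>t\<^sup>n exp (\<alpha> t)\<close>. Pairing conjugate roots gives the real form.\<close>

section \<open>Variation measures\<close>

text \<open>Three difficulties fix the shape of the argument. The inverse characteristic matrix is
  only \<open>O(1 / norm z)\<close>, which does not give an absolutely convergent inversion
  integral; so the asymptotics are found for the solution convolved twice with
  \<open>exp (p t)\<close>. The smoothing is then undone without differentiation: on the transform
  side \<open>w - p\<close> times the solution is the forcing plus the delay operator minus
  \<open>p\<close>, by the equation itself, and on coefficients at a root this operator is
  multiplication by \<open>l - p\<close>. Next, \<open>f\<close> and \<open>\<Sigma>\<close> are
  controlled only through weighted integrals and need not be exponentially bounded, so neither is
  transformed; only the integrated forcing is, and its exponential bound is deduced from convergence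
  of the weighted forcing at the real point \<alpha>. For this reason \<alpha> is treated along with
  the dominant roots even when it is no root. Finally, stochastic integrals are fixed only almost
  surely at each time. The residual process \<open>Y\<close> is continuous by construction, so
  limits are proved on countable grids and carried over to all times by continuity.\<close>

lemma sets_sigma_halfline: "sigma_algebra {0..} halfline_sets"
 using sets.sigma_algebra_axioms[of "restrict_space borel {0::real..}"] by (simp add: space_restrict_space)

text \<open>Both variation measures are instances: \<open>w\<close> is \<open>norm (\<mu> A)\<close>
  for the total variation and the truncated value \<open>ennreal (\<nu> A)\<close> for the upper
  variation.\<close>

definition partition_sup :: "(real set => ennreal) => real set => ennreal" where
 "partition_sup w E = (\<Squnion>P \<in> {P. finite P \<and> disjoint P \<and> P \<subseteq> halfline_sets \<and> \<Union>P = E}. \<Sum>A\<in>P. w A)"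

text \<open>Uniting partitions of disjoint sets makes the supremum superadditive, which bounds every
  finite and then the infinite sum by the value on the union. For the other inequality a partition
  of the union is cut along the sets \<open>E i\<close>, and countable subadditivity of
  \<open>w\<close> pays for the cut; subadditivity is all that norms and positive parts can
  offer.\<close>

lemma partition_sup_measure:
 assumes w0: "w {} = 0"
  and w: "!!A :: nat => real set. range A \<subseteq> halfline_sets ==> disjoint_family A ==> w (\<Union>i. A i) <= (\<Sum>i. w (A i))"
 shows "countably_additive halfline_sets (partition_sup w)"
proof (rule countably_additiveI)
 fix E :: "nat => real set"
 assume E: "range E \<subseteq> halfline_sets" and d: "disjoint_family E" and UE: "(\<Union>i. E i) \<in> halfline_sets"
 interpret S: sigma_algebra "{0..}" halfline_sets by (rule sets_sigma_halfline)
 let ?V = "partition_sup w"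
 let ?Pt = "%E. {P. finite P \<and> disjoint P \<and> P \<subseteq> halfline_sets \<and> \<Union>P = E}"
 have super: "?V X + ?V Y <= ?V (X \<union> Y)" if XY: "X \<inter> Y = {}" "X \<in> halfline_sets" "Y \<in> halfline_sets" for X Y
 proof -
  have "(\<Sum>A\<in>P. w A) + (\<Sum>A\<in>Q. w A) <= ?V (X \<union> Y)" if P: "P \<in> ?Pt X" and Q: "Q \<in> ?Pt Y" for P Q
  proof -
   \<comment> \<open>Two partitions of disjoint sets can share only the empty cell, and
     \<open>w {} = 0\<close>, so no cell is counted twice.\<close>
   have PQ: "P \<inter> Q \<subseteq> {{}}" using P Q XY(1) by auto
   have "(\<Sum>A\<in>P. w A) + (\<Sum>A\<in>Q. w A) = (\<Sum>A\<in>P \<union> Q. w A) + (\<Sum>A\<in>P \<inter> Q. w A)"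
    using P Q by (simp add: sum.union_inter)
   also have "(\<Sum>A\<in>P \<inter> Q. w A) = 0" by (rule sum.neutral) (use PQ w0 in auto)
   also have "(\<Sum>A\<in>P \<union> Q. w A) + 0 <= ?V (X \<union> Y)"
    unfolding partition_sup_def add_0_right
   proof (rule SUP_upper, intro CollectI conjI)
    have "A \<inter> B = {}" if "A \<in> P \<union> Q" "B \<in> P \<union> Q" "A \<noteq> B" for A B
    proof -
     have "A \<inter> B = {}" if "A \<in> P" "B \<in> Q" for A B using that P Q XY(1) by auto
     moreover have "A \<in> R ==> B \<in> R ==> A \<inter> B = {}" if "R = P \<or> R = Q" for R
      using that P Q \<open>A \<noteq> B\<close> by (auto dest: disjointD)
     ultimately show ?thesis using that by blast
    qed
    then show "disjoint (P \<union> Q)" by (simp add: disjoint_def)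
   qed (use P Q in auto)
   finally show ?thesis .
  qed
  note le = this
  have ne: "?Pt Z \<noteq> {}" if "Z \<in> halfline_sets" for Z
  proof -
   have "{Z} \<in> ?Pt Z" using that by (auto simp: disjoint_def)
   then show ?thesis by blast
  qed
  have "(\<Sum>A\<in>P. w A) + ?V Y <= ?V (X \<union> Y)" if "P \<in> ?Pt X" for P
   unfolding partition_sup_def[of w Y] ennreal_SUP_add_right[OF ne[OF XY(3)]]
   by (intro SUP_least le that)
  then show ?thesis
   unfolding partition_sup_def[of w X] ennreal_SUP_add_left[OF ne[OF XY(2)], symmetric]
   by (intro SUP_least)
 qed
 have mono: "?V X <= ?V Y" if "X \<subseteq> Y" "X \<in> halfline_sets" "Y \<in> halfline_sets" for X Y
 proof -
  have "?V X + ?V (Y - X) <= ?V (X \<union> (Y - X))" using that by (intro super) auto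
  moreover have "X \<union> (Y - X) = Y" using that by auto
  ultimately show ?thesis by (metis le_iff_add order_trans)
 qed
 show "(\<Sum>i. ?V (E i)) = ?V (\<Union>i. E i)"
 proof (rule antisym)
  have fin: "(\<Sum>i<n. ?V (E i)) <= ?V (\<Union>i<n. E i)" for n
  proof (induction n)
   case 0 then show ?case by simp
  next
   case (Suc n)
   have "?V (\<Union>i<n. E i) + ?V (E n) <= ?V ((\<Union>i<n. E i) \<union> E n)"
   proof (intro super)
    have "E i \<inter> E n = {}" if "i < n" for i using d that by (auto simp: disjoint_family_on_def)
    then show "(\<Union>i<n. E i) \<inter> E n = {}" by auto
   qed (use E in auto)
   moreover have "(\<Union>i<n. E i) \<union> E n = (\<Union>i<Suc n. E i)" by (auto simp: less_Suc_eq)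
   ultimately show ?case using Suc by (simp add: order_trans[OF add_right_mono])
  qed
  have "(\<Sum>i<n. ?V (E i)) <= ?V (\<Union>i. E i)" for n
   by (rule order_trans[OF fin mono]) (use E UE in auto)
  then show "(\<Sum>i. ?V (E i)) <= ?V (\<Union>i. E i)"
   by (auto simp: suminf_eq_SUP intro!: SUP_least)
 next
  show "?V (\<Union>i. E i) <= (\<Sum>i. ?V (E i))"
   unfolding partition_sup_def[of w "\<Union>i. E i"]
  proof (intro SUP_least)
   fix P assume P: "P \<in> ?Pt (\<Union>i. E i)"
   have "w A <= (\<Sum>i. w (A \<inter> E i))" if "A \<in> P" for A
   proof -
    have "A = (\<Union>i. A \<inter> E i)" using P that by auto
    moreover have "w (\<Union>i. A \<inter> E i) <= (\<Sum>i. w (A \<inter> E i))"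
     using P that E d by (intro w) (auto simp: disjoint_family_on_def)
    ultimately show ?thesis by simp
   qed
   then have "(\<Sum>A\<in>P. w A) <= (\<Sum>A\<in>P. \<Sum>i. w (A \<inter> E i))" by (intro sum_mono)
   also have "... = (\<Sum>i. \<Sum>A\<in>P. w (A \<inter> E i))" by (simp add: suminf_sum)
   also have "... <= (\<Sum>i. ?V (E i))"
   proof (intro suminf_le)
    fix i
    let ?Q = "(%A. A \<inter> E i) ` P"
    have "(\<Sum>A\<in>P. w (A \<inter> E i)) = (\<Sum>A\<in>?Q. w A)"
    \<comment> \<open>Distinct cells of \<open>P\<close> are disjoint, so cells with equal trace on
      \<open>E i\<close> have empty trace and weight \<open>0\<close>; merging them changes
      nothing.\<close>
    proof (rule sum.reindex_nontrivial[symmetric, unfolded comp_def])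
     show "finite P" using P by simp
     fix A B assume "A \<in> P" "B \<in> P" "A \<noteq> B" "A \<inter> E i = B \<inter> E i"
     moreover then have "A \<inter> B = {}" using P by (auto simp: disjoint_def)
     ultimately have "A \<inter> E i = {}" by auto
     then show "w (A \<inter> E i) = 0" using w0 by simp
    qed
    also have "... <= ?V (E i)"
     unfolding partition_sup_def
    proof (rule SUP_upper, safe)
     show "finite ?Q" using P by simp
     show "disjoint ?Q" using P by (fastforce simp: disjoint_def)
     show "A \<inter> E i \<in> halfline_sets" if "A \<in> P" for A using P E that by auto
     fix x assume "x \<in> E i" then have "x \<in> \<Union>P" using P by auto
     then show "x \<in> \<Union>?Q" using \<open>x \<in> E i\<close> by auto
    qed
    finally show "(\<Sum>A\<in>P. w (A \<inter> E i)) <= ?V (E i)" .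
   qed auto
   finally show "(\<Sum>A\<in>P. w A) <= (\<Sum>i. ?V (E i))" .
  qed
 qed
qed

lemma partition_sup_positive: "w {} = 0 ==> positive halfline_sets (partition_sup w)"
proof -
 assume w0: "w {} = 0"
 have "(\<Sum>A\<in>P. w A) = 0" if "\<Union>P = {}" for P
  by (rule sum.neutral) (use that w0 in auto)
 then show ?thesis unfolding positive_def partition_sup_def
  by (auto intro!: antisym SUP_least)
qed

lemma emeasure_partition_sup:
 assumes "w {} = 0"
  and "!!A :: nat => real set. range A \<subseteq> halfline_sets ==> disjoint_family A ==> w (\<Union>i. A i) <= (\<Sum>i. w (A i))"
  and "N = measure_of {0..} halfline_sets (partition_sup w)"
  and "E \<in> halfline_sets"
 shows "emeasure N E = partition_sup w E"
 using emeasure_measure_of_sigma[OF sets_sigma_halfline partition_sup_positive partition_sup_measure] assms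
 by blast

lemma ennreal_norm_sums_le:
 fixes f :: "nat => 'b::real_normed_vector"
 assumes "f sums s"
 shows "ennreal (norm s) <= (\<Sum>i. ennreal (norm (f i)))"
proof (rule LIMSEQ_le_const2)
 show "(%n. ennreal (norm (\<Sum>i<n. f i))) \<longlonglongrightarrow> ennreal (norm s)"
  using assms unfolding sums_def by (intro tendsto_ennrealI tendsto_norm)
 have "ennreal (norm (\<Sum>i<n. f i)) <= (\<Sum>i<n. ennreal (norm (f i)))" for n
  by (subst sum_ennreal) (auto intro!: ennreal_leI norm_sum)
 also have "!!n. (\<Sum>i<n. ennreal (norm (f i))) <= (\<Sum>i. ennreal (norm (f i)))"
  by (rule sum_le_suminf) auto
 finally show "\<exists>N. \<forall>n\<ge>N. ennreal (norm (\<Sum>i<n. f i)) <= (\<Sum>i. ennreal (norm (f i)))"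
  by (blast intro: order_trans)
qed

lemma ennreal_sums_le:
 fixes f :: "nat => real"
 assumes "f sums s"
 shows "ennreal s <= (\<Sum>i. ennreal (f i))"
proof (rule LIMSEQ_le_const2)
 show "(%n. ennreal (\<Sum>i<n. f i)) \<longlonglongrightarrow> ennreal s"
  using assms unfolding sums_def by (intro tendsto_ennrealI)
 have "ennreal (\<Sum>i<n. f i) <= (\<Sum>i<n. ennreal (f i))" for n
 proof -
  have "ennreal (\<Sum>i<n. f i) <= ennreal (\<Sum>i<n. max 0 (f i))" by (intro ennreal_leI sum_mono) auto
  also have "... = (\<Sum>i<n. ennreal (max 0 (f i)))" by (subst sum_ennreal) auto
  also have "... = (\<Sum>i<n. ennreal (f i))" by (simp add: ennreal_max_0)
  finally show ?thesis .
 qed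
 also have "!!n. (\<Sum>i<n. ennreal (f i)) <= (\<Sum>i. ennreal (f i))"
  by (rule sum_le_suminf) auto
 finally show "\<exists>N. \<forall>n\<ge>N. ennreal (\<Sum>i<n. f i) <= (\<Sum>i. ennreal (f i))"
  by (blast intro: order_trans)
qed

lemma matrix_measure_empty: "matrix_measure \<mu> ==> \<mu> {} = 0"
proof -
 assume "matrix_measure \<mu>"
 then have "(%i::nat. \<mu> {}) sums \<mu> (\<Union>i::nat. {})"
  unfolding matrix_measure_def by (elim allE[of _ "%i. {}"]) (auto simp: disjoint_family_on_def)
 then have "(%i::nat. \<mu> {}) sums \<mu> {}" by simp
 then have "(%i::nat. \<mu> {}) \<longlonglongrightarrow> 0" using sums_summable summable_LIMSEQ_zero by blast
 then show ?thesis using LIMSEQ_unique tendsto_const by blast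
qed

lemma emeasure_total_variation:
 assumes mu: "matrix_measure \<mu>" and E: "E \<in> halfline_sets"
 shows "emeasure (total_variation \<mu>) E = partition_sup (%A. ennreal (norm (\<mu> A))) E"
proof (rule emeasure_partition_sup[OF _ _ _ E])
 show "ennreal (norm (\<mu> {})) = 0" using matrix_measure_empty[OF mu] by simp
 show "ennreal (norm (\<mu> (\<Union>i. A i))) <= (\<Sum>i. ennreal (norm (\<mu> (A i))))"
  if "range A \<subseteq> halfline_sets" "disjoint_family A" for A
  by (rule ennreal_norm_sums_le) (use mu that in \<open>auto simp: matrix_measure_def\<close>)
 show "total_variation \<mu> = measure_of {0..} halfline_sets (partition_sup (%A. ennreal (norm (\<mu> A))))"
  unfolding total_variation_def partition_sup_def ..
qed

text \<open>The left side uses single subsets, as in \<open>upper_variation\<close>, the right side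
  partitions. A subset \<open>A\<close> competes through the partition \<open>{A, E - A}\<close>;
  conversely, cells of negative value contribute \<open>0\<close> after \<open>ennreal\<close>, and
  by additivity the others merge into one subset.\<close>

lemma upper_variation_eq:
 assumes nu: "!!A :: nat => real set. range A \<subseteq> halfline_sets ==> disjoint_family A ==> (%i. \<nu> (A i)) sums \<nu> (\<Union>i. A i)"
  and nu0: "\<nu> {} = (0::real)" and E: "E \<in> halfline_sets"
 shows "(\<Squnion>A \<in> {A \<in> halfline_sets. A \<subseteq> E}. ennreal (\<nu> A)) = partition_sup (%A. ennreal (\<nu> A)) E"
proof (rule antisym)
 interpret S: sigma_algebra "{0..}" halfline_sets by (rule sets_sigma_halfline)
 have add2: "\<nu> (A \<union> B) = \<nu> A + \<nu> B" if "A \<in> halfline_sets" "B \<in> halfline_sets" "A \<inter> B = {}" for A B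
 proof -
  have "(%i. \<nu> (binaryset A B i)) sums \<nu> (\<Union>i. binaryset A B i)"
   using that by (intro nu) (auto simp: range_binaryset_eq disjoint_family_on_def binaryset_def)
  moreover have "(%i. \<nu> (binaryset A B i)) sums (\<nu> A + \<nu> B)"
   by (rule binaryset_sums[of \<nu>, OF nu0])
  ultimately show ?thesis by (simp add: UN_binaryset_eq sums_iff)
 qed
 show "(\<Squnion>A \<in> {A \<in> halfline_sets. A \<subseteq> E}. ennreal (\<nu> A)) <= partition_sup (%A. ennreal (\<nu> A)) E"
 proof (intro SUP_least)
  fix A assume A: "A \<in> {A \<in> halfline_sets. A \<subseteq> E}"
  have "ennreal (\<nu> A) <= (\<Sum>A\<in>{A, E - A}. ennreal (\<nu> A))"
   by (rule member_le_sum) auto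
  also have "... <= partition_sup (%A. ennreal (\<nu> A)) E"
   unfolding partition_sup_def using A E by (intro SUP_upper) (auto simp: disjoint_def)
  finally show "ennreal (\<nu> A) <= partition_sup (%A. ennreal (\<nu> A)) E" .
 qed
 show "partition_sup (%A. ennreal (\<nu> A)) E <= (\<Squnion>A \<in> {A \<in> halfline_sets. A \<subseteq> E}. ennreal (\<nu> A))"
  unfolding partition_sup_def
 proof (intro SUP_least)
  fix P assume P: "P \<in> {P. finite P \<and> disjoint P \<and> P \<subseteq> halfline_sets \<and> \<Union>P = E}"
  have fa: "(\<Sum>A\<in>Q. \<nu> A) = \<nu> (\<Union>Q)" if "finite Q" "disjoint Q" "Q \<subseteq> halfline_sets" for Q
   using that
  proof (induction Q)
   case (insert A Q)
   have "\<Union>Q \<in> halfline_sets" using insert by (intro sets.finite_Union) auto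
   moreover have "A \<inter> \<Union>Q = {}" using insert by (auto simp: disjoint_def)
   ultimately show ?case using insert add2[of A "\<Union>Q"] by (auto simp: pairwise_insert)
  qed (simp add: nu0)
  let ?Q = "{A \<in> P. \<nu> A >= 0}"
  have "(\<Sum>A\<in>P. ennreal (\<nu> A)) = (\<Sum>A\<in>?Q. ennreal (\<nu> A))"
   using P by (intro sum.mono_neutral_right) (auto simp: ennreal_eq_0_iff)
  also have "... = ennreal (\<nu> (\<Union>?Q))"
   using P by (subst sum_ennreal) (auto intro!: arg_cong[of _ _ ennreal] fa simp: disjoint_def)
  also have "... <= (\<Squnion>A \<in> {A \<in> halfline_sets. A \<subseteq> E}. ennreal (\<nu> A))"
   using P by (intro SUP_upper) (auto intro!: sets.finite_Union)
  finally show "(\<Sum>A\<in>P. ennreal (\<nu> A)) <= (\<Squnion>A \<in> {A \<in> halfline_sets. A \<subseteq> E}. ennreal (\<nu> A))" .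
 qed
qed

lemma sets_upper_variation [simp, measurable_cong]: "sets (upper_variation \<nu>) = halfline_sets"
 unfolding upper_variation_def using sets_sigma_halfline
 by (simp add: sigma_algebra.sets_measure_of_eq)

lemma space_upper_variation [simp]: "space (upper_variation \<nu>) = {0..}"
 unfolding upper_variation_def by (rule space_measure_of) (auto simp: sets_restrict_space)

lemma sets_total_variation [simp, measurable_cong]: "sets (total_variation \<nu>) = halfline_sets"
 unfolding total_variation_def using sets_sigma_halfline
 by (simp add: sigma_algebra.sets_measure_of_eq)

text \<open>The sign \<open>c\<close> treats both Jordan parts of an entry at once. Each entry is at
  most the Frobenius norm, so the inequality holds cell by cell and passes to suprema over
  partitions. Integrability against the total variation is thereby inherited by every entry.\<close>

lemma emeasure_upper_variation_le:
 fixes \<mu> :: "real set => real^'n^'m"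
 assumes mu: "matrix_measure \<mu>" and c: "c = 1 \<or> c = -1"
 shows "upper_variation (%E. c * \<mu> E $ i $ j) <= total_variation \<mu>"
proof -
 let ?\<nu> = "%E. c * \<mu> E $ i $ j"
 have nu: "(%i. ?\<nu> (A i)) sums ?\<nu> (\<Union>i. A i)"
  if "range A \<subseteq> halfline_sets" "disjoint_family A" for A :: "nat => real set"
 proof (intro sums_mult)
  have "(%i. \<mu> (A i)) sums \<mu> (\<Union>i. A i)" using mu that by (auto simp: matrix_measure_def)
  then show "(%n. \<mu> (A n) $ i $ j) sums \<mu> (\<Union>i. A i) $ i $ j"
   by (intro bounded_linear.sums[OF bounded_linear_vec_nth])
 qed
 have nu0: "?\<nu> {} = 0" using matrix_measure_empty[OF mu] by simp
 have em: "emeasure (upper_variation ?\<nu>) E = partition_sup (%A. ennreal (?\<nu> A)) E"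
  if "E \<in> halfline_sets" for E
 proof (rule emeasure_partition_sup[OF _ _ _ that])
  show "ennreal (?\<nu> {}) = 0" by (subst nu0) (rule ennreal_0)
  show "ennreal (?\<nu> (\<Union>i. A i)) <= (\<Sum>i. ennreal (?\<nu> (A i)))"
   if "range A \<subseteq> halfline_sets" "disjoint_family A" for A
   by (rule ennreal_sums_le[OF nu[OF that]])
  show "upper_variation ?\<nu> = measure_of {0..} halfline_sets (partition_sup (%A. ennreal (?\<nu> A)))"
   unfolding upper_variation_def
   by (rule measure_of_eq) (use upper_variation_eq[OF nu nu0] sets_sigma_halfline in
     \<open>auto simp: sigma_algebra.sigma_sets_eq sets_restrict_space\<close>)
 qed
 have "emeasure (upper_variation ?\<nu>) E <= emeasure (total_variation \<mu>) E" for E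
 proof (cases "E \<in> halfline_sets")
  case True
  have "?\<nu> A <= norm (\<mu> A)" for A
  proof -
   have "?\<nu> A <= \<bar>\<mu> A $ i $ j\<bar>" using c by auto
   also have "... <= norm (\<mu> A $ i)" by (metis Finite_Cartesian_Product.norm_nth_le real_norm_def)
   also have "... <= norm (\<mu> A)" by (rule Finite_Cartesian_Product.norm_nth_le)
   finally show ?thesis .
  qed
  then show ?thesis unfolding em[OF True] emeasure_total_variation[OF mu True] partition_sup_def
   by (intro SUP_mono, rule_tac x = n in bexI, intro sum_mono ennreal_leI) simp_all
 qed (simp add: emeasure_notin_sets)
 then show ?thesis
  by (subst le_measure) auto
qed

section \<open>Laplace transforms and causal convolutions\<close>

abbreviation HL :: "real measure" where "HL \<equiv> restrict_space lborel {0::real..}"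

text \<open>Vanishing for negative times makes the rate free to increase and lets convolutions be
  written without cutting the integral at \<open>t\<close>.\<close>

definition expb :: "(real => complex) => bool" where
 "expb f \<longleftrightarrow> f \<in> borel_measurable borel \<and> (\<forall>t<0. f t = 0) \<and> (\<exists>C c. \<forall>t. norm (f t) <= C * exp (c * t))"

text \<open>A kernel is a density \<kappa> against a measure on the half-line with exponential
  weight \<open>a\<close>. Two cases occur: variation parts of \<mu> with density \<open>1\<close>,
  which may have atoms, and \<open>HL\<close> with an exponential or an inverse transform as
  density. Delay terms and smoothing are thus handled by the same lemmas.\<close>

definition kern :: "real measure => (real => complex) => real => bool" where
 "kern N \<kappa> a \<longleftrightarrow> sigma_finite_measure N \<and> sets N = halfline_sets \<and> \<kappa> \<in> borel_measurable N \<and>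
  integrable N (%s. exp (- a * s) * norm (\<kappa> s))"

definition conv :: "real measure => (real => complex) => (real => complex) => real => complex" where
 "conv N \<kappa> f t = (LINT s|N. \<kappa> s * f (t - s))"

definition lapk :: "real measure => (real => complex) => complex => complex" where
 "lapk N \<kappa> z = (LINT s|N. exp (- z * of_real s) * \<kappa> s)"

definition lap :: "(real => complex) => complex => complex" where
 "lap f z = (LINT t|lborel. exp (- z * of_real t) * f t)"

text \<open>Transforms are compared only at large real \<open>w\<close>: no abscissa has to be
  tracked, poles are avoided eventually, and uniqueness still holds for continuous
  functions.\<close>

definition laps :: "(real => complex) => (real => complex) => bool" where
 "laps f \<phi> \<longleftrightarrow> expb f \<and> (\<forall>\<^sub>F w in at_top. lap f (of_real w) = \<phi> w)"

lemma expb_bound: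
 assumes "expb f"
 obtains C c0 where "C >= 0" "!!c t. c >= c0 ==> norm (f t) <= C * exp (c * t)"
proof -
 obtain C c0 where b: "!!t. norm (f t) <= C * exp (c0 * t)" using assms unfolding expb_def by blast
 have C: "C >= 0" using b[of 0] norm_ge_zero[of "f 0"] by (simp del: norm_ge_zero)
 have "norm (f t) <= C * exp (c * t)" if "c >= c0" for c t
 proof (cases "t < 0")
  case True then show ?thesis using assms C by (simp add: expb_def)
 next
  case False
  have "C * exp (c0 * t) <= C * exp (c * t)" using C that False by (intro mult_left_mono) (auto intro: mult_right_mono)
  then show ?thesis using b[of t] by linarith
 qed
 then show ?thesis using that C by blast
qed

lemma expb_measurable [measurable_dest]: "expb f ==> f \<in> borel_measurable borel"
 by (simp add: expb_def)

lemma kern_space: "kern N \<kappa> a ==> space N = {0..}"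
 unfolding kern_def by (metis sets_eq_imp_space_eq space_restrict_space space_borel Int_UNIV_right)

lemma kern_id_measurable: "kern N \<kappa> a ==> (%s. s) \<in> borel_measurable N"
proof -
 assume "kern N \<kappa> a"
 then have "sets N = halfline_sets" by (simp add: kern_def)
 moreover have "(%s::real. s) \<in> borel_measurable (restrict_space borel {0..})"
  by (intro measurable_restrict_space1) simp
 ultimately show ?thesis using measurable_cong_sets by blast
qed

lemma kern_mono:
 assumes "kern N \<kappa> a" "a <= b" shows "kern N \<kappa> b"
proof -
 note [measurable] = kern_id_measurable[OF assms(1)]
 have [measurable]: "\<kappa> \<in> borel_measurable N" using assms by (simp add: kern_def)
 have "integrable N (%s. exp (- b * s) * norm (\<kappa> s))"
 proof (rule Bochner_Integration.integrable_bound)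
  show "integrable N (%s. exp (- a * s) * norm (\<kappa> s))" using assms by (simp add: kern_def)
  show "AE s in N. norm (exp (- b * s) * norm (\<kappa> s)) <= norm (exp (- a * s) * norm (\<kappa> s))"
  proof (rule AE_I2)
   fix s assume "s \<in> space N"
   then have "s >= 0" using kern_space[OF assms(1)] by simp
   then have "exp (- b * s) <= exp (- a * s)" using assms(2) by (simp add: mult_right_mono)
   then show "norm (exp (- b * s) * norm (\<kappa> s)) <= norm (exp (- a * s) * norm (\<kappa> s))"
    by (simp add: abs_mult mult_right_mono)
  qed
 qed measurable
 then show ?thesis using assms by (simp add: kern_def)
qed

lemma kern_integrable_exp:
 assumes "kern N \<kappa> a" "a <= Re z" shows "integrable N (%s. exp (- z * of_real s) * \<kappa> s)"
proof -
 have k: "kern N \<kappa> (Re z)" using kern_mono assms by blast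
 note [measurable] = kern_id_measurable[OF k]
 have [measurable]: "\<kappa> \<in> borel_measurable N" using k by (simp add: kern_def)
 show ?thesis
 proof (rule Bochner_Integration.integrable_bound)
  show "integrable N (%s. exp (- Re z * s) * norm (\<kappa> s))" using k by (simp add: kern_def)
  show "AE s in N. norm (exp (- z * of_real s) * \<kappa> s) <= norm (exp (- Re z * s) * norm (\<kappa> s))"
   by (simp add: norm_mult)
 qed measurable
qed

lemma conv_integrand_le:
 assumes k: "kern N \<kappa> a" and C: "C >= 0" and b: "!!t. norm (f t) <= C * exp (c * t)" and "a <= c" and "s \<in> space N"
 shows "norm (\<kappa> s * f (t - s)) <= C * exp (c * t) * (exp (- a * s) * norm (\<kappa> s))"
proof -
 have s: "s >= 0" using assms kern_space[OF k] by simp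
 have "norm (f (t - s)) <= C * exp (c * (t - s))" by (rule b)
 also have "... = C * exp (c * t) * exp (- c * s)" by (simp add: algebra_simps exp_add exp_diff exp_minus divide_simps)
 also have "... <= C * exp (c * t) * exp (- a * s)"
  using s C \<open>a <= c\<close> by (intro mult_left_mono) (auto intro: mult_right_mono)
 finally have "norm (\<kappa> s) * norm (f (t - s)) <= norm (\<kappa> s) * (C * exp (c * t) * exp (- a * s))"
  by (rule mult_left_mono) simp
 then show ?thesis by (simp add: norm_mult mult_ac)
qed

lemma conv_bound:
 assumes k: "kern N \<kappa> a" and f: "expb f" and C: "C >= 0" and b: "!!t. norm (f t) <= C * exp (c * t)" and "a <= c"
 shows "integrable N (%s. \<kappa> s * f (t - s))"
  and "norm (conv N \<kappa> f t) <= C * exp (c * t) * (LINT s|N. exp (- a * s) * norm (\<kappa> s))"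
proof -
 note [measurable] = kern_id_measurable[OF k] f[THEN expb_measurable]
 have [measurable]: "\<kappa> \<in> borel_measurable N" using k by (simp add: kern_def)
 have int: "integrable N (%s. C * exp (c * t) * (exp (- a * s) * norm (\<kappa> s)))" using k by (simp add: kern_def)
 have le: "norm (\<kappa> s * f (t - s)) <= C * exp (c * t) * (exp (- a * s) * norm (\<kappa> s))" if "s \<in> space N" for s
  by (rule conv_integrand_le[OF k C b \<open>a <= c\<close> that])
 show i: "integrable N (%s. \<kappa> s * f (t - s))"
 proof (rule Bochner_Integration.integrable_bound[OF int])
  show "AE s in N. norm (\<kappa> s * f (t - s)) <= norm (C * exp (c * t) * (exp (- a * s) * norm (\<kappa> s)))"
   using le C by (intro AE_I2) (simp add: abs_mult)
 qed measurable
 have "norm (conv N \<kappa> f t) <= (LINT s|N. norm (\<kappa> s * f (t - s)))"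
  unfolding conv_def by (rule integral_norm_bound)
 also have "... <= (LINT s|N. C * exp (c * t) * (exp (- a * s) * norm (\<kappa> s)))"
  by (rule integral_mono[OF integrable_norm[OF i] int le])
 also have "... = C * exp (c * t) * (LINT s|N. exp (- a * s) * norm (\<kappa> s))" by simp
 finally show "norm (conv N \<kappa> f t) <= C * exp (c * t) * (LINT s|N. exp (- a * s) * norm (\<kappa> s))" .
qed

lemma conv_measurable:
 assumes k: "kern N \<kappa> a" and f: "f \<in> borel_measurable borel"
 shows "conv N \<kappa> f \<in> borel_measurable borel"
proof -
 interpret sigma_finite_measure N using k by (simp add: kern_def)
 note [measurable] = kern_id_measurable[OF k] f
 have [measurable]: "\<kappa> \<in> borel_measurable N" using k by (simp add: kern_def)
 show ?thesis unfolding conv_def[abs_def] by measurable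
qed

lemma conv_integrable:
 assumes "kern N \<kappa> a" and "expb f"
 shows "integrable N (%s. \<kappa> s * f (t - s))"
proof -
 obtain C c0 where C: "C >= 0" and b: "!!c t. c >= c0 ==> norm (f t) <= C * exp (c * t)"
  using expb_bound[OF assms(2)] by blast
 show ?thesis by (rule conv_bound(1)[OF assms C, of "max a c0"]) (use b in auto)
qed

lemma expb_conv:
 assumes k: "kern N \<kappa> a" and f: "expb f" shows "expb (conv N \<kappa> f)"
proof -
 obtain C c0 where C: "C >= 0" and b: "!!c t. c >= c0 ==> norm (f t) <= C * exp (c * t)"
  using expb_bound[OF f] by blast
 have "norm (conv N \<kappa> f t) <= C * (LINT s|N. exp (- a * s) * norm (\<kappa> s)) * exp (max a c0 * t)" for t
 proof -
  have "norm (conv N \<kappa> f t) <= C * exp (max a c0 * t) * (LINT s|N. exp (- a * s) * norm (\<kappa> s))"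
   by (rule conv_bound(2)[OF k f C]) (use b in auto)
  then show ?thesis by (simp only: mult_ac)
 qed
 moreover have "conv N \<kappa> f t = 0" if "t < 0" for t
 proof -
  have "conv N \<kappa> f t = (LINT s|N. 0)" unfolding conv_def
   by (rule Bochner_Integration.integral_cong) (use f that kern_space[OF k] in \<open>auto simp: expb_def\<close>)
  then show ?thesis by simp
 qed
 ultimately show ?thesis using conv_measurable[OF k expb_measurable[OF f]] unfolding expb_def by blast
qed

lemma real_exp_halfline_integrable:
 assumes "b > 0" shows "integrable lborel (%t::real. indicator {0..} t * exp (- b * t))"
proof -
 have "(\<integral>\<^sup>+ t. ennreal (exp (- b * t)) * indicator {0..} t \<partial>lborel) = ennreal (0 - (- exp (- b * 0) / b))"
 proof (rule nn_integral_FTC_atLeast)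
  show "DERIV (%t. - exp (- b * t) / b) t :> exp (- b * t)" for t
   using assms by (auto intro!: derivative_eq_intros)
  have "((%t. exp (- (b * t))) \<longlongrightarrow> 0) at_top"
   using assms by real_asymp
  then have "((%t. - exp (- (b * t)) / b) \<longlongrightarrow> - 0 / b) at_top" using assms by (intro tendsto_intros) auto
  then show "((%t. - exp (- b * t) / b) \<longlongrightarrow> 0) at_top" by simp
 qed auto
 then have "(\<integral>\<^sup>+ t. ennreal (indicator {0..} t * exp (- b * t)) \<partial>lborel) < \<infinity>"
  by (subst nn_integral_cong[where v = "%t. ennreal (exp (- b * t)) * indicator {0..} t"])
   (auto split: split_indicator)
 then show ?thesis by (intro integrableI_nonneg) auto
qed

lemma integral_exp_halfline:
 assumes "Re z > 0"
 shows "integrable HL (%t. exp (- z * of_real t))" "(LINT t|HL. exp (- z * of_real t)) = 1 / z"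
proof -
 have int: "integrable lborel (%t::real. indicator {0..} t *\<^sub>R exp (- z * of_real t))"
  by (rule Bochner_Integration.integrable_bound[OF real_exp_halfline_integrable[OF assms]])
   (auto split: split_indicator)
 then show "integrable HL (%t. exp (- z * of_real t))" by (simp add: integrable_restrict_space)
 have lim1: "((%T. LINT t|lborel. indicator {0..T} t *\<^sub>R exp (- z * of_real t)) \<longlongrightarrow>
   (LINT t|lborel. indicator {0..} t *\<^sub>R exp (- z * of_real t))) at_top"
 proof (rule integral_dominated_convergence_at_top[where w = "%t. indicator {0..} t * exp (- Re z * t)"])
  show "AE t in lborel. ((%T. indicator {0..T} t *\<^sub>R exp (- z * of_real t)) \<longlongrightarrow> indicator {0..} t *\<^sub>R exp (- z * of_real t)) at_top"
  proof (rule AE_I2)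
   fix t :: real
   have "\<forall>\<^sub>F T in at_top. indicator {0..T} t *\<^sub>R exp (- z * of_real t) = indicator {0..} t *\<^sub>R exp (- z * of_real t)"
    using eventually_ge_at_top[of t] by eventually_elim (auto split: split_indicator)
   then show "((%T. indicator {0..T} t *\<^sub>R exp (- z * of_real t)) \<longlongrightarrow> indicator {0..} t *\<^sub>R exp (- z * of_real t)) at_top"
    by (rule tendsto_eventually)
  qed
  show "\<forall>\<^sub>F T in at_top. AE t in lborel. norm (indicator {0..T} t *\<^sub>R exp (- z * of_real t)) <= indicator {0..} t * exp (- Re z * t)"
   by (intro always_eventually allI AE_I2) (auto split: split_indicator)
 qed (use real_exp_halfline_integrable[OF assms] in auto)
 have "(LINT t|lborel. indicator {0..T} t *\<^sub>R exp (- z * of_real t)) = 1 / z - exp (- z * of_real T) / z" if "T >= 0" for T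
 proof -
  have "(LINT t|lborel. indicator {0..T} t *\<^sub>R exp (- z * of_real t)) = - exp (- z * of_real T) / z - (- exp (- z * of_real 0) / z)"
  proof (rule integral_FTC_Icc[OF that])
   fix x :: real
   have "((%x. - exp (- z * x) / z) has_field_derivative exp (- z * of_real x)) (at (of_real x))"
    using assms by (auto intro!: derivative_eq_intros)
   then show "((%x. - exp (- z * of_real x) / z) has_vector_derivative exp (- z * of_real x)) (at x within {0..T})"
    using has_vector_derivative_real_field[of "%x. - exp (- z * x) / z" "exp (- z * of_real x)" x "{0..T}"] by simp
  qed (auto intro!: continuous_intros)
  then show ?thesis by simp
 qed
 moreover have "((%T. 1 / z - exp (- z * of_real T) / z) \<longlongrightarrow> 1 / z - 0 / z) at_top"
 proof (intro tendsto_intros)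
  have "((%T. exp (- (Re z * T))) \<longlongrightarrow> 0) at_top" using assms by real_asymp
  then show "((%T. exp (- z * of_real T)) \<longlongrightarrow> 0) at_top" by - (rule tendsto_norm_zero_cancel, simp)
 qed (use assms in auto)
 ultimately have "((%T. LINT t|lborel. indicator {0..T} t *\<^sub>R exp (- z * of_real t)) \<longlongrightarrow> 1 / z) at_top"
  by (rule_tac Lim_transform_eventually[of "%T. 1 / z - exp (- z * of_real T) / z"])
   (auto intro!: eventually_mono[OF eventually_ge_at_top[of 0]])
 then have "(LINT t|lborel. indicator {0..} t *\<^sub>R exp (- z * of_real t)) = 1 / z"
  using lim1 tendsto_unique trivial_limit_at_top_linorder by blast
 then show "(LINT t|HL. exp (- z * of_real t)) = 1 / z" by (simp add: integral_restrict_space)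
qed

lemma sets_HL: "sets HL = halfline_sets" by (simp add: sets_restrict_space)

lemma sigma_finite_HL: "sigma_finite_measure HL"
 by (rule sigma_finite_measure_restrict_space) (auto simp: lborel.sigma_finite_measure_axioms)

lemma kern_exp:
 assumes "Re l < a" shows "kern HL (%s. exp (l * of_real s)) a"
proof -
 have "integrable HL (%s. exp (- complex_of_real (a - Re l) * of_real s))"
  using assms by (intro integral_exp_halfline) auto
 then have "integrable HL (%s. norm (exp (- complex_of_real (a - Re l) * of_real s)))" by (rule integrable_norm)
 then have "integrable HL (%s. exp (- a * s) * norm (exp (l * of_real s)))"
  by (rule Bochner_Integration.integrable_cong[THEN iffD1, rotated -1])
   (auto simp: exp_add[symmetric] algebra_simps)
 then show ?thesis unfolding kern_def using sigma_finite_HL sets_HL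
  by (auto intro!: measurable_restrict_space1)
qed

lemma lapk_exp:
 assumes "Re l < Re z" shows "lapk HL (%s. exp (l * of_real s)) z = 1 / (z - l)"
proof -
 have "lapk HL (%s. exp (l * of_real s)) z = (LINT s|HL. exp (- (z - l) * of_real s))"
  unfolding lapk_def by (intro Bochner_Integration.integral_cong) (auto simp: exp_add[symmetric] algebra_simps)
 then show ?thesis using integral_exp_halfline(2)[of "z - l"] assms by simp
qed

lemma lap_integrable:
 assumes f: "expb f" and b: "!!t. norm (f t) <= C * exp (c * t)" and z: "Re z > c"
 shows "integrable lborel (%t. exp (- z * of_real t) * f t)"
proof -
 note [measurable] = expb_measurable[OF f]
 have C: "C >= 0" using b[of 0] norm_ge_zero[of "f 0"] by (simp del: norm_ge_zero)
 have "integrable lborel (%t. C * (indicator {0..} t * exp (- (Re z - c) * t)))"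
  using real_exp_halfline_integrable[of "Re z - c"] z by auto
 then show ?thesis
 proof (rule Bochner_Integration.integrable_bound)
  show "AE t in lborel. norm (exp (- z * of_real t) * f t) <= norm (C * (indicator {0..} t * exp (- (Re z - c) * t)))"
  proof (rule AE_I2)
   fix t :: real
   show "norm (exp (- z * of_real t) * f t) <= norm (C * (indicator {0..} t * exp (- (Re z - c) * t)))"
   proof (cases "t < 0")
    case True then show ?thesis using f by (simp add: expb_def)
   next
    case False
    have "norm (exp (- z * of_real t) * f t) <= exp (- Re z * t) * (C * exp (c * t))"
     using b[of t] by (simp add: norm_mult)
    also have "... = C * exp (- (Re z - c) * t)" by (simp add: exp_add[symmetric] algebra_simps)
    finally show ?thesis using False C by (simp add: abs_mult)
   qed
  qed
 qed measurable
qed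

lemma lap_conv:
 assumes k: "kern N \<kappa> a" and f: "expb f" and b: "!!t. norm (f t) <= C * exp (c * t)" and z: "Re z > c" "Re z >= a"
 shows "lap (conv N \<kappa> f) z = lapk N \<kappa> z * lap f z"
proof -
 interpret N: sigma_finite_measure N using k by (simp add: kern_def)
 interpret P: pair_sigma_finite N lborel ..
 note [measurable] = kern_id_measurable[OF k] expb_measurable[OF f]
 have [measurable]: "\<kappa> \<in> borel_measurable N" using k by (simp add: kern_def)
 let ?h = "%(s, t). exp (- z * of_real t) * (\<kappa> s * f (t - s))"
 have int: "integrable lborel (%t. exp (- z * of_real t) * f t)" by (rule lap_integrable[OF f b z(1)])
 \<comment> \<open>The factor \<open>exp (- z * t)\<close> splits between \<open>s\<close> and
   \<open>t - s\<close>, after which translation invariance decouples the double integral. The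
   spelling \<open>- s + 1 * t\<close> matches the affine change of variables used below.\<close>
 have eq: "exp (- z * of_real t) * (\<kappa> s * f (t - s)) =
  exp (- z * of_real s) * \<kappa> s * (exp (- z * of_real (- s + 1 * t)) * f (- s + 1 * t))" for s t
  by (simp add: exp_add[symmetric] algebra_simps)
 have shift_int: "integrable lborel (%t. exp (- z * of_real (- s + 1 * t)) * f (- s + 1 * t))" for s :: real
  using lborel_integrable_real_affine[OF int, of 1 "- s"] by simp
 have shift: "(LINT t|lborel. exp (- z * of_real (- s + 1 * t)) * f (- s + 1 * t)) = lap f z" for s :: real
  unfolding lap_def using lborel_integral_real_affine[of 1 "%t. exp (- z * of_real t) * f t" "- s"] by simp
 have shiftn: "(LINT t|lborel. norm (exp (- z * of_real (- s + 1 * t)) * f (- s + 1 * t))) = (LINT t|lborel. norm (exp (- z * of_real t) * f t))" for s :: real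
  using lborel_integral_real_affine[of 1 "%t. norm (exp (- z * of_real t) * f t)" "- s"] by simp
 have int2: "integrable (N \<Otimes>\<^sub>M lborel) ?h"
 proof (rule P.Fubini_integrable)
  show "AE s in N. integrable lborel (%t. ?h (s, t))"
   unfolding prod.case eq using shift_int by (intro AE_I2 integrable_mult_right) auto
  have "(LINT t|lborel. norm (?h (s, t))) = norm (exp (- z * of_real s) * \<kappa> s) * (LINT t|lborel. norm (exp (- z * of_real t) * f t))" for s
   unfolding prod.case eq norm_mult[of "exp (- z * of_real s) * \<kappa> s"] by (simp only: integral_mult_right_zero shiftn)
  then show "integrable N (%s. LINT t|lborel. norm (?h (s, t)))"
   using kern_integrable_exp[OF k z(2)] by (auto intro!: integrable_mult_left integrable_norm simp del: norm_mult)
 qed measurable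
 have "lap (conv N \<kappa> f) z = (LINT t|lborel. LINT s|N. ?h (s, t))"
  unfolding lap_def conv_def by simp
 also have "... = (LINT s|N. LINT t|lborel. ?h (s, t))"
  using P.Fubini_integral[of "%s t. ?h (s, t)"] int2 by simp
 also have "... = (LINT s|N. exp (- z * of_real s) * \<kappa> s * lap f z)"
  unfolding prod.case eq by (simp only: integral_mult_right_zero shift)
 also have "... = lapk N \<kappa> z * lap f z" unfolding lapk_def by simp
 finally show ?thesis .
qed

lemma laps_expb: "laps f \<phi> ==> expb f" by (simp add: laps_def)

lemma laps_conv:
 assumes k: "kern N \<kappa> a" and f: "laps f \<phi>"
 shows "laps (conv N \<kappa> f) (%w. lapk N \<kappa> (of_real w) * \<phi> w)"
proof -
 obtain C c where b: "!!t. norm (f t) <= C * exp (c * t)" using f unfolding laps_def expb_def by blast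
 have "\<forall>\<^sub>F w in at_top. lap f (of_real w) = \<phi> w" using f by (simp add: laps_def)
 then have "\<forall>\<^sub>F w in at_top. lap (conv N \<kappa> f) (of_real w) = lapk N \<kappa> (of_real w) * \<phi> w"
  using eventually_gt_at_top[of c] eventually_ge_at_top[of a]
  by eventually_elim (use lap_conv[OF k laps_expb[OF f] b] in auto)
 then show ?thesis using expb_conv[OF k laps_expb[OF f]] by (simp add: laps_def)
qed

lemma laps_conv_exp:
 assumes f: "laps f \<phi>"
 shows "laps (conv HL (%s. exp (l * of_real s)) f) (%w. \<phi> w / (of_real w - l))"
proof -
 have k: "kern HL (%s. exp (l * of_real s)) (Re l + 1)" by (rule kern_exp) simp
 have "laps (conv HL (%s. exp (l * of_real s)) f) (%w. lapk HL (%s. exp (l * of_real s)) (of_real w) * \<phi> w)"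
  by (rule laps_conv[OF k f])
 moreover have "\<forall>\<^sub>F w in at_top. lapk HL (%s. exp (l * of_real s)) (of_real w) * \<phi> w = \<phi> w / (of_real w - l)"
  using eventually_gt_at_top[of "Re l"] by eventually_elim (simp add: lapk_exp)
 ultimately show ?thesis unfolding laps_def
  using eventually_elim2 by force
qed

lemma laps_cong: "laps f \<phi> ==> (\<forall>\<^sub>F w in at_top. \<phi> w = \<psi> w) ==> laps f \<psi>"
 unfolding laps_def using eventually_elim2 by force

lemma laps_linear:
 assumes f: "laps f \<phi>" and g: "laps g \<psi>"
 shows "laps (%t. A * f t + B * g t) (%w. A * \<phi> w + B * \<psi> w)"
proof -
 note [measurable] = f[THEN laps_expb, THEN expb_measurable] g[THEN laps_expb, THEN expb_measurable]
 obtain C c where C: "C >= 0" and b: "!!c' t. c' >= c ==> norm (f t) <= C * exp (c' * t)"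
  using expb_bound[OF laps_expb[OF f]] by blast
 obtain D d where D: "D >= 0" and e: "!!c' t. c' >= d ==> norm (g t) <= D * exp (c' * t)"
  using expb_bound[OF laps_expb[OF g]] by blast
 have "norm (A * f t + B * g t) <= (norm A * C + norm B * D) * exp (max c d * t)" for t
 proof -
  have "norm (A * f t + B * g t) <= norm A * norm (f t) + norm B * norm (g t)"
   by (metis norm_mult norm_triangle_ineq)
  also have "... <= norm A * (C * exp (max c d * t)) + norm B * (D * exp (max c d * t))"
   by (intro add_mono mult_left_mono b e) auto
  finally show ?thesis by (simp add: algebra_simps)
 qed
 moreover have "(%t. A * f t + B * g t) \<in> borel_measurable borel" by measurable
 moreover have "A * f t + B * g t = 0" if "t < 0" for t
  using that laps_expb[OF f] laps_expb[OF g] by (simp add: expb_def)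
 ultimately have ex: "expb (%t. A * f t + B * g t)"
  unfolding expb_def by blast
 have "\<forall>\<^sub>F w in at_top. lap (%t. A * f t + B * g t) (of_real w) = A * \<phi> w + B * \<psi> w"
 proof -
  have "\<forall>\<^sub>F w in at_top. lap f (of_real w) = \<phi> w" "\<forall>\<^sub>F w in at_top. lap g (of_real w) = \<psi> w"
   using f g by (auto simp: laps_def)
  then show ?thesis using eventually_gt_at_top[of c] eventually_gt_at_top[of d]
  proof eventually_elim
   case (elim w)
   have "integrable lborel (%t. exp (- of_real w * of_real t) * f t)"
    by (rule lap_integrable[OF laps_expb[OF f], of C c]) (use b elim in auto)
   moreover have "integrable lborel (%t. exp (- of_real w * of_real t) * g t)"
    by (rule lap_integrable[OF laps_expb[OF g], of D d]) (use e elim in auto)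
   ultimately have "lap (%t. A * f t + B * g t) (of_real w) = A * lap f (of_real w) + B * lap g (of_real w)"
    unfolding lap_def distrib_left mult.left_commute[of _ A] mult.left_commute[of _ B]
    by (subst Bochner_Integration.integral_add) auto
   then show ?case using elim by simp
  qed
 qed
 then show ?thesis using ex by (simp add: laps_def)
qed

lemma laps_zero: "laps (%t. 0) (%w. 0)"
proof -
 have "expb (%t. 0)" unfolding expb_def by (intro conjI exI[of _ 0]) simp_all
 then show ?thesis by (simp add: laps_def lap_def)
qed

lemma laps_add: "laps f \<phi> ==> laps g \<psi> ==> laps (%t. f t + g t) (%w. \<phi> w + \<psi> w)"
 using laps_linear[of f \<phi> g \<psi> 1 1] by simp

lemma laps_diff: "laps f \<phi> ==> laps g \<psi> ==> laps (%t. f t - g t) (%w. \<phi> w - \<psi> w)"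
 using laps_linear[of f \<phi> g \<psi> 1 "-1"] by simp

lemma laps_cmult: "laps f \<phi> ==> laps (%t. A * f t) (%w. A * \<phi> w)"
 using laps_linear[of f \<phi> f \<phi> A 0] by simp

lemma laps_sum:
 assumes "!!i. i \<in> I ==> laps (f i) (\<phi> i)"
 shows "laps (%t. \<Sum>i\<in>I. f i t) (%w. \<Sum>i\<in>I. \<phi> i w)"
 using assms
proof (induction I rule: infinite_finite_induct)
 case (insert x I)
 then show ?case using laps_add[of "f x" "\<phi> x"] by simp
qed (simp_all add: laps_zero)

lemma expb_laps: "expb f ==> laps f (%w. lap f (of_real w))" by (simp add: laps_def)

text \<open>Lerch's theorem by Weierstrass: with \<open>v = exp (- t)\<close> the hypotheses say
  that \<psi> is orthogonal to all polynomials in \<open>v\<close>. Approximating \<psi> uniformly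
  by such polynomials shows that the integral of its square vanishes, and continuity
  finishes.\<close>

lemma lerch_real:
 fixes \<psi> :: "real => real"
 assumes cont: "continuous_on {0..} \<psi>" and b: "!!t. t >= 0 ==> \<bar>\<psi> t\<bar> <= C * exp (- t)"
  and zero: "!!n::nat. (LINT t|HL. exp (- t) ^ n * \<psi> t) = 0" and "t0 >= 0"
 shows "\<psi> t0 = 0"
proof -
 have [measurable]: "(%t. t) \<in> borel_measurable HL" by (intro measurable_restrict_space1) simp
 have [measurable]: "\<psi> \<in> borel_measurable HL"
  using borel_measurable_continuous_on_restrict[OF cont]
  by (simp add: measurable_cong_sets[OF sets_HL refl])
 have C: "C >= 0" using b[of 0] by auto
 have "integrable HL (%t. exp (- complex_of_real 1 * of_real t))"
  by (rule integral_exp_halfline) simp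
 then have "integrable HL (%t. norm (exp (- complex_of_real 1 * of_real t)))" by (rule integrable_norm)
 then have iexp: "integrable HL (%t. exp (- t))" by simp
 have iC: "integrable HL (%t. C * exp (- t))" using iexp by simp
 have ipsi: "integrable HL \<psi>"
  by (rule Bochner_Integration.integrable_bound[OF iC]) (use b C in \<open>auto simp: space_restrict_space\<close>)
 have en: "exp (- t) ^ n <= (1::real)" if "t >= 0" for t :: real and n
  using that by (intro power_le_one) auto
 have ipow: "integrable HL (%t. exp (- t) ^ n * \<psi> t)" for n
 proof (rule Bochner_Integration.integrable_bound[OF ipsi])
  show "AE t in HL. norm (exp (- t) ^ n * \<psi> t) <= norm (\<psi> t)"
   using en by (auto simp: abs_mult space_restrict_space power_abs intro!: AE_I2 mult_left_le_one_le)
 qed measurable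
 have isq: "integrable HL (%t. \<psi> t * \<psi> t)"
 proof (rule Bochner_Integration.integrable_bound[OF integrable_mult_right[OF ipsi, of C]])
  show "AE t in HL. norm (\<psi> t * \<psi> t) <= norm (C * \<psi> t)"
  proof (rule AE_I2)
   fix t assume "t \<in> space HL"
   then have t: "t >= 0" by (simp add: space_restrict_space)
   have "\<bar>\<psi> t\<bar> <= C * exp (- t)" using b t by simp
   also have "... <= C * 1" using C t by (intro mult_left_mono) auto
   finally have "\<bar>\<psi> t\<bar> * \<bar>\<psi> t\<bar> <= C * \<bar>\<psi> t\<bar>" by (intro mult_right_mono) simp_all
   then show "norm (\<psi> t * \<psi> t) <= norm (C * \<psi> t)" using C by (simp add: abs_mult)
  qed
 qed simp
 \<comment> \<open>The bound \<open>C * exp (- t)\<close> becomes \<open>C * v\<close>, so the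
   function of \<open>v\<close> extends continuously by \<open>0\<close> to \<open>v = 0\<close>, as
   uniform approximation on the compact interval requires.\<close>
 let ?\<phi> = "%v::real. if v <= 0 then 0 else \<psi> (- ln v)"
 have phib: "\<bar>?\<phi> v\<bar> <= C * v" if "0 <= v" "v <= 1" for v
  using b[of "- ln v"] that by (auto simp: ln_le_zero_iff)
 have contphi: "continuous_on {0..1} ?\<phi>"
  unfolding continuous_on_eq_continuous_within
 proof
  fix x :: real assume x: "x \<in> {0..1}"
  show "continuous (at x within {0..1}) ?\<phi>"
  proof (cases "x = 0")
   case True
   have "(?\<phi> \<longlongrightarrow> 0) (at 0 within {0..1})"
   proof (rule Lim_null_comparison)
    show "\<forall>\<^sub>F v in at 0 within {0..1}. norm (?\<phi> v) <= C * v"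
     unfolding eventually_at real_norm_def by (intro exI[of _ 1] conjI ballI impI phib) auto
    show "((%v. C * v) \<longlongrightarrow> 0) (at 0 within {0..1})"
     by (rule tendsto_eq_intros refl)+ simp
   qed
   then show ?thesis using True by (simp add: continuous_within)
  next
   case False
   then have x: "0 < x" "x <= 1" using x by auto
   have c1: "continuous_on {0<..1} (%v. \<psi> (- ln v))"
    by (rule continuous_on_compose2[OF cont]) (auto intro!: continuous_intros)
   have c2: "continuous_on {0<..1} ?\<phi>"
    by (rule continuous_on_cong[THEN iffD1, OF refl _ c1]) auto
   have "at x within {0<..1} = at x within {0..1}"
    by (rule at_within_nhd[of x "{0<..}"]) (use x in auto)
   then show ?thesis using c2 x unfolding continuous_on_eq_continuous_within by force
  qed
 qed
 have small: "(LINT t|HL. \<psi> t * \<psi> t) <= e * (LINT t|HL. \<bar>\<psi> t\<bar>)" if e: "e > 0" for e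
 proof -
  obtain p where p: "real_polynomial_function p" and pe: "!!v. v \<in> {0..1} ==> \<bar>?\<phi> v - p v\<bar> < e"
   using Stone_Weierstrass_real_polynomial_function[OF compact_Icc contphi e] by auto
  obtain a m where pa: "p = (%v. \<Sum>i\<le>m. a i * v ^ i)" using p unfolding real_polynomial_function_iff_sum by blast
  have ip: "integrable HL (%t. p (exp (- t)) * \<psi> t)"
   unfolding pa sum_distrib_right mult.assoc using ipow by auto
  have "(LINT t|HL. p (exp (- t)) * \<psi> t) = 0"
   unfolding pa sum_distrib_right mult.assoc using ipow zero by (subst Bochner_Integration.integral_sum) auto
  then have "(LINT t|HL. \<psi> t * \<psi> t) = (LINT t|HL. \<psi> t * \<psi> t - p (exp (- t)) * \<psi> t)"
   using isq ip by simp
  also have "... <= (LINT t|HL. e * \<bar>\<psi> t\<bar>)"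
  proof (rule integral_mono)
   fix t assume "t \<in> space HL"
   then have t: "t >= 0" by (simp add: space_restrict_space)
   have "\<bar>\<psi> t - p (exp (- t))\<bar> <= e" using pe[of "exp (- t)"] t by (simp add: less_imp_le)
   then have "\<bar>\<psi> t - p (exp (- t))\<bar> * \<bar>\<psi> t\<bar> <= e * \<bar>\<psi> t\<bar>" by (rule mult_right_mono) simp
   then show "\<psi> t * \<psi> t - p (exp (- t)) * \<psi> t <= e * \<bar>\<psi> t\<bar>"
    by (simp add: abs_mult[symmetric] left_diff_distrib[symmetric])
  qed (use isq ip ipsi in auto)
  finally show ?thesis by simp
 qed
 let ?I = "LINT t|HL. \<psi> t * \<psi> t"
 have K: "(LINT t|HL. \<bar>\<psi> t\<bar>) >= 0" by simp
 have "?I <= 0"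
 proof (rule field_le_epsilon)
  fix e :: real assume "e > 0"
  then have "?I <= e / (1 + (LINT t|HL. \<bar>\<psi> t\<bar>)) * (LINT t|HL. \<bar>\<psi> t\<bar>)"
   using K \<open>e > 0\<close> by (intro small divide_pos_pos add_pos_nonneg) auto
  also have "1 + (LINT t|HL. \<bar>\<psi> t\<bar>) > 0" using K by linarith
  then have "e / (1 + (LINT t|HL. \<bar>\<psi> t\<bar>)) * (LINT t|HL. \<bar>\<psi> t\<bar>) <= e"
   using \<open>e > 0\<close> by (simp add: pos_divide_le_eq distrib_left)
  finally show "?I <= 0 + e" by simp
 qed
 moreover have "?I >= 0" by simp
 ultimately have I0: "?I = 0" by simp
 let ?T = "t0 + 1"
 have si: "set_integrable lborel {0..} (%t. \<psi> t * \<psi> t)"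
  using isq by (simp add: integrable_restrict_space set_integrable_def)
 have si2: "set_integrable lborel {0..?T} (%t. \<psi> t * \<psi> t)" by (rule set_integrable_subset[OF si]) auto
 have "(LINT t:{0..?T}|lborel. \<psi> t * \<psi> t) <= (LINT t:{0..}|lborel. \<psi> t * \<psi> t)"
  using si si2 unfolding set_lebesgue_integral_def set_integrable_def
  by (intro integral_mono) (auto split: split_indicator)
 also have "... = ?I" by (simp add: integral_restrict_space set_lebesgue_integral_def)
 finally have "integral {0..?T} (%t. \<psi> t * \<psi> t) <= 0"
  using set_borel_integral_eq_integral(2)[OF si2] I0 by simp
 moreover have "integral {0..?T} (%t. \<psi> t * \<psi> t) >= 0"
  by (rule integral_nonneg) (use set_borel_integral_eq_integral(1)[OF si2] in auto)
 ultimately have "integral (cbox 0 ?T) (%t. \<psi> t * \<psi> t) = 0" by simp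
 moreover have "continuous_on (cbox 0 ?T) (%t. \<psi> t * \<psi> t)"
  by (intro continuous_intros continuous_on_subset[OF cont]) auto
 ultimately have "\<forall>x\<in>{0..?T}. \<psi> x * \<psi> x = 0"
  using integral_eq_0_iff[of 0 ?T "%t. \<psi> t * \<psi> t"] \<open>t0 >= 0\<close> by simp
 then have "\<psi> t0 * \<psi> t0 = 0" using \<open>t0 >= 0\<close> by simp
 then show ?thesis by simp
qed

text \<open>Multiplying by \<open>exp (- w0 * t)\<close> produces decay, and the moments in
  \<open>exp (- t)\<close> are then transforms at \<open>w0 + n\<close>. The extra \<open>1\<close>
  in \<open>w0\<close> supplies the decay rate that \<open>lerch_real\<close> asks for. The
  functional \<open>h\<close> is the real or the imaginary part.\<close>

lemma laps_unique_zero: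
 assumes f: "laps f (%w. 0)" and cont: "continuous_on {0..} f"
 shows "f t = 0"
proof (cases "t < 0")
 case True then show ?thesis using f by (simp add: laps_def expb_def)
next
 case t: False
 note ex = laps_expb[OF f]
 obtain C c0 where C: "C >= 0" and b: "!!c t. c >= c0 ==> norm (f t) <= C * exp (c * t)"
  using expb_bound[OF ex] by blast
 obtain w1 where w1: "!!w. w >= w1 ==> lap f (of_real w) = 0"
  using f unfolding laps_def eventually_at_top_linorder by auto
 define w0 where "w0 = max w1 (c0 + 1)"
 have exint: "integrable lborel (%t. exp (- of_real w * of_real t) * f t)" if "w >= w0" for w
  by (rule lap_integrable[OF ex, of C c0]) (use b that in \<open>auto simp: w0_def\<close>)
 have key: "h (f t) = 0" if h: "bounded_linear h" "!!z. \<bar>h z\<bar> <= norm z" for h :: "complex => real"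
 proof -
  interpret bounded_linear h by (rule h)
  have hr: "h (of_real r * z) = r * h z" for r z by (metis scaleR scaleR_conv_of_real real_scaleR_def)
  have "exp (- w0 * t) * h (f t) = 0"
  proof (rule lerch_real[of "%t. exp (- w0 * t) * h (f t)" C])
   show "continuous_on {0..} (%t. exp (- w0 * t) * h (f t))"
    by (intro continuous_intros continuous_on cont)
   show "\<bar>exp (- w0 * t) * h (f t)\<bar> <= C * exp (- t)" if "t >= 0" for t
   proof -
    have "c0 <= w0 - 1" by (simp add: w0_def)
    from b[OF this, of t] have "\<bar>h (f t)\<bar> <= C * exp ((w0 - 1) * t)" using h(2)[of "f t"] by linarith
    then have "exp (- w0 * t) * \<bar>h (f t)\<bar> <= exp (- w0 * t) * (C * exp ((w0 - 1) * t))" by (rule mult_left_mono) simp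
    also have "... = C * exp (- t)" by (simp add: exp_add[symmetric] algebra_simps)
    finally show ?thesis by (simp add: abs_mult)
   qed
   fix n :: nat
   have "(LINT t|HL. exp (- t) ^ n * (exp (- w0 * t) * h (f t))) = (LINT t|lborel. indicator {0..} t *\<^sub>R (exp (- t) ^ n * (exp (- w0 * t) * h (f t))))"
    by (simp add: integral_restrict_space)
   also have "... = (LINT t|lborel. h (exp (- of_real (w0 + n) * of_real t) * f t))"
   proof (rule Bochner_Integration.integral_cong[OF refl])
    fix t
    have "exp (- of_real (w0 + n) * of_real t) = complex_of_real (exp (- (w0 + n) * t))"
     by (simp add: exp_of_real[symmetric])
    moreover have "exp (- (w0 + n) * t) = exp (- t) ^ n * exp (- w0 * t)"
     by (simp add: exp_of_nat_mult[symmetric] exp_add[symmetric] algebra_simps)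
    moreover have "f t = 0" if "t < 0" using ex that by (simp add: expb_def)
    ultimately show "indicator {0..} t *\<^sub>R (exp (- t) ^ n * (exp (- w0 * t) * h (f t))) = h (exp (- of_real (w0 + n) * of_real t) * f t)"
     by (simp only: hr) (auto simp: zero split: split_indicator)
   qed
   also have "... = h (lap f (of_real (w0 + n)))"
    unfolding lap_def by (rule integral_bounded_linear[OF h(1) exint]) simp
   also have "... = 0" using w1[of "w0 + n"] by (simp add: w0_def zero)
   finally show "(LINT t|HL. exp (- t) ^ n * (exp (- w0 * t) * h (f t))) = 0" .
  qed (use t in auto)
  then show ?thesis by simp
 qed
 have "Re (f t) = 0" "Im (f t) = 0"
  by (auto intro!: key bounded_linear_Re bounded_linear_Im abs_Re_le_cmod abs_Im_le_cmod)
 then show ?thesis by (simp add: complex_eq_iff)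
qed

lemma laps_unique:
 assumes f: "laps f \<phi>" "continuous_on {0..} f" and g: "laps g \<psi>" "continuous_on {0..} g"
  and eq: "\<forall>\<^sub>F w in at_top. \<phi> w = \<psi> w"
 shows "f t = g t"
proof -
 have "laps (%t. f t - g t) (%w. 0)"
  by (rule laps_cong[OF laps_diff[OF f(1) g(1)]]) (use eq in \<open>auto elim: eventually_mono\<close>)
 then have "f t - g t = 0" by (rule laps_unique_zero) (intro continuous_intros f g)
 then show ?thesis by simp
qed

lemma expb_isCont:
 assumes f: "expb f" and c: "continuous_on {0..} f" and v: "v \<noteq> 0"
 shows "isCont f v"
proof (cases "v < 0")
 case True
 have "isCont (%_. 0::complex) v" by simp
 moreover have "\<forall>\<^sub>F x in nhds v. f x = 0"
  using True f by (auto simp: expb_def eventually_nhds intro!: exI[of _ "{..<0}"])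
 ultimately show ?thesis by (subst isCont_cong[where g = "%_. 0"]) auto
next
 case False
 then have "v \<in> interior {0..}" using v by simp
 then show ?thesis using c continuous_on_interior by blast
qed

text \<open>Dominated convergence along sequences; continuity at \<open>t - s\<close> is asked for
  \<open>N\<close>-almost all \<open>s\<close>. A jump of \<open>f\<close> at \<open>0\<close> is
  therefore harmless for \<open>HL\<close>, while atoms of \<open>N\<close> call for
  \<open>f\<close> continuous on the whole line.\<close>

lemma conv_continuous:
 assumes k: "kern N \<kappa> a" and f: "expb f" and c: "!!t. AE s in N. isCont f (t - s)"
 shows "continuous_on S (conv N \<kappa> f)"
proof -
 note [measurable] = kern_id_measurable[OF k] f[THEN expb_measurable]
 have [measurable]: "\<kappa> \<in> borel_measurable N" using k by (simp add: kern_def)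
 obtain C c0 where C: "C >= 0" and b: "!!c t. c >= c0 ==> norm (f t) <= C * exp (c * t)"
  using expb_bound[OF f] by blast
 define d where "d = max 0 (max a c0)"
 have "isCont (conv N \<kappa> f) t" for t
  unfolding continuous_at_sequentially
 proof (intro allI impI)
  fix x :: "nat => real" assume x: "x \<longlonglongrightarrow> t"
  obtain T where T: "!!n. \<bar>x n\<bar> <= T"
   using convergent_imp_Bseq[OF convergentI[OF x]] unfolding Bseq_def by auto
  show "(conv N \<kappa> f \<circ> x) \<longlonglongrightarrow> conv N \<kappa> f t"
   unfolding conv_def o_def
  proof (rule integral_dominated_convergence[where w = "%s. C * exp (d * T) * (exp (- a * s) * norm (\<kappa> s))"])
   show "AE s in N. (%i. \<kappa> s * f (x i - s)) \<longlonglongrightarrow> \<kappa> s * f (t - s)"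
    using c[of t]
   proof eventually_elim
    case (elim s)
    have "(%i. x i - s) \<longlonglongrightarrow> t - s" by (intro tendsto_intros x)
    from isCont_tendsto_compose[OF elim this] show ?case by (intro tendsto_intros)
   qed
   show "AE s in N. norm (\<kappa> s * f (x i - s)) <= C * exp (d * T) * (exp (- a * s) * norm (\<kappa> s))" for i
   proof (rule AE_I2)
    fix s assume s: "s \<in> space N"
    have "norm (\<kappa> s * f (x i - s)) <= C * exp (d * x i) * (exp (- a * s) * norm (\<kappa> s))"
     by (rule conv_integrand_le[OF k C]) (use b s in \<open>auto simp: d_def\<close>)
    also have "... <= C * exp (d * T) * (exp (- a * s) * norm (\<kappa> s))"
     using C T[of i] by (intro mult_right_mono mult_left_mono) (auto simp: d_def intro!: mult_left_mono)
    finally show "norm (\<kappa> s * f (x i - s)) <= C * exp (d * T) * (exp (- a * s) * norm (\<kappa> s))" .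
   qed
  qed (use k in \<open>auto simp: kern_def\<close>)
 qed
 then show ?thesis by (simp add: continuous_at_imp_continuous_on)
qed

lemma AE_HL: "AE s in lborel. P s ==> AE s in HL. P s"
 by (subst AE_restrict_space_iff) auto

lemma conv_HL_continuous:
 assumes k: "kern HL \<kappa> a" and f: "expb f" and c: "continuous_on {0..} f"
 shows "continuous_on S (conv HL \<kappa> f)"
proof (rule conv_continuous[OF k f])
 fix t :: real
 show "AE s in HL. isCont f (t - s)"
  using AE_HL[OF AE_lborel_singleton[of t]] by eventually_elim (auto intro!: expb_isCont[OF f c])
qed

section \<open>Asymptotics at a fixed exponential rate and their behaviour under convolution\<close>

lemma poly_bound:
 fixes f :: "real => complex"
 assumes f: "expb f" and ev: "\<forall>\<^sub>F t in at_top. norm (f t) <= K1 * t ^ n * exp (\<alpha> * t)"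
 obtains K where "K >= 0" "!!t v. t >= 1 ==> v <= t ==> norm (f v) <= K * t ^ n * exp (\<alpha> * v)"
proof -
 obtain C c where C: "C >= 0" and b: "!!c' t. c' >= c ==> norm (f t) <= C * exp (c' * t)"
  using expb_bound[OF f] by blast
 obtain T0 where T0: "!!t. t >= T0 ==> norm (f t) <= K1 * t ^ n * exp (\<alpha> * t)"
  using ev unfolding eventually_at_top_linorder by auto
 define T where "T = max 1 T0"
 \<comment> \<open>Beyond \<open>T\<close> the eventual bound applies; on the bounded range before
   \<open>T\<close> the exponential bound is rewritten with rate \<alpha> at the cost of the second
   constant. Using \<open>t ^ n\<close> instead of \<open>v ^ n\<close> yields one majorant for all
   \<open>v\<close> below \<open>t\<close>, as dominated convergence requires.\<close>
 define K where "K = max \<bar>K1\<bar> (C * exp (\<bar>c - \<alpha>\<bar> * T))"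
 have K0: "K >= 0" by (simp add: K_def)
 have "norm (f v) <= K * t ^ n * exp (\<alpha> * v)" if t: "t >= 1" "v <= t" for t v
 proof -
  consider "v < 0" | "0 <= v" "v < T" | "v >= T" by linarith
  then show ?thesis
  proof cases
   case 1 then show ?thesis using f K0 t by (auto simp: expb_def)
  next
   case 2
   have "norm (f v) <= C * exp (c * v)" using b by simp
   also have "... = C * exp ((c - \<alpha>) * v) * exp (\<alpha> * v)" by (simp add: exp_add[symmetric] algebra_simps)
   also have "... <= C * exp (\<bar>c - \<alpha>\<bar> * T) * exp (\<alpha> * v)"
    using C 2 by (intro mult_right_mono mult_left_mono) (auto intro!: mult_mono)
   also have "... <= K * exp (\<alpha> * v)" by (intro mult_right_mono) (auto simp: K_def)
   also have "... <= K * t ^ n * exp (\<alpha> * v)" using K0 t by (intro mult_right_mono) (auto simp: mult_ge1_I mult_le_cancel_left1)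
   finally show ?thesis .
  next
   case 3
   have "norm (f v) <= K1 * v ^ n * exp (\<alpha> * v)" using T0[of v] 3 by (simp add: T_def)
   also have "... <= K * t ^ n * exp (\<alpha> * v)"
    using 3 t by (intro mult_right_mono mult_mono power_mono) (auto simp: K_def T_def)
   finally show ?thesis .
  qed
 qed
 then show ?thesis using that K0 by blast
qed

text \<open>The elements of \<Lambda> are meant to have real part \<alpha>, so after division only
  their oscillations \<open>cis (Im l * t)\<close> remain. Coefficients may vanish: with all
  \<open>A l = 0\<close> the statement is that \<open>f\<close> is of smaller order than
  \<open>t ^ n * exp (\<alpha> * t)\<close>.\<close>

definition asym :: "nat => real => complex set => (complex => complex) => (real => complex) => bool" where
 "asym n \<alpha> \<Lambda> A f \<longleftrightarrow>
  ((%t. f t / of_real (t ^ n * exp (\<alpha> * t)) - (\<Sum>l\<in>\<Lambda>. A l * cis (Im l * t))) \<longlongrightarrow> 0) at_top"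

lemma asym_linear:
 assumes "asym n \<alpha> \<Lambda> A f" "asym n \<alpha> \<Lambda> B g"
 shows "asym n \<alpha> \<Lambda> (%l. x * A l + y * B l) (%t. x * f t + y * g t)"
proof -
 have "((%t. x * (f t / of_real (t ^ n * exp (\<alpha> * t)) - (\<Sum>l\<in>\<Lambda>. A l * cis (Im l * t))) +
   y * (g t / of_real (t ^ n * exp (\<alpha> * t)) - (\<Sum>l\<in>\<Lambda>. B l * cis (Im l * t)))) \<longlongrightarrow> x * 0 + y * 0) at_top"
  using assms unfolding asym_def by (intro tendsto_intros)
 then show ?thesis unfolding asym_def
  by (simp add: algebra_simps sum.distrib sum_distrib_left add_divide_distrib)
qed

lemma asym_zero: "asym n \<alpha> \<Lambda> (%l. 0) (%t. 0)"
 by (simp add: asym_def)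

lemma asym_add: "asym n \<alpha> \<Lambda> A f ==> asym n \<alpha> \<Lambda> B g ==> asym n \<alpha> \<Lambda> (%l. A l + B l) (%t. f t + g t)"
 using asym_linear[of n \<alpha> \<Lambda> A f B g 1 1] by simp

lemma asym_cmult: "asym n \<alpha> \<Lambda> A f ==> asym n \<alpha> \<Lambda> (%l. x * A l) (%t. x * f t)"
 using asym_linear[of n \<alpha> \<Lambda> A f A f x 0] by simp

lemma asym_diff: "asym n \<alpha> \<Lambda> A f ==> asym n \<alpha> \<Lambda> B g ==> asym n \<alpha> \<Lambda> (%l. A l - B l) (%t. f t - g t)"
 using asym_linear[of n \<alpha> \<Lambda> A f B g 1 "-1"] by simp

lemma asym_sum:
 "(!!i. i \<in> I ==> asym n \<alpha> \<Lambda> (A i) (f i)) ==> asym n \<alpha> \<Lambda> (%l. \<Sum>i\<in>I. A i l) (%t. \<Sum>i\<in>I. f i t)"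
 by (induction I rule: infinite_finite_induct) (auto intro: asym_zero asym_add)

lemma asym_cong: "asym n \<alpha> \<Lambda> A f ==> (!!l. l \<in> \<Lambda> ==> A l = B l) ==> asym n \<alpha> \<Lambda> B f"
 unfolding asym_def by (simp cong: sum.cong)

lemma asym_single:
 assumes l: "l \<in> \<Lambda>" "finite \<Lambda>" "Re l = \<alpha>" and lim: "((%t. exp (- l * of_real t) * f t / of_real (t ^ m)) \<longlongrightarrow> L) at_top"
  and m: "m <= n"
 shows "asym n \<alpha> \<Lambda> (%l'. if l' = l \<and> m = n then L else 0) f"
proof -
 have eq: "f t / of_real (t ^ m * exp (\<alpha> * t)) = exp (- l * of_real t) * f t / of_real (t ^ m) * cis (Im l * t)" for t
 proof -
  have "exp (- l * of_real t) * cis (Im l * t) = complex_of_real (exp (- \<alpha> * t))"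
   using l(3) by (simp add: cis_conv_exp exp_add[symmetric] exp_of_real[symmetric] complex_eq_iff algebra_simps Re_exp Im_exp flip: exp_of_real)
  then have "exp (- l * of_real t) * f t / of_real (t ^ m) * cis (Im l * t) = complex_of_real (exp (- \<alpha> * t)) * f t / of_real (t ^ m)"
   by (metis (no_types, lifting) mult.assoc mult.commute times_divide_eq_left)
  then show ?thesis by (simp add: exp_minus field_simps)
 qed
 have norm_cis_lim: "((%t. g t * cis (Im l * t)) \<longlongrightarrow> 0) at_top" if "(g \<longlongrightarrow> 0) at_top" for g
  by (rule tendsto_norm_zero_cancel) (use tendsto_norm_zero[OF that] in \<open>simp add: norm_mult\<close>)
 show ?thesis
 proof (cases "m = n")
  case True
  have "((%t. (exp (- l * of_real t) * f t / of_real (t ^ m) - L) * cis (Im l * t)) \<longlongrightarrow> 0) at_top"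
   by (rule norm_cis_lim) (use tendsto_diff[OF lim tendsto_const[of L]] in simp)
  moreover have "(\<Sum>l'\<in>\<Lambda>. (if l' = l \<and> m = n then L else 0) * cis (Im l' * t)) = L * cis (Im l * t)" for t
   using True l by (simp add: if_distrib[of "%x. x * _"] cong: if_cong)
  ultimately show ?thesis unfolding asym_def using True eq by (simp add: left_diff_distrib)
 next
  case False
  then have mn: "m < n" using m by simp
  have "((%t. exp (- l * of_real t) * f t / of_real (t ^ m) * of_real (1 / t ^ (n - m))) \<longlongrightarrow> L * of_real 0) at_top"
  proof (intro tendsto_mult lim tendsto_of_real)
   have "filterlim (%t::real. t ^ (n - m)) at_top at_top"
    using mn by (intro filterlim_pow_at_top filterlim_ident) auto
   then show "((%t. 1 / t ^ (n - m)) \<longlongrightarrow> (0::real)) at_top"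
    by (intro tendsto_divide_0[OF tendsto_const] filterlim_at_top_imp_at_infinity)
  qed
  then have "((%t. exp (- l * of_real t) * f t / of_real (t ^ m) * of_real (1 / t ^ (n - m)) * cis (Im l * t)) \<longlongrightarrow> 0) at_top"
   by (intro norm_cis_lim) simp
  moreover have "f t / of_real (t ^ n * exp (\<alpha> * t)) = exp (- l * of_real t) * f t / of_real (t ^ m) * of_real (1 / t ^ (n - m)) * cis (Im l * t)" for t
  proof -
   have "t ^ n = t ^ m * t ^ (n - m)" using mn by (simp add: power_add[symmetric])
   then have "f t / of_real (t ^ n * exp (\<alpha> * t)) = f t / of_real (t ^ m * exp (\<alpha> * t)) * of_real (1 / t ^ (n - m))" by simp
   then show ?thesis unfolding eq by (simp add: mult_ac)
  qed
  ultimately show ?thesis unfolding asym_def using False by simp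
 qed
qed

lemma asym_small:
 assumes "((%t. f t / of_real (exp (\<alpha> * t))) \<longlongrightarrow> 0) at_top"
 shows "asym n \<alpha> \<Lambda> (%l. 0) f"
proof -
 have "((%t. f t / of_real (t ^ n * exp (\<alpha> * t))) \<longlongrightarrow> 0) at_top"
 proof (rule Lim_null_comparison)
  show "((%t. norm (f t / of_real (exp (\<alpha> * t)))) \<longlongrightarrow> 0) at_top" using assms by (rule tendsto_norm_zero)
  show "\<forall>\<^sub>F t in at_top. norm (f t / of_real (t ^ n * exp (\<alpha> * t))) <= norm (f t / of_real (exp (\<alpha> * t)))"
   using eventually_ge_at_top[of 1]
  proof eventually_elim
   case (elim t)
   then have "1 <= t ^ n" by simp
   then have "1 * exp (\<alpha> * t) <= t ^ n * exp (\<alpha> * t)" by (rule mult_right_mono) simp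
   then show ?case using elim by (auto simp: norm_divide norm_mult norm_power intro!: divide_left_mono mult_pos_pos)
  qed
 qed
 then show ?thesis by (simp add: asym_def)
qed

text \<open>Each \<open>exp (l * t)\<close> is an eigenfunction of convolution, with eigenvalue the
  transform of the kernel at \<open>l\<close>. Integrability on the critical line itself is enough:
  the polynomial factor is absorbed by \<open>((t - s) / t) ^ n\<close>, which tends to
  \<open>1\<close>, and a multiple of \<open>exp (- \<alpha> * s) * norm (\<kappa> s)\<close>
  dominates.\<close>

lemma asym_conv:
 assumes k: "kern N \<kappa> \<alpha>" and f: "expb f" and fin: "finite \<Lambda>" and re: "!!l. l \<in> \<Lambda> ==> Re l = \<alpha>"
  and asy: "asym n \<alpha> \<Lambda> A f"
 shows "asym n \<alpha> \<Lambda> (%l. lapk N \<kappa> l * A l) (conv N \<kappa> f)"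
proof -
 note [measurable] = kern_id_measurable[OF k] f[THEN expb_measurable]
 have [measurable]: "\<kappa> \<in> borel_measurable N" using k by (simp add: kern_def)
 define P where "P v = (\<Sum>l\<in>\<Lambda>. A l * cis (Im l * v))" for v
 define Q where "Q v = f v / of_real (v ^ n * exp (\<alpha> * v)) - P v" for v
 define SA where "SA = (\<Sum>l\<in>\<Lambda>. norm (A l))"
 have PB: "norm (P v) <= SA" for v unfolding P_def SA_def by (rule sum_norm_le) (simp add: norm_mult)
 have Q0: "(Q \<longlongrightarrow> 0) at_top" using asy unfolding asym_def Q_def P_def .
 have "\<forall>\<^sub>F t in at_top. norm (f t) <= (SA + 1) * t ^ n * exp (\<alpha> * t)"
  using tendstoD[OF Q0, of 1, simplified] eventually_gt_at_top[of 0]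
 proof eventually_elim
  case (elim t)
  have "f t / of_real (t ^ n * exp (\<alpha> * t)) = Q t + P t" by (simp add: Q_def)
  then have "norm (f t / of_real (t ^ n * exp (\<alpha> * t))) <= SA + 1"
   using elim PB[of t] norm_triangle_ineq[of "Q t" "P t"] by simp
  then show ?case using elim by (simp add: norm_divide norm_mult norm_power pos_divide_le_eq mult_ac)
 qed
 from poly_bound[OF f this] obtain K where K: "K >= 0"
  "!!t v. t >= 1 ==> v <= t ==> norm (f v) <= K * t ^ n * exp (\<alpha> * v)" by blast
 \<comment> \<open>The integrand of the convolution minus that of the claimed limit; it tends to
   \<open>0\<close> for each fixed \<open>s\<close> and is dominated uniformly in
   \<open>t >= 1\<close>.\<close>
 define u where "u t s = \<kappa> s * f (t - s) / of_real (t ^ n * exp (\<alpha> * t)) - of_real (exp (- \<alpha> * s)) * \<kappa> s * P (t - s)" for t s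
 have u_meas: "(%s. u t s) \<in> borel_measurable N" for t
  unfolding u_def P_def cis_conv_exp by measurable
 have lim: "((%t. LINT s|N. u t s) \<longlongrightarrow> (LINT s|N. 0)) at_top"
 proof (rule integral_dominated_convergence_at_top[where w = "%s. (K + SA) * (exp (- \<alpha> * s) * norm (\<kappa> s))"])
  show "AE s in N. ((%t. u t s) \<longlongrightarrow> 0) at_top"
  proof (rule AE_I2)
   fix s assume "s \<in> space N"
   then have s: "s >= 0" using kern_space[OF k] by simp
   have sh: "filterlim (%t. t - s) at_top at_top"
    using filterlim_tendsto_add_at_top[OF tendsto_const[of "- s"] filterlim_ident] by simp
   have 1: "((%t. Q (t - s)) \<longlongrightarrow> 0) at_top" by (rule filterlim_compose[OF Q0 sh])
   have r: "((%t. ((t - s) / t) ^ n) \<longlongrightarrow> 1) at_top"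
   proof -
    have "((%t. (t - s) / t) \<longlongrightarrow> 1) at_top" by real_asymp
    from tendsto_power[OF this, of n] show ?thesis by simp
   qed
   have "((%t. Q (t - s) * of_real (((t - s) / t) ^ n) + P (t - s) * of_real (((t - s) / t) ^ n - 1)) \<longlongrightarrow> 0 * of_real 1 + 0) at_top"
   proof (intro tendsto_add tendsto_mult 1 tendsto_of_real r)
    have z: "((%t. SA * norm (((t - s) / t) ^ n - 1)) \<longlongrightarrow> SA * norm (1 - 1 :: real)) at_top"
     by (intro tendsto_intros r)
    show "((%t. P (t - s) * of_real (((t - s) / t) ^ n - 1)) \<longlongrightarrow> 0) at_top"
    proof (rule Lim_null_comparison)
     show "\<forall>\<^sub>F t in at_top. norm (P (t - s) * of_real (((t - s) / t) ^ n - 1)) <= SA * norm (((t - s) / t) ^ n - 1)"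
     proof (rule always_eventually, rule allI)
      fix t
      have "norm (P (t - s) * of_real (((t - s) / t) ^ n - 1)) = norm (P (t - s)) * norm (((t - s) / t) ^ n - 1)"
       by (simp only: norm_mult norm_of_real real_norm_def)
      then show "norm (P (t - s) * of_real (((t - s) / t) ^ n - 1)) <= SA * norm (((t - s) / t) ^ n - 1)"
       using PB[of "t - s"] by (simp add: mult_right_mono)
     qed
     show "((%t. SA * norm (((t - s) / t) ^ n - 1)) \<longlongrightarrow> 0) at_top" using z by simp
    qed
   qed
   then have 2: "((%t. of_real (exp (- \<alpha> * s)) * \<kappa> s * (Q (t - s) * of_real (((t - s) / t) ^ n) + P (t - s) * of_real (((t - s) / t) ^ n - 1))) \<longlongrightarrow>
     of_real (exp (- \<alpha> * s)) * \<kappa> s * 0) at_top" by (intro tendsto_mult tendsto_const) simp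
   have "\<forall>\<^sub>F t in at_top. of_real (exp (- \<alpha> * s)) * \<kappa> s * (Q (t - s) * of_real (((t - s) / t) ^ n) + P (t - s) * of_real (((t - s) / t) ^ n - 1)) = u t s"
    using eventually_gt_at_top[of s]
   proof eventually_elim
    case (elim t)
    define E where "E = complex_of_real (exp (- \<alpha> * s))"
    have E0: "E \<noteq> 0" by (simp add: E_def)
    have e: "complex_of_real (exp (\<alpha> * (t - s))) = E * of_real (exp (\<alpha> * t))"
     unfolding E_def of_real_mult[symmetric] exp_add[symmetric] by (simp add: algebra_simps)
    have "Q (t - s) * of_real (((t - s) / t) ^ n) + P (t - s) * of_real (((t - s) / t) ^ n - 1)
     = f (t - s) / of_real ((t - s) ^ n * exp (\<alpha> * (t - s))) * of_real (((t - s) / t) ^ n) - P (t - s)"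
     by (simp add: Q_def algebra_simps)
    also have "f (t - s) / of_real ((t - s) ^ n * exp (\<alpha> * (t - s))) * of_real (((t - s) / t) ^ n) =
     f (t - s) / of_real (t ^ n * exp (\<alpha> * (t - s)))"
     using elim s by (simp add: power_divide field_simps)
    also have "of_real (exp (- \<alpha> * s)) * \<kappa> s * (f (t - s) / of_real (t ^ n * exp (\<alpha> * (t - s))) - P (t - s)) = u t s"
     unfolding u_def of_real_mult e E_def[symmetric] using E0 by (simp add: field_simps)
    finally show ?case .
   qed
   from Lim_transform_eventually[OF 2 this] show "((%t. u t s) \<longlongrightarrow> 0) at_top" by simp
  qed
  show "\<forall>\<^sub>F t in at_top. AE s in N. norm (u t s) <= (K + SA) * (exp (- \<alpha> * s) * norm (\<kappa> s))"
   using eventually_ge_at_top[of 1]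
  proof eventually_elim
   case t: (elim t)
   show ?case
   proof (rule AE_I2)
    fix s assume "s \<in> space N"
    then have s: "s >= 0" using kern_space[OF k] by simp
    have "norm (f (t - s)) <= K * t ^ n * exp (\<alpha> * (t - s))" by (rule K(2)) (use t s in auto)
    also have "... = K * exp (- \<alpha> * s) * (t ^ n * exp (\<alpha> * t))" by (simp add: exp_add[symmetric] exp_diff exp_minus field_simps)
    finally have "norm (f (t - s)) / (t ^ n * exp (\<alpha> * t)) <= K * exp (- \<alpha> * s)"
     using t by (simp add: pos_divide_le_eq)
    then have "norm (\<kappa> s) * (norm (f (t - s)) / (t ^ n * exp (\<alpha> * t))) <= norm (\<kappa> s) * (K * exp (- \<alpha> * s))"
     by (rule mult_left_mono) simp
    moreover have "norm (\<kappa> s * f (t - s) / of_real (t ^ n * exp (\<alpha> * t))) = norm (\<kappa> s) * (norm (f (t - s)) / (t ^ n * exp (\<alpha> * t)))"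
     using t by (simp add: norm_mult norm_divide norm_power abs_mult power_abs)
    moreover have "norm (of_real (exp (- \<alpha> * s)) * \<kappa> s * P (t - s)) <= exp (- \<alpha> * s) * norm (\<kappa> s) * SA"
     using PB[of "t - s"] by (simp add: norm_mult mult_left_mono)
    ultimately show "norm (u t s) <= (K + SA) * (exp (- \<alpha> * s) * norm (\<kappa> s))"
     unfolding u_def using norm_triangle_ineq4[of "\<kappa> s * f (t - s) / of_real (t ^ n * exp (\<alpha> * t))" "of_real (exp (- \<alpha> * s)) * \<kappa> s * P (t - s)"]
     by (simp add: algebra_simps)
   qed
  qed
  show "integrable N (%s. (K + SA) * (exp (- \<alpha> * s) * norm (\<kappa> s)))" using k by (simp add: kern_def)
 qed (use u_meas in auto)
 have "(LINT s|N. u t s) = conv N \<kappa> f t / of_real (t ^ n * exp (\<alpha> * t)) - (\<Sum>l\<in>\<Lambda>. lapk N \<kappa> l * A l * cis (Im l * t))" for t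
 proof -
  have eq: "of_real (exp (- \<alpha> * s)) * \<kappa> s * P (t - s) = (\<Sum>l\<in>\<Lambda>. (exp (- l * of_real s) * \<kappa> s) * (A l * cis (Im l * t)))" for s
   unfolding P_def sum_distrib_left
  proof (rule sum.cong[OF refl])
   fix l assume "l \<in> \<Lambda>"
   then have "exp (- l * of_real s) = of_real (exp (- \<alpha> * s)) * cis (- (Im l * s))"
    using re by (auto simp: complex_eq_iff Re_exp Im_exp)
   moreover have "cis (Im l * (t - s)) = cis (- (Im l * s)) * cis (Im l * t)"
    by (simp add: cis_mult algebra_simps)
   ultimately show "of_real (exp (- \<alpha> * s)) * \<kappa> s * (A l * cis (Im l * (t - s))) = exp (- l * of_real s) * \<kappa> s * (A l * cis (Im l * t))"
    by (simp add: mult_ac)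
  qed
  have i1: "integrable N (%s. (exp (- l * of_real s) * \<kappa> s) * (A l * cis (Im l * t)))" if "l \<in> \<Lambda>" for l
   by (intro integrable_mult_left kern_integrable_exp[OF k]) (use re[OF that] in auto)
  have i2: "integrable N (%s. \<Sum>l\<in>\<Lambda>. (exp (- l * of_real s) * \<kappa> s) * (A l * cis (Im l * t)))"
   using i1 by auto
  have "(LINT s|N. u t s) = (LINT s|N. \<kappa> s * f (t - s) / of_real (t ^ n * exp (\<alpha> * t))) - (LINT s|N. (\<Sum>l\<in>\<Lambda>. (exp (- l * of_real s) * \<kappa> s) * (A l * cis (Im l * t))))"
   unfolding u_def eq using conv_integrable[OF k f, of t] i2 by (intro Bochner_Integration.integral_diff) auto
  also have "(LINT s|N. (\<Sum>l\<in>\<Lambda>. (exp (- l * of_real s) * \<kappa> s) * (A l * cis (Im l * t)))) = (\<Sum>l\<in>\<Lambda>. lapk N \<kappa> l * A l * cis (Im l * t))"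
  proof -
   have "(LINT s|N. (\<Sum>l\<in>\<Lambda>. (exp (- l * of_real s) * \<kappa> s) * (A l * cis (Im l * t)))) = (\<Sum>l\<in>\<Lambda>. lapk N \<kappa> l * (A l * cis (Im l * t)))"
    using i1 by (subst Bochner_Integration.integral_sum) (simp_all only: lapk_def integral_mult_left_zero)
   then show ?thesis by (simp only: mult.assoc)
  qed
  finally show ?thesis by (simp add: conv_def)
 qed
 then show ?thesis using lim unfolding asym_def by simp
qed

text \<open>The resonant case, in which the kernel is not integrable at the critical rate.
  Substituting \<open>s = t * x\<close> turns the quotient into an integral over \<open>x\<close>
  whose limit is \<open>L\<close> times the integral of \<open>(1 - x) ^ m\<close> over
  \<open>[0, 1]\<close>; one power of \<open>t\<close> and the factor \<open>1 / (m + 1)\<close> are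
  gained. Iteration gives the \<open>1 / fact m\<close> of \<open>iter_tendsto\<close>.\<close>

lemma conv_exp_power:
 assumes f: "expb f" and lim: "((%t. exp (- l * of_real t) * f t / of_real (t ^ m)) \<longlongrightarrow> L) at_top"
 shows "((%t. exp (- l * of_real t) * conv HL (%s. exp (l * of_real s)) f t / of_real (t ^ Suc m)) \<longlongrightarrow> L / of_nat (Suc m)) at_top"
proof -
 note [measurable] = f[THEN expb_measurable]
 define q where "q v = exp (- l * of_real v) * f v" for v :: real
 have qm [measurable]: "q \<in> borel_measurable borel" unfolding q_def by measurable
 have q0: "q v = 0" if "v < 0" for v using f that by (simp add: q_def expb_def)
 have limq: "((%t. q t / of_real (t ^ m)) \<longlongrightarrow> L) at_top" using lim by (simp add: q_def)
 have nq: "norm (q v) = exp (- Re l * v) * norm (f v)" for v by (simp add: q_def norm_mult)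
 have "\<forall>\<^sub>F t in at_top. norm (f t) <= (norm L + 1) * t ^ m * exp (Re l * t)"
  using tendstoD[OF limq, of 1, simplified] eventually_gt_at_top[of 0]
 proof eventually_elim
  case (elim t)
  have "norm (q t / of_real (t ^ m)) <= norm L + 1"
   using elim(1) norm_triangle_ineq2[of "q t / of_real (t ^ m)" L] by (simp add: dist_norm)
  then have "norm (q t) <= (norm L + 1) * t ^ m" using elim(2)
   by (simp add: norm_divide power_abs norm_power pos_divide_le_eq)
  then have "exp (Re l * t) * norm (q t) <= exp (Re l * t) * ((norm L + 1) * t ^ m)" by (rule mult_left_mono) simp
  moreover have "exp (Re l * t) * norm (q t) = norm (f t)" by (simp add: nq exp_minus)
  ultimately show ?case by (simp only: mult_ac)
 qed
 from poly_bound[OF f this] obtain K where K: "K >= 0"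
  "!!t v. t >= 1 ==> v <= t ==> norm (f v) <= K * t ^ m * exp (Re l * v)" by blast
 have Kq: "norm (q v) <= K * t ^ m" if "t >= 1" "v <= t" for t v
 proof -
  have "exp (- Re l * v) * norm (f v) <= exp (- Re l * v) * (K * t ^ m * exp (Re l * v))"
   by (rule mult_left_mono[OF K(2)]) (use that in auto)
  then show ?thesis by (simp add: nq exp_minus field_simps)
 qed
 let ?g = "%t x. indicator {0..} x *\<^sub>R (q (t * (1 - x)) / of_real (t ^ m))"
 let ?G = "%x. (indicator {0..1} x * (1 - x) ^ m) *\<^sub>R L"
 have lim2: "((%t. LINT x|lborel. ?g t x) \<longlongrightarrow> (LINT x|lborel. ?G x)) at_top"
 proof (rule integral_dominated_convergence_at_top[where w = "%x. K * indicator {0..1} x"])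
  show "AE x in lborel. ((%t. ?g t x) \<longlongrightarrow> ?G x) at_top"
   using AE_lborel_singleton[of 1]
  proof eventually_elim
   case (elim x)
   consider "x < 0" | "0 <= x" "x < 1" | "x > 1" using elim by linarith
   then show ?case
   proof cases
    case 1 then show ?thesis by simp
   next
    case 2
    have sh: "filterlim (%t. t * (1 - x)) at_top at_top"
     using filterlim_at_top_mult_tendsto_pos[OF tendsto_const[of "1 - x"] _ filterlim_ident] 2 by simp
    have "((%t. q (t * (1 - x)) / of_real ((t * (1 - x)) ^ m) * of_real ((1 - x) ^ m)) \<longlongrightarrow> L * of_real ((1 - x) ^ m)) at_top"
     by (intro tendsto_mult tendsto_const filterlim_compose[OF limq sh])
    moreover have "\<forall>\<^sub>F t in at_top. q (t * (1 - x)) / of_real ((t * (1 - x)) ^ m) * of_real ((1 - x) ^ m) = ?g t x"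
     using eventually_gt_at_top[of 0] by eventually_elim (use 2 in \<open>simp add: power_mult_distrib\<close>)
    ultimately have "((%t. ?g t x) \<longlongrightarrow> L * of_real ((1 - x) ^ m)) at_top"
     by (rule Lim_transform_eventually)
    then show ?thesis using 2 by (simp add: scaleR_conv_of_real mult.commute)
   next
    case 3
    have "\<forall>\<^sub>F t in at_top. 0 = ?g t x"
     using eventually_gt_at_top[of 0]
    proof eventually_elim
     case (elim t)
     then have "t * (1 - x) < 0" using 3 by (simp add: mult_pos_neg)
     then show ?case using q0 by simp
    qed
    from Lim_transform_eventually[OF tendsto_const this] show ?thesis using 3 by simp
   qed
  qed
  show "\<forall>\<^sub>F t in at_top. AE x in lborel. norm (?g t x) <= K * indicator {0..1} x"
   using eventually_ge_at_top[of 1]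
  proof eventually_elim
   case t: (elim t)
   show ?case
   proof (rule AE_I2)
    fix x :: real
    consider "x < 0" | "0 <= x" "x <= 1" | "x > 1" by linarith
    then show "norm (?g t x) <= K * indicator {0..1} x"
    proof cases
     case 2
     have "norm (q (t * (1 - x))) <= K * t ^ m"
      by (rule Kq) (use t 2 in \<open>auto simp: mult_le_cancel_left1\<close>)
     then show ?thesis using 2 t by (simp add: norm_divide norm_power pos_divide_le_eq)
    next
     case 3
     then have "t * (1 - x) < 0" using t by (simp add: mult_pos_neg)
     then show ?thesis using q0 3 by simp
    qed simp
   qed
  qed
 qed auto
 have "(LINT x|lborel. (1 - x) ^ m * indicator {0..1} x) = - ((1 - 1) ^ Suc m / real (Suc m)) - - ((1 - 0) ^ Suc m / real (Suc m))"
 proof (rule integral_FTC_Icc_real)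
  show "DERIV (%x. - ((1 - x) ^ Suc m / real (Suc m))) x :> (1 - x) ^ m" for x
   by (rule derivative_eq_intros refl | simp)+
 qed auto
 then have "(LINT x|lborel. indicator {0..1} x * (1 - x) ^ m) = 1 / real (Suc m)" by (simp add: mult.commute)
 moreover have "integrable lborel (%x::real. indicator {0..1} x * (1 - x) ^ m)"
 proof -
  have "continuous_on {0..1} (%x::real. (1 - x) ^ m)" by (intro continuous_intros)
  from borel_integrable_atLeastAtMost'[OF this] show ?thesis by (simp add: set_integrable_def)
 qed
 ultimately have G: "(LINT x|lborel. ?G x) = L / of_nat (Suc m)"
  by (subst integral_scaleR_left) (auto simp: scaleR_conv_of_real)
 have "\<forall>\<^sub>F t in at_top. (LINT x|lborel. ?g t x) = exp (- l * of_real t) * conv HL (%s. exp (l * of_real s)) f t / of_real (t ^ Suc m)"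
  using eventually_gt_at_top[of 0]
 proof eventually_elim
  case (elim t)
  have "exp (- l * of_real t) * conv HL (%s. exp (l * of_real s)) f t =
   (LINT s|lborel. exp (- l * of_real t) * (indicator {0..} s *\<^sub>R (exp (l * of_real s) * f (t - s))))"
   unfolding conv_def by (subst integral_restrict_space) (auto simp del: mult_scaleR_right)
  also have "... = (LINT s|lborel. indicator {0..} s *\<^sub>R q (t - s))"
   by (intro Bochner_Integration.integral_cong)
    (auto simp: q_def exp_add[symmetric] algebra_simps exp_diff exp_minus divide_inverse split: split_indicator)
  also have "... = \<bar>t\<bar> *\<^sub>R (LINT x|lborel. indicator {0..} (0 + t * x) *\<^sub>R q (t - (0 + t * x)))"
   using elim by (intro lborel_integral_real_affine) auto
  also have "(LINT x|lborel. indicator {0..} (0 + t * x) *\<^sub>R q (t - (0 + t * x))) = (LINT x|lborel. ?g t x * of_real (t ^ m))"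
   using elim by (intro Bochner_Integration.integral_cong) (auto simp: algebra_simps zero_le_mult_iff split: split_indicator)
  finally show ?case using elim by (simp add: scaleR_conv_of_real)
 qed
 from Lim_transform_eventually[OF lim2 this] show ?thesis using G by simp
qed

lemma laps_iter:
 "laps f \<phi> ==> laps ((conv HL (%s. exp (l * of_real s)) ^^ m) f) (%w. \<phi> w / (of_real w - l) ^ m)"
proof (induction m)
 case (Suc m)
 then show ?case using laps_conv_exp[of "(conv HL (%s. exp (l * of_real s)) ^^ m) f" "%w. \<phi> w / (of_real w - l) ^ m" l]
  by (simp add: divide_simps mult_ac)
qed simp

lemma iter_tendsto:
 assumes f: "laps f \<phi>" and lim: "((%t. exp (- l * of_real t) * f t) \<longlongrightarrow> L) at_top"
 shows "((%t. exp (- l * of_real t) * (conv HL (%s. exp (l * of_real s)) ^^ m) f t / of_real (t ^ m)) \<longlongrightarrow> L / fact m) at_top"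
proof (induction m)
 case 0 then show ?case using lim by simp
next
 case (Suc m)
 show ?case using conv_exp_power[OF laps_expb[OF laps_iter[OF f]] Suc] by (simp add: mult.commute)
qed

lemma iter_continuous:
 assumes "laps f \<phi>" "continuous_on {0..} f"
 shows "continuous_on {0..} ((conv HL (%s. exp (l * of_real s)) ^^ m) f)"
proof (induction m)
 case (Suc m)
 show ?case using conv_HL_continuous[OF kern_exp[of l "Re l + 1"] laps_expb[OF laps_iter[OF assms(1)]] Suc] by simp
qed (use assms in simp)

section \<open>Partial fractions of the inverse characteristic matrix\<close>

lemma integrable_inverse_square_shift:
 assumes "b > 0" shows "integrable lborel (%y::real. 1 / (b\<^sup>2 + y\<^sup>2))"
proof -
 have "integrable lborel (%y::real. max 1 (1 / b\<^sup>2) * inverse (1 + y\<^sup>2))"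
  using integrable_inverse_1_plus_square by (simp add: set_integrable_def einterval_def)
 then show ?thesis
 proof (rule Bochner_Integration.integrable_bound)
  show "AE y in lborel. norm (1 / (b\<^sup>2 + y\<^sup>2)) <= norm (max 1 (1 / b\<^sup>2) * inverse (1 + y\<^sup>2))"
  proof (rule AE_I2)
   fix y :: real
   have b2: "b\<^sup>2 > 0" using assms by simp
   have "1 + y\<^sup>2 <= max 1 (1 / b\<^sup>2) * b\<^sup>2 + max 1 (1 / b\<^sup>2) * y\<^sup>2"
   proof (rule add_mono)
    have "1 = 1 / b\<^sup>2 * b\<^sup>2" using b2 by simp
    also have "... <= max 1 (1 / b\<^sup>2) * b\<^sup>2" using b2 by (intro mult_right_mono) auto
    finally show "1 <= max 1 (1 / b\<^sup>2) * b\<^sup>2" .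
    have "1 * y\<^sup>2 <= max 1 (1 / b\<^sup>2) * y\<^sup>2" by (intro mult_right_mono) auto
    then show "y\<^sup>2 <= max 1 (1 / b\<^sup>2) * y\<^sup>2" by simp
   qed
   then have "1 + y\<^sup>2 <= max 1 (1 / b\<^sup>2) * (b\<^sup>2 + y\<^sup>2)" by (simp add: distrib_left)
   moreover have "b\<^sup>2 + y\<^sup>2 > 0" "1 + y\<^sup>2 > 0" using b2 by (auto simp: add_pos_nonneg)
   ultimately have "1 / (b\<^sup>2 + y\<^sup>2) <= max 1 (1 / b\<^sup>2) / (1 + y\<^sup>2)" by (simp add: divide_simps mult.commute)
   moreover have "0 <= max 1 (1 / b\<^sup>2) / (1 + y\<^sup>2)" by (intro divide_nonneg_pos) (auto simp: add_pos_nonneg)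
   ultimately show "norm (1 / (b\<^sup>2 + y\<^sup>2)) <= norm (max 1 (1 / b\<^sup>2) * inverse (1 + y\<^sup>2))"
    using \<open>b\<^sup>2 + y\<^sup>2 > 0\<close> by (simp add: divide_inverse)
  qed
 qed measurable
qed

text \<open>Cauchy's formula for a half-plane: the boundary line is the only part of a large rectangle that
 contributes in the limit.\<close>

lemma halfplane_cauchy_formula:
 fixes J :: "complex => complex"
 assumes hol: "J holomorphic_on {z. \<gamma>0 < Re z}" and g: "\<gamma>0 < \<gamma>" "p < \<gamma>"
  and bd: "!!z. Re z >= \<gamma> ==> norm (J z) <= C / (norm (z - of_real p))\<^sup>2"
  and w: "Re w > \<gamma>"
 shows "integrable lborel (%y. J (Complex \<gamma> y))"
  and "integrable lborel (%y. J (Complex \<gamma> y) / (w - Complex \<gamma> y))"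
  and "(LINT y|lborel. J (Complex \<gamma> y) / (w - Complex \<gamma> y)) = 2 * of_real pi * J w"
proof -
 have contJ: "continuous_on {z. \<gamma>0 < Re z} J" by (rule holomorphic_on_imp_continuous_on[OF hol])
 have cc: "continuous_on UNIV (%y. Complex \<gamma> y)"
  unfolding Complex_eq by (intro continuous_intros)
 have contl: "continuous_on UNIV (%y. J (Complex \<gamma> y))"
  by (rule continuous_on_compose2[OF contJ cc]) (use g in auto)
 then have m1 [measurable]: "(%y. J (Complex \<gamma> y)) \<in> borel_measurable borel"
  by (rule borel_measurable_continuous_onI)
 have ne: "w - Complex \<gamma> y \<noteq> 0" for y using w by (auto simp: complex_eq_iff)
 have contl2: "continuous_on UNIV (%y. J (Complex \<gamma> y) / (w - Complex \<gamma> y))"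
  by (intro continuous_intros contl cc) (use ne in auto)
 then have m2 [measurable]: "(%y. J (Complex \<gamma> y) / (w - Complex \<gamma> y)) \<in> borel_measurable borel"
  by (rule borel_measurable_continuous_onI)
 have C: "C >= 0"
 proof -
  have "0 <= C / (norm (of_real \<gamma> - of_real p :: complex))\<^sup>2"
   using bd[of "of_real \<gamma>"] by (auto intro: order_trans[OF norm_ge_zero])
  moreover have "(norm (of_real \<gamma> - of_real p :: complex))\<^sup>2 > 0" using g by auto
  ultimately show ?thesis by (simp add: zero_le_divide_iff)
 qed
 have sq: "(norm (Complex \<gamma> y - of_real p))\<^sup>2 = (\<gamma> - p)\<^sup>2 + y\<^sup>2" for y
  by (simp add: cmod_def)
 have "integrable lborel (%y. C * (1 / ((\<gamma> - p)\<^sup>2 + y\<^sup>2)))"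
  using g by (intro integrable_mult_right integrable_inverse_square_shift) simp
 then show i1: "integrable lborel (%y. J (Complex \<gamma> y))"
 proof (rule Bochner_Integration.integrable_bound)
  show "AE y in lborel. norm (J (Complex \<gamma> y)) <= norm (C * (1 / ((\<gamma> - p)\<^sup>2 + y\<^sup>2)))"
   using bd[of "Complex \<gamma> _"] C unfolding sq by (intro AE_I2) simp
 qed simp
 have "integrable lborel (%y. 1 / (Re w - \<gamma>) * norm (J (Complex \<gamma> y)))" using i1 by auto
 then show i2: "integrable lborel (%y. J (Complex \<gamma> y) / (w - Complex \<gamma> y))"
 proof (rule Bochner_Integration.integrable_bound)
  have "Re w - \<gamma> <= norm (w - Complex \<gamma> y)" for y using complex_Re_le_cmod[of "w - Complex \<gamma> y"] by simp
  then have "norm (J (Complex \<gamma> y)) / norm (w - Complex \<gamma> y) <= norm (J (Complex \<gamma> y)) / (Re w - \<gamma>)" for y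
   using w by (intro divide_left_mono mult_pos_pos) (use ne in auto)
  then show "AE y in lborel. norm (J (Complex \<gamma> y) / (w - Complex \<gamma> y)) <= norm (1 / (Re w - \<gamma>) * norm (J (Complex \<gamma> y)))"
   using w by (intro AE_I2) (simp add: norm_divide abs_mult)
 qed simp
 let ?g = "%y. J (Complex \<gamma> y) / (w - Complex \<gamma> y)"
 have lim: "((%T. LINT y|lborel. indicator {-T..T} y *\<^sub>R ?g y) \<longlongrightarrow> (LINT y|lborel. ?g y)) at_top"
 proof (rule integral_dominated_convergence_at_top[where w = "%y. norm (?g y)"])
  show "AE y in lborel. ((%T. indicator {-T..T} y *\<^sub>R ?g y) \<longlongrightarrow> ?g y) at_top"
  proof (rule AE_I2)
   fix y :: real
   have "\<forall>\<^sub>F T in at_top. indicator {-T..T} y *\<^sub>R ?g y = ?g y"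
    using eventually_ge_at_top[of "\<bar>y\<bar>"] by eventually_elim (simp add: abs_le_iff indicator_def)
   then show "((%T. indicator {-T..T} y *\<^sub>R ?g y) \<longlongrightarrow> ?g y) at_top" by (rule tendsto_eventually)
  qed
  show "\<forall>\<^sub>F T in at_top. AE y in lborel. norm (indicator {-T..T} y *\<^sub>R ?g y) <= norm (?g y)"
   by (intro always_eventually allI AE_I2) (auto split: split_indicator)
 qed (use i2 in auto)
 \<comment> \<open>The three far sides have total length \<open>4 * T\<close>; on them
   \<open>norm (J z) <= 4 * C / T\<^sup>2\<close> and \<open>1 / norm (z - w) <= 2 / T\<close>,
   which multiplies to \<open>32 * C / T\<^sup>2\<close>. The threshold for \<open>T\<close> keeps
   those sides at distance at least \<open>T / 2\<close> from both \<open>w\<close> and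
   \<open>p\<close>.\<close>
 have bound: "norm ((LINT y|lborel. indicator {-T..T} y *\<^sub>R ?g y) - 2 * of_real pi * J w) <= 32 * C / T\<^sup>2"
  if T: "T > 2 * (norm w + \<bar>\<gamma>\<bar> + \<bar>p\<bar> + 1)" for T
 proof -
  have "0 < T' \<and> n < T' - b \<and> 2 * (c + b) <= T' \<and> 2 * (n + b) <= T'" if "2 * (n + b + c + 1) < T'" "0 <= n" "0 <= b" "0 <= c" for n b c T' :: real
   using that by auto
  from this[OF T norm_ge_zero abs_ge_zero abs_ge_zero] have T0: "T > 0" and nw: "norm w < T - \<bar>\<gamma>\<bar>"
   and Tp: "2 * (\<bar>p\<bar> + \<bar>\<gamma>\<bar>) <= T" and Tw: "2 * (norm w + \<bar>\<gamma>\<bar>) <= T" by auto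
  define a1 a2 a3 a4 where "a1 = Complex \<gamma> (-T)" and "a2 = Complex (\<gamma> + T) (-T)" and "a3 = Complex (\<gamma> + T) T" and "a4 = Complex \<gamma> T"
  let ?h = "%z. J z / (z - w)"
  have wb: "Re w < \<gamma> + T" "\<bar>Im w\<bar> < T"
  proof -
   have "Re w <= norm w" by (rule complex_Re_le_cmod)
   also note nw
   also have "T - \<bar>\<gamma>\<bar> <= \<gamma> + T" using abs_ge_minus_self[of \<gamma>] by simp
   finally show "Re w < \<gamma> + T" .
   have "\<bar>Im w\<bar> <= norm w" by (rule abs_Im_le_cmod)
   also note nw
   also have "T - \<bar>\<gamma>\<bar> <= T" by simp
   finally show "\<bar>Im w\<bar> < T" .
  qed
  have wbox: "w \<in> box a1 a3" using w wb by (auto simp: box_def Basis_complex_def a1_def a3_def)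
  have rp: "rectpath a1 a3 = linepath a1 a2 +++ linepath a2 a3 +++ linepath a3 a4 +++ linepath a4 a1"
   by (simp add: rectpath_def Let_def a1_def a2_def a3_def a4_def)
  have wn: "winding_number (rectpath a1 a3) w = 1" by (rule winding_number_rectpath[OF wbox])
  have sub: "path_image (rectpath a1 a3) \<subseteq> {z. \<gamma>0 < Re z} - {w}"
  proof -
   have "path_image (rectpath a1 a3) \<subseteq> cbox a1 a3 - {w}"
    using path_image_rectpath_subset_cbox[of a1 a3] path_image_rectpath_inter_box[of a1 a3] wbox T0
    by (auto simp: a1_def a3_def)
   moreover have "cbox a1 a3 \<subseteq> {z. \<gamma>0 < Re z}" using g by (auto simp: cbox_def Basis_complex_def a1_def a3_def)
   ultimately show ?thesis by blast
  qed
  have opn: "open {z. \<gamma>0 < Re z}" by (simp add: open_halfspace_Re_gt)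
  have "(?h has_contour_integral (2 * pi * \<i> * winding_number (rectpath a1 a3) w * J w)) (rectpath a1 a3)"
   using sub w g by (intro Cauchy_integral_formula_convex_simple[OF convex_halfspace_Re_gt hol])
    (auto simp: interior_open[OF opn])
  then have hci: "(?h has_contour_integral (2 * pi * \<i> * J w)) (rectpath a1 a3)" using wn by simp
  have segs: "closed_segment x y \<subseteq> {z. \<gamma>0 < Re z} - {w}" if "(x, y) \<in> {(a1, a2), (a2, a3), (a3, a4), (a4, a1)}" for x y
   using sub that unfolding rp by (auto simp: path_image_join)
  have ci: "?h contour_integrable_on linepath x y" if "(x, y) \<in> {(a1, a2), (a2, a3), (a3, a4), (a4, a1)}" for x y
  proof (rule contour_integrable_continuous_linepath)
   show "continuous_on (closed_segment x y) ?h"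
    using segs[OF that] by (intro continuous_intros continuous_on_subset[OF contJ]) auto
  qed
  have sum: "2 * pi * \<i> * J w = contour_integral (linepath a1 a2) ?h + contour_integral (linepath a2 a3) ?h
    + contour_integral (linepath a3 a4) ?h + contour_integral (linepath a4 a1) ?h"
   using contour_integral_unique[OF hci] unfolding rp
   by (simp add: contour_integral_join ci contour_integrable_joinI add.assoc)
  have small: "norm (contour_integral (linepath x y) ?h) <= (4 * C / T\<^sup>2 * (2 / T)) * norm (y - x)"
   if xy: "(x, y) \<in> {(a1, a2), (a2, a3), (a3, a4)}" for x y
  proof (rule contour_integral_bound_linepath)
   show "?h contour_integrable_on linepath x y" using ci xy by blast
   show "0 <= 4 * C / T\<^sup>2 * (2 / T)" using C T0 by simp
   fix z assume z: "z \<in> closed_segment x y"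
   have "z \<in> cbox a1 a3" "(\<bar>Im z\<bar> = T \<or> Re z = \<gamma> + T)"
   proof -
    have "z \<in> path_image (rectpath a1 a3)" unfolding rp using z xy by (auto simp: path_image_join)
    then show "z \<in> cbox a1 a3" using path_image_rectpath_subset_cbox[of a1 a3] T0 by (auto simp: a1_def a3_def)
    show "(\<bar>Im z\<bar> = T \<or> Re z = \<gamma> + T)"
     using z xy T0 by (auto simp: a1_def a2_def a3_def a4_def closed_segment_same_Re closed_segment_same_Im)
   qed
   then have rez: "Re z >= \<gamma>" and far: "\<bar>Im z\<bar> = T \<or> Re z = \<gamma> + T"
    by (auto simp: cbox_def Basis_complex_def a1_def a3_def)
   have zT: "norm (z - q) >= T / 2" if "2 * (norm q + \<bar>\<gamma>\<bar>) <= T" for q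
   proof -
    have "norm (z - q) >= T - \<bar>\<gamma>\<bar> - norm q"
     using far
    proof
     assume "\<bar>Im z\<bar> = T"
     moreover have "\<bar>Im z\<bar> <= \<bar>Im (z - q)\<bar> + \<bar>Im q\<bar>" by simp
     ultimately have "T <= norm (z - q) + norm q"
      using abs_Im_le_cmod[of "z - q"] abs_Im_le_cmod[of q] by linarith
     then show ?thesis using abs_ge_zero[of \<gamma>] by linarith
    next
     assume "Re z = \<gamma> + T"
     moreover have "Re z <= \<bar>Re (z - q)\<bar> + \<bar>Re q\<bar>" by simp
     ultimately have "\<gamma> + T <= norm (z - q) + norm q"
      using abs_Re_le_cmod[of "z - q"] abs_Re_le_cmod[of q] by linarith
     then show ?thesis using abs_ge_minus_self[of \<gamma>] by linarith
    qed
    moreover have "T' / 2 <= x" if "T' - b - n <= x" "2 * (n + b) <= T'" for T' b n x :: real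
     using that by auto
    ultimately show ?thesis using that by blast
   qed
   have zp: "norm (z - of_real p) >= T / 2" by (rule zT) (use Tp in simp)
   have zw: "norm (z - w) >= T / 2" by (rule zT) (use Tw in simp)
   have "norm (J z) <= C / (norm (z - of_real p))\<^sup>2" by (rule bd[OF rez])
   also have "... <= C / (T / 2)\<^sup>2"
    using zp T0 C by (intro divide_left_mono power_mono mult_pos_pos zero_less_power) auto
   also have "... = 4 * C / T\<^sup>2" by (simp add: power_divide)
   finally have "norm (J z) / norm (z - w) <= 4 * C / T\<^sup>2 / (T / 2)"
    using zw T0 C by (intro frac_le) auto
   then show "norm (?h z) <= 4 * C / T\<^sup>2 * (2 / T)" by (simp add: norm_divide)
  qed
  have lens: "norm (a2 - a1) = T" "norm (a3 - a2) = 2 * T" "norm (a4 - a3) = T"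
   using T0 by (auto simp: a1_def a2_def a3_def a4_def cmod_def real_sqrt_mult)
  \<comment> \<open>The left side is traversed downwards, and this sign turns \<open>z - w\<close>
    into \<open>w - z\<close>.\<close>
  have left: "contour_integral (linepath a4 a1) ?h = \<i> * (LINT y|lborel. indicator {-T..T} y *\<^sub>R ?g y)"
  proof -
   have "contour_integral (linepath a4 a1) ?h = - contour_integral (linepath a1 a4) ?h"
    by (rule contour_integral_reverse_linepath) (use segs[of a4 a1] in \<open>auto intro!: continuous_intros continuous_on_subset[OF contJ]\<close>)
   also have "contour_integral (linepath a1 a4) ?h = \<i> * integral {-T..T} (%y. ?h (Complex \<gamma> y))"
    by (rule contour_integral_linepath_same_Re) (use T0 in \<open>auto simp: a1_def a4_def\<close>)
   also have "integral {-T..T} (%y. ?h (Complex \<gamma> y)) = integral {-T..T} (%y. - ?g y)"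
    by (rule integral_cong) (metis minus_diff_eq minus_divide_right)
   also have "... = - integral {-T..T} ?g" by simp
   also have "integral {-T..T} ?g = (LINT y:{-T..T}|lborel. ?g y)"
    by (rule set_borel_integral_eq_integral(2)[symmetric])
     (intro borel_integrable_atLeastAtMost' continuous_on_subset[OF contl2], simp)
   finally show ?thesis by (simp add: set_lebesgue_integral_def)
  qed
  have "\<i> * ((LINT y|lborel. indicator {-T..T} y *\<^sub>R ?g y) - 2 * of_real pi * J w) =
   - (contour_integral (linepath a1 a2) ?h + contour_integral (linepath a2 a3) ?h + contour_integral (linepath a3 a4) ?h)"
   using sum left by (simp add: algebra_simps)
  from arg_cong[OF this, of norm] have "norm ((LINT y|lborel. indicator {-T..T} y *\<^sub>R ?g y) - 2 * of_real pi * J w) =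
   norm (contour_integral (linepath a1 a2) ?h + contour_integral (linepath a2 a3) ?h + contour_integral (linepath a3 a4) ?h)"
   by (simp only: norm_mult norm_ii mult_1 norm_minus_cancel)
  also have "... <= (4 * C / T\<^sup>2 * (2 / T)) * T + (4 * C / T\<^sup>2 * (2 / T)) * (2 * T) + (4 * C / T\<^sup>2 * (2 / T)) * T"
   using small[of a1 a2] small[of a2 a3] small[of a3 a4] unfolding lens
   by (intro order_trans[OF norm_triangle_ineq] add_mono) auto
  also have "... = 32 * C / T\<^sup>2" using T0 by (simp add: field_simps)
  finally show ?thesis using T0 by simp
 qed
 have "((%T. (LINT y|lborel. indicator {-T..T} y *\<^sub>R ?g y) - 2 * of_real pi * J w) \<longlongrightarrow> 0) at_top"
 proof (rule Lim_null_comparison)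
  show "\<forall>\<^sub>F T in at_top. norm ((LINT y|lborel. indicator {-T..T} y *\<^sub>R ?g y) - 2 * of_real pi * J w) <= 32 * C / T\<^sup>2"
   using eventually_gt_at_top[of "2 * (norm w + \<bar>\<gamma>\<bar> + \<bar>p\<bar> + 1)"] by eventually_elim (rule bound)
  show "((%T. 32 * C / T\<^sup>2) \<longlongrightarrow> 0) at_top" by real_asymp
 qed
 then have "((%T. LINT y|lborel. indicator {-T..T} y *\<^sub>R ?g y) \<longlongrightarrow> 2 * of_real pi * J w) at_top"
  by (rule Lim_null[THEN iffD2])
 then show "(LINT y|lborel. ?g y) = 2 * of_real pi * J w"
  using lim tendsto_unique trivial_limit_at_top_linorder by blast
qed

text \<open>The Bromwich integral on the line \<open>Re z = \<gamma>\<close>, parametrised by the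
  imaginary part; \<open>dz = i dy\<close> removes the factor \<open>i\<close> from the usual
  constant.\<close>

definition invlap :: "(complex => complex) => real => real => complex" where
 "invlap J \<gamma> t = (LINT y|lborel. exp (Complex \<gamma> y * of_real t) * J (Complex \<gamma> y)) / (2 * of_real pi)"

text \<open>Quadratic decay of \<open>J\<close> makes the integral absolutely convergent, so Fubini
  applies: transforming \<open>exp (z * t)\<close> first gives \<open>1 / (w - z)\<close>, and what
  remains is Cauchy's formula for the half-plane.\<close>

lemma invlap:
 fixes J :: "complex => complex"
 assumes hol: "J holomorphic_on {z. \<gamma>0 < Re z}" and g: "\<gamma>0 < \<gamma>" "p < \<gamma>"
  and bd: "!!z. Re z >= \<gamma> ==> norm (J z) <= C / (norm (z - of_real p))\<^sup>2"
  and a: "\<gamma> < a"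
 shows "kern HL (invlap J \<gamma>) a" and "Re w >= a ==> lapk HL (invlap J \<gamma>) w = J w"
proof -
 have i1: "integrable lborel (%y. J (Complex \<gamma> y))"
  by (rule halfplane_cauchy_formula(1)[OF hol g bd, of "of_real (\<gamma> + 1)"]) auto
 have m1 [measurable]: "(%y. J (Complex \<gamma> y)) \<in> borel_measurable borel" using borel_measurable_integrable[OF i1] by simp
 have mC [measurable]: "(%y. Complex \<gamma> y) \<in> borel_measurable borel"
  unfolding Complex_eq by measurable
 define I where "I = (LINT y|lborel. norm (J (Complex \<gamma> y)))"
 have meas: "invlap J \<gamma> \<in> borel_measurable borel"
  unfolding invlap_def[abs_def] by measurable
 have bnd: "norm (invlap J \<gamma> t) <= I / (2 * pi) * exp (\<gamma> * t)" for t
 proof -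
  have "norm (LINT y|lborel. exp (Complex \<gamma> y * of_real t) * J (Complex \<gamma> y)) <= (LINT y|lborel. exp (\<gamma> * t) * norm (J (Complex \<gamma> y)))"
   by (rule order_trans[OF integral_norm_bound]) (simp add: norm_mult)
  then show ?thesis by (simp add: invlap_def norm_divide I_def divide_right_mono mult.commute)
 qed
 have iHL: "integrable HL (%t. exp (- (b - \<gamma>) * t))" if "b > \<gamma>" for b
  using real_exp_halfline_integrable[of "b - \<gamma>"] that by (simp add: integrable_restrict_space)
 have mHL: "(%t. t) \<in> borel_measurable HL" by (intro measurable_restrict_space1) simp
 have meas2 [measurable]: "invlap J \<gamma> \<in> borel_measurable HL" using meas by (intro measurable_restrict_space1) simp
 have "integrable HL (%t. I / (2 * pi) * exp (- (a - \<gamma>) * t))" using iHL[OF a] by simp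
 then have "integrable HL (%s. exp (- a * s) * norm (invlap J \<gamma> s))"
 proof (rule Bochner_Integration.integrable_bound)
  show "AE s in HL. norm (exp (- a * s) * norm (invlap J \<gamma> s)) <= norm (I / (2 * pi) * exp (- (a - \<gamma>) * s))"
  proof (rule AE_I2)
   fix s
   have "exp (- a * s) * norm (invlap J \<gamma> s) <= exp (- a * s) * (I / (2 * pi) * exp (\<gamma> * s))"
    by (rule mult_left_mono[OF bnd]) simp
   also have "... = I / (2 * pi) * exp (- (a - \<gamma>) * s)" by (simp add: exp_add[symmetric] algebra_simps)
   finally show "norm (exp (- a * s) * norm (invlap J \<gamma> s)) <= norm (I / (2 * pi) * exp (- (a - \<gamma>) * s))"
    unfolding real_norm_def abs_mult abs_exp_cancel abs_norm_cancel
    by (rule order_trans) (intro mult_right_mono abs_ge_self, simp)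
  qed
 qed (use mHL in measurable)
 then show "kern HL (invlap J \<gamma>) a" unfolding kern_def using sigma_finite_HL sets_HL meas2 by blast
 show "lapk HL (invlap J \<gamma>) w = J w" if w: "Re w >= a"
 proof -
  interpret H: sigma_finite_measure HL by (rule sigma_finite_HL)
  interpret P: pair_sigma_finite HL lborel ..
  note [measurable] = mHL
  have wg: "Re w > \<gamma>" using w a by simp
  let ?F = "%(t, y). exp (- w * of_real t) * (exp (Complex \<gamma> y * of_real t) * J (Complex \<gamma> y))"
  have nF: "norm (?F (t, y)) = exp (- (Re w - \<gamma>) * t) * norm (J (Complex \<gamma> y))" for t y
   by (simp add: norm_mult exp_add[symmetric] algebra_simps)
  have eF: "?F (t, y) = exp (- (w - Complex \<gamma> y) * of_real t) * J (Complex \<gamma> y)" for t y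
   by (simp add: exp_add[symmetric] algebra_simps)
  have int2: "integrable (HL \<Otimes>\<^sub>M lborel) ?F"
  proof (rule P.Fubini_integrable)
   show "?F \<in> borel_measurable (HL \<Otimes>\<^sub>M lborel)" by measurable
   show "integrable HL (%t. LINT y|lborel. norm (?F (t, y)))"
    unfolding nF using iHL[OF wg] by simp
   show "AE t in HL. integrable lborel (%y. ?F (t, y))"
   proof (rule AE_I2)
    fix t
    have "integrable lborel (%y. exp (- (Re w - \<gamma>) * t) * norm (J (Complex \<gamma> y)))" using i1 by auto
    then show "integrable lborel (%y. ?F (t, y))"
    proof (rule Bochner_Integration.integrable_bound)
     have [measurable]: "(%y. exp (Complex \<gamma> y * of_real t)) \<in> borel_measurable borel"
      unfolding Complex_eq by (intro borel_measurable_continuous_onI continuous_intros)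
     show "(%y. ?F (t, y)) \<in> borel_measurable lborel" unfolding prod.case
      by (intro borel_measurable_times borel_measurable_const) simp_all
     show "AE y in lborel. norm (?F (t, y)) <= norm (exp (- (Re w - \<gamma>) * t) * norm (J (Complex \<gamma> y)))"
      unfolding nF by (simp add: abs_mult)
    qed
   qed
  qed
  have "lapk HL (invlap J \<gamma>) w = (LINT t|HL. LINT y|lborel. ?F (t, y)) / (2 * of_real pi)"
   unfolding lapk_def invlap_def by simp
  also have "(LINT t|HL. LINT y|lborel. ?F (t, y)) = (LINT y|lborel. LINT t|HL. ?F (t, y))"
   using P.Fubini_integral[of "%t y. ?F (t, y)"] int2 by simp
  also have "... = (LINT y|lborel. J (Complex \<gamma> y) / (w - Complex \<gamma> y))"
  proof (rule Bochner_Integration.integral_cong[OF refl])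
   fix y
   have "(LINT t|HL. exp (- (w - Complex \<gamma> y) * of_real t)) = 1 / (w - Complex \<gamma> y)"
    by (rule integral_exp_halfline(2)) (use wg in simp)
   then show "(LINT t|HL. ?F (t, y)) = J (Complex \<gamma> y) / (w - Complex \<gamma> y)" unfolding eF by simp
  qed
  also have "... = 2 * of_real pi * J w" by (rule halfplane_cauchy_formula(3)[OF hol g bd wg])
  finally show ?thesis by simp
 qed
qed

text \<open>Differentiation under the integral. The factor \<open>s\<close> produced by the
  derivative is paid by half of the distance from \<open>z\<close> to the line
  \<open>Re z = a\<close>, through \<open>\<delta> * s <= exp (\<delta> * s)\<close>.\<close>

lemma lapk_one_holomorphic:
 assumes k: "kern N (%_. 1) a"
 shows "lapk N (%_. 1) holomorphic_on {z. a < Re z}"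
proof (rule holomorphic_onI)
 fix z assume z: "z \<in> {z. a < Re z}"
 define \<delta> where "\<delta> = (Re z - a) / 2"
 have d: "\<delta> > 0" using z by (simp add: \<delta>_def)
 note [measurable] = kern_id_measurable[OF k]
 let ?e = "%z s. exp (- z * complex_of_real s)"
 have "(lapk N (%_. 1) has_field_derivative (LINT s|N. - of_real s * ?e z s)) (at z within ball z \<delta>)"
  unfolding has_field_derivative_iff tendsto_at_iff_sequentially
 proof (intro allI impI)
  fix X assume X: "\<forall>i. X i \<in> ball z \<delta> - {z}" and lim: "X \<longlonglongrightarrow> z"
  have Re_ge: "Re w >= a + \<delta>" if "w \<in> ball z \<delta>" for w
  proof -
   have "norm (z - w) < \<delta>" using that by (simp add: dist_norm)
   moreover have "Re z = a + 2 * \<delta>" by (simp add: \<delta>_def field_simps)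
   ultimately show ?thesis using abs_Re_le_cmod[of "z - w"] unfolding minus_complex.sel by linarith
  qed
  have int: "integrable N (?e w)" if "w \<in> ball z \<delta>" for w
   using kern_integrable_exp[OF k, of w] Re_ge[OF that] d by simp
  have eq: "(lapk N (%_. 1) (X i) - lapk N (%_. 1) z) / (X i - z) = (LINT s|N. (?e (X i) s - ?e z s) / (X i - z))" for i
   using int[of "X i"] int[of z] X d unfolding lapk_def by simp
  have "(%i. LINT s|N. (?e (X i) s - ?e z s) / (X i - z)) \<longlonglongrightarrow> (LINT s|N. - of_real s * ?e z s)"
  proof (rule integral_dominated_convergence[where w = "%s. 1 / \<delta> * (exp (- a * s) * norm (1::complex))"])
   show "integrable N (%s. 1 / \<delta> * (exp (- a * s) * norm (1::complex)))" using k by (simp add: kern_def)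
   show "AE s in N. (%i. (?e (X i) s - ?e z s) / (X i - z)) \<longlonglongrightarrow> - of_real s * ?e z s"
   proof (rule AE_I2)
    fix s
    have "((%z. ?e z s) has_field_derivative - of_real s * ?e z s) (at z)"
     by (auto intro!: derivative_eq_intros)
    then have "((%w. (?e w s - ?e z s) / (w - z)) \<longlongrightarrow> - of_real s * ?e z s) (at z)"
     by (simp add: has_field_derivative_iff)
    moreover have "filterlim X (at z) sequentially"
     using X lim by (auto simp: filterlim_at intro!: always_eventually)
    ultimately show "(%i. (?e (X i) s - ?e z s) / (X i - z)) \<longlonglongrightarrow> - of_real s * ?e z s"
     by (rule filterlim_compose)
   qed
   show "AE s in N. norm ((?e (X i) s - ?e z s) / (X i - z)) <= 1 / \<delta> * (exp (- a * s) * norm (1::complex))" for i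
   proof (rule AE_I2)
    fix s assume "s \<in> space N"
    then have s: "s >= 0" using kern_space[OF k] by simp
    have "norm (?e (X i) s - ?e z s) <= (exp (- a * s) / \<delta>) * norm (X i - z)"
    proof (rule field_differentiable_bound[of "ball z \<delta>"])
     fix w assume w: "w \<in> ball z \<delta>"
     show "((%z. ?e z s) has_field_derivative - of_real s * ?e w s) (at w within ball z \<delta>)"
      by (auto intro!: derivative_eq_intros)
     have "\<delta> * s <= exp (\<delta> * s)" using exp_ge_add_one_self[of "\<delta> * s"] by linarith
     have "exp (- Re w * s) <= exp (- (a + \<delta>) * s)"
      unfolding exp_le_cancel_iff using Re_ge[OF w] s by (intro mult_right_mono) auto
     then have "s * exp (- Re w * s) <= s * exp (- (a + \<delta>) * s)" using s by (rule mult_left_mono)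
     also have "... = (\<delta> * s) * (exp (- a * s) * exp (- \<delta> * s)) / \<delta>"
      using d by (simp add: exp_add[symmetric] algebra_simps)
     also have "... <= exp (\<delta> * s) * (exp (- a * s) * exp (- \<delta> * s)) / \<delta>"
      using d \<open>\<delta> * s <= exp (\<delta> * s)\<close> by (intro divide_right_mono mult_right_mono) auto
     also have "... = exp (- a * s) / \<delta>" by (simp add: exp_add[symmetric] algebra_simps)
     finally show "norm (- of_real s * ?e w s) <= exp (- a * s) / \<delta>"
      using s by (simp add: norm_mult)
    qed (use X d in auto)
    moreover have "norm (X i - z) > 0" using X by simp
    ultimately show "norm ((?e (X i) s - ?e z s) / (X i - z)) <= 1 / \<delta> * (exp (- a * s) * norm (1::complex))"
     by (simp add: norm_divide pos_divide_le_eq)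
   qed
  qed measurable
  then show "((%w. (lapk N (%_. 1) w - lapk N (%_. 1) z) / (w - z)) \<circ> X) \<longlonglongrightarrow> (LINT s|N. - of_real s * ?e z s)"
   unfolding o_def eq .
 qed
 moreover have "at z within ball z \<delta> = at z" by (rule at_within_open) (use d in auto)
 ultimately have "lapk N (%_. 1) field_differentiable at z"
  unfolding field_differentiable_def by auto
 then show "lapk N (%_. 1) field_differentiable at z within {z. a < Re z}"
  by (rule field_differentiable_at_within)
qed

section \<open>Principal parts at finitely many poles\<close>

lemma analytic_quotient:
 assumes "g analytic_on {l}"
 obtains g1 where "g1 analytic_on {l}" "!!z. z \<noteq> l ==> g z / (z - l) = g l / (z - l) + g1 z"
proof
 let ?F = "%z. if z = l then deriv g l else g z / (z - l) - g l / (z - l)"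
 show "?F analytic_on {l}"
  by (rule pole_theorem_analytic[OF assms]) (auto intro!: exI[of _ 1])
 show "g z / (z - l) = g l / (z - l) + ?F z" if "z \<noteq> l" for z using that by simp
qed

text \<open>Repeated removal of the value at \<open>l\<close>, that is, a Taylor expansion of
  \<open>g\<close> divided by the pole. Only the top coefficient \<open>g l\<close> is named, since
  no other one survives in the final limit.\<close>

lemma partial_fraction_local:
 assumes "g analytic_on {l}"
 shows "\<exists>c h. h analytic_on {l} \<and> c n = g l \<and>
  (\<forall>z. z \<noteq> l \<longrightarrow> g z / (z - l) ^ Suc n = (\<Sum>m\<le>n. c m / (z - l) ^ Suc m) + h z)"
 using assms
proof (induction n arbitrary: g)
 case 0
 obtain g1 where g1: "g1 analytic_on {l}" "!!z. z \<noteq> l ==> g z / (z - l) = g l / (z - l) + g1 z"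
  using analytic_quotient[OF 0] by blast
 then show ?case by (intro exI[of _ "%_. g l"] exI[of _ g1]) auto
next
 case (Suc n)
 obtain g1 where g1: "g1 analytic_on {l}" "!!z. z \<noteq> l ==> g z / (z - l) = g l / (z - l) + g1 z"
  using analytic_quotient[OF Suc.prems] by blast
 obtain c h where h: "h analytic_on {l}"
  and c: "!!z. z \<noteq> l ==> g1 z / (z - l) ^ Suc n = (\<Sum>m\<le>n. c m / (z - l) ^ Suc m) + h z"
  using Suc.IH[OF g1(1)] by blast
 define c' where "c' = c (Suc n := g l)"
 have "g z / (z - l) ^ Suc (Suc n) = (\<Sum>m\<le>Suc n. c' m / (z - l) ^ Suc m) + h z" if "z \<noteq> l" for z
 proof -
  have "g z / (z - l) ^ Suc (Suc n) = (g z / (z - l)) / (z - l) ^ Suc n" by simp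
  also have "... = g l / (z - l) ^ Suc (Suc n) + g1 z / (z - l) ^ Suc n"
   unfolding g1(2)[OF that] by (simp add: add_divide_distrib)
  also have "g1 z / (z - l) ^ Suc n = (\<Sum>m\<le>n. c' m / (z - l) ^ Suc m) + h z"
   unfolding c[OF that] c'_def by (intro arg_cong2[of _ _ _ _ "(+)"] sum.cong) auto
  finally show ?thesis by (simp add: c'_def)
 qed
 then show ?case using h by (intro exI[of _ c'] exI[of _ h]) (auto simp: c'_def)
qed

text \<open>The remainder is glued from local pieces: at a pole it takes the value of the local
  analytic part minus the principal parts of the other poles, elsewhere it is \<open>f\<close> minus
  all principal parts. A common exponent \<open>Suc n\<close> is imposed on all poles; a pole of
  lower order just has top coefficient \<open>0\<close>.\<close>

lemma partial_fractions:
 assumes S: "open S" and fin: "finite \<Lambda>" and sub: "\<Lambda> \<subseteq> S" and f: "f holomorphic_on S - \<Lambda>"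
  and loc: "!!l. l \<in> \<Lambda> ==> \<exists>g. g analytic_on {l} \<and> (\<forall>\<^sub>F z in at l. f z = g z / (z - l) ^ Suc n)"
 obtains c H where "H holomorphic_on S"
  "!!z. z \<in> S - \<Lambda> ==> f z = (\<Sum>l\<in>\<Lambda>. \<Sum>m\<le>n. c l m / (z - l) ^ Suc m) + H z"
  "!!l. l \<in> \<Lambda> ==> ((%z. f z * (z - l) ^ Suc n) \<longlongrightarrow> c l n) (at l)"
proof -
 have "\<forall>l\<in>\<Lambda>. \<exists>c h. h analytic_on {l} \<and> (\<forall>\<^sub>F z in at l. f z = (\<Sum>m\<le>n. c m / (z - l) ^ Suc m) + h z) \<and>
  ((%z. f z * (z - l) ^ Suc n) \<longlongrightarrow> c n) (at l)"
 proof
  fix l assume "l \<in> \<Lambda>"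
  then obtain g where g: "g analytic_on {l}" and ev: "\<forall>\<^sub>F z in at l. f z = g z / (z - l) ^ Suc n"
   using loc by blast
  obtain c h where h: "h analytic_on {l}" and c: "c n = g l"
   "!!z. z \<noteq> l ==> g z / (z - l) ^ Suc n = (\<Sum>m\<le>n. c m / (z - l) ^ Suc m) + h z"
   using partial_fraction_local[OF g, of n] by blast
  have ne: "\<forall>\<^sub>F z in at l. z \<noteq> l" by (rule eventually_neq_at_within)
  have "\<forall>\<^sub>F z in at l. f z = (\<Sum>m\<le>n. c m / (z - l) ^ Suc m) + h z"
   using ev ne by eventually_elim (rule trans, assumption, rule c(2))
  moreover have "((%z. f z * (z - l) ^ Suc n) \<longlongrightarrow> c n) (at l)"
  proof (rule Lim_transform_eventually)
   have "isCont g l" using g by (rule analytic_at_imp_isCont)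
   then show "(g \<longlongrightarrow> c n) (at l)" unfolding c(1) by (simp add: isCont_def)
   show "\<forall>\<^sub>F z in at l. g z = f z * (z - l) ^ Suc n"
    using ev ne by eventually_elim simp
  qed
  ultimately show "\<exists>c h. h analytic_on {l} \<and> (\<forall>\<^sub>F z in at l. f z = (\<Sum>m\<le>n. c m / (z - l) ^ Suc m) + h z) \<and>
  ((%z. f z * (z - l) ^ Suc n) \<longlongrightarrow> c n) (at l)" using h by blast
 qed
 from bchoice[OF this] obtain c where "\<forall>l\<in>\<Lambda>. \<exists>h. h analytic_on {l} \<and>
  (\<forall>\<^sub>F z in at l. f z = (\<Sum>m\<le>n. c l m / (z - l) ^ Suc m) + h z) \<and>
  ((%z. f z * (z - l) ^ Suc n) \<longlongrightarrow> c l n) (at l)" by blast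
 from bchoice[OF this] obtain h where ch: "\<forall>l\<in>\<Lambda>. h l analytic_on {l} \<and>
  (\<forall>\<^sub>F z in at l. f z = (\<Sum>m\<le>n. c l m / (z - l) ^ Suc m) + h l z) \<and>
  ((%z. f z * (z - l) ^ Suc n) \<longlongrightarrow> c l n) (at l)" by blast
 have h: "h l analytic_on {l}"
  and ev: "\<forall>\<^sub>F z in at l. f z = (\<Sum>m\<le>n. c l m / (z - l) ^ Suc m) + h l z"
  and lim: "((%z. f z * (z - l) ^ Suc n) \<longlongrightarrow> c l n) (at l)" if "l \<in> \<Lambda>" for l
  using ch that by simp_all
 define PP where "PP l z = (\<Sum>m\<le>n. c l m / (z - l) ^ Suc m)" for l z
 have PPan: "PP l' analytic_on {l}" if "l' \<noteq> l" for l l'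
  unfolding PP_def using that by (intro analytic_intros) auto
 define H where "H z = (if z \<in> \<Lambda> then h z z - (\<Sum>l\<in>\<Lambda>-{z}. PP l z) else f z - (\<Sum>l\<in>\<Lambda>. PP l z))" for z
 have "H analytic_on S"
 proof (subst analytic_on_analytic_at, intro ballI)
  fix z assume z: "z \<in> S"
  show "H analytic_on {z}"
  proof (cases "z \<in> \<Lambda>")
   case True
   let ?K = "%w. h z w - (\<Sum>l\<in>\<Lambda>-{z}. PP l w)"
   have K: "?K analytic_on {z}" using h[OF True] by (intro analytic_intros PPan) auto
   have "open (- (\<Lambda> - {z}))" using fin by (intro open_Compl finite_imp_closed) auto
   then have "\<forall>\<^sub>F w in at z. w \<in> - (\<Lambda> - {z})" by (rule eventually_at_in_open') auto
   then have "\<forall>\<^sub>F w in at z. H w = ?K w"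
    using ev[OF True] eventually_neq_at_within[of z z UNIV]
   proof eventually_elim
    case (elim w)
    then have "w \<notin> \<Lambda>" by auto
    then have "H w = PP z w + h z w - (\<Sum>l\<in>\<Lambda>. PP l w)" using elim by (simp add: H_def PP_def)
    also have "(\<Sum>l\<in>\<Lambda>. PP l w) = PP z w + (\<Sum>l\<in>\<Lambda>-{z}. PP l w)" using fin True by (rule sum.remove)
    finally show ?case by simp
   qed
   moreover have "H z = ?K z" using True by (simp add: H_def)
   ultimately have "\<forall>\<^sub>F w in nhds z. H w = ?K w" by (simp add: eventually_nhds_conv_at)
   from analytic_at_cong[OF this refl] K show ?thesis by simp
  next
   case False
   have opn: "open (S - \<Lambda>)" using S fin by (intro open_Diff finite_imp_closed)
   have "f analytic_on {z}" using f opn z False analytic_at by blast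
   then have K: "(%w. f w - (\<Sum>l\<in>\<Lambda>. PP l w)) analytic_on {z}"
    using False by (intro analytic_intros PPan) auto
   have "\<forall>\<^sub>F w in nhds z. w \<in> S - \<Lambda>" using opn z False by (intro eventually_nhds_in_open) auto
   then have "\<forall>\<^sub>F w in nhds z. H w = f w - (\<Sum>l\<in>\<Lambda>. PP l w)"
    by eventually_elim (simp add: H_def)
   from analytic_at_cong[OF this refl] K show ?thesis by simp
  qed
 qed
 then have "H holomorphic_on S" by (rule analytic_imp_holomorphic)
 moreover have "f z = (\<Sum>l\<in>\<Lambda>. \<Sum>m\<le>n. c l m / (z - l) ^ Suc m) + H z" if "z \<in> S - \<Lambda>" for z
  using that by (simp add: H_def PP_def)
 ultimately show ?thesis using that lim by blast
qed

text \<open>Connects the coefficient read off from a local quotient with the formal Laurent series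
  in which \<open>laurent_matrix\<close> is expressed.\<close>

lemma laurent_coeff_top:
 assumes g: "g analytic_on {l}" and ev: "\<forall>\<^sub>F z in at l. f z = g z / (z - l) ^ Suc n"
 shows "fls_nth (laurent_expansion f l) (- int (n + 1)) = g l"
proof -
 have G: "(%x. g (l + x)) has_fps_expansion fps_expansion g l" by (rule analytic_at_imp_has_fps_expansion[OF g])
 have "(%x. g (l + x) * x powi (- int (Suc n))) has_laurent_expansion fls_shift (- (- int (Suc n))) (fps_to_fls (fps_expansion g l))"
  by (intro laurent_expansion_intros has_laurent_expansion_fps[OF G])
 moreover have "\<forall>\<^sub>F x in at 0. g (l + x) * x powi (- int (Suc n)) = f (l + x)"
 proof -
  have "\<forall>\<^sub>F x in at 0. f (x + l) = g (x + l) / (x + l - l) ^ Suc n"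
   using ev unfolding eventually_at_to_0[of _ l] .
  then show ?thesis
   by eventually_elim (simp add: power_int_minus add.commute divide_inverse del: power_Suc of_nat_Suc)
 qed
 ultimately have "(%x. f (l + x)) has_laurent_expansion fls_shift (- (- int (Suc n))) (fps_to_fls (fps_expansion g l))"
  by (subst (asm) has_laurent_expansion_cong[OF _ refl]) auto
 then have "laurent_expansion f l = fls_shift (- (- int (Suc n))) (fps_to_fls (fps_expansion g l))"
  by (rule laurent_expansion_eqI)
 then show ?thesis by (simp add: fps_expansion_def)
qed

text \<open>Principal parts decay at least like \<open>1 / norm z\<close>, so far out the remainder
  inherits this decay from \<open>f\<close>; on the rest of the closed half-plane, a compact set, it
  is bounded by continuity.\<close>

lemma remainder_bound:
 fixes f H :: "complex => complex"
 assumes hol: "H holomorphic_on {z. \<gamma>0 < Re z}" and g: "\<gamma>0 < \<gamma>" "p < \<gamma>" and fin: "finite \<Lambda>"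
  and dec: "!!z. z \<in> {z. \<gamma>0 < Re z} - \<Lambda> ==> f z = (\<Sum>l\<in>\<Lambda>. \<Sum>m\<le>n. c l m / (z - l) ^ Suc m) + H z"
  and fb: "!!z. Re z >= \<gamma> ==> norm z >= R ==> norm (f z) <= K / norm z"
 shows "\<exists>C. \<forall>z. Re z >= \<gamma> \<longrightarrow> norm (H z) <= C / norm (z - of_real p)"
proof -
 \<comment> \<open>Chosen so that \<open>norm z >= R'\<close> forces \<open>norm (z - l)\<close> to
   be at least \<open>1\<close> and at least \<open>norm z / 2\<close> for every pole, and
   \<open>norm (z - of_real p)\<close> to be at most \<open>2 * norm z\<close>.\<close>
 define R' where "R' = max R 1 + 2 * (\<Sum>l\<in>\<Lambda>. norm l) + 2 * \<bar>p\<bar> + 2"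
 define c1 where "c1 = (\<Sum>l\<in>\<Lambda>. \<Sum>m\<le>n. norm (c l m))"
 have large: "norm (H z * (z - of_real p)) <= 2 * \<bar>K\<bar> + 4 * c1" if z: "Re z >= \<gamma>" "norm z >= R'" for z
 proof -
  have sumnn: "(\<Sum>l\<in>\<Lambda>. norm l) >= 0" by (rule sum_nonneg) simp
  have z1: "norm z >= R" "norm z >= 2 + 2 * \<bar>p\<bar>" "norm z > 0" using z sumnn by (auto simp: R'_def)
  have zl: "norm (z - l) >= norm z / 2" "norm (z - l) >= 1" if "l \<in> \<Lambda>" for l
  proof -
   have "norm l <= (\<Sum>l\<in>\<Lambda>. norm l)" using that fin by (intro member_le_sum) auto
   then have "norm z >= 2 * norm l + 2" using z by (auto simp: R'_def)
   then show "norm (z - l) >= norm z / 2" "norm (z - l) >= 1" using norm_triangle_ineq2[of z l] norm_ge_zero[of l] by linarith+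
  qed
  have znL: "z \<notin> \<Lambda>" using zl(2)[of z] by auto
  have "H z = f z - (\<Sum>l\<in>\<Lambda>. \<Sum>m\<le>n. c l m / (z - l) ^ Suc m)" using dec[of z] z g znL by simp
  then have "norm (H z) <= norm (f z) + norm (\<Sum>l\<in>\<Lambda>. \<Sum>m\<le>n. c l m / (z - l) ^ Suc m)"
   by (simp add: norm_triangle_ineq4)
  also have "norm (\<Sum>l\<in>\<Lambda>. \<Sum>m\<le>n. c l m / (z - l) ^ Suc m) <= (\<Sum>l\<in>\<Lambda>. \<Sum>m\<le>n. norm (c l m) * (2 / norm z))"
  proof (intro sum_norm_le)
   fix l m assume l: "l \<in> \<Lambda>"
   have "norm z / 2 <= norm (z - l) ^ 1" using zl(1)[OF l] by simp
   also have "... <= norm (z - l) ^ Suc m" using zl(2)[OF l] by (intro power_increasing) auto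
   finally have "norm (c l m) / norm (z - l) ^ Suc m <= norm (c l m) / (norm z / 2)"
    using z1 zl(2)[OF l] by (intro divide_left_mono mult_pos_pos zero_less_power) auto
   then show "norm (c l m / (z - l) ^ Suc m) <= norm (c l m) * (2 / norm z)"
    by (simp add: norm_divide norm_power norm_mult)
  qed
  also have "... = c1 * (2 / norm z)" unfolding c1_def sum_distrib_right ..
  also have "norm (f z) <= \<bar>K\<bar> / norm z"
   using fb[OF z(1) z1(1)] z1 by (meson abs_ge_self divide_right_mono norm_ge_zero order_trans)
  finally have "norm (H z) <= (\<bar>K\<bar> + 2 * c1) / norm z" by (simp add: add_divide_distrib mult.commute)
  moreover have "norm (z - of_real p) <= 2 * norm z"
   using norm_triangle_ineq4[of z "of_real p"] z1 by simp
  ultimately have "norm (H z) * norm (z - of_real p) <= (\<bar>K\<bar> + 2 * c1) / norm z * (2 * norm z)"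
   using z1(3) by (intro mult_mono divide_nonneg_pos) (auto simp: c1_def intro!: add_nonneg_nonneg sum_nonneg)
  also have "... = 2 * \<bar>K\<bar> + 4 * c1" using z1(3) by (simp add: field_simps)
  finally show ?thesis by (simp add: norm_mult)
 qed
 have "compact ({z. Re z >= \<gamma>} \<inter> cball 0 R')" by (intro closed_Int_compact closed_halfspace_Re_ge) auto
 moreover have "continuous_on ({z. Re z >= \<gamma>} \<inter> cball 0 R') (%z. H z * (z - of_real p))"
  by (intro continuous_intros continuous_on_subset[OF holomorphic_on_imp_continuous_on[OF hol]]) (use g in auto)
 ultimately have "bounded ((%z. H z * (z - of_real p)) ` ({z. Re z >= \<gamma>} \<inter> cball 0 R'))"
  by (intro compact_imp_bounded compact_continuous_image)
 then obtain B where B: "!!z. Re z >= \<gamma> ==> norm z <= R' ==> norm (H z * (z - of_real p)) <= B"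
  unfolding bounded_iff by force
 have "norm (H z) <= max B (2 * \<bar>K\<bar> + 4 * c1) / norm (z - of_real p)" if z: "Re z >= \<gamma>" for z
 proof -
  have "norm (H z * (z - of_real p)) <= max B (2 * \<bar>K\<bar> + 4 * c1)"
   using large[OF z] B[OF z] by (cases "norm z <= R'") auto
  moreover have "norm (z - of_real p) > 0" using z g by (auto simp: complex_eq_iff)
  ultimately show ?thesis by (simp add: pos_le_divide_eq norm_mult)
 qed
 then show ?thesis by blast
qed

section \<open>Inverses of matrices: Cramer's rule and bounds far from the origin\<close>

lemma matrix_inv_inverse: "invertible A ==> A ** matrix_inv A = mat 1"
 unfolding matrix_inv_def invertible_def by (rule someI_ex[THEN conjunct1])

text \<open>Cramer's rule for the columns of the inverse. It displays each entry as a quotient of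
  determinants, which is how holomorphy and the pole structure of the inverse become
  visible.\<close>

lemma matrix_inv_cofactor:
 fixes A :: "'a::field^'n^'n"
 assumes "det A \<noteq> 0"
 shows "matrix_inv A $ i $ j = det (\<chi> i' k. if k = i then axis j 1 $ i' else A $ i' $ k) / det A"
proof -
 have inv: "A ** matrix_inv A = mat 1" using assms invertible_det_nz matrix_inv_inverse by blast
 have "A *v (matrix_inv A *v axis j 1) = axis j 1"
  by (simp add: matrix_vector_mul_assoc inv)
 then have "matrix_inv A *v axis j 1 = (\<chi> k. det (\<chi> i' k'. if k' = k then axis j 1 $ i' else A $ i' $ k') / det A)"
  using cramer[OF assms] by blast
 moreover have "(matrix_inv A *v axis j 1) $ i = matrix_inv A $ i $ j"
  by (simp add: matrix_vector_mul_component axis_def inner_vec_def matrix_vector_mult_def if_distrib cong: if_cong)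
 ultimately show ?thesis by simp
qed

lemma det_holomorphic:
 fixes A :: "complex => complex^'n^'n"
 assumes "!!i j. (%z. A z $ i $ j) holomorphic_on S"
 shows "(%z. det (A z)) holomorphic_on S"
 unfolding det_def using assms by (intro holomorphic_intros) auto

text \<open>Diagonal dominance: \<open>z - M\<close> is invertible, with inverse of size \<open>1 / norm z\<close>, once \<open>z\<close> exceeds
 the entries of \<open>M\<close>.\<close>

lemma shifted_matrix_bound:
 fixes A :: "complex^'n^'n" and x :: "complex^'n"
 assumes A: "!!i j. A $ i $ j = (if i = j then z else 0) - M i j" and M: "!!i j. norm (M i j) <= m"
 shows "(norm z - of_nat CARD('n) * m) * (\<Sum>i\<in>UNIV. norm (x $ i)) <= (\<Sum>i\<in>UNIV. norm ((A *v x) $ i))"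
proof -
 have eq: "z * x $ i = (A *v x) $ i + (\<Sum>k\<in>UNIV. M i k * x $ k)" for i
  by (simp add: matrix_vector_mult_def A left_diff_distrib sum_subtractf if_distrib[of "%a. a * _"] cong: if_cong)
 have "norm z * (\<Sum>i\<in>UNIV. norm (x $ i)) = (\<Sum>i\<in>UNIV. norm (z * x $ i))" by (simp add: sum_distrib_left norm_mult)
 also have "... <= (\<Sum>i\<in>UNIV. norm ((A *v x) $ i) + m * (\<Sum>k\<in>UNIV. norm (x $ k)))"
 proof (rule sum_mono)
  fix i :: 'n
  have "norm (\<Sum>k\<in>UNIV. M i k * x $ k) <= (\<Sum>k\<in>UNIV. m * norm (x $ k))"
   by (rule sum_norm_le) (auto simp: norm_mult intro!: mult_right_mono M)
  then show "norm (z * x $ i) <= norm ((A *v x) $ i) + m * (\<Sum>k\<in>UNIV. norm (x $ k))"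
   unfolding eq using norm_triangle_ineq[of "(A *v x) $ i" "\<Sum>k\<in>UNIV. M i k * x $ k"]
   by (simp add: sum_distrib_left)
 qed
 also have "... = (\<Sum>i\<in>UNIV. norm ((A *v x) $ i)) + of_nat CARD('n) * m * (\<Sum>i\<in>UNIV. norm (x $ i))"
  by (simp add: sum.distrib mult.assoc)
 finally show ?thesis by (simp add: left_diff_distrib)
qed

lemma shifted_matrix_inv:
 fixes A :: "complex^'n^'n"
 assumes A: "!!i j. A $ i $ j = (if i = j then z else 0) - M i j" and M: "!!i j. norm (M i j) <= m"
  and z: "norm z > of_nat CARD('n) * m"
 shows "det A \<noteq> 0" and "norm (matrix_inv A $ i $ j) <= 1 / (norm z - of_nat CARD('n) * m)"
proof -
 have "x = 0" if "A *v x = 0" for x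
 proof -
  have "(norm z - of_nat CARD('n) * m) * (\<Sum>i\<in>UNIV. norm (x $ i)) <= 0"
   using shifted_matrix_bound[OF A M, of x] that by simp
  then have "(\<Sum>i\<in>UNIV. norm (x $ i)) <= 0" using z by (simp add: mult_le_0_iff)
  then have "(\<Sum>i\<in>UNIV. norm (x $ i)) = 0" by (intro antisym sum_nonneg) auto
  then show ?thesis by (simp add: sum_nonneg_eq_0_iff vec_eq_iff)
 qed
 then show d: "det A \<noteq> 0"
  using matrix_left_invertible_ker[of A] invertible_left_inverse[of A] invertible_det_nz[of A] by blast
 have inv: "A ** matrix_inv A = mat 1" using d invertible_det_nz matrix_inv_inverse by blast
 let ?x = "matrix_inv A *v axis j 1"
 have Ax: "A *v ?x = axis j 1" by (simp add: matrix_vector_mul_assoc inv)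
 have "(\<Sum>i\<in>UNIV. norm ((axis j 1 :: complex^'n) $ i)) = 1" by (simp add: axis_def if_distrib cong: if_cong)
 then have "(norm z - of_nat CARD('n) * m) * (\<Sum>i\<in>UNIV. norm (?x $ i)) <= 1"
  using shifted_matrix_bound[OF A M, of ?x] unfolding Ax by simp
 then have "(\<Sum>i\<in>UNIV. norm (?x $ i)) <= 1 / (norm z - of_nat CARD('n) * m)"
  using z by (simp add: pos_le_divide_eq mult.commute)
 moreover have "norm (?x $ i) <= (\<Sum>i\<in>UNIV. norm (?x $ i))" by (rule member_le_sum) auto
 moreover have "?x $ i = matrix_inv A $ i $ j"
  by (simp add: axis_def matrix_vector_mult_def if_distrib cong: if_cong)
 ultimately show "norm (matrix_inv A $ i $ j) <= 1 / (norm z - of_nat CARD('n) * m)" by simp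
qed

section \<open>A deterministic Volterra equation\<close>

text \<open>A substitute for Gronwall's inequality. On \<open>[0, t]\<close> the continuous function
  \<open>\<phi> s * exp (- c * s)\<close> attains a maximum \<open>m\<close>; the hypothesis at the
  maximising point gives \<open>m <= C + m / 2\<close>, hence \<open>m <= 2 * C\<close>, a bound
  independent of \<open>t\<close>.\<close>

lemma self_bound:
 fixes \<phi> :: "real => real"
 assumes cont: "continuous_on {0..} \<phi>" and nn: "!!t. \<phi> t >= 0"
  and step: "!!T m t. T >= 0 ==> m >= 0 ==> (!!s. 0 <= s ==> s <= T ==> \<phi> s <= m * exp (c * s)) ==>
    0 <= t ==> t <= T ==> \<phi> t <= (C + m / 2) * exp (c * t)"
  and t: "t >= 0"
 shows "\<phi> t <= 2 * C * exp (c * t)"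
proof -
 let ?\<psi> = "%s. \<phi> s * exp (- c * s)"
 have psi: "\<phi> s = ?\<psi> s * exp (c * s)" for s by (simp add: exp_minus)
 have "continuous_on {0..t} ?\<psi>" by (intro continuous_intros continuous_on_subset[OF cont]) auto
 then obtain s0 where s0: "s0 \<in> {0..t}" and max: "!!s. s \<in> {0..t} ==> ?\<psi> s <= ?\<psi> s0"
  using continuous_attains_sup[of "{0..t}" ?\<psi>] t by auto
 have le: "\<phi> s <= ?\<psi> s0 * exp (c * s)" if "0 <= s" "s <= t" for s
 proof -
  have "?\<psi> s * exp (c * s) <= ?\<psi> s0 * exp (c * s)"
   by (rule mult_right_mono[OF max]) (use that in auto)
  then show ?thesis by (simp only: psi[symmetric])
 qed
 have "\<phi> s0 <= (C + ?\<psi> s0 / 2) * exp (c * s0)"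
 proof (rule step[of t])
  show "\<phi> s <= ?\<psi> s0 * exp (c * s)" if "0 <= s" "s <= t" for s by (rule le[OF that])
 qed (use s0 t nn in auto)
 then have "?\<psi> s0 * exp (c * s0) <= (C + ?\<psi> s0 / 2) * exp (c * s0)" by (simp only: psi[symmetric])
 then have "?\<psi> s0 <= C + ?\<psi> s0 / 2" by simp
 then have "?\<psi> s0 <= 2 * C" by simp
 then have "?\<psi> s0 * exp (c * t) <= 2 * C * exp (c * t)" by (rule mult_right_mono) simp
 then show ?thesis using le[of t] t by linarith
qed

lemma causal_measurable:
 fixes f :: "real => complex"
 assumes "continuous_on {0..} f" "!!t. t < 0 ==> f t = 0"
 shows "f \<in> borel_measurable borel"
proof -
 have "(%t. indicator {0..} t *\<^sub>R f t) \<in> borel_measurable borel"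
  using assms(1) by (rule borel_measurable_continuous_on_indicator[rotated]) simp
 moreover have "(%t. indicator {0..} t *\<^sub>R f t) = f"
  using assms(2) by (auto simp: fun_eq_iff indicator_def)
 ultimately show ?thesis by simp
qed

text \<open>A path is at first only locally bounded. Since a causal convolution at time
  \<open>t\<close> sees no values after \<open>t\<close>, cutting the path at \<open>T\<close> makes
  the bounds for \<open>expb\<close> functions available up to \<open>T\<close>.\<close>

lemma truncate_expb:
 fixes f :: "real => complex"
 assumes m: "f \<in> borel_measurable borel" "!!t. t < 0 ==> f t = 0" and "M >= 0"
  and b: "!!s. 0 <= s ==> s <= T ==> norm (f s) <= M * exp (c * s)"
 shows "expb (%t. if t <= T then f t else 0)" "norm (if t <= T then f t else 0) <= M * exp (c * t)"
proof -
 show b': "norm (if t <= T then f t else 0) <= M * exp (c * t)" for t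
  using b[of t] m(2)[of t] \<open>M >= 0\<close> by (cases "t < 0") auto
 have "(%t. if t <= T then f t else 0) \<in> borel_measurable borel" using m(1) by measurable
 moreover have "(if t <= T then f t else 0) = 0" if "t < 0" for t using m(2)[OF that] by simp
  ultimately show "expb (%t. if t <= T then f t else 0)"
  unfolding expb_def using b' by blast
qed

lemma conv_truncate:
 assumes "kern N \<kappa> a" "t <= T"
 shows "conv N \<kappa> f t = conv N \<kappa> (%t. if t <= T then f t else 0) t"
 unfolding conv_def
 by (rule Bochner_Integration.integral_cong) (use assms kern_space[OF assms(1)] in auto)

lemma kern_one: "c > 0 ==> kern HL (%_. 1) c"
 using kern_exp[of 0 c] by simp

lemma integral_exp_HL: "c > 0 ==> (LINT s|HL. exp (- c * s)) = 1 / c"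
proof -
 assume c: "c > 0"
 have "complex_of_real (LINT s|HL. exp (- c * s)) = (LINT s|HL. complex_of_real (exp (- c * s)))" by simp
 also have "... = (LINT s|HL. exp (- complex_of_real c * of_real s))" by (simp add: exp_of_real[symmetric])
 also have "... = 1 / of_real c" using integral_exp_halfline(2)[of "of_real c"] c by simp
 also have "... = of_real (1 / c)" by simp
 finally show ?thesis using of_real_eq_iff by blast
qed

lemma conv_one_bound:
 assumes "expb f" "M >= 0" "!!t. norm (f t) <= M * exp (c * t)" "c > 0"
 shows "norm (conv HL (%_. 1) f t) <= M / c * exp (c * t)"
 using conv_bound(2)[OF kern_one[OF assms(4)] assms(1-3), of t] integral_exp_HL[OF assms(4)] by (simp add: mult_ac)

lemma laps_self_eq: "laps f \<phi> ==> laps f \<psi> ==> \<forall>\<^sub>F w in at_top. \<phi> w = \<psi> w"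
 unfolding laps_def using eventually_elim2 by force

lemma eventually_complex_neq: "\<forall>\<^sub>F w in at_top. of_real w \<noteq> (l::complex)"
 using eventually_gt_at_top[of "Re l"] by eventually_elim auto

text \<open>The integrated equation for one path, componentwise and complex valued:
  \<open>Np\<close> and \<open>Nm\<close> stand for the Jordan parts of the entries of \<mu>, and
  time integration is convolution with \<open>1\<close>. Of \<open>x\<close> only continuity and
  causality are assumed; its growth is deduced.\<close>

locale volterra =
 fixes Np Nm :: "'d::finite => 'd => real measure" and a :: real
  and x g :: "'d => real => complex"
 assumes kp: "!!i j. kern (Np i j) (%_. 1) a" and km: "!!i j. kern (Nm i j) (%_. 1) a"
  and g: "!!i. expb (g i)" "!!i. continuous_on {0..} (g i)"
  and x: "!!i. continuous_on {0..} (x i)" "!!i t. t < 0 ==> x i t = 0"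
  and eq: "!!i t. x i t = g i t + conv HL (%_. 1)
    (%u. \<Sum>j\<in>UNIV. conv (Np i j) (%_. 1) (x j) u - conv (Nm i j) (%_. 1) (x j) u) t"
begin

definition Mh :: "'d => 'd => complex => complex" where
 "Mh i j z = lapk (Np i j) (%_. 1) z - lapk (Nm i j) (%_. 1) z"

text \<open>At rate \<open>c\<close> the delay operator has norm at most \<open>K\<close> and
  integration has norm at most \<open>1 / c\<close>, so \<open>c >= 2 * K\<close> makes their
  composition a contraction by one half, in the form that \<open>self_bound\<close> uses.\<close>

lemma expb_x: "expb (x i)"
proof -
 have "\<forall>i. \<exists>C c0. C >= 0 \<and> (\<forall>c\<ge>c0. \<forall>t. norm (g i t) <= C * exp (c * t))"
  using expb_bound[OF g(1)] by metis
 then obtain Cg c0 where Cg: "!!i. Cg i >= 0" and bg: "!!i c t. c >= c0 i ==> norm (g i t) <= Cg i * exp (c * t)"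
  by metis
 define kk where "kk i j = (LINT s|Np i j. exp (- a * s) * norm (1::complex)) + (LINT s|Nm i j. exp (- a * s) * norm (1::complex))" for i j
 have kk0: "kk i j >= 0" for i j unfolding kk_def by (intro add_nonneg_nonneg integral_nonneg_AE) auto
 define K where "K = (\<Sum>i\<in>UNIV. \<Sum>j\<in>UNIV. kk i j)"
 have K0: "K >= 0" unfolding K_def by (intro sum_nonneg kk0)
 define c where "c = Max (insert 1 (insert a (insert (2 * K) (range c0))))"
 have c: "c >= 1" "c >= a" "c >= 2 * K" "!!i. c >= c0 i" unfolding c_def by (rule Max_ge; simp)+
 have mx: "x i \<in> borel_measurable borel" for i by (rule causal_measurable[OF x(1) x(2)])
 define \<phi> where "\<phi> t = (\<Sum>i\<in>UNIV. norm (x i t))" for t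
 have x_le: "norm (x i t) <= \<phi> t" for i t unfolding \<phi>_def by (rule member_le_sum) auto
 have bound: "\<phi> t <= 2 * (\<Sum>i\<in>UNIV. Cg i) * exp (c * t)" if t: "t >= 0" for t
 proof (rule self_bound[OF _ _ _ t])
  show "continuous_on {0..} \<phi>" unfolding \<phi>_def by (intro continuous_intros x)
  show "\<phi> t >= 0" for t unfolding \<phi>_def by (intro sum_nonneg) auto
  fix T m t :: real assume T: "T >= 0" and m: "m >= 0" and le: "!!s. 0 <= s ==> s <= T ==> \<phi> s <= m * exp (c * s)"
   and t: "0 <= t" "t <= T"
  define x' where "x' j t = (if t <= T then x j t else 0)" for j t
  have x'b: "norm (x' j t) <= m * exp (c * t)" and x'e: "expb (x' j)" for j t
   unfolding x'_def using truncate_expb[OF mx x(2) m, where T = T and c = c] le x_le order_trans by blast+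
  have cp: "norm (conv (Np i j) (%_. 1) (x' j) u - conv (Nm i j) (%_. 1) (x' j) u) <= m * kk i j * exp (c * u)" for i j u
  proof -
   have "norm (conv (Np i j) (%_. 1) (x' j) u) <= m * exp (c * u) * (LINT s|Np i j. exp (- a * s) * norm (1::complex))"
    by (rule conv_bound(2)[OF kp x'e m x'b c(2)])
   moreover have "norm (conv (Nm i j) (%_. 1) (x' j) u) <= m * exp (c * u) * (LINT s|Nm i j. exp (- a * s) * norm (1::complex))"
    by (rule conv_bound(2)[OF km x'e m x'b c(2)])
   ultimately show ?thesis unfolding kk_def
    using norm_triangle_ineq4[of "conv (Np i j) (%_. 1) (x' j) u" "conv (Nm i j) (%_. 1) (x' j) u"]
    by (simp add: algebra_simps)
  qed
  define D where "D i u = (\<Sum>j\<in>UNIV. conv (Np i j) (%_. 1) (x' j) u - conv (Nm i j) (%_. 1) (x' j) u)" for i u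
  have Db: "norm (D i u) <= m * (\<Sum>j\<in>UNIV. kk i j) * exp (c * u)" for i u
   unfolding D_def sum_distrib_left sum_distrib_right by (rule sum_norm_le) (rule cp)
  have De: "expb (D i)" for i
  proof -
   have "laps (D i) (%w. \<Sum>j\<in>UNIV. lap (conv (Np i j) (%_. 1) (x' j)) (of_real w) - lap (conv (Nm i j) (%_. 1) (x' j)) (of_real w))"
    unfolding D_def[abs_def] by (intro laps_sum laps_diff expb_laps expb_conv[OF kp] expb_conv[OF km] x'e)
   then show ?thesis by (rule laps_expb)
  qed
  have k1: "kern HL (%_. 1) c" using c by (intro kern_one) simp
  \<comment> \<open>Up to time \<open>T\<close> the truncated path enters the equation with the same
    values as the path itself.\<close>
  have xe: "x i t = g i t + conv HL (%_. 1) (D i) t" for i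
  proof -
   have "D i u = (\<Sum>j\<in>UNIV. conv (Np i j) (%_. 1) (x j) u - conv (Nm i j) (%_. 1) (x j) u)" if "u <= T" for u
    unfolding D_def x'_def conv_truncate[OF kp that, symmetric] conv_truncate[OF km that, symmetric] ..
   then have "(%u. if u <= T then D i u else 0) = (%u. if u <= T then (\<Sum>j\<in>UNIV. conv (Np i j) (%_. 1) (x j) u - conv (Nm i j) (%_. 1) (x j) u) else 0)"
    by (simp add: fun_eq_iff)
   then show ?thesis unfolding eq[of i t] conv_truncate[OF k1 t(2), of "D i"]
    by (subst conv_truncate[OF k1 t(2)]) simp
  qed
  have "norm (x i t) <= Cg i * exp (c * t) + (m * (\<Sum>j\<in>UNIV. kk i j)) / c * exp (c * t)" for i
  proof -
   have "norm (conv HL (%_. 1) (D i) t) <= (m * (\<Sum>j\<in>UNIV. kk i j)) / c * exp (c * t)"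
    by (rule conv_one_bound[OF De _ Db]) (use c m kk0 in \<open>auto intro!: mult_nonneg_nonneg sum_nonneg\<close>)
   then show ?thesis unfolding xe using norm_triangle_ineq[of "g i t" "conv HL (%_. 1) (D i) t"] bg[OF c(4)[of i], of t] by linarith
  qed
  then have "\<phi> t <= (\<Sum>i\<in>UNIV. Cg i * exp (c * t) + (m * (\<Sum>j\<in>UNIV. kk i j)) / c * exp (c * t))"
   unfolding \<phi>_def by (intro sum_mono)
  also have "... = ((\<Sum>i\<in>UNIV. Cg i) + m * K / c) * exp (c * t)"
   by (simp add: sum.distrib sum_distrib_right sum_distrib_left K_def sum_divide_distrib distrib_right)
  also have "... <= ((\<Sum>i\<in>UNIV. Cg i) + m / 2) * exp (c * t)"
  proof (intro mult_right_mono add_left_mono)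
   have "K / c <= 1 / 2" using c by (simp add: divide_simps)
   then have "m * (K / c) <= m * (1 / 2)" using m by (rule mult_left_mono)
   then show "m * K / c <= m / 2" by simp
  qed simp
  finally show "\<phi> t <= ((\<Sum>i\<in>UNIV. Cg i) + m / 2) * exp (c * t)" .
 qed
 have "norm (x i t) <= 2 * (\<Sum>i\<in>UNIV. Cg i) * exp (c * t)" for t
  using bound[of t] x_le[of i t] x(2)[of t i] Cg by (cases "t < 0") (auto intro!: mult_nonneg_nonneg sum_nonneg)
 then show ?thesis unfolding expb_def using mx x(2) by auto
qed

definition xh :: "'d => real => complex" where "xh i w = lap (x i) (of_real w)"
definition gh :: "'d => real => complex" where "gh i w = lap (g i) (of_real w)"

lemma laps_x: "laps (x i) (xh i)" unfolding xh_def[abs_def] by (rule expb_laps[OF expb_x])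
lemma laps_g: "laps (g i) (gh i)" unfolding gh_def[abs_def] by (rule expb_laps[OF g(1)])

lemma laps_delay:
 assumes "!!j. laps (v j) (vh j)"
 shows "laps (%u. \<Sum>j\<in>UNIV. conv (Np i j) (%_. 1) (v j) u - conv (Nm i j) (%_. 1) (v j) u) (%w. \<Sum>j\<in>UNIV. Mh i j (of_real w) * vh j w)"
 unfolding Mh_def left_diff_distrib
 by (intro laps_sum laps_diff laps_conv[OF kp] laps_conv[OF km] assms)

lemma xh_eq: "\<forall>\<^sub>F w in at_top. \<forall>i. of_real w * xh i w = of_real w * gh i w + (\<Sum>j\<in>UNIV. Mh i j (of_real w) * xh j w)"
proof (rule eventually_all_finite)
 fix i
 have "laps (%t. g i t + conv HL (%s. exp (0 * of_real s)) (%u. \<Sum>j\<in>UNIV. conv (Np i j) (%_. 1) (x j) u - conv (Nm i j) (%_. 1) (x j) u) t)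
  (%w. gh i w + (\<Sum>j\<in>UNIV. Mh i j (of_real w) * xh j w) / (of_real w - 0))"
  by (intro laps_add laps_g laps_conv_exp laps_delay laps_x)
 then have "laps (x i) (%w. gh i w + (\<Sum>j\<in>UNIV. Mh i j (of_real w) * xh j w) / of_real w)"
 proof -
  have "(%t. g i t + conv HL (%_. 1) (%u. \<Sum>j\<in>UNIV. conv (Np i j) (%_. 1) (x j) u - conv (Nm i j) (%_. 1) (x j) u) t) = x i"
   by (rule ext) (rule eq[symmetric])
  moreover assume "laps (%t. g i t + conv HL (%s. exp (0 * of_real s)) (%u. \<Sum>j\<in>UNIV. conv (Np i j) (%_. 1) (x j) u - conv (Nm i j) (%_. 1) (x j) u) t)
  (%w. gh i w + (\<Sum>j\<in>UNIV. Mh i j (of_real w) * xh j w) / (of_real w - 0))"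
  ultimately show ?thesis by simp
 qed
 from laps_self_eq[OF laps_x this] eventually_gt_at_top[of 0]
 show "\<forall>\<^sub>F w in at_top. of_real w * xh i w = of_real w * gh i w + (\<Sum>j\<in>UNIV. Mh i j (of_real w) * xh j w)"
  by eventually_elim (simp add: field_simps)
qed

text \<open>Integration by parts hidden in a definition: \<open>W l\<close> is the convolution of
  \<open>exp (l * t)\<close> with the differential of \<open>g\<close>, including the initial mass
  \<open>g 0\<close>, written without differentiating \<open>g\<close>. Its transform is
  \<open>w * gh w / (w - l)\<close>.\<close>

definition W :: "complex => 'd => real => complex" where
 "W l i t = g i t + l * conv HL (%s. exp (l * of_real s)) (g i) t"

lemma laps_W: "laps (W l i) (%w. of_real w * gh i w / (of_real w - l))"
proof -
 have "laps (W l i) (%w. gh i w + l * (gh i w / (of_real w - l)))"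
  unfolding W_def[abs_def] by (intro laps_add laps_cmult laps_conv_exp laps_g)
 then show ?thesis
  by (rule laps_cong) (use eventually_complex_neq[of l] in \<open>eventually_elim, simp add: field_simps\<close>)
qed

lemma conv_exp_continuous:
 "expb f ==> continuous_on {0..} f ==> continuous_on S (conv HL (%s. exp (l * of_real s)) f)"
 by (rule conv_HL_continuous[OF kern_exp[of l "Re l + 1"]]) auto

lemma W_continuous: "continuous_on {0..} (W l i)"
 unfolding W_def[abs_def] by (intro continuous_intros conv_exp_continuous g)

text \<open>The measures may have atoms, so the argument must be continuous across \<open>0\<close>
  as well; functions smoothed by an exponential convolution are.\<close>

lemma delay_continuous:
 assumes "!!j. expb (v j)" "!!j. continuous_on UNIV (v j)"
 shows "continuous_on S (%u. \<Sum>j\<in>UNIV. conv (Np i j) (%_. 1) (v j) u - conv (Nm i j) (%_. 1) (v j) u)"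
 using assms(2) by (intro continuous_intros conv_continuous[OF kp assms(1)] conv_continuous[OF km assms(1)])
  (auto simp: continuous_on_eq_continuous_at)

text \<open>The assumption on \<open>A\<close> says that each coefficient vector lies in the kernel
  of the characteristic matrix at \<open>l\<close>. On such vectors the delay operator minus
  \<open>p\<close> is multiplication by \<open>l - p\<close>, exactly the inverse of one smoothing
  by \<open>exp (p * t)\<close>.\<close>

lemma asym_delay:
 assumes al: "a <= \<alpha>" and fin: "finite \<Lambda>" and re: "!!l. l \<in> \<Lambda> ==> Re l = \<alpha>"
  and v: "!!j. expb (v j)" "!!j. asym n \<alpha> \<Lambda> (A j) (v j)"
  and A: "!!i l. l \<in> \<Lambda> ==> (\<Sum>j\<in>UNIV. Mh i j l * A j l) = l * A i l"
 shows "asym n \<alpha> \<Lambda> (%l. (l - p) * A i l)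
  (%t. (\<Sum>j\<in>UNIV. conv (Np i j) (%_. 1) (v j) t - conv (Nm i j) (%_. 1) (v j) t) - p * v i t)"
proof (rule asym_cong)
 show "asym n \<alpha> \<Lambda> (%l. (\<Sum>j\<in>UNIV. lapk (Np i j) (%_. 1) l * A j l - lapk (Nm i j) (%_. 1) l * A j l) - p * A i l)
  (%t. (\<Sum>j\<in>UNIV. conv (Np i j) (%_. 1) (v j) t - conv (Nm i j) (%_. 1) (v j) t) - p * v i t)"
  by (intro asym_diff asym_sum asym_cmult v asym_conv[OF kern_mono[OF kp al]] asym_conv[OF kern_mono[OF km al]] fin re)
 show "(\<Sum>j\<in>UNIV. lapk (Np i j) (%_. 1) l * A j l - lapk (Nm i j) (%_. 1) l * A j l) - p * A i l = (l - p) * A i l"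
  if "l \<in> \<Lambda>" for l
  using A[OF that, of i] by (simp add: Mh_def left_diff_distrib)
qed

text \<open>The expansion is read off for the doubly smoothed solution \<open>u2\<close>, where the
  remainder has an integrable inverse transform, and then lifted to \<open>u1\<close> and to
  \<open>x\<close>. The identity \<open>res\<close> keeps the coefficient vectors in the kernel of
  the characteristic matrix, so each lift costs the factor \<open>l - p\<close> and brings in
  neither new frequencies nor higher powers.\<close>

theorem asymptotics:
 fixes c :: "'d => 'd => complex => nat => complex" and G H :: "'d => 'd => complex => complex"
 assumes num: "a <= \<alpha>" "\<gamma>0 < \<gamma>" "\<gamma> < \<alpha>" "p < \<gamma>" and fin: "finite \<Lambda>" and re: "!!l. l \<in> \<Lambda> ==> Re l = \<alpha>"
  and H: "!!i j. H i j holomorphic_on {z. \<gamma>0 < Re z}"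
  and Hb: "!!i j z. Re z >= \<gamma> ==> norm (H i j z) <= C i j / norm (z - of_real p)"
  and dec: "!!i j. \<forall>\<^sub>F w in at_top. G i j (of_real w) = (\<Sum>l\<in>\<Lambda>. \<Sum>m\<le>n. c i j l m / (of_real w - l) ^ Suc m) + H i j (of_real w)"
  and inv: "!!i k. \<forall>\<^sub>F w in at_top. (\<Sum>j\<in>UNIV. G i j (of_real w) * ((if j = k then of_real w else 0) - Mh j k (of_real w))) = (if i = k then 1 else 0)"
  and res: "!!l i k. l \<in> \<Lambda> ==> (\<Sum>j\<in>UNIV. Mh i j l * c j k l n) = l * c i k l n"
  and lim: "!!l i. l \<in> insert (of_real \<alpha>) \<Lambda> ==> ((%t. exp (- l * of_real t) * W l i t) \<longlongrightarrow> L l i) at_top"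
 shows "asym n \<alpha> \<Lambda> (%l. (\<Sum>j\<in>UNIV. c i j l n * L l j) / fact n) (x i)"
proof -
 let ?E = "conv HL (%s. exp (complex_of_real p * of_real s))"
 let ?q = "%w::real. complex_of_real w - of_real p"
 have E_kern: "kern HL (%s. exp (complex_of_real p * of_real s)) \<alpha>" by (rule kern_exp) (use num in simp)
 have E_lapk: "lapk HL (%s. exp (complex_of_real p * of_real s)) l = 1 / (l - of_real p)" if "Re l = \<alpha>" for l
  by (rule lapk_exp) (use that num in simp)
 have lp: "l - of_real p \<noteq> 0" if "Re l = \<alpha>" for l using that num by (auto simp: complex_eq_iff)
 \<comment> \<open>The identity \<open>inv\<close> inverts the transformed equation from the left:
   the transform of the solution is \<open>G\<close> applied to \<open>w * gh\<close>.\<close>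
 have xh_G: "\<forall>\<^sub>F w in at_top. xh i w = (\<Sum>j\<in>UNIV. G i j (of_real w) * (of_real w * gh j w))" for i
 proof -
  have "\<forall>\<^sub>F w in at_top. \<forall>k. (\<Sum>j\<in>UNIV. G i j (of_real w) * ((if j = k then of_real w else 0) - Mh j k (of_real w))) = (if i = k then 1 else 0)"
   by (intro eventually_all_finite inv)
  with xh_eq show ?thesis
  proof eventually_elim
   case (elim w)
   have "of_real w * gh j w = (\<Sum>k\<in>UNIV. ((if j = k then of_real w else 0) - Mh j k (of_real w)) * xh k w)" for j
    using elim(1)[rule_format, of j]
    by (simp add: left_diff_distrib sum_subtractf if_distrib[of "%y. y * _"] cong: if_cong)
   then have "(\<Sum>j\<in>UNIV. G i j (of_real w) * (of_real w * gh j w)) =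
    (\<Sum>j\<in>UNIV. \<Sum>k\<in>UNIV. G i j (of_real w) * ((if j = k then of_real w else 0) - Mh j k (of_real w)) * xh k w)"
    by (simp add: sum_distrib_left mult.assoc)
   also have "... = (\<Sum>k\<in>UNIV. (\<Sum>j\<in>UNIV. G i j (of_real w) * ((if j = k then of_real w else 0) - Mh j k (of_real w))) * xh k w)"
    by (subst sum.swap) (simp add: sum_distrib_right)
   also have "... = xh i w" using elim(2) by (simp add: if_distrib[of "%y. y * _"] cong: if_cong)
   finally show ?case by simp
  qed
 qed
 define u1 where "u1 i = ?E (x i)" for i
 define u2 where "u2 i = ?E (u1 i)" for i
 have laps_u1: "laps (u1 i) (%w. xh i w / ?q w)" for i unfolding u1_def by (rule laps_conv_exp[OF laps_x])
 have laps_u2: "laps (u2 i) (%w. xh i w / ?q w / ?q w)" for i unfolding u2_def by (rule laps_conv_exp[OF laps_u1])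
 have cont_u1: "continuous_on S (u1 i)" for i S unfolding u1_def by (rule conv_exp_continuous[OF expb_x x(1)])
 have cont_u2: "continuous_on S (u2 i)" for i S unfolding u2_def by (rule conv_exp_continuous[OF laps_expb[OF laps_u1] cont_u1])
 note ex_u1 = laps_expb[OF laps_u1] and ex_u2 = laps_expb[OF laps_u2]
 \<comment> \<open>Two factors \<open>z - p\<close> in the denominator give quadratic decay. The
   factor \<open>z - \<alpha>\<close> cancels the denominator that the weighted forcing at \<alpha>
   brings in, and its zero at \<alpha> makes the remainder negligible.\<close>
 define J where "J i j z = (z - of_real \<alpha>) * H i j z / (z - of_real p)\<^sup>2" for i j z
 have J_hol: "J i j holomorphic_on {z. max \<gamma>0 p < Re z}" for i j
  unfolding J_def[abs_def] using holomorphic_on_subset[OF H[of i j], of "{z. max \<gamma>0 p < Re z}"]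
  by (intro holomorphic_intros) auto
 \<comment> \<open>The constant comes from
   \<open>norm (z - \<alpha>) <= norm (z - p) + (\<alpha> - p)\<close>, whose last term is at most
   \<open>(\<alpha> - p) / (\<gamma> - p)\<close> times \<open>norm (z - p)\<close>; the decay of
   \<open>H\<close> cancels this power of \<open>norm (z - p)\<close>.\<close>
 have J_bd: "norm (J i j z) <= (1 + (\<alpha> - p) / (\<gamma> - p)) * C i j / (norm (z - of_real p))\<^sup>2" if z: "Re z >= \<gamma>" for i j z
 proof -
  let ?r = "norm (z - of_real p)"
  have r: "?r >= \<gamma> - p" using complex_Re_le_cmod[of "z - of_real p"] z by simp
  have r0: "?r > 0" "\<gamma> - p > 0" using r num by linarith+
  have "norm (z - of_real \<alpha>) <= ?r + norm (of_real p - of_real \<alpha> :: complex)"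
   using norm_triangle_ineq[of "z - of_real p" "of_real p - of_real \<alpha>"] by simp
  also have "norm (of_real p - of_real \<alpha> :: complex) = \<alpha> - p" using num by (simp flip: of_real_diff)
  also have "\<alpha> - p <= (\<alpha> - p) / (\<gamma> - p) * ?r"
  proof -
   have "(\<alpha> - p) / (\<gamma> - p) * (\<gamma> - p) <= (\<alpha> - p) / (\<gamma> - p) * ?r" using r num by (intro mult_left_mono) auto
   then show ?thesis using r0 by simp
  qed
  finally have 1: "norm (z - of_real \<alpha>) <= (1 + (\<alpha> - p) / (\<gamma> - p)) * ?r" by (simp add: distrib_right)
  have "norm (z - of_real \<alpha>) * norm (H i j z) <= ((1 + (\<alpha> - p) / (\<gamma> - p)) * ?r) * (C i j / ?r)"
   by (intro mult_mono 1 Hb z) (use r0 num in auto)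
  also have "... = (1 + (\<alpha> - p) / (\<gamma> - p)) * C i j" using r0 by simp
  finally show ?thesis unfolding J_def norm_divide norm_mult norm_power using r0 by (intro divide_right_mono) auto
 qed
 have J_lap: "kern HL (invlap (J i j) \<gamma>) \<alpha>" "Re w >= \<alpha> ==> lapk HL (invlap (J i j) \<gamma>) w = J i j w" for i j w
  using invlap[OF J_hol _ _ J_bd, where a = \<alpha>] num by auto
 define it where "it l m = ((conv HL (%s. exp (l * of_real s))) ^^ m)" for l m
 \<comment> \<open>The principal part at \<open>l\<close> acts on the weighted forcing of
   \<open>l\<close>, iterated \<open>m\<close> times for the term of order \<open>m + 1\<close>; the
   remainder acts on the weighted forcing of \<alpha>.\<close>
 define cand where "cand i t = (\<Sum>j\<in>UNIV. (\<Sum>l\<in>\<Lambda>. \<Sum>m\<le>n. c i j l m * ?E (?E (it l m (W l j))) t) + conv HL (invlap (J i j) \<gamma>) (W (of_real \<alpha>) j) t)" for i t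
 have laps_it: "laps (it l m (W l j)) (%w. of_real w * gh j w / (of_real w - l) / (of_real w - l) ^ m)" for l m j
  unfolding it_def by (rule laps_iter[OF laps_W])
 have cont_it: "continuous_on {0..} (it l m (W l j))" for l m j
  unfolding it_def by (rule iter_continuous[OF laps_W W_continuous])
 have "laps (cand i) (%w. \<Sum>j\<in>UNIV. (\<Sum>l\<in>\<Lambda>. \<Sum>m\<le>n. c i j l m * (of_real w * gh j w / (of_real w - l) / (of_real w - l) ^ m / ?q w / ?q w))
   + lapk HL (invlap (J i j) \<gamma>) (of_real w) * (of_real w * gh j w / (of_real w - of_real \<alpha>)))" for i
  unfolding cand_def[abs_def]
  by (intro laps_sum laps_add laps_cmult laps_conv_exp laps_it laps_conv[OF J_lap(1)] laps_W)
 moreover have "\<forall>\<^sub>F w in at_top. (\<Sum>j\<in>UNIV. (\<Sum>l\<in>\<Lambda>. \<Sum>m\<le>n. c i j l m * (of_real w * gh j w / (of_real w - l) / (of_real w - l) ^ m / ?q w / ?q w))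
   + lapk HL (invlap (J i j) \<gamma>) (of_real w) * (of_real w * gh j w / (of_real w - of_real \<alpha>))) = xh i w / ?q w / ?q w" for i
 proof -
  have "\<forall>\<^sub>F w in at_top. \<forall>j. G i j (of_real w) = (\<Sum>l\<in>\<Lambda>. \<Sum>m\<le>n. c i j l m / (of_real w - l) ^ Suc m) + H i j (of_real w)"
   by (intro eventually_all_finite dec)
  then show ?thesis using xh_G[of i] eventually_gt_at_top[of \<alpha>]
  proof eventually_elim
   case (elim w)
   have w: "complex_of_real w - of_real \<alpha> \<noteq> 0" using elim by simp
   have "(\<Sum>l\<in>\<Lambda>. \<Sum>m\<le>n. c i j l m * (of_real w * gh j w / (of_real w - l) / (of_real w - l) ^ m / ?q w / ?q w))
    + lapk HL (invlap (J i j) \<gamma>) (of_real w) * (of_real w * gh j w / (of_real w - of_real \<alpha>))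
    = G i j (of_real w) * (of_real w * gh j w) / ?q w / ?q w" for j
   proof -
    have "lapk HL (invlap (J i j) \<gamma>) (of_real w) = (of_real w - of_real \<alpha>) * H i j (of_real w) / (?q w)\<^sup>2"
     using J_lap(2)[of "of_real w" i j] elim by (simp add: J_def)
    then have "lapk HL (invlap (J i j) \<gamma>) (of_real w) * (of_real w * gh j w / (of_real w - of_real \<alpha>)) = H i j (of_real w) * (of_real w * gh j w / ?q w / ?q w)"
     using w by (simp add: power2_eq_square)
    moreover have "(\<Sum>l\<in>\<Lambda>. \<Sum>m\<le>n. c i j l m * (of_real w * gh j w / (of_real w - l) / (of_real w - l) ^ m / ?q w / ?q w))
     = (\<Sum>l\<in>\<Lambda>. \<Sum>m\<le>n. c i j l m / (of_real w - l) ^ Suc m) * (of_real w * gh j w / ?q w / ?q w)"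
     unfolding sum_distrib_right by (intro sum.cong refl) (simp add: mult_ac)
    ultimately have "(\<Sum>l\<in>\<Lambda>. \<Sum>m\<le>n. c i j l m * (of_real w * gh j w / (of_real w - l) / (of_real w - l) ^ m / ?q w / ?q w))
     + lapk HL (invlap (J i j) \<gamma>) (of_real w) * (of_real w * gh j w / (of_real w - of_real \<alpha>))
     = G i j (of_real w) * (of_real w * gh j w / ?q w / ?q w)"
     using elim(1) by (simp only: distrib_right)
    then show ?thesis by (simp only: times_divide_eq_right)
   qed
   then show ?case using elim(2) by (simp add: sum_divide_distrib)
  qed
 qed
 ultimately have laps_cand: "laps (cand i) (%w. xh i w / ?q w / ?q w)" for i
  by (rule laps_cong)
 have cont_cand: "continuous_on {0..} (cand i)" for i
  unfolding cand_def[abs_def]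
  by (intro continuous_intros conv_exp_continuous laps_expb[OF laps_conv_exp[OF laps_it]] laps_expb[OF laps_it] cont_it
    conv_HL_continuous[OF J_lap(1)] laps_expb[OF laps_W] W_continuous)
 have u2_cand: "u2 i = cand i" for i
  by (rule ext, rule laps_unique[OF laps_u2 cont_u2 laps_cand cont_cand]) simp
 have aW: "asym 0 \<alpha> {of_real \<alpha>} (%l. L (of_real \<alpha>) j) (W (of_real \<alpha>) j)" for j
 proof -
  have "asym 0 \<alpha> {of_real \<alpha>} (%l'. if l' = of_real \<alpha> \<and> 0 = (0::nat) then L (of_real \<alpha>) j else 0) (W (of_real \<alpha>) j)"
   by (rule asym_single) (use lim[of "of_real \<alpha>" j] in auto)
  then show ?thesis by (rule asym_cong) simp
 qed
 have smallI: "asym n \<alpha> \<Lambda> (%l. 0) f" if "asym 0 \<alpha> {of_real \<alpha>} A f" "A (of_real \<alpha>) = 0" for f A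
  using that by (intro asym_small) (simp add: asym_def)
 \<comment> \<open>The coefficient at \<alpha> is the value of \<open>J\<close> there times the
   limit \<open>L\<close>, and \<open>J\<close> vanishes at \<alpha>.\<close>
 have rem: "asym n \<alpha> \<Lambda> (%l. 0) (conv HL (invlap (J i j) \<gamma>) (W (of_real \<alpha>) j))" for i j
 proof (rule smallI)
  show "asym 0 \<alpha> {of_real \<alpha>} (%l. lapk HL (invlap (J i j) \<gamma>) l * L (of_real \<alpha>) j) (conv HL (invlap (J i j) \<gamma>) (W (of_real \<alpha>) j))"
   by (rule asym_conv[OF J_lap(1) laps_expb[OF laps_W] _ _ aW]) auto
  show "lapk HL (invlap (J i j) \<gamma>) (of_real \<alpha>) * L (of_real \<alpha>) j = 0"
   using J_lap(2)[of "of_real \<alpha>" i j] by (simp add: J_def)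
 qed
 define y where "y i = W (of_real p) i" for i
 \<comment> \<open>A resolvent identity: \<open>1 / (w - p)\<close> is
   \<open>1 / (w - \<alpha>)\<close> minus
   \<open>(\<alpha> - p) / ((w - \<alpha>) * (w - p))\<close>. At \<alpha> the two coefficients
   cancel, so the forcing weighted with \<open>p\<close> is of lower order than
   \<open>exp (\<alpha> * t)\<close>.\<close>
 have y_eq: "y i = (%t. W (of_real \<alpha>) i t - of_real (\<alpha> - p) * ?E (W (of_real \<alpha>) i) t)" for i
 proof (rule ext, rule laps_unique)
  show "laps (y i) (%w. of_real w * gh i w / ?q w)" unfolding y_def by (rule laps_W)
  show "laps (%t. W (of_real \<alpha>) i t - of_real (\<alpha> - p) * ?E (W (of_real \<alpha>) i) t)
   (%w. of_real w * gh i w / (of_real w - of_real \<alpha>) - of_real (\<alpha> - p) * (of_real w * gh i w / (of_real w - of_real \<alpha>) / ?q w))"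
   by (intro laps_diff laps_cmult laps_conv_exp laps_W)
  show "\<forall>\<^sub>F w in at_top. of_real w * gh i w / ?q w = of_real w * gh i w / (of_real w - of_real \<alpha>) - of_real (\<alpha> - p) * (of_real w * gh i w / (of_real w - of_real \<alpha>) / ?q w)"
   using eventually_complex_neq[of "of_real \<alpha>"] eventually_complex_neq[of "of_real p"]
   by eventually_elim (simp add: divide_simps, simp add: algebra_simps)
 qed (auto simp: y_def intro!: W_continuous continuous_intros conv_exp_continuous laps_expb[OF laps_W])
 have ex_y: "laps (y i) (%w. of_real w * gh i w / ?q w)" for i unfolding y_def by (rule laps_W)
 have cont_y: "continuous_on {0..} (y i)" for i unfolding y_def by (rule W_continuous)
 have a_y: "asym n \<alpha> \<Lambda> (%l. 0) (y i)" for i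
  unfolding y_eq
 proof (rule smallI)
  show "asym 0 \<alpha> {of_real \<alpha>} (%l. L (of_real \<alpha>) i - of_real (\<alpha> - p) * (lapk HL (%s. exp (complex_of_real p * of_real s)) l * L (of_real \<alpha>) i))
   (%t. W (of_real \<alpha>) i t - of_real (\<alpha> - p) * ?E (W (of_real \<alpha>) i) t)"
   by (intro asym_diff asym_cmult aW asym_conv[OF E_kern laps_expb[OF laps_W]]) auto
  show "L (of_real \<alpha>) i - of_real (\<alpha> - p) * (lapk HL (%s. exp (complex_of_real p * of_real s)) (of_real \<alpha>) * L (of_real \<alpha>) i) = 0"
   using E_lapk[of "of_real \<alpha>"] lp[of "of_real \<alpha>"] by simp
 qed
 \<comment> \<open>Each of the two smoothings contributes a factor
   \<open>1 / (l - p)\<close>.\<close>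
 define A2 where "A2 i l = (\<Sum>j\<in>UNIV. c i j l n * L l j) / fact n / (l - of_real p)\<^sup>2" for i l
 have a_u2: "asym n \<alpha> \<Lambda> (A2 i) (u2 i)" for i
 proof (rule asym_cong)
  have 1: "asym n \<alpha> \<Lambda> (%l'. if l' = l \<and> m = n then L l j / fact m else 0) (it l m (W l j))" if "l \<in> \<Lambda>" "m <= n" for l m j
   unfolding it_def using that fin re
   by (intro asym_single iter_tendsto[OF laps_W lim]) auto
  show "asym n \<alpha> \<Lambda> (%l'. \<Sum>j\<in>UNIV. (\<Sum>l\<in>\<Lambda>. \<Sum>m\<le>n. c i j l m *
    (lapk HL (%s. exp (complex_of_real p * of_real s)) l' * (lapk HL (%s. exp (complex_of_real p * of_real s)) l' * (if l' = l \<and> m = n then L l j / fact m else 0)))) + 0) (u2 i)"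
   unfolding u2_cand cand_def[abs_def]
   by (intro asym_sum asym_add rem asym_cmult asym_conv[OF E_kern _ fin re] 1 laps_expb[OF laps_conv_exp[OF laps_it]] laps_expb[OF laps_it]) auto
  fix l' assume l': "l' \<in> \<Lambda>"
  have "(\<Sum>l\<in>\<Lambda>. \<Sum>m\<le>n. c i j l m * (r * (r * (if l' = l \<and> m = n then L l j / fact m else 0)))) = c i j l' n * (r * (r * (L l' j / fact n)))" for r j
  proof -
   have "(\<Sum>l\<in>\<Lambda>. \<Sum>m\<le>n. c i j l m * (r * (r * (if l' = l \<and> m = n then L l j / fact m else 0))))
    = (\<Sum>l\<in>\<Lambda>. if l' = l then c i j l n * (r * (r * (L l j / fact n))) else 0)"
    by (intro sum.cong refl) (auto simp: if_distrib[of "%y. _ * y"] cong: if_cong)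
   then show ?thesis using l' fin by simp
  qed
  note key = this
  show "(\<Sum>j\<in>UNIV. (\<Sum>l\<in>\<Lambda>. \<Sum>m\<le>n. c i j l m *
    (lapk HL (%s. exp (complex_of_real p * of_real s)) l' * (lapk HL (%s. exp (complex_of_real p * of_real s)) l' * (if l' = l \<and> m = n then L l j / fact m else 0)))) + 0) = A2 i l'"
   unfolding key E_lapk[OF re[OF l']] A2_def by (simp add: sum_divide_distrib power2_eq_square mult_ac)
 qed
 have M_A2: "(\<Sum>j\<in>UNIV. Mh i j l * (r * A2 j l)) = l * (r * A2 i l)" if "l \<in> \<Lambda>" for i l r
 proof -
  have "(\<Sum>j\<in>UNIV. Mh i j l * (r * A2 j l)) = (\<Sum>j\<in>UNIV. \<Sum>k\<in>UNIV. Mh i j l * c j k l n * (r * L l k / fact n / (l - of_real p)\<^sup>2))"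
   by (simp add: A2_def sum_distrib_left sum_divide_distrib mult_ac)
  also have "... = (\<Sum>k\<in>UNIV. (\<Sum>j\<in>UNIV. Mh i j l * c j k l n) * (r * L l k / fact n / (l - of_real p)\<^sup>2))"
   by (subst sum.swap) (simp only: sum_distrib_right)
  also have "... = l * (r * A2 i l)"
   unfolding res[OF that] by (simp add: A2_def sum_distrib_left sum_divide_distrib mult_ac)
  finally show ?thesis .
 qed
 have step_laps: "laps (%t. f t + ((\<Sum>j\<in>UNIV. conv (Np i j) (%_. 1) (v j) t - conv (Nm i j) (%_. 1) (v j) t) - of_real p * v i t)) (%w. \<phi> w + ((\<Sum>j\<in>UNIV. Mh i j (of_real w) * vh j w) - of_real p * vh i w))"
  if "laps f \<phi>" "!!j. laps (v j) (vh j)" for f v \<phi> vh i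
  by (intro laps_add laps_diff laps_cmult laps_delay that)
 \<comment> \<open>On transforms, \<open>w - p\<close> times \<open>xh\<close> equals
   \<open>w * gh + Mh xh - p * xh\<close>; division by \<open>(w - p)\<^sup>2\<close> expresses the
   once smoothed solution through the twice smoothed one.\<close>
 have u1_eq: "u1 i = (%t. ?E (y i) t + ((\<Sum>j\<in>UNIV. conv (Np i j) (%_. 1) (u2 j) t - conv (Nm i j) (%_. 1) (u2 j) t) - of_real p * u2 i t))" for i
 proof (rule ext, rule laps_unique[OF laps_u1 cont_u1 step_laps[OF laps_conv_exp[OF ex_y] laps_u2]])
  show "\<forall>\<^sub>F w in at_top. xh i w / ?q w = of_real w * gh i w / ?q w / ?q w + ((\<Sum>j\<in>UNIV. Mh i j (of_real w) * (xh j w / ?q w / ?q w)) - of_real p * (xh i w / ?q w / ?q w))"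
   using xh_eq eventually_complex_neq[of "of_real p"]
  proof eventually_elim
   case (elim w)
   have "(\<Sum>j\<in>UNIV. Mh i j (of_real w) * (xh j w / ?q w / ?q w)) = (of_real w * xh i w - of_real w * gh i w) / ?q w / ?q w"
    using elim(1) by (simp add: sum_divide_distrib)
   then show ?case using elim(2) by (simp add: divide_simps) (simp add: algebra_simps)
  qed
 qed (intro continuous_intros conv_exp_continuous laps_expb[OF ex_y] cont_y delay_continuous ex_u2 cont_u2)+
 have a_u1: "asym n \<alpha> \<Lambda> (%l. (l - of_real p) * A2 i l) (u1 i)" for i
 proof -
  have "asym n \<alpha> \<Lambda> (%l. lapk HL (%s. exp (complex_of_real p * of_real s)) l * 0 + (l - of_real p) * A2 i l) (u1 i)"
   unfolding u1_eq
   by (intro asym_add asym_conv[OF E_kern laps_expb[OF ex_y] fin re a_y] asym_delay[OF num(1) fin re ex_u2 a_u2])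
    (use M_A2[of _ _ 1] in auto)
  then show ?thesis by (rule asym_cong) simp
 qed
 have x_eq: "x i = (%t. y i t + ((\<Sum>j\<in>UNIV. conv (Np i j) (%_. 1) (u1 j) t - conv (Nm i j) (%_. 1) (u1 j) t) - of_real p * u1 i t))" for i
 proof (rule ext, rule laps_unique[OF laps_x x(1) step_laps[OF ex_y laps_u1]])
  show "\<forall>\<^sub>F w in at_top. xh i w = of_real w * gh i w / ?q w + ((\<Sum>j\<in>UNIV. Mh i j (of_real w) * (xh j w / ?q w)) - of_real p * (xh i w / ?q w))"
   using xh_eq eventually_complex_neq[of "of_real p"]
  proof eventually_elim
   case (elim w)
   have "(\<Sum>j\<in>UNIV. Mh i j (of_real w) * (xh j w / ?q w)) = (of_real w * xh i w - of_real w * gh i w) / ?q w"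
    using elim(1) by (simp add: sum_divide_distrib)
   then show ?case using elim(2) by (simp add: divide_simps) (simp add: algebra_simps)
  qed
 qed (intro continuous_intros cont_y delay_continuous ex_u1 cont_u1)+
 have "asym n \<alpha> \<Lambda> (%l. 0 + (l - of_real p) * ((l - of_real p) * A2 i l)) (x i)"
  unfolding x_eq by (intro asym_add a_y asym_delay[OF num(1) fin re ex_u1 a_u1]) (use M_A2 in auto)
 then show ?thesis
  by (rule asym_cong) (use lp re in \<open>auto simp: A2_def power2_eq_square\<close>)
qed

end

section \<open>Wiener integrals\<close>

text \<open>Lists of triples instead of a common grid: sums of step functions are then
  concatenations and no refinement is ever needed. A triple stands for a random height on the
  interval from its first entry, excluded, to its second, included.\<close>

type_synonym ('x, 'y) steps = "(real \<times> real \<times> ('x => real^'y)) list"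

lemma vec_nth_borel [measurable]: "(%v::real^'e. v $ k) \<in> borel_measurable borel"
 by (intro borel_measurable_continuous_onI continuous_intros)

locale brownian = prob_space M for M :: "'a measure" +
 fixes F :: "real => 'a measure" and B :: "real => 'a => real^'e"
 assumes tf: "time_filtration M F" and bm: "brownian_motion M F B"
begin

lemma subalg_M: "t >= 0 ==> subalgebra M (F t)"
 using tf by (auto simp: time_filtration_def)

lemma meas_F_M: "f \<in> borel_measurable (F t) ==> t >= 0 ==> f \<in> borel_measurable M"
 using measurable_from_subalg[OF subalg_M] by blast

lemma meas_F_mono: "f \<in> borel_measurable (F s) ==> 0 <= s ==> s <= t ==> f \<in> borel_measurable (F t)"
 using measurable_from_subalg tf unfolding time_filtration_def by blast

lemma space_F: "t >= 0 ==> space (F t) = space M"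
 using subalg_M by (auto simp: subalgebra_def)

lemma B_meas: "0 <= t ==> t <= u ==> B t \<in> borel_measurable (F u)"
 using bm meas_F_mono[of "B t" t u] by (auto simp: brownian_motion_def)

lemma B_meas_M: "0 <= t ==> B t \<in> borel_measurable M"
 using B_meas[of t t] meas_F_M by auto

definition dB :: "real => real => 'e => 'a => real" where
 "dB s t k w = (B t w - B s w) $ k"

lemma dB_meas: "0 <= s ==> s <= t ==> t <= u ==> dB s t k \<in> borel_measurable (F u)"
 unfolding dB_def[abs_def] using B_meas[of s u] B_meas[of t u] by measurable

lemma dB_normal:
 assumes "0 <= s" "s < t"
 shows "distributed M lborel (dB s t k) (normal_density 0 (sqrt (t - s)))"
 using bm assms unfolding brownian_motion_def dB_def[abs_def] by blast

lemma dB_moments: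
 assumes "0 <= s" "s < t"
 shows "has_bochner_integral M (dB s t k) 0" "has_bochner_integral M (%w. dB s t k w * dB s t k w) (t - s)"
proof -
 note D = dB_normal[OF assms, of k]
 have s0: "sqrt (t - s) > 0" using assms by simp
 have i1: "integrable M (%w. dB s t k w ^ n)" for n
 proof -
  have "integrable lborel (%x. normal_density 0 (sqrt (t - s)) x * (x - 0) ^ n)"
   by (rule integrable_normal_moment[OF s0])
  then show ?thesis
   using distributed_integrable[OF D, of "%x. x ^ n"] s0 by (simp add: normal_density_nonneg)
 qed
 have e0: "expectation (dB s t k) = 0" by (rule normal_distributed_expectation[OF s0 D])
 then show "has_bochner_integral M (dB s t k) 0" using i1[of 1] by (simp add: has_bochner_integral_iff)
 have "variance (dB s t k) = (sqrt (t - s))\<^sup>2" by (rule normal_distributed_variance[OF s0 D])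
 then have "expectation (%w. (dB s t k w)\<^sup>2) = t - s" using e0 assms by simp
 then show "has_bochner_integral M (%w. dB s t k w * dB s t k w) (t - s)"
  using i1[of 2] by (simp add: has_bochner_integral_iff power2_eq_square)
qed

lemma dB_cross:
 assumes "0 <= s" "s < t" "k \<noteq> l"
 shows "has_bochner_integral M (%w. dB s t k w * dB s t l w) 0"
proof -
 have iv: "indep_vars (%_. borel) (%k w. dB s t k w) UNIV"
  using bm assms unfolding brownian_motion_def dB_def by blast
 have iv2: "indep_vars (%_. borel) (%k w. dB s t k w) {k, l}"
  by (rule indep_vars_subset[OF iv]) simp
 have m: "integrable M (dB s t j)" "expectation (dB s t j) = 0" for j
  using dB_moments(1)[OF assms(1,2)] by (auto simp: has_bochner_integral_iff)
 have "expectation (%w. \<Prod>j\<in>{k, l}. dB s t j w) = (\<Prod>j\<in>{k, l}. expectation (dB s t j))"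
  by (rule indep_vars_lebesgue_integral[OF _ iv2]) (use m in auto)
 moreover have "integrable M (%w. \<Prod>j\<in>{k, l}. dB s t j w)"
  by (rule indep_vars_integrable[OF _ iv2]) (use m in auto)
 ultimately show ?thesis using assms(3) m(2) by (simp add: has_bochner_integral_iff)
qed

section \<open>Independence of the past and covariances of increments\<close>

lemma indep_past:
 assumes st: "0 <= s" "s < t" and U: "U \<in> borel_measurable (F s)"
  and \<phi>: "\<phi> \<in> borel_measurable borel"
 shows "indep_var borel (U :: 'a => real) borel (%w. \<phi> (B t w - B s w) :: real)"
proof -
 let ?V = "vimage_algebra (space M) (%w. B t w - B s w) borel"
 have ind: "indep_set (sets (F s)) (sets ?V)" using bm st unfolding brownian_motion_def by blast
 have Um: "U \<in> borel_measurable M" using meas_F_M[OF U] st by simp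
 have Bm: "(%w. B t w - B s w) \<in> borel_measurable M" using B_meas_M st by (intro borel_measurable_diff) auto
 have Vm: "(%w. \<phi> (B t w - B s w)) \<in> borel_measurable M" using Bm \<phi> by measurable
 have Vm': "(%w. \<phi> (B t w - B s w)) \<in> borel_measurable ?V"
  using measurable_compose[OF measurable_vimage_algebra1[of "%w. B t w - B s w" "space M" borel] \<phi>] by simp
 have 1: "sigma_sets (space M) {U -` A \<inter> space M |A. A \<in> sets borel} \<subseteq> sets (F s)"
 proof -
  have "{U -` A \<inter> space M |A. A \<in> sets borel} \<subseteq> sets (F s)"
   using measurable_sets[OF U] space_F[of s] st by auto
  then show ?thesis using sets.sigma_sets_subset[of _ "F s"] space_F[of s] st by simp
 qed
 have 2: "sigma_sets (space M) {(%w. \<phi> (B t w - B s w)) -` A \<inter> space M |A. A \<in> sets borel} \<subseteq> sets ?V"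
 proof -
  have "{(%w. \<phi> (B t w - B s w)) -` A \<inter> space M |A. A \<in> sets borel} \<subseteq> sets ?V"
   using measurable_sets[OF Vm'] by auto
  then show ?thesis using sets.sigma_sets_subset[of _ ?V] by simp
 qed
 have "indep_set (sigma_sets (space M) {U -` A \<inter> space M |A. A \<in> sets borel})
  (sigma_sets (space M) {(%w. \<phi> (B t w - B s w)) -` A \<inter> space M |A. A \<in> sets borel})"
  using ind unfolding indep_set_def
  by (rule indep_sets_mono_sets) (use 1 2 in \<open>auto split: bool.split\<close>)
 then show ?thesis unfolding indep_var_eq using Um Vm by blast
qed

lemma past_increment:
 assumes st: "0 <= s" "s <= t" and U: "U \<in> borel_measurable (F s)" and iU: "integrable M U"
 shows "has_bochner_integral M (%w. U w * dB s t k w) 0"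
proof (cases "s = t")
 case True then show ?thesis by (simp add: dB_def has_bochner_integral_zero)
next
 case False
 then have st': "s < t" using st by simp
 have iv: "indep_var borel U borel (dB s t k)"
  using indep_past[OF st(1) st' U, of "%v. v $ k"] by (simp add: dB_def[abs_def])
 have m: "integrable M (dB s t k)" "expectation (dB s t k) = 0"
  using dB_moments(1)[OF st(1) st'] by (auto simp: has_bochner_integral_iff)
 show ?thesis
  using indep_var_lebesgue_integral[OF iv iU m(1)] indep_var_integrable[OF iv iU m(1)] m(2)
  by (simp add: has_bochner_integral_iff)
qed

lemma past_increment_product:
 assumes st: "0 <= s" "s <= t" and U: "U \<in> borel_measurable (F s)" and iU: "integrable M U"
 shows "has_bochner_integral M (%w. U w * (dB s t k w * dB s t l w)) ((if k = l then t - s else 0) * expectation U)"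
proof (cases "s = t")
 case True then show ?thesis by (simp add: dB_def has_bochner_integral_zero)
next
 case False
 then have st': "s < t" using st by simp
 have iv: "indep_var borel U borel (%w. dB s t k w * dB s t l w)"
  using indep_past[OF st(1) st' U, of "%v. v $ k * v $ l"] by (simp add: dB_def[abs_def])
 have "has_bochner_integral M (%w. dB s t k w * dB s t l w) (if k = l then t - s else 0)"
  using dB_moments(2)[OF st(1) st', of k] dB_cross[OF st(1) st', of k l] by auto
 then have m: "integrable M (%w. dB s t k w * dB s t l w)" "expectation (%w. dB s t k w * dB s t l w) = (if k = l then t - s else 0)"
  by (auto simp: has_bochner_integral_iff)
 show ?thesis
  using indep_var_lebesgue_integral[OF iv iU m(1)] indep_var_integrable[OF iv iU m(1)] m(2)
  by (simp add: has_bochner_integral_iff mult.commute)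
qed

lemma integrable_bounded_times:
 assumes "V \<in> borel_measurable M" "bounded (V ` space M)" "integrable M X"
 shows "integrable M (%w. V w * X w :: real)"
proof -
 obtain K where K: "!!w. w \<in> space M ==> \<bar>V w\<bar> <= K"
  using assms(2) unfolding bounded_iff by auto
 have "integrable M (%w. \<bar>K\<bar> * X w)" using assms(3) by simp
 then show ?thesis
 proof (rule Bochner_Integration.integrable_bound)
  show "AE w in M. norm (V w * X w) <= norm (\<bar>K\<bar> * X w)"
  proof (rule AE_I2)
   fix w assume "w \<in> space M"
   then have "\<bar>V w\<bar> <= \<bar>K\<bar>" using K[of w] by linarith
   then have "\<bar>V w\<bar> * \<bar>X w\<bar> <= \<bar>K\<bar> * \<bar>X w\<bar>" by (rule mult_right_mono) simp
   then show "norm (V w * X w) <= norm (\<bar>K\<bar> * X w)" by (simp add: abs_mult)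
  qed
 qed (use assms borel_measurable_integrable in auto)
qed

text \<open>The length of the intersection of the intervals \<open>(a, b]\<close> and
  \<open>(c, d]\<close>, equal to \<open>0\<close> when they do not meet.\<close>

definition overlap :: "real => real => real => real => real" where
 "overlap a b c d = max 0 (min b d - max a c)"

text \<open>If the intervals meet, they are cut at \<open>c\<close> and at the earlier of the two
  right end points. Two different pieces are successive, so the later increment is independent of
  all other factors and has mean \<open>0\<close>; only the product over the common piece is
  left.\<close>

lemma increment_covariance_le:
 assumes ab: "0 <= a" "a <= b" and cd: "c <= d" and ac: "a <= c"
  and xi: "\<xi> \<in> borel_measurable (F a)" "bounded (\<xi> ` space M)"
  and eta: "\<eta> \<in> borel_measurable (F c)" "bounded (\<eta> ` space M)"
 shows "has_bochner_integral M (%w. (\<xi> w * dB a b k w) * (\<eta> w * dB c d l w))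
  ((if k = l then overlap a b c d else 0) * expectation (%w. \<xi> w * \<eta> w))"
proof -
 define V where "V w = \<xi> w * \<eta> w" for w
 have xic: "\<xi> \<in> borel_measurable (F c)" using meas_F_mono[OF xi(1) ab(1) ac] .
 have Vm: "V \<in> borel_measurable (F u)" if "c <= u" for u
  unfolding V_def[abs_def] using meas_F_mono[OF xic _ that] meas_F_mono[OF eta(1) _ that] ab ac by simp
 have VM: "V \<in> borel_measurable M" using meas_F_M[OF Vm[of c]] ab ac by simp
 have Vb: "bounded (V ` space M)"
 proof -
  obtain K L where K: "!!w. w \<in> space M ==> \<bar>\<xi> w\<bar> <= K" and L: "!!w. w \<in> space M ==> \<bar>\<eta> w\<bar> <= L"
   using xi(2) eta(2) unfolding bounded_iff by auto
  have "\<bar>V w\<bar> <= K * L" if "w \<in> space M" for w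
   unfolding V_def abs_mult by (rule mult_mono[OF K L]) (use that K[OF that] in auto)
  then show ?thesis unfolding bounded_iff by auto
 qed
 have Vi: "integrable M V" using integrable_bounded_times[OF VM Vb, of "%_. 1"] by simp
 have ViB: "integrable M (%w. V w * dB s t j w)" if "0 <= s" "s <= t" for s t j
 proof (cases "s = t")
  case False
  then have "integrable M (dB s t j)" using dB_moments(1)[of s t j] that by (auto simp: has_bochner_integral_iff)
  then show ?thesis by (rule integrable_bounded_times[OF VM Vb])
 qed (simp add: dB_def)
 have split: "dB s u j w = dB s t j w + dB t u j w" for s t u j w by (simp add: dB_def)
 have zero: "has_bochner_integral M (%w. (V w * dB s t i w) * dB u v j w) 0"
  if "0 <= s" "s <= t" "t <= u" "u <= v" "c <= u" for s t u v i j
 proof (rule past_increment)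
  show "(%w. V w * dB s t i w) \<in> borel_measurable (F u)"
   using Vm[OF that(5)] dB_meas[OF that(1,2,3)] by simp
  show "integrable M (%w. V w * dB s t i w)" by (rule ViB) (use that in auto)
 qed (use that in auto)
 have c0: "0 <= c" using ab ac by simp
 show ?thesis
 proof (cases "b <= c")
  case True
  then have "overlap a b c d = 0" by (simp add: overlap_def)
  moreover have "has_bochner_integral M (%w. (V w * dB a b k w) * dB c d l w) 0"
   by (rule zero) (use True ab cd in auto)
  ultimately show ?thesis by (cases "k = l") (simp_all add: V_def mult_ac)
 next
  case False
  then have cb: "c <= b" by simp
  have t1: "has_bochner_integral M (%w. (V w * dB a c k w) * dB c d l w) 0"
   by (rule zero) (use ab ac cd in auto)
  have t2: "has_bochner_integral M (%w. V w * (dB c b k w * dB c d l w)) ((if k = l then overlap a b c d else 0) * expectation V)"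
  proof (cases "b <= d")
   case True
   have X: "has_bochner_integral M (%w. V w * (dB c b k w * dB c b l w) + (V w * dB c b k w) * dB b d l w)
     ((if k = l then b - c else 0) * expectation V + 0)"
    by (intro has_bochner_integral_add past_increment_product zero Vm Vi) (use cb True c0 in auto)
   have o: "overlap a b c d = b - c" using True cb ac by (simp add: overlap_def)
   show ?thesis unfolding o split[of c d l _ b] using X by (cases "k = l") (simp_all add: algebra_simps)
  next
   case False
   have X: "has_bochner_integral M (%w. V w * (dB c d k w * dB c d l w) + (V w * dB c d l w) * dB d b k w)
     ((if k = l then d - c else 0) * expectation V + 0)"
    by (intro has_bochner_integral_add past_increment_product zero Vm Vi) (use cd False c0 in auto)
   have o: "overlap a b c d = d - c" using False cd ac by (simp add: overlap_def)
   show ?thesis unfolding o split[of c b k _ d] using X by (cases "k = l") (simp_all add: algebra_simps)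
  qed
  have "has_bochner_integral M (%w. (V w * dB a c k w) * dB c d l w + V w * (dB c b k w * dB c d l w))
   (0 + (if k = l then overlap a b c d else 0) * expectation V)"
   by (rule has_bochner_integral_add[OF t1 t2])
  then show ?thesis unfolding split[of a b k _ c] by (cases "k = l") (simp_all add: V_def[abs_def] algebra_simps)
 qed
qed

lemma increment_covariance:
 assumes ab: "0 <= a" "a <= b" and cd: "0 <= c" "c <= d"
  and xi: "\<xi> \<in> borel_measurable (F a)" "bounded (\<xi> ` space M)"
  and eta: "\<eta> \<in> borel_measurable (F c)" "bounded (\<eta> ` space M)"
 shows "has_bochner_integral M (%w. (\<xi> w * dB a b k w) * (\<eta> w * dB c d l w))
  ((if k = l then overlap a b c d else 0) * expectation (%w. \<xi> w * \<eta> w))"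
proof (cases "a <= c")
 case True then show ?thesis using increment_covariance_le[OF ab cd(2) True xi eta] by simp
next
 case False
 then have "c <= a" by simp
 from increment_covariance_le[OF cd ab(2) this eta xi, of l k]
 show ?thesis by (simp add: mult.commute overlap_def min.commute max.commute eq_commute[of k l] cong: if_cong)
qed

definition valid :: "('a, 'e) steps => bool" where
 "valid l \<longleftrightarrow> (\<forall>(a, b, \<xi>) \<in> set l. 0 <= a \<and> a <= b \<and> \<xi> \<in> borel_measurable (F a) \<and> bounded (\<xi> ` space M))"

definition sint :: "('a, 'e) steps => 'a => real" where
 "sint l w = (\<Sum>(a, b, \<xi>) \<leftarrow> l. \<xi> w \<bullet> (B b w - B a w))"

definition sval :: "('a, 'e) steps => 'a => real => real^'e" where
 "sval l w s = (\<Sum>(a, b, \<xi>) \<leftarrow> l. indicator {a<..b} s *\<^sub>R \<xi> w)"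

lemma valid_simps [simp]: "valid []"
 "valid ((a, b, \<xi>) # l) \<longleftrightarrow> (0 <= a \<and> a <= b \<and> \<xi> \<in> borel_measurable (F a) \<and> bounded (\<xi> ` space M)) \<and> valid l"
 "valid (l @ l') \<longleftrightarrow> valid l \<and> valid l'"
 by (auto simp: valid_def ball_Un)

lemma sint_simps [simp]: "sint [] w = 0" "sint ((a, b, \<xi>) # l) w = \<xi> w \<bullet> (B b w - B a w) + sint l w"
 "sint (l @ l') w = sint l w + sint l' w"
 by (auto simp: sint_def)

lemma sval_simps [simp]: "sval [] w s = 0" "sval ((a, b, \<xi>) # l) w s = indicator {a<..b} s *\<^sub>R \<xi> w + sval l w s"
 "sval (l @ l') w s = sval l w s + sval l' w s"
 by (auto simp: sval_def)

lemma sint_measurable: "valid l ==> sint l \<in> borel_measurable M"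
proof (induction l)
 case (Cons p l)
 obtain a b \<xi> where p: "p = (a, b, \<xi>)" by (cases p)
 have [measurable]: "B a \<in> borel_measurable M" "B b \<in> borel_measurable M" "\<xi> \<in> borel_measurable M" "sint l \<in> borel_measurable M"
  using Cons p B_meas_M meas_F_M by auto
 show ?case unfolding p sint_simps(2)[abs_def] by measurable
qed (simp add: sint_def[abs_def])

lemma sval_measurable: "valid l ==> (%(w, s). sval l w s) \<in> borel_measurable (M \<Otimes>\<^sub>M lborel)"
proof (induction l)
 case (Cons p l)
 obtain a b \<xi> where p: "p = (a, b, \<xi>)" by (cases p)
 have [measurable]: "\<xi> \<in> borel_measurable M" "(%(w, s). sval l w s) \<in> borel_measurable (M \<Otimes>\<^sub>M lborel)"
  using Cons p meas_F_M by auto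
 show ?case unfolding p sval_simps(2)[abs_def] by measurable
qed (simp add: sval_def[abs_def])

lemma overlap_integral:
 "has_bochner_integral lborel (%s. (indicator {a<..b} s *\<^sub>R x) \<bullet> (indicator {c<..d} s *\<^sub>R y)) (overlap a b c d * (x \<bullet> (y :: real^'e)))"
proof -
 have eq: "(indicator {a<..b} s *\<^sub>R x) \<bullet> (indicator {c<..d} s *\<^sub>R y) = indicator {max a c<..min b d} s *\<^sub>R (x \<bullet> y)" for s
  by (auto split: split_indicator)
 have em: "emeasure lborel {max a c<..min b d} = ennreal (overlap a b c d)"
 proof (cases "max a c <= min b d")
  case True then show ?thesis using emeasure_lborel_Ioc[OF True] by (simp only: overlap_def max_absorb2 diff_ge_0_iff_ge)
 next
  case False
  then have "{max a c<..min b d} = {}" "overlap a b c d = 0" by (simp_all only: overlap_def greaterThanAtMost_empty_iff)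
  then show ?thesis by (simp only: emeasure_empty ennreal_0)
 qed
 from em have "has_bochner_integral lborel (%s. indicator {max a c<..min b d} s *\<^sub>R (x \<bullet> y)) (measure lborel {max a c<..min b d} *\<^sub>R (x \<bullet> y))"
  by (intro has_bochner_integral_indicator) auto
 moreover have "measure lborel {max a c<..min b d} = overlap a b c d"
 proof -
  have "overlap a b c d >= 0" by (simp add: overlap_def)
  then show ?thesis by (simp only: measure_def em enn2real_ennreal)
 qed
 ultimately show ?thesis unfolding eq by simp
qed

lemma pair_covariance:
 assumes ab: "0 <= a" "a <= b" and cd: "0 <= c" "c <= d"
  and xi: "\<xi> \<in> borel_measurable (F a)" "bounded (\<xi> ` space M)"
  and eta: "\<eta> \<in> borel_measurable (F c)" "bounded (\<eta> ` space M)"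
 shows "\<exists>v. has_bochner_integral M (%w. (\<xi> w \<bullet> (B b w - B a w)) * (\<eta> w \<bullet> (B d w - B c w))) v \<and>
  has_bochner_integral M (%w. overlap a b c d * (\<xi> w \<bullet> \<eta> w)) v"
proof (intro exI conjI)
 let ?o = "overlap a b c d"
 have comp: "(%w. \<zeta> w $ k) \<in> borel_measurable (F u)" "bounded ((%w. \<zeta> w $ k) ` space M)"
  if "\<zeta> \<in> borel_measurable (F u)" "bounded (\<zeta> ` space M)" for \<zeta> :: "'a => real^'e" and u k
 proof -
  show "(%w. \<zeta> w $ k) \<in> borel_measurable (F u)" using that(1) by measurable
  show "bounded ((%w. \<zeta> w $ k) ` space M)"
   using bounded_component_cart[OF that(2), of k] by (simp add: image_image)
 qed
 have int: "integrable M (%w. \<xi> w $ k * \<eta> w $ k)" for k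
 proof -
  have m: "(%w. \<xi> w $ k) \<in> borel_measurable M" "(%w. \<eta> w $ k) \<in> borel_measurable M"
   using comp(1)[OF xi] comp(1)[OF eta] meas_F_M ab cd by blast+
  have "integrable M (%w. \<eta> w $ k * 1)" by (rule integrable_bounded_times[OF m(2) comp(2)[OF eta]]) simp
  then show ?thesis using integrable_bounded_times[OF m(1) comp(2)[OF xi]] by simp
 qed
 have "has_bochner_integral M (%w. \<Sum>k\<in>UNIV. \<Sum>l\<in>UNIV. (\<xi> w $ k * dB a b k w) * (\<eta> w $ l * dB c d l w))
  (\<Sum>k\<in>UNIV. \<Sum>l\<in>UNIV. (if k = l then ?o else 0) * expectation (%w. \<xi> w $ k * \<eta> w $ l))"
  by (intro has_bochner_integral_sum increment_covariance[OF ab cd comp[OF xi] comp[OF eta]])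
 moreover have "(\<Sum>k\<in>UNIV. \<Sum>l\<in>UNIV. (if k = l then ?o else 0) * expectation (%w. \<xi> w $ k * \<eta> w $ l))
  = ?o * (\<Sum>k\<in>UNIV. expectation (%w. \<xi> w $ k * \<eta> w $ k))"
  by (simp add: if_distrib[of "%y. y * _"] sum_distrib_left cong: if_cong)
 ultimately show "has_bochner_integral M (%w. (\<xi> w \<bullet> (B b w - B a w)) * (\<eta> w \<bullet> (B d w - B c w)))
   (?o * (\<Sum>k\<in>UNIV. expectation (%w. \<xi> w $ k * \<eta> w $ k)))"
  by (simp add: inner_vec_def sum_product dB_def)
 have "has_bochner_integral M (%w. \<Sum>k\<in>UNIV. \<xi> w $ k * \<eta> w $ k) (\<Sum>k\<in>UNIV. expectation (%w. \<xi> w $ k * \<eta> w $ k))"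
  by (intro has_bochner_integral_sum has_bochner_integral_integrable int)
 then show "has_bochner_integral M (%w. ?o * (\<xi> w \<bullet> \<eta> w)) (?o * (\<Sum>k\<in>UNIV. expectation (%w. \<xi> w $ k * \<eta> w $ k)))"
  unfolding inner_vec_def inner_real_def by (rule has_bochner_integral_mult_right)
qed

lemma step_covariance_single:
 assumes p: "valid [(a, b, \<xi>)]" and l: "valid l"
 shows "(\<forall>w. integrable lborel (%s. (indicator {a<..b} s *\<^sub>R \<xi> w) \<bullet> sval l w s)) \<and>
  (\<exists>v. has_bochner_integral M (%w. (\<xi> w \<bullet> (B b w - B a w)) * sint l w) v \<and>
  has_bochner_integral M (%w. LINT s|lborel. (indicator {a<..b} s *\<^sub>R \<xi> w) \<bullet> sval l w s) v)"
 using l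
proof (induction l)
 case (Cons q l)
 obtain c d \<eta> where q: "q = (c, d, \<eta>)" by (cases q)
 have vl: "valid l" using Cons.prems q by simp
 from Cons.IH[OF vl] obtain v where int: "!!w. integrable lborel (%s. (indicator {a<..b} s *\<^sub>R \<xi> w) \<bullet> sval l w s)"
  and v: "has_bochner_integral M (%w. (\<xi> w \<bullet> (B b w - B a w)) * sint l w) v"
   "has_bochner_integral M (%w. LINT s|lborel. (indicator {a<..b} s *\<^sub>R \<xi> w) \<bullet> sval l w s) v" by blast
 obtain u where u: "has_bochner_integral M (%w. (\<xi> w \<bullet> (B b w - B a w)) * (\<eta> w \<bullet> (B d w - B c w))) u"
  "has_bochner_integral M (%w. overlap a b c d * (\<xi> w \<bullet> \<eta> w)) u"
  using pair_covariance[of a b c d \<xi> \<eta>] p Cons.prems q by auto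
 have oi: "integrable lborel (%s. (indicator {a<..b} s *\<^sub>R \<xi> w) \<bullet> (indicator {c<..d} s *\<^sub>R \<eta> w))"
  "(LINT s|lborel. (indicator {a<..b} s *\<^sub>R \<xi> w) \<bullet> (indicator {c<..d} s *\<^sub>R \<eta> w)) = overlap a b c d * (\<xi> w \<bullet> \<eta> w)" for w
  using overlap_integral[of a b "\<xi> w" c d "\<eta> w"] by (auto simp: has_bochner_integral_iff)
 have i2: "integrable lborel (%s. (indicator {a<..b} s *\<^sub>R \<xi> w) \<bullet> sval (q # l) w s)" for w
  unfolding q sval_simps(2) inner_add_right using oi(1) int by (rule Bochner_Integration.integrable_add)
 have "has_bochner_integral M (%w. (\<xi> w \<bullet> (B b w - B a w)) * sint (q # l) w) (u + v)"
  unfolding q sint_simps(2) distrib_left by (rule has_bochner_integral_add[OF u(1) v(1)])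
 moreover have "has_bochner_integral M (%w. LINT s|lborel. (indicator {a<..b} s *\<^sub>R \<xi> w) \<bullet> sval (q # l) w s) (u + v)"
  unfolding q sval_simps(2) inner_add_right Bochner_Integration.integral_add[OF oi(1) int] oi(2)
  by (rule has_bochner_integral_add[OF u(2) v(2)])
 ultimately show ?case using i2 by blast
qed (auto intro!: exI[of _ 0])

text \<open>The common value is left existential: what matters is the equality of the two
  expectations, and in this form it is additive, so induction over either list just adds
  witnesses.\<close>

lemma step_covariance:
 assumes l: "valid l" and l': "valid l'"
 shows "(\<forall>w. integrable lborel (%s. sval l w s \<bullet> sval l' w s)) \<and>
  (\<exists>v. has_bochner_integral M (%w. sint l w * sint l' w) v \<and>
  has_bochner_integral M (%w. LINT s|lborel. sval l w s \<bullet> sval l' w s) v)"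
 using l
proof (induction l)
 case (Cons q l)
 obtain a b \<xi> where q: "q = (a, b, \<xi>)" by (cases q)
 have vl: "valid l" and vq: "valid [(a, b, \<xi>)]" using Cons.prems q by auto
 from Cons.IH[OF vl] obtain v where int: "!!w. integrable lborel (%s. sval l w s \<bullet> sval l' w s)"
  and v: "has_bochner_integral M (%w. sint l w * sint l' w) v"
   "has_bochner_integral M (%w. LINT s|lborel. sval l w s \<bullet> sval l' w s) v" by blast
 from step_covariance_single[OF vq l'] obtain u where
  oi: "!!w. integrable lborel (%s. (indicator {a<..b} s *\<^sub>R \<xi> w) \<bullet> sval l' w s)"
  and u: "has_bochner_integral M (%w. (\<xi> w \<bullet> (B b w - B a w)) * sint l' w) u"
  "has_bochner_integral M (%w. LINT s|lborel. (indicator {a<..b} s *\<^sub>R \<xi> w) \<bullet> sval l' w s) u" by blast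
 have i2: "integrable lborel (%s. sval (q # l) w s \<bullet> sval l' w s)" for w
  unfolding q sval_simps(2) inner_add_left using oi(1) int by (rule Bochner_Integration.integrable_add)
 have "has_bochner_integral M (%w. sint (q # l) w * sint l' w) (u + v)"
  unfolding q sint_simps(2) distrib_right by (rule has_bochner_integral_add[OF u(1) v(1)])
 moreover have "has_bochner_integral M (%w. LINT s|lborel. sval (q # l) w s \<bullet> sval l' w s) (u + v)"
  unfolding q sval_simps(2) inner_add_left Bochner_Integration.integral_add[OF oi(1) int]
  by (rule has_bochner_integral_add[OF u(2) v(2)])
 ultimately show ?case using i2 by blast
qed (auto intro!: exI[of _ 0])

lemma step_isometry:
 assumes "valid l"
 shows "(\<integral>\<^sup>+ w. ennreal ((norm (sint l w))\<^sup>2) \<partial>M) = (\<integral>\<^sup>+ w. (\<integral>\<^sup>+ s. ennreal ((norm (sval l w s))\<^sup>2) \<partial>lborel) \<partial>M)"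
proof -
 from step_covariance[OF assms assms] obtain v where
  int: "!!w. integrable lborel (%s. sval l w s \<bullet> sval l w s)"
  and v: "has_bochner_integral M (%w. sint l w * sint l w) v"
  "has_bochner_integral M (%w. LINT s|lborel. sval l w s \<bullet> sval l w s) v" by blast
 have "(\<integral>\<^sup>+ w. ennreal ((norm (sint l w))\<^sup>2) \<partial>M) = ennreal v"
  using v(1) by (simp add: power2_eq_square has_bochner_integral_iff nn_integral_eq_integral)
 moreover have "(\<integral>\<^sup>+ s. ennreal ((norm (sval l w s))\<^sup>2) \<partial>lborel) = ennreal (LINT s|lborel. sval l w s \<bullet> sval l w s)" for w
  using nn_integral_eq_integral[OF int[of w]] by (simp add: power2_norm_eq_inner)
 moreover have "(\<integral>\<^sup>+ w. ennreal (LINT s|lborel. sval l w s \<bullet> sval l w s) \<partial>M) = ennreal v"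
  using v(2) by (auto simp: has_bochner_integral_iff nn_integral_eq_integral intro!: integral_nonneg_AE)
 ultimately show ?thesis by simp
qed

end

text \<open>The squared \<open>L2\<close> norm with values in \<open>ennreal\<close>, so that
  triangle inequalities and limits come without proofs of square integrability. Being squared, it
  obeys the triangle inequality with factor \<open>2\<close>.\<close>

definition N2 :: "'b measure => ('b => 'c::real_normed_vector) => ennreal" where
 "N2 \<mu> f = (\<integral>\<^sup>+ x. ennreal ((norm (f x))\<^sup>2) \<partial>\<mu>)"

lemma N2_add:
 fixes f g :: "'b => 'c::{real_normed_vector, second_countable_topology}"
 assumes [measurable]: "f \<in> borel_measurable \<mu>" "g \<in> borel_measurable \<mu>"
 shows "N2 \<mu> (%x. f x + g x) <= 2 * N2 \<mu> f + 2 * N2 \<mu> g"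
proof -
 have "N2 \<mu> (%x. f x + g x) <= (\<integral>\<^sup>+ x. 2 * ennreal ((norm (f x))\<^sup>2) + 2 * ennreal ((norm (g x))\<^sup>2) \<partial>\<mu>)"
  unfolding N2_def
 proof (rule nn_integral_mono)
  fix x
  have "(norm (f x + g x))\<^sup>2 <= (norm (f x) + norm (g x))\<^sup>2" by (intro power_mono norm_triangle_ineq) simp
  also have "... <= 2 * (norm (f x))\<^sup>2 + 2 * (norm (g x))\<^sup>2"
   using sum_squares_bound[of "norm (f x)" "norm (g x)"] by (simp add: power2_sum)
  finally have "ennreal ((norm (f x + g x))\<^sup>2) <= ennreal (2 * (norm (f x))\<^sup>2 + 2 * (norm (g x))\<^sup>2)" by (rule ennreal_leI)
  then show "ennreal ((norm (f x + g x))\<^sup>2) <= 2 * ennreal ((norm (f x))\<^sup>2) + 2 * ennreal ((norm (g x))\<^sup>2)"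
   by (simp add: ennreal_mult)
 qed
 also have "... = 2 * N2 \<mu> f + 2 * N2 \<mu> g"
  unfolding N2_def by (subst nn_integral_add) (auto simp: nn_integral_cmult)
 finally show ?thesis .
qed

lemma N2_scale: "f \<in> borel_measurable \<mu> ==> N2 \<mu> (%x. c *\<^sub>R f x) = ennreal (c\<^sup>2) * N2 \<mu> f"
 unfolding N2_def by (simp add: power_mult_distrib ennreal_mult nn_integral_cmult)

lemma N2_uminus: "N2 \<mu> (%x. - f x) = N2 \<mu> f"
 by (simp add: N2_def)

lemma N2_commute: "N2 \<mu> (%x. f x - g x) = N2 \<mu> (%x. g x - f x)"
 by (simp add: N2_def norm_minus_commute)

lemma N2_diff:
 fixes f g :: "'b => 'c::{real_normed_vector, second_countable_topology}"
 assumes [measurable]: "f \<in> borel_measurable \<mu>" "g \<in> borel_measurable \<mu>"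
 shows "N2 \<mu> (%x. f x - g x) <= 2 * N2 \<mu> f + 2 * N2 \<mu> g"
 using N2_add[of f \<mu> "%x. - g x"] N2_uminus[of \<mu> g] by simp

lemma N2_triangle:
 fixes f g h :: "'b => 'c::{real_normed_vector, second_countable_topology}"
 assumes [measurable]: "f \<in> borel_measurable \<mu>" "g \<in> borel_measurable \<mu>" "h \<in> borel_measurable \<mu>"
 shows "N2 \<mu> (%x. f x - h x) <= 2 * N2 \<mu> (%x. f x - g x) + 2 * N2 \<mu> (%x. g x - h x)"
 using N2_add[of "%x. f x - g x" \<mu> "%x. g x - h x"] by simp

lemma N2_mono: "(!!x. x \<in> space \<mu> ==> norm (f x) <= norm (g x)) ==> N2 \<mu> f <= N2 \<mu> g"
 unfolding N2_def by (intro nn_integral_mono ennreal_leI power_mono) auto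

lemma N2_zero [simp]: "N2 \<mu> (%x. 0) = 0"
 by (simp add: N2_def)

lemma N2_AE_cong: "AE x in \<mu>. f x = g x ==> N2 \<mu> f = N2 \<mu> g"
 unfolding N2_def by (rule nn_integral_cong_AE) auto

text \<open>Turns the factor \<open>2\<close> of \<open>N2_add\<close> and
  \<open>N2_triangle\<close> into an epsilon argument with two errors below a quarter.\<close>

lemma ennreal_quarters:
 assumes "x <= 2 * y + 2 * z" "y < ennreal (e / 4)" "z < ennreal (e / 4)"
 shows "x < ennreal e"
proof -
 obtain y' where y': "y = ennreal y'" "y' >= 0" using assms(2) by (cases y) auto
 obtain z' where z': "z = ennreal z'" "z' >= 0" using assms(3) by (cases z) auto
 have lt: "y' < e / 4" "z' < e / 4" using assms(2,3) y' z' by (auto simp: ennreal_less_iff)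
 have "x <= ennreal (2 * y' + 2 * z')" using assms(1) y' z' by (simp add: ennreal_mult)
 also have "... < ennreal e" using lt y' z' by (subst ennreal_less_iff) auto
 finally show ?thesis .
qed

section \<open>Wiener integrals as mean-square limits of step integrals\<close>

context brownian begin

text \<open>The approximating steps may be random although the integrand is deterministic, because
  the Ito integral is defined through arbitrary simple processes. The domain of integration is put
  into \<open>h\<close> by an indicator. As a relation this is closed under sums, multiples and
  limits, and \<open>wi_unique\<close> supplies uniqueness up to null sets.\<close>

definition wi :: "(real => real^'e) => ('a => real) => bool" where
 "wi h I \<longleftrightarrow> h \<in> borel_measurable borel \<and> I \<in> borel_measurable M \<and>
  (\<forall>e>0. \<exists>l. valid l \<and> N2 (M \<Otimes>\<^sub>M lborel) (%p. h (snd p) - sval l (fst p) (snd p)) < ennreal e \<and>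
    N2 M (%w. I w - sint l w) < ennreal e)"

lemma wi_measurable: "wi h I ==> h \<in> borel_measurable borel" "wi h I ==> I \<in> borel_measurable M"
 by (auto simp: wi_def)

lemma sval_measurable': "valid l ==> (%p. sval l (fst p) (snd p)) \<in> borel_measurable (M \<Otimes>\<^sub>M lborel)"
 using sval_measurable by (simp add: case_prod_beta')

lemma N2_pair:
 fixes f :: "'a \<times> real => 'c::{real_normed_vector, second_countable_topology}"
 assumes [measurable]: "f \<in> borel_measurable (M \<Otimes>\<^sub>M lborel)"
 shows "N2 (M \<Otimes>\<^sub>M lborel) f = (\<integral>\<^sup>+ w. (\<integral>\<^sup>+ s. ennreal ((norm (f (w, s)))\<^sup>2) \<partial>lborel) \<partial>M)"
 unfolding N2_def by (rule lborel.nn_integral_fst[symmetric]) measurable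

lemma N2_det:
 fixes h :: "real => 'c::{real_normed_vector, second_countable_topology}"
 assumes [measurable]: "h \<in> borel_measurable borel"
 shows "N2 (M \<Otimes>\<^sub>M lborel) (%p. h (snd p)) = N2 lborel h"
 by (subst N2_pair) (auto simp: N2_def emeasure_space_1)

lemma N2_sint: "valid l ==> N2 M (sint l) = N2 (M \<Otimes>\<^sub>M lborel) (%p. sval l (fst p) (snd p))"
 using step_isometry[of l] by (subst N2_pair) (auto simp: sval_measurable' N2_def)

text \<open>The factor \<open>4\<close> comes from two uses of the squared triangle inequality
  around the step isometry; a bound with some constant is all that the passages to the limit ask
  for.\<close>

lemma wi_bound:
 assumes wi: "wi h I" shows "N2 M I <= 4 * N2 lborel h"
proof (rule ennreal_le_epsilon)
 note [measurable] = wi_measurable[OF wi]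
 fix e :: real assume e: "e > 0"
 \<comment> \<open>The share is \<open>e / 6\<close> because the two error terms enter with total
   factor \<open>2 + 4\<close>.\<close>
 obtain l where l: "valid l" and 1: "N2 (M \<Otimes>\<^sub>M lborel) (%p. h (snd p) - sval l (fst p) (snd p)) < ennreal (e / 6)"
  and 2: "N2 M (%w. I w - sint l w) < ennreal (e / 6)"
 proof -
  have "e / 6 > 0" using e by simp
  then show ?thesis using that wi unfolding wi_def by blast
 qed
 note [measurable] = sint_measurable[OF l] sval_measurable'[OF l]
 have "N2 M I <= 2 * N2 M (%w. I w - sint l w) + 2 * N2 M (sint l)"
  using N2_add[of "%w. I w - sint l w" M "sint l"] by simp
 also have "N2 M (sint l) <= 2 * N2 (M \<Otimes>\<^sub>M lborel) (%p. h (snd p)) + 2 * N2 (M \<Otimes>\<^sub>M lborel) (%p. h (snd p) - sval l (fst p) (snd p))"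
  unfolding N2_sint[OF l] using N2_diff[of "%p. h (snd p)" "M \<Otimes>\<^sub>M lborel" "%p. h (snd p) - sval l (fst p) (snd p)"] by simp
 also have "N2 (M \<Otimes>\<^sub>M lborel) (%p. h (snd p)) = N2 lborel h" by (rule N2_det) simp
 finally have "N2 M I <= 2 * N2 M (%w. I w - sint l w) + 2 * (2 * N2 lborel h + 2 * N2 (M \<Otimes>\<^sub>M lborel) (%p. h (snd p) - sval l (fst p) (snd p)))"
  by (simp add: add_left_mono mult_left_mono)
 also have "... <= 2 * ennreal (e / 6) + 2 * (2 * N2 lborel h + 2 * ennreal (e / 6))"
  by (intro add_mono mult_left_mono order_refl less_imp_le[OF 1] less_imp_le[OF 2]) auto
 also have "... = 4 * N2 lborel h + (2 * ennreal (e / 6) + 4 * ennreal (e / 6))"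
  by (simp add: distrib_left algebra_simps)
 also have "2 * ennreal (e / 6) + 4 * ennreal (e / 6) = ennreal e"
 proof -
  have "2 * ennreal (e / 6) + 4 * ennreal (e / 6) = ennreal (2 * (e / 6)) + ennreal (4 * (e / 6))"
   using e by (simp only: ennreal_mult ennreal_numeral zero_le_numeral less_imp_le divide_nonneg_pos zero_less_numeral)
  also have "... = ennreal (2 * (e / 6) + 4 * (e / 6))" using e by (intro ennreal_plus[symmetric]) auto
  finally show ?thesis by simp
 qed
 finally show "N2 M I <= 4 * N2 lborel h + ennreal e" .
qed

lemma wi_add:
 assumes a: "wi h I" and b: "wi h' I'" shows "wi (%s. h s + h' s) (%w. I w + I' w)"
 unfolding wi_def
proof (intro conjI allI impI)
 note [measurable] = wi_measurable[OF a] wi_measurable[OF b]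
 show "(%s. h s + h' s) \<in> borel_measurable borel" "(%w. I w + I' w) \<in> borel_measurable M" by measurable
 fix e :: real assume e: "e > 0"
 then have e4: "e / 4 > 0" by simp
 obtain l where l: "valid l" and 1: "N2 (M \<Otimes>\<^sub>M lborel) (%p. h (snd p) - sval l (fst p) (snd p)) < ennreal (e / 4)"
  and 2: "N2 M (%w. I w - sint l w) < ennreal (e / 4)"
  using a e4 unfolding wi_def by blast
 obtain l' where l': "valid l'" and 3: "N2 (M \<Otimes>\<^sub>M lborel) (%p. h' (snd p) - sval l' (fst p) (snd p)) < ennreal (e / 4)"
  and 4: "N2 M (%w. I' w - sint l' w) < ennreal (e / 4)"
  using b e4 unfolding wi_def by blast
 note [measurable] = sint_measurable[OF l] sval_measurable'[OF l] sint_measurable[OF l'] sval_measurable'[OF l']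
 have "N2 (M \<Otimes>\<^sub>M lborel) (%p. (h (snd p) - sval l (fst p) (snd p)) + (h' (snd p) - sval l' (fst p) (snd p))) < ennreal e"
  by (rule ennreal_quarters[OF N2_add 1 3]) measurable
 moreover have "N2 M (%w. (I w - sint l w) + (I' w - sint l' w)) < ennreal e"
  by (rule ennreal_quarters[OF N2_add 2 4]) measurable
 ultimately show "\<exists>l. valid l \<and> N2 (M \<Otimes>\<^sub>M lborel) (%p. (h (snd p) + h' (snd p)) - sval l (fst p) (snd p)) < ennreal e \<and>
   N2 M (%w. (I w + I' w) - sint l w) < ennreal e"
  using l l' by (intro exI[of _ "l @ l'"]) (simp add: add_diff_add)
qed

lemma wi_scale:
 assumes a: "wi h I" shows "wi (%s. c *\<^sub>R h s) (%w. c * I w)"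
 unfolding wi_def
proof (intro conjI allI impI)
 note [measurable] = wi_measurable[OF a]
 show "(%s. c *\<^sub>R h s) \<in> borel_measurable borel" "(%w. c * I w) \<in> borel_measurable M" by measurable
 fix e :: real assume e: "e > 0"
 \<comment> \<open>Dividing by \<open>c\<^sup>2 + 1\<close> rather than by \<open>c\<^sup>2\<close>
   covers \<open>c = 0\<close>.\<close>
 have c1: "c\<^sup>2 + 1 > 0" by (simp add: add_nonneg_pos)
 then have e4: "e / (c\<^sup>2 + 1) > 0" using e by simp
 obtain l where l: "valid l" and 1: "N2 (M \<Otimes>\<^sub>M lborel) (%p. h (snd p) - sval l (fst p) (snd p)) < ennreal (e / (c\<^sup>2 + 1))"
  and 2: "N2 M (%w. I w - sint l w) < ennreal (e / (c\<^sup>2 + 1))"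
  using a e4 unfolding wi_def by blast
 note [measurable] = sint_measurable[OF l] sval_measurable'[OF l]
 define l' where "l' = map (%(a, b, \<xi>). (a, b, %w. c *\<^sub>R \<xi> w)) l"
 have s1: "sint l' w = c * sint l w" for w
  unfolding l'_def sint_def by (induction l) (auto simp: algebra_simps)
 have s2: "sval l' w s = c *\<^sub>R sval l w s" for w s
  unfolding l'_def sval_def by (induction l) (auto simp: algebra_simps)
 have bs: "bounded ((%w. c *\<^sub>R \<xi> w) ` space M)" if "bounded (\<xi> ` space M)" for \<xi> :: "'a => real^'e"
  using bounded_scaling[OF that, of c] by (simp add: image_image)
 have l': "valid l'" using l unfolding l'_def valid_def by (auto intro!: bs borel_measurable_scaleR)
 have small: "ennreal (c\<^sup>2) * x < ennreal e" if "x < ennreal (e / (c\<^sup>2 + 1))" for x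
 proof -
  have "x < top" by (rule less_trans[OF that ennreal_less_top])
  then obtain x' where x': "x = ennreal x'" "x' >= 0" by (cases x) auto
  have "x' < e / (c\<^sup>2 + 1)" using that x' by (simp add: ennreal_less_iff)
  then have "x' * (c\<^sup>2 + 1) < e" using c1 by (simp add: pos_less_divide_eq)
  then have "c\<^sup>2 * x' < e" using x' by (simp add: distrib_left mult.commute)
  then show ?thesis using x' by (simp add: ennreal_mult[symmetric] ennreal_less_iff)
 qed
 have "N2 (M \<Otimes>\<^sub>M lborel) (%p. c *\<^sub>R h (snd p) - sval l' (fst p) (snd p)) < ennreal e"
  unfolding s2 scaleR_diff_right[symmetric] by (subst N2_scale) (auto intro: small 1)
 moreover have "N2 M (%w. c * I w - sint l' w) < ennreal e"
 proof -
  have "N2 M (%w. c *\<^sub>R (I w - sint l w)) < ennreal e" by (subst N2_scale) (auto intro: small 2)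
  then show ?thesis by (simp add: s1 right_diff_distrib)
 qed
 ultimately show "\<exists>l. valid l \<and> N2 (M \<Otimes>\<^sub>M lborel) (%p. c *\<^sub>R h (snd p) - sval l (fst p) (snd p)) < ennreal e \<and>
   N2 M (%w. c * I w - sint l w) < ennreal e"
  using l' by blast
qed

lemma wi_diff: "wi h I ==> wi h' I' ==> wi (%s. h s - h' s) (%w. I w - I' w)"
 using wi_add[of h I "%s. -1 *\<^sub>R h' s" "%w. -1 * I' w"] wi_scale[of h' I' "-1"] by simp

lemma wi_zero: "wi (%_. 0) (%_. 0)"
 unfolding wi_def by (auto intro!: exI[of _ "[]"])

lemma wi_sum: "(!!i. i \<in> A ==> wi (h i) (I i)) ==> wi (%s. \<Sum>i\<in>A. h i s) (%w. \<Sum>i\<in>A. I i w)"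
proof (induction A rule: infinite_finite_induct)
 case (insert x A)
 then show ?case using wi_add[of "h x" "I x" "%s. \<Sum>i\<in>A. h i s" "%w. \<Sum>i\<in>A. I i w"] by simp
qed (simp_all add: wi_zero)

lemma wi_dist: "wi h I ==> wi h' I' ==> N2 M (%w. I w - I' w) <= 4 * N2 lborel (%s. h s - h' s)"
 using wi_bound[OF wi_diff] .

lemma N2_eq_0_iff: "f \<in> borel_measurable \<mu> ==> N2 \<mu> f = 0 \<longleftrightarrow> (AE x in \<mu>. f x = 0)"
 unfolding N2_def by (subst nn_integral_0_iff_AE) auto

lemma wi_unique:
 assumes a: "wi h I" and b: "wi h' I'" and eq: "AE s in lborel. h s = h' s"
 shows "AE w in M. I w = I' w"
proof -
 note [measurable] = wi_measurable[OF a] wi_measurable[OF b]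
 have "N2 lborel (%s. h s - h' s) = N2 lborel (%s::real. 0 :: real^'e)"
  by (rule N2_AE_cong) (use eq in auto)
 then have "N2 M (%w. I w - I' w) = 0" using wi_dist[OF a b] by simp
 then show ?thesis by (subst (asm) N2_eq_0_iff) auto
qed

lemma N2_fatou:
 fixes X :: "nat => 'a => real"
 assumes m: "!!n. X n \<in> borel_measurable M" and lim: "AE w in M. (%n. X n w) \<longlonglongrightarrow> Y w"
  and b: "\<forall>\<^sub>F n in sequentially. N2 M (X n) <= C"
 shows "N2 M Y <= C"
proof -
 have "N2 M Y = (\<integral>\<^sup>+ w. liminf (%n. ennreal ((norm (X n w))\<^sup>2)) \<partial>M)"
  unfolding N2_def
 proof (rule nn_integral_cong_AE, use lim in eventually_elim)
  case (elim w)
  have "(%n. ennreal ((norm (X n w))\<^sup>2)) \<longlonglongrightarrow> ennreal ((norm (Y w))\<^sup>2)"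
   by (intro tendsto_ennrealI tendsto_power tendsto_norm elim)
  then show ?case by (rule lim_imp_Liminf[OF sequentially_bot, symmetric])
 qed
 also have "... <= liminf (%n. N2 M (X n))"
  unfolding N2_def by (rule nn_integral_liminf) (use m in measurable)
 also have "... <= limsup (%n. N2 M (X n))" by (rule Liminf_le_Limsup) simp
 also have "... <= C" by (rule Limsup_bounded[OF b])
 finally show ?thesis .
qed

text \<open>The integrals are Cauchy in mean square by \<open>wi_dist\<close>, and Fatou's lemma
  transfers this to the almost sure limit \<open>J\<close>; thus \<open>J\<close> is approximated by
  the steps of a late \<open>I k\<close>.\<close>

lemma wi_limit:
 assumes wi: "!!k. wi (h k) (I k)" and h: "(%k. N2 lborel (%s. h k s - g s)) \<longlonglongrightarrow> 0" and g: "g \<in> borel_measurable borel"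
  and J: "J \<in> borel_measurable M" and lim: "AE w in M. (%k. I k w) \<longlonglongrightarrow> J w"
 shows "wi g J"
 unfolding wi_def
proof (intro conjI allI impI g J)
 note [measurable] = wi_measurable[OF wi] g J
 fix e :: real assume e: "e > 0"
 have hk: "\<forall>\<^sub>F k in sequentially. N2 lborel (%s. h k s - g s) < ennreal d" if "d > 0" for d :: real
  using order_tendstoD(2)[OF h, of "ennreal d"] that by simp
 \<comment> \<open>Bookkeeping for one quarter: two such errors give \<open>e / 32\<close> for the
   difference of two integrands, the factor \<open>4\<close> of \<open>wi_dist\<close> makes it
   \<open>e / 8\<close>, and this leaves a strict inequality with \<open>e / 4\<close> after the
   limit.\<close>
 obtain k where k: "N2 lborel (%s. h k s - g s) < ennreal (e / 4 / 4 / 8)"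
  using hk[of "e / 4 / 4 / 8"] e unfolding eventually_sequentially by auto
 have k': "N2 lborel (%s. h k s - g s) < ennreal (e / 4)"
  using k e by (elim order.strict_trans2) (auto intro!: ennreal_leI)
 have cauchy: "\<forall>\<^sub>F m in sequentially. N2 M (%w. I k w - I m w) <= ennreal (e / 4 / 2)"
 proof -
  have "\<forall>\<^sub>F m in sequentially. N2 lborel (%s. h m s - g s) < ennreal (e / 4 / 4 / 8)"
   by (rule hk) (use e in simp)
  then show ?thesis
 proof eventually_elim
  case (elim m)
  have "N2 lborel (%s. h k s - h m s) < ennreal (e / 4 / 8)"
   by (rule ennreal_quarters[OF N2_triangle[where g = g] , of _ _ _ "e / 4 / 8"])
    (use k elim in \<open>auto simp: N2_commute[of _ g] mult.commute\<close>)
  then have "4 * N2 lborel (%s. h k s - h m s) <= 4 * ennreal (e / 4 / 8)" by (intro mult_left_mono) auto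
  also have "... = ennreal (4 * (e / 4 / 8))" using e by (subst ennreal_mult) auto
  finally show ?case using wi_dist[OF wi wi, of k m] by simp
 qed
 qed
 have "N2 M (%w. I k w - J w) <= ennreal (e / 4 / 2)"
 proof (rule N2_fatou[OF _ _ cauchy])
  show "AE w in M. (%n. I k w - I n w) \<longlonglongrightarrow> I k w - J w"
   using lim by eventually_elim (intro tendsto_intros)
 qed measurable
 also have "... < ennreal (e / 4)" using e by (subst ennreal_less_iff) auto
 finally have IJ: "N2 M (%w. I k w - J w) < ennreal (e / 4)" .
 obtain l where l: "valid l" and 1: "N2 (M \<Otimes>\<^sub>M lborel) (%p. h k (snd p) - sval l (fst p) (snd p)) < ennreal (e / 4)"
  and 2: "N2 M (%w. I k w - sint l w) < ennreal (e / 4)"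
 proof -
  have "e / 4 > 0" using e by simp
  then show ?thesis using that wi[of k] unfolding wi_def by blast
 qed
 note [measurable] = sint_measurable[OF l] sval_measurable'[OF l]
 have "N2 (M \<Otimes>\<^sub>M lborel) (%p. g (snd p) - h k (snd p)) = N2 lborel (%s. g s - h k s)"
  by (rule N2_det) measurable
 then have 3: "N2 (M \<Otimes>\<^sub>M lborel) (%p. g (snd p) - h k (snd p)) < ennreal (e / 4)" using k' N2_commute[of lborel g "h k"] by simp
 have 4: "N2 M (%w. J w - I k w) < ennreal (e / 4)" using IJ N2_commute[of M J "I k"] by simp
 have "N2 (M \<Otimes>\<^sub>M lborel) (%p. g (snd p) - sval l (fst p) (snd p)) < ennreal e"
  by (rule ennreal_quarters[OF N2_triangle 3 1]) measurable
 moreover have "N2 M (%w. J w - sint l w) < ennreal e"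
  by (rule ennreal_quarters[OF N2_triangle 4 2]) measurable
 ultimately show "\<exists>l. valid l \<and> N2 (M \<Otimes>\<^sub>M lborel) (%p. g (snd p) - sval l (fst p) (snd p)) < ennreal e \<and>
   N2 M (%w. J w - sint l w) < ennreal e" using l by blast
qed

definition grid :: "nat => (nat => real) => (nat => 'a => real^'e) => ('a, 'e) steps" where
 "grid N \<tau> \<xi> = map (%i. (\<tau> i, \<tau> (Suc i), \<xi> i)) [0..<N]"

lemma sint_grid: "sint (grid N \<tau> \<xi>) w = (\<Sum>i<N. \<xi> i w \<bullet> (B (\<tau> (Suc i)) w - B (\<tau> i) w))"
 unfolding sint_def grid_def by (simp add: o_def interv_sum_list_conv_sum_set_nat atLeast0LessThan)

lemma sval_grid: "sval (grid N \<tau> \<xi>) w s = (\<Sum>i<N. indicator {\<tau> i<..\<tau> (Suc i)} s *\<^sub>R \<xi> i w)"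
 unfolding sval_def grid_def by (simp add: o_def interv_sum_list_conv_sum_set_nat atLeast0LessThan)

lemma valid_grid:
 "valid (grid N \<tau> \<xi>) \<longleftrightarrow> (\<forall>i<N. 0 <= \<tau> i \<and> \<tau> i <= \<tau> (Suc i) \<and> \<xi> i \<in> borel_measurable (F (\<tau> i)) \<and> bounded (\<xi> i ` space M))"
 unfolding valid_def grid_def by auto

lemma wi_sint:
 assumes "valid l" "!!w s. sval l w s = h s" "h \<in> borel_measurable borel"
 shows "wi h (sint l)"
 unfolding wi_def using assms by (auto intro!: exI[of _ l] simp: sint_measurable)

text \<open>Component \<open>i\<close> of the integral is the integral of row \<open>i\<close>,
  whose product with an increment is an inner product. The grid of a simple process lies in the
  interval \<open>T\<close>, so the process vanishes outside \<open>T\<close> and restricting by the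
  indicator creates no error.\<close>

lemma has_ito_wi:
 fixes H :: "real => real^'e^'d" and I :: "'a => real^'d"
 assumes T: "is_interval T" "T \<subseteq> {0..}" and ito: "has_ito_integral M F B T (%s _. H s) I"
  and H: "(%s. indicator T s *\<^sub>R H s) \<in> borel_measurable borel"
 shows "wi (%s. indicator T s *\<^sub>R (H s $ i)) (%w. I w $ i)"
proof -
 from ito obtain N \<tau> \<xi> where sp: "!!k. simple_process M F T (N k) (\<tau> k) (\<xi> k)"
  and c1: "(%k. \<integral>\<^sup>+ w. (\<integral>\<^sup>+ s\<in>T. ennreal ((norm (simple_value (N k) (\<tau> k) (\<xi> k) s w - H s))\<^sup>2) \<partial>lborel) \<partial>M) \<longlonglongrightarrow> 0"
  and c2: "(%k. \<integral>\<^sup>+ w. ennreal ((norm (simple_ito B (N k) (\<tau> k) (\<xi> k) w - I w))\<^sup>2) \<partial>M) \<longlonglongrightarrow> 0"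
  and Im: "I \<in> borel_measurable M"
  unfolding has_ito_integral_def by blast
 have nth: "(%v::real^'e^'d. v $ i) \<in> borel_measurable borel"
  by (intro borel_measurable_continuous_onI continuous_intros)
 have hm: "(%s. indicator T s *\<^sub>R (H s $ i)) \<in> borel_measurable borel"
  using measurable_compose[OF H nth] by simp
 define l where "l k = grid (N k) (\<tau> k) (%m w. \<xi> k m w $ i)" for k
 have tau: "\<tau> k m \<in> T" if "m <= N k" for k m using sp[of k] that unfolding simple_process_def by blast
 have valid: "valid (l k)" for k
  unfolding l_def valid_grid
 proof (intro allI impI)
  fix m assume m: "m < N k"
  have "\<tau> k m <= \<tau> k (Suc m)" "\<xi> k m \<in> borel_measurable (F (\<tau> k m))" "bounded (\<xi> k m ` space M)"
   using sp[of k] m unfolding simple_process_def by blast+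
  moreover then have "bounded ((%w. \<xi> k m w $ i) ` space M)"
   using bounded_linear_image[OF _ bounded_linear_vec_nth, of "\<xi> k m ` space M" i] by (simp add: image_image)
  moreover have "(%w. \<xi> k m w $ i) \<in> borel_measurable (F (\<tau> k m))"
   by (rule measurable_compose[OF _ nth]) (use calculation in simp)
  ultimately show "0 <= \<tau> k m \<and> \<tau> k m <= \<tau> k (Suc m) \<and> (%w. \<xi> k m w $ i) \<in> borel_measurable (F (\<tau> k m)) \<and> bounded ((%w. \<xi> k m w $ i) ` space M)"
   using tau[of m k] m T by auto
 qed
 have outside: "indicator {\<tau> k m<..\<tau> k (Suc m)} s = (0::real)" if "m < N k" "s \<notin> T" for k m s
 proof -
  have "{\<tau> k m<..\<tau> k (Suc m)} \<subseteq> T"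
   using T(1) tau[of m k] tau[of "Suc m" k] that unfolding is_interval_1 by fastforce
  then have "s \<notin> {\<tau> k m<..\<tau> k (Suc m)}" using that(2) by blast
  then show ?thesis by simp
 qed
 have sv: "sval (l k) w s = simple_value (N k) (\<tau> k) (\<xi> k) s w $ i" for k w s
  unfolding l_def sval_grid simple_value_def by simp
 have si: "sint (l k) w = simple_ito B (N k) (\<tau> k) (\<xi> k) w $ i" for k w
  unfolding l_def sint_grid simple_ito_def by (simp add: matrix_vector_mult_def inner_vec_def)
 have d1: "N2 (M \<Otimes>\<^sub>M lborel) (%p. indicator T (snd p) *\<^sub>R (H (snd p) $ i) - sval (l k) (fst p) (snd p))
  <= (\<integral>\<^sup>+ w. (\<integral>\<^sup>+ s\<in>T. ennreal ((norm (simple_value (N k) (\<tau> k) (\<xi> k) s w - H s))\<^sup>2) \<partial>lborel) \<partial>M)" for k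
 proof (subst N2_pair)
  note [measurable] = sval_measurable'[OF valid[of k]] hm
  show "(%p. indicator T (snd p) *\<^sub>R (H (snd p) $ i) - sval (l k) (fst p) (snd p)) \<in> borel_measurable (M \<Otimes>\<^sub>M lborel)"
   using measurable_compose[OF measurable_snd, of "%s. indicator T s *\<^sub>R (H s $ i)" lborel borel M] hm by measurable
  show "(\<integral>\<^sup>+ w. (\<integral>\<^sup>+ s. ennreal ((norm (indicator T (snd (w, s)) *\<^sub>R (H (snd (w, s)) $ i) - sval (l k) (fst (w, s)) (snd (w, s))))\<^sup>2) \<partial>lborel) \<partial>M)
   <= (\<integral>\<^sup>+ w. (\<integral>\<^sup>+ s\<in>T. ennreal ((norm (simple_value (N k) (\<tau> k) (\<xi> k) s w - H s))\<^sup>2) \<partial>lborel) \<partial>M)"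
  proof (intro nn_integral_mono)
   fix w s
   show "ennreal ((norm (indicator T (snd (w, s)) *\<^sub>R (H (snd (w, s)) $ i) - sval (l k) (fst (w, s)) (snd (w, s))))\<^sup>2)
    <= ennreal ((norm (simple_value (N k) (\<tau> k) (\<xi> k) s w - H s))\<^sup>2) * indicator T s"
   proof (cases "s \<in> T")
    case True
    have "norm (H s $ i - simple_value (N k) (\<tau> k) (\<xi> k) s w $ i) <= norm (simple_value (N k) (\<tau> k) (\<xi> k) s w - H s)"
     using Finite_Cartesian_Product.norm_nth_le[of "simple_value (N k) (\<tau> k) (\<xi> k) s w - H s" i] by (simp add: norm_minus_commute)
    then show ?thesis using True by (auto simp: sv intro!: ennreal_leI power_mono)
   next
    case False
    have "simple_value (N k) (\<tau> k) (\<xi> k) s w = 0"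
     unfolding simple_value_def by (rule sum.neutral) (use outside False in auto)
    then show ?thesis using False by (simp add: sv)
   qed
  qed
 qed
 have d2: "N2 M (%w. I w $ i - sint (l k) w) <= (\<integral>\<^sup>+ w. ennreal ((norm (simple_ito B (N k) (\<tau> k) (\<xi> k) w - I w))\<^sup>2) \<partial>M)" for k
  unfolding N2_def si
 proof (intro nn_integral_mono ennreal_leI power_mono)
  fix w
  show "norm (I w $ i - simple_ito B (N k) (\<tau> k) (\<xi> k) w $ i) <= norm (simple_ito B (N k) (\<tau> k) (\<xi> k) w - I w)"
   using Finite_Cartesian_Product.norm_nth_le[of "simple_ito B (N k) (\<tau> k) (\<xi> k) w - I w" i] by (simp add: abs_minus_commute)
 qed simp
 show ?thesis unfolding wi_def
 proof (intro conjI allI impI hm)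
  show "(%w. I w $ i) \<in> borel_measurable M" using Im by measurable
  fix e :: real assume "e > 0"
  then have e: "ennreal e > 0" by simp
  from order_tendstoD(2)[OF c1 e] order_tendstoD(2)[OF c2 e]
  have "\<forall>\<^sub>F k in sequentially. valid (l k) \<and> N2 (M \<Otimes>\<^sub>M lborel) (%p. indicator T (snd p) *\<^sub>R (H (snd p) $ i) - sval (l k) (fst p) (snd p)) < ennreal e \<and>
    N2 M (%w. I w $ i - sint (l k) w) < ennreal e"
   by eventually_elim (intro conjI valid le_less_trans[OF d1] le_less_trans[OF d2])
  then show "\<exists>l. valid l \<and> N2 (M \<Otimes>\<^sub>M lborel) (%p. indicator T (snd p) *\<^sub>R (H (snd p) $ i) - sval l (fst p) (snd p)) < ennreal e \<and>
    N2 M (%w. I w $ i - sint l w) < ennreal e"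
   unfolding eventually_sequentially by blast
 qed
qed

end

text \<open>Step approximation on the uniform grid of mesh \<open>v / N\<close>; \<open>\<sigma> = 0\<close> samples at left and
 \<open>\<sigma> = 1\<close> at right end points.\<close>

definition gstep :: "real => real => nat => nat => (real => 'b::real_normed_vector) => real => 'b" where
 "gstep u v \<sigma> N H s = (\<Sum>i<N. indicator {u + (v - u) * real i / real N<..u + (v - u) * real (Suc i) / real N} s *\<^sub>R
   H (u + (v - u) * real (i + \<sigma>) / real N))"

lemma gstep_eq:
 assumes uv: "u < v" and N: "N > 0" and s: "u < s" "s <= v"
 obtains i where "i < N" "gstep u v \<sigma> N H s = H (u + (v - u) * real (i + \<sigma>) / real N)"
  "u + (v - u) * real i / real N < s" "s <= u + (v - u) * real (Suc i) / real N"
proof -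
 let ?\<tau> = "%i. u + (v - u) * real i / real N"
 define x where "x = (s - u) * N / (v - u)"
 have x: "0 < x" "x <= N" using uv s N by (auto simp: x_def divide_simps mult_right_mono)
 \<comment> \<open>The cells are open on the left and closed on the right, hence the
   ceiling.\<close>
 define i where "i = nat (\<lceil>x\<rceil> - 1)"
 have ce: "\<lceil>x\<rceil> >= 1" using x(1) by (simp add: ceiling_less_iff one_le_ceiling)
 have i: "real i < x" "x <= real (Suc i)" using ce unfolding i_def by linarith+
 have iN: "i < N" using i x by linarith
 have tau: "?\<tau> i < s" "s <= ?\<tau> (Suc i)"
 proof -
  have sx: "s = u + (v - u) * x / N" using uv N by (simp add: x_def)
  show "?\<tau> i < s" unfolding sx using i(1) uv N by (simp add: divide_strict_right_mono)
  show "s <= ?\<tau> (Suc i)" unfolding sx using i(2) uv N by (intro add_left_mono divide_right_mono mult_left_mono) auto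
 qed
 have mono: "?\<tau> a <= ?\<tau> b" if "a <= b" for a b
  using that uv by (intro add_left_mono divide_right_mono mult_left_mono) auto
 have ind: "indicator {?\<tau> j<..?\<tau> (Suc j)} s = (if j = i then 1 else 0 :: real)" if "j < N" for j
 proof -
  consider "j = i" | "Suc j <= i" | "Suc i <= j" by linarith
  then show ?thesis
  proof cases
   case 1 then show ?thesis using tau by simp
  next
   case 2 then show ?thesis using mono[OF 2] tau by auto
  next
   case 3 then show ?thesis using mono[OF 3] tau by auto
  qed
 qed
 have "gstep u v \<sigma> N H s = (\<Sum>j<N. (if j = i then 1 else 0 :: real) *\<^sub>R H (?\<tau> (j + \<sigma>)))"
  unfolding gstep_def by (intro sum.cong refl) (simp only: ind lessThan_iff)
 also have "... = H (?\<tau> (i + \<sigma>))" using iN by (simp add: if_distrib[of "%r. r *\<^sub>R _"] cong: if_cong)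
 finally show ?thesis using that iN tau by blast
qed

lemma gstep_outside:
 assumes "u <= v" "s <= u \<or> v < s" shows "gstep u v \<sigma> N H s = 0"
 unfolding gstep_def
proof (rule sum.neutral, intro ballI)
 fix i assume i: "i \<in> {..<N}"
 have "(v - u) * (real (Suc i) / real N) <= (v - u) * 1" using i assms(1) by (intro mult_left_mono) auto
 moreover have "0 <= (v - u) * real i / real N" using assms(1) by simp
 ultimately have "s \<notin> {u + (v - u) * real i / real N<..u + (v - u) * real (Suc i) / real N}"
  using assms(2) by auto
 then show "indicator {u + (v - u) * real i / real N<..u + (v - u) * real (Suc i) / real N} s *\<^sub>R H (u + (v - u) * real (i + \<sigma>) / real N) = 0"
  by simp
qed

lemma gstep_approx:
 fixes H :: "real => 'b::real_normed_vector"
 assumes cont: "continuous_on {u..v} H" and uv: "u <= v" and e: "e > 0" and \<sigma>: "\<sigma> <= 1"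
 shows "\<forall>\<^sub>F N in sequentially. \<forall>s. norm (gstep u v \<sigma> N H s - indicator {u<..v} s *\<^sub>R H s) <= e"
proof (cases "u = v")
 case True
 have "gstep u v \<sigma> N H s - indicator {u<..v} s *\<^sub>R H s = 0" for s N using gstep_outside[of u v s \<sigma> N H] True le_less_linear[of s v] by auto
 then show ?thesis using e by simp
next
 case False
 then have uv': "u < v" using uv by simp
 have "uniformly_continuous_on {u..v} H" by (rule compact_uniformly_continuous[OF cont compact_Icc])
 then obtain d where d: "d > 0" and dH: "!!x y. x \<in> {u..v} ==> y \<in> {u..v} ==> dist y x < d ==> dist (H y) (H x) < e"
  unfolding uniformly_continuous_on_def using e by metis
 have "((%N. (v - u) / real N) \<longlongrightarrow> 0) sequentially" by (rule lim_const_over_n)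
 then have "\<forall>\<^sub>F N in sequentially. (v - u) / real N < d" using d by (rule order_tendstoD(2))
 then show ?thesis using eventually_gt_at_top[of 0]
 proof eventually_elim
  case (elim N)
  show ?case
  proof
   fix s
   show "norm (gstep u v \<sigma> N H s - indicator {u<..v} s *\<^sub>R H s) <= e"
   proof (cases "u < s \<and> s <= v")
    case False
    then show ?thesis using gstep_outside[OF uv, of s \<sigma> N H] e by auto
   next
    case True
    then obtain i where i: "i < N" "gstep u v \<sigma> N H s = H (u + (v - u) * real (i + \<sigma>) / real N)"
     "u + (v - u) * real i / real N < s" "s <= u + (v - u) * real (Suc i) / real N"
     using gstep_eq[OF uv' elim(2)] by blast
    let ?t = "u + (v - u) * real (i + \<sigma>) / real N"
    have step: "u + (v - u) * real (Suc i) / real N = u + (v - u) * real i / real N + (v - u) / real N"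
     by (simp add: distrib_left add_divide_distrib)
    have t01: "?t = u + (v - u) * real i / real N \<or> ?t = u + (v - u) * real (Suc i) / real N"
     using \<sigma> by (cases \<sigma>) auto
    have arith: "\<bar>y - s\<bar> <= r" if "y = p \<or> y = q" "p < s" "s <= q" "q = p + r" for y p q r
     using that by auto
    have "\<bar>?t - s\<bar> <= (v - u) / real N" by (rule arith[OF t01 i(3,4) step])
    then have "dist ?t s < d" using elim(1) by (simp add: dist_real_def)
    moreover have "?t \<in> {u..v}"
    proof -
     have "(v - u) * (real (i + \<sigma>) / real N) <= (v - u) * 1" using i(1) \<sigma> uv by (intro mult_left_mono) auto
     then show ?thesis using uv by auto
    qed
    ultimately have "dist (H ?t) (H s) < e" using dH[of s ?t] True by auto
    then show ?thesis using True i(2) by (simp add: dist_norm)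
   qed
  qed
 qed
qed

text \<open>Abel summation: the sum against increments of \<open>Y\<close> becomes boundary terms
  minus a sum of \<open>Y\<close> at right end points against increments of \<phi>, and the latter
  are integrals of the derivative. So \<open>Y\<close> may be merely continuous, as paths of
  stochastic integrals are.\<close>

lemma riemann_stieltjes_by_parts:
 fixes Y \<phi> \<phi>' :: "real => real"
 assumes t: "0 <= t" and Y: "continuous_on {0..t} Y" and d: "!!x. (\<phi> has_real_derivative \<phi>' x) (at x)"
  and c: "continuous_on UNIV \<phi>'"
 shows "(%N. \<Sum>i<N. \<phi> (t * real i / real N) * (Y (t * real (Suc i) / real N) - Y (t * real i / real N))) \<longlonglongrightarrow>
  \<phi> t * Y t - \<phi> 0 * Y 0 - (LINT s:{0..t}|lborel. \<phi>' s * Y s)"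
proof -
 have Yi: "set_integrable lborel {0..t} (%s. \<phi>' s * Y s)"
  by (intro borel_integrable_atLeastAtMost' continuous_intros Y continuous_on_subset[OF c]) simp
 have pi: "set_integrable lborel {a..b} \<phi>'" for a b
  by (intro borel_integrable_atLeastAtMost' continuous_on_subset[OF c]) simp
 have ioc: "(LINT s|lborel. indicator {a<..b} s * \<phi>' s) = \<phi> b - \<phi> a" "integrable lborel (%s. indicator {a<..b} s * \<phi>' s)" if "a <= b" for a b
 proof -
  have i1: "integrable lborel (%s. \<phi>' s * indicator {a..b} s)" using pi[of a b] by (simp add: set_integrable_def mult.commute)
  have ae: "AE s in lborel. indicator {a<..b} s * \<phi>' s = \<phi>' s * indicator {a..b} s"
   using AE_lborel_singleton[of a] by eventually_elim (auto split: split_indicator)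
  have cm: "\<phi>' \<in> borel_measurable borel" by (rule borel_measurable_continuous_onI[OF c])
  have "(LINT s|lborel. indicator {a<..b} s * \<phi>' s) = (LINT s|lborel. \<phi>' s * indicator {a..b} s)"
   using ae cm by (intro integral_cong_AE) auto
  also have "... = \<phi> b - \<phi> a"
   by (rule integral_FTC_Icc_real[OF that]) (use d c in \<open>auto simp: continuous_on_eq_continuous_at\<close>)
  finally show "(LINT s|lborel. indicator {a<..b} s * \<phi>' s) = \<phi> b - \<phi> a" .
  show "integrable lborel (%s. indicator {a<..b} s * \<phi>' s)"
   using i1 ae cm by (subst integrable_cong_AE[where g = "%s. \<phi>' s * indicator {a..b} s"]) auto
 qed
 define R where "R N = (LINT s|lborel. gstep 0 t 1 N Y s * \<phi>' s)" for N
 have sumeq: "(\<Sum>i<N. \<phi> (t * real i / real N) * (Y (t * real (Suc i) / real N) - Y (t * real i / real N)))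
   = \<phi> t * Y t - \<phi> 0 * Y 0 - R N" and Rint: "integrable lborel (%s. gstep 0 t 1 N Y s * \<phi>' s)" if N: "N > 0" for N
 proof -
  let ?\<tau> = "%i. t * real i / real N"
  have mono: "?\<tau> i <= ?\<tau> (Suc i)" for i using t by (intro divide_right_mono mult_left_mono) auto
  have g: "gstep 0 t 1 N Y s * \<phi>' s = (\<Sum>i<N. (indicator {?\<tau> i<..?\<tau> (Suc i)} s * \<phi>' s) * Y (?\<tau> (Suc i)))" for s
   unfolding gstep_def sum_distrib_right by (intro sum.cong) (auto simp: mult_ac)
  show "integrable lborel (%s. gstep 0 t 1 N Y s * \<phi>' s)"
   unfolding g using ioc(2)[OF mono] by (intro Bochner_Integration.integrable_sum integrable_mult_left)
  have "R N = (\<Sum>i<N. (\<phi> (?\<tau> (Suc i)) - \<phi> (?\<tau> i)) * Y (?\<tau> (Suc i)))"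
   unfolding R_def g using ioc[OF mono]
   by (subst Bochner_Integration.integral_sum) (auto simp only: integral_mult_left_zero integrable_mult_left)
  then have "(\<Sum>i<N. \<phi> (?\<tau> i) * (Y (?\<tau> (Suc i)) - Y (?\<tau> i))) + R N =
   (\<Sum>i<N. \<phi> (?\<tau> (Suc i)) * Y (?\<tau> (Suc i)) - \<phi> (?\<tau> i) * Y (?\<tau> i))"
   by (simp add: sum.distrib[symmetric] algebra_simps)
  also have "... = \<phi> (?\<tau> N) * Y (?\<tau> N) - \<phi> (?\<tau> 0) * Y (?\<tau> 0)"
   by (rule sum_lessThan_telescope)
  also have "... = \<phi> t * Y t - \<phi> 0 * Y 0" using N by simp
  finally show "(\<Sum>i<N. \<phi> (?\<tau> i) * (Y (?\<tau> (Suc i)) - Y (?\<tau> i))) = \<phi> t * Y t - \<phi> 0 * Y 0 - R N" by simp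
 qed
 define K where "K = (LINT s|lborel. indicator {0..t} s * \<bar>\<phi>' s\<bar>)"
 have Ki: "integrable lborel (%s. indicator {0..t} s * \<bar>\<phi>' s\<bar>)"
  using set_integrable_abs[OF pi[of 0 t]] by (simp add: set_integrable_def)
 have K0: "K >= 0" unfolding K_def by (intro integral_nonneg_AE AE_I2) auto
 have Yi': "integrable lborel (%s. (indicator {0<..t} s * Y s) * \<phi>' s)" and Yeq: "(LINT s|lborel. (indicator {0<..t} s * Y s) * \<phi>' s) = (LINT s:{0..t}|lborel. \<phi>' s * Y s)"
 proof -
  have ae: "AE s in lborel. (indicator {0<..t} s * Y s) * \<phi>' s = indicator {0..t} s *\<^sub>R (\<phi>' s * Y s)"
   using AE_lborel_singleton[of 0] by eventually_elim (auto split: split_indicator)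
  have m1: "(%s. indicator {0..t} s *\<^sub>R (\<phi>' s * Y s)) \<in> borel_measurable borel"
   using Yi by (simp add: set_integrable_def borel_measurable_integrable)
  have eq2: "(%s. (indicator {0<..t} s * Y s) * \<phi>' s) = (%s. indicator {0<..t} s * (indicator {0..t} s *\<^sub>R (\<phi>' s * Y s)))"
   by (auto simp: fun_eq_iff split: split_indicator)
  have m2: "(%s. (indicator {0<..t} s * Y s) * \<phi>' s) \<in> borel_measurable borel"
   unfolding eq2 using m1 by (intro borel_measurable_times) auto
  show "integrable lborel (%s. (indicator {0<..t} s * Y s) * \<phi>' s)"
   using ae Yi m1 m2 by (subst integrable_cong_AE[where g = "%s. indicator {0..t} s *\<^sub>R (\<phi>' s * Y s)"]) (auto simp: set_integrable_def)
  show "(LINT s|lborel. (indicator {0<..t} s * Y s) * \<phi>' s) = (LINT s:{0..t}|lborel. \<phi>' s * Y s)"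
   unfolding set_lebesgue_integral_def using ae m1 m2 by (intro integral_cong_AE) auto
 qed
 have "R \<longlonglongrightarrow> (LINT s:{0..t}|lborel. \<phi>' s * Y s)"
 proof (rule LIMSEQ_I)
  fix r :: real assume r: "r > 0"
  define e where "e = r / (2 * (K + 1))"
  have e: "e > 0" using r K0 by (simp add: e_def)
  from gstep_approx[OF Y t e order_refl] eventually_gt_at_top[of 0]
  have "\<forall>\<^sub>F N in sequentially. norm (R N - (LINT s:{0..t}|lborel. \<phi>' s * Y s)) < r"
  proof (eventually_elim, simp)
   fix N assume N: "\<forall>s. \<bar>gstep 0 t (Suc 0) N Y s - indicator {0<..t} s * Y s\<bar> <= e" "0 < N"
   have "R N - (LINT s:{0..t}|lborel. \<phi>' s * Y s) = (LINT s|lborel. gstep 0 t 1 N Y s * \<phi>' s - (indicator {0<..t} s * Y s) * \<phi>' s)"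
    unfolding R_def Yeq[symmetric] by (rule Bochner_Integration.integral_diff[symmetric, OF Rint[OF N(2)] Yi'])
   also have "\<bar>...\<bar> <= (LINT s|lborel. e * (indicator {0..t} s * \<bar>\<phi>' s\<bar>))"
   proof (rule order_trans[OF integral_abs_bound integral_mono])
    show "integrable lborel (%s. \<bar>gstep 0 t 1 N Y s * \<phi>' s - (indicator {0<..t} s * Y s) * \<phi>' s\<bar>)"
     using Rint[OF N(2)] Yi' by auto
    show "integrable lborel (%s. e * (indicator {0..t} s * \<bar>\<phi>' s\<bar>))" using Ki by simp
    fix s
    have "\<bar>gstep 0 t 1 N Y s - indicator {0<..t} s * Y s\<bar> <= e * indicator {0..t} s"
    proof (cases "s \<in> {0..t}")
     case True then show ?thesis using N(1) by simp
    next
     case False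
     then show ?thesis using gstep_outside[OF t, of s 1 N Y] by auto
    qed
    then have "\<bar>gstep 0 t 1 N Y s - indicator {0<..t} s * Y s\<bar> * \<bar>\<phi>' s\<bar> <= e * indicator {0..t} s * \<bar>\<phi>' s\<bar>"
     by (rule mult_right_mono) simp
    then show "\<bar>gstep 0 t 1 N Y s * \<phi>' s - (indicator {0<..t} s * Y s) * \<phi>' s\<bar> <= e * (indicator {0..t} s * \<bar>\<phi>' s\<bar>)"
     by (simp only: abs_mult[symmetric] left_diff_distrib mult.assoc)
   qed
   also have "... = e * K" by (simp add: K_def)
   also have "... < r"
   proof -
    have "e * K <= e * (K + 1)" using e by (intro mult_left_mono) auto
    also have "... = r / 2" using K0 by (simp add: e_def divide_simps)
    finally show ?thesis using r by simp
   qed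
   finally show "\<bar>R N - (LINT s:{0..t}|lborel. \<phi>' s * Y s)\<bar> < r" .
  qed
  then show "\<exists>no. \<forall>n\<ge>no. norm (R n - (LINT s:{0..t}|lborel. \<phi>' s * Y s)) < r"
   unfolding eventually_sequentially .
 qed
 then have "(%N. \<phi> t * Y t - \<phi> 0 * Y 0 - R N) \<longlonglongrightarrow> \<phi> t * Y t - \<phi> 0 * Y 0 - (LINT s:{0..t}|lborel. \<phi>' s * Y s)"
  by (intro tendsto_intros)
 then show ?thesis
  by (rule Lim_transform_eventually) (use eventually_gt_at_top[of 0] in \<open>eventually_elim, simp only: sumeq\<close>)
qed

lemma N2_tendsto_0:
 fixes g :: "nat => real => 'b::{real_normed_vector, second_countable_topology}"
 assumes h: "h \<in> borel_measurable lborel" "N2 lborel h < \<infinity>"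
  and le: "!!e. e > 0 ==> \<forall>\<^sub>F N in sequentially. AE s in lborel. norm (g N s) <= e * norm (h s)"
 shows "(%N. N2 lborel (g N)) \<longlonglongrightarrow> 0"
proof (rule order_tendstoI)
 fix a :: ennreal assume "0 < a"
 then obtain c where c: "0 < c" "c < a" using dense by blast
 then obtain r where r: "c = ennreal r" "r > 0" by (cases c) auto
 obtain b where b: "N2 lborel h = ennreal b" "b >= 0" using h(2) by (cases "N2 lborel h") auto
 define e where "e = sqrt (r / (1 + b))"
 have e: "e > 0" using r b by (simp add: e_def)
 have e2: "e\<^sup>2 * b <= r"
 proof -
  have "e\<^sup>2 = r / (1 + b)" using r b by (simp add: e_def)
  moreover have "r / (1 + b) * b <= r / (1 + b) * (1 + b)" using r b by (intro mult_left_mono) auto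
  ultimately show ?thesis using b by simp
 qed
 show "\<forall>\<^sub>F N in sequentially. N2 lborel (g N) < a"
  using le[OF e]
 proof eventually_elim
  case (elim N)
  have "N2 lborel (g N) <= N2 lborel (%s. e *\<^sub>R h s)"
   unfolding N2_def by (rule nn_integral_mono_AE, use elim in eventually_elim)
    (use e in \<open>auto intro!: ennreal_leI power_mono\<close>)
  also have "... = ennreal (e\<^sup>2) * ennreal b" using N2_scale[OF h(1)] b by simp
  also have "... = ennreal (e\<^sup>2 * b)" using b by (simp add: ennreal_mult)
  also have "... <= c" using e2 r by (simp add: ennreal_leI)
  finally show ?case using c by simp
 qed
qed simp

lemma gstep_N2:
 fixes h :: "real => 'b::{real_normed_vector, second_countable_topology}"
 assumes h: "continuous_on {u..v} h" and uv: "u <= v"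
 shows "(%N. N2 lborel (%s. gstep u v 0 N h s - indicator {u<..v} s *\<^sub>R h s)) \<longlonglongrightarrow> 0"
proof (rule N2_tendsto_0[where h = "indicator {u<..v} :: real => real"])
 have "N2 lborel (indicator {u<..v} :: real => real) = (\<integral>\<^sup>+ s. indicator {u<..v} s \<partial>lborel)"
  unfolding N2_def by (intro nn_integral_cong) (auto split: split_indicator)
 then show "N2 lborel (indicator {u<..v} :: real => real) < \<infinity>" using uv by simp
 fix e :: real assume e: "e > 0"
 have "\<forall>\<^sub>F N in sequentially. \<forall>s. norm (gstep u v 0 N h s - indicator {u<..v} s *\<^sub>R h s) <= e"
  by (rule gstep_approx[OF h uv e]) simp
 then show "\<forall>\<^sub>F N in sequentially. AE s in lborel. norm (gstep u v 0 N h s - indicator {u<..v} s *\<^sub>R h s) <= e * norm (indicator {u<..v} s :: real)"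
 proof eventually_elim
  case (elim N)
  have "norm (gstep u v 0 N h s - indicator {u<..v} s *\<^sub>R h s) <= e * norm (indicator {u<..v} s :: real)" for s
   using elim[rule_format, of s] gstep_outside[OF uv, of s 0 N h] by (cases "s \<in> {u<..v}") auto
  then show ?case by simp
 qed
qed simp

lemma N2_vec:
 fixes f :: "'b => real^'d"
 assumes "f \<in> borel_measurable \<mu>"
 shows "N2 \<mu> f = (\<Sum>i\<in>UNIV. N2 \<mu> (%x. f x $ i))"
proof -
 note [measurable] = assms
 have "(norm (f x))\<^sup>2 = (\<Sum>i\<in>UNIV. (norm (f x $ i))\<^sup>2)" for x
  by (simp add: norm_vec_def L2_set_def sum_nonneg)
 then have "N2 \<mu> f = (\<integral>\<^sup>+ x. (\<Sum>i\<in>UNIV. ennreal ((norm (f x $ i))\<^sup>2)) \<partial>\<mu>)"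
  unfolding N2_def by (simp add: sum_ennreal)
 also have "... = (\<Sum>i\<in>UNIV. N2 \<mu> (%x. f x $ i))"
  unfolding N2_def by (intro nn_integral_sum) measurable
 finally show ?thesis .
qed

lemma N2_indicator_tail:
 fixes h :: "real => 'b::{real_normed_vector, second_countable_topology}"
 assumes h: "h \<in> borel_measurable borel" and fin: "N2 lborel h < \<infinity>"
 shows "(%k::nat. N2 lborel (%s. indicator {real k<..} s *\<^sub>R h s)) \<longlonglongrightarrow> 0"
proof -
 let ?f = "%s. (norm (h s))\<^sup>2"
 have int: "integrable lborel ?f"
  using fin h by (intro integrableI_nonneg) (auto simp: N2_def)
 have "(%k. LINT s|lborel. indicator {real k<..} s * ?f s) \<longlonglongrightarrow> (LINT s|lborel. (%_::real. 0) s)"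
 proof (rule integral_dominated_convergence[where w = ?f])
  show "AE s in lborel. (%k. indicator {real k<..} s * ?f s) \<longlonglongrightarrow> 0"
  proof (rule AE_I2)
   fix s :: real
   have "\<forall>\<^sub>F k in sequentially. indicator {real k<..} s * ?f s = 0"
   proof -
    obtain n :: nat where "s <= real n" using real_arch_simple by blast
    then show ?thesis unfolding eventually_sequentially by (intro exI[of _ n]) (auto simp: indicator_def)
   qed
   then show "(%k. indicator {real k<..} s * ?f s) \<longlonglongrightarrow> 0" by (rule tendsto_eventually)
  qed
 qed (use h int in \<open>auto split: split_indicator\<close>)
 moreover have "ennreal (LINT s|lborel. indicator {real k<..} s * ?f s) = N2 lborel (%s. indicator {real k<..} s *\<^sub>R h s)" for k
 proof -
  have "integrable lborel (%s. indicator {real k<..} s * ?f s)"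
   by (rule Bochner_Integration.integrable_bound[OF \<open>integrable lborel ?f\<close>]) (use h in \<open>auto split: split_indicator\<close>)
  then have "ennreal (LINT s|lborel. indicator {real k<..} s * ?f s) = (\<integral>\<^sup>+ s. ennreal (indicator {real k<..} s * ?f s) \<partial>lborel)"
   by (intro nn_integral_eq_integral[symmetric]) auto
  also have "... = N2 lborel (%s. indicator {real k<..} s *\<^sub>R h s)"
   unfolding N2_def by (intro nn_integral_cong) (auto split: split_indicator)
  finally show ?thesis .
 qed
 ultimately show ?thesis using tendsto_ennrealI[of "%k. LINT s|lborel. indicator {real k<..} s * ?f s" "LINT s|lborel. (%_::real. 0) s"] by simp
qed

section \<open>Existence of the Ito integral of a deterministic integrand\<close>

context brownian begin

text \<open>Weighting the squared increments by \<open>4 ^ k\<close> leaves a geometric series of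
  ratio \<open>1 / 4\<close> in expectation. Almost surely the weighted series is finite, which
  forces the increments below a multiple of \<open>(1 / 2) ^ k\<close>.\<close>

lemma fast_cauchy_AE:
 fixes Z :: "nat => 'a => real"
 assumes m: "!!k. Z k \<in> borel_measurable M" and C: "C >= 0"
  and b: "!!k. N2 M (%w. Z (Suc k) w - Z k w) <= ennreal (C / 16 ^ k)"
 shows "AE w in M. convergent (%k. Z k w)"
proof -
 note [measurable] = m
 let ?d = "%k w. ennreal (4 ^ k * (Z (Suc k) w - Z k w)\<^sup>2)"
 have "(\<integral>\<^sup>+ w. (\<Sum>k. ?d k w) \<partial>M) = (\<Sum>k. \<integral>\<^sup>+ w. ?d k w \<partial>M)"
  by (rule nn_integral_suminf) measurable
 also have "... <= (\<Sum>k. ennreal (C * (1/4) ^ k))"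
 proof (intro suminf_le)
  fix k
  have "(\<integral>\<^sup>+ w. ?d k w \<partial>M) = ennreal (4 ^ k) * N2 M (%w. Z (Suc k) w - Z k w)"
   unfolding N2_def by (subst nn_integral_cmult[symmetric]) (auto simp: ennreal_mult)
  also have "... <= ennreal (4 ^ k) * ennreal (C / 16 ^ k)" by (rule mult_left_mono[OF b]) simp
  also have "... = ennreal (4 ^ k * (C / 16 ^ k))" using C by (subst ennreal_mult) auto
  also have "4 ^ k * (C / 16 ^ k) = C * (1/4) ^ k"
  proof -
   have "(16::real) ^ k = 4 ^ k * 4 ^ k" by (simp add: power_mult_distrib[symmetric])
   then show ?thesis by (simp add: power_divide)
  qed
  finally show "(\<integral>\<^sup>+ w. ?d k w \<partial>M) <= ennreal (C * (1/4) ^ k)" .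
 qed auto
 also have "... = ennreal (\<Sum>k. C * (1/4) ^ k)"
  by (rule suminf_ennreal2) (use C in \<open>auto intro!: summable_mult summable_geometric\<close>)
 also have "... < \<infinity>" by simp
 finally have "AE w in M. (\<Sum>k. ?d k w) \<noteq> \<infinity>"
  by (intro nn_integral_PInf_AE) (auto simp: less_top)
 then show ?thesis
 proof eventually_elim
  case (elim w)
  define Sd where "Sd = (\<Sum>k. ?d k w)"
  have "Sd \<noteq> \<infinity>" using elim unfolding Sd_def .
  then obtain K where K0: "K >= 0" and SdK: "Sd = ennreal K" by (cases Sd) auto
  have K: "K >= 0" "(\<Sum>k. ?d k w) = ennreal K" using K0 SdK unfolding Sd_def .
  have le: "norm (Z (Suc k) w - Z k w) <= sqrt K * (1/2) ^ k" for k
  proof -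
   define f where "f = (%k. ?d k w)"
   have "sum f {k} <= suminf f" by (rule sum_le_suminf) auto
   then have "f k <= suminf f" by simp
   also have "suminf f = ennreal K" using K(2) unfolding f_def .
   finally have "ennreal (4 ^ k * (Z (Suc k) w - Z k w)\<^sup>2) <= ennreal K" unfolding f_def .
   then have "4 ^ k * (Z (Suc k) w - Z k w)\<^sup>2 <= K" using K0 by (simp only: ennreal_le_iff)
   moreover have "(4::real) ^ k = (2 ^ k)\<^sup>2" by (simp add: power2_eq_square power_mult_distrib[symmetric])
   ultimately have "(2 ^ k * (Z (Suc k) w - Z k w))\<^sup>2 <= K" by (simp only: power_mult_distrib)
   from real_sqrt_le_mono[OF this] have "\<bar>2 ^ k * (Z (Suc k) w - Z k w)\<bar> <= sqrt K"
    by (simp only: real_sqrt_abs)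
   then have "2 ^ k * \<bar>Z (Suc k) w - Z k w\<bar> <= sqrt K" by (simp add: abs_mult)
   then show ?thesis by (simp add: power_divide pos_le_divide_eq mult.commute)
  qed
  have "summable (%k. Z (Suc k) w - Z k w)"
   by (rule summable_comparison_test[of _ "%k. sqrt K * (1/2) ^ k"])
    (use le in \<open>auto intro!: summable_mult summable_geometric\<close>)
  then have "convergent (%n. \<Sum>k<n. Z (Suc k) w - Z k w)" by (simp add: summable_iff_convergent)
  then have "convergent (%n. Z n w - Z 0 w)" by (simp only: sum_lessThan_telescope[of "%k. Z k w"])
  then have "convergent (%n. (Z n w - Z 0 w) + Z 0 w)" by (intro convergent_add convergent_const)
  then show ?case by simp
 qed
qed

text \<open>As \<open>ito_integral\<close> is a \<open>SOME\<close>, its properties rest on this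
  existence. Step approximations with errors \<open>4 / 16 ^ k\<close> have integrals that converge
  almost surely in each component, so the limit is obtained directly as a measurable
  function.\<close>

lemma ito_integral_exists:
 fixes H :: "real => real^'e^'d"
 assumes cont: "continuous_on {0..} H" and T: "T = {0..} \<or> (\<exists>t\<ge>0. T = {0..t})"
  and fin: "(\<integral>\<^sup>+ s\<in>T. ennreal ((norm (H s))\<^sup>2) \<partial>lborel) < \<infinity>"
 shows "\<exists>I. has_ito_integral M F B T (%s _. H s) I"
proof -
 have Tb: "T \<in> sets borel" and T0: "T \<subseteq> {0..}" and Ti: "is_interval T" using T by (auto simp: is_interval_1)
 let ?h = "%s. indicator T s *\<^sub>R H s"
 have hm [measurable]: "?h \<in> borel_measurable borel"
  by (rule borel_measurable_continuous_on_indicator) (use Tb T0 cont continuous_on_subset in auto)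
 have hN: "N2 lborel ?h = (\<integral>\<^sup>+ s\<in>T. ennreal ((norm (H s))\<^sup>2) \<partial>lborel)"
  unfolding N2_def by (intro nn_integral_cong) (auto split: split_indicator)
 \<comment> \<open>For the half-line the integrand is first cut at a late time \<open>v\<close>; for
   a compact interval \<open>v\<close> is its end point and the tail is \<open>0\<close>.\<close>
 have tail: "\<exists>v\<ge>0. {0..v} \<subseteq> T \<and> N2 lborel (%s. indicator {v<..} s *\<^sub>R ?h s) < ennreal e" if e: "e > 0" for e
  using T
 proof
  assume "T = {0..}"
  have "\<forall>\<^sub>F k in sequentially. N2 lborel (%s. indicator {real k<..} s *\<^sub>R ?h s) < ennreal e"
   by (rule order_tendstoD(2)[OF N2_indicator_tail[OF hm]]) (use fin hN e in auto)
  then obtain k where "N2 lborel (%s. indicator {real k<..} s *\<^sub>R ?h s) < ennreal e" unfolding eventually_sequentially by auto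
  then show ?thesis using \<open>T = {0..}\<close> by (intro exI[of _ "real k"]) auto
 next
  assume "\<exists>t\<ge>0. T = {0..t}"
  then obtain t where t: "t >= 0" "T = {0..t}" by blast
  have "(%s. indicator {t<..} s *\<^sub>R ?h s) = (%s. 0)" using t by (auto simp: fun_eq_iff split: split_indicator)
  then show ?thesis using t e by (intro exI[of _ t]) simp
 qed
 have "\<exists>v N. v >= 0 \<and> {0..v} \<subseteq> T \<and> N > 0 \<and> N2 lborel (%s. gstep 0 v 0 N H s - ?h s) <= ennreal (4 / 16 ^ k)" for k :: nat
 proof -
  \<comment> \<open>Two errors of this size, the discretisation and the tail, are each doubled by
    the triangle inequality; this accounts for \<open>4 / 16 ^ k\<close>.\<close>
  have e: "(1/16) ^ k > (0::real)" by simp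
  obtain v where v: "v >= 0" "{0..v} \<subseteq> T" and tl: "N2 lborel (%s. indicator {v<..} s *\<^sub>R ?h s) < ennreal ((1/16) ^ k)"
   using tail[OF e] by blast
  have "\<forall>\<^sub>F N in sequentially. N2 lborel (%s. gstep 0 v 0 N H s - indicator {0<..v} s *\<^sub>R H s) < ennreal ((1/16) ^ k)"
   by (rule order_tendstoD(2)[OF gstep_N2]) (use e v continuous_on_subset[OF cont, of "{0..v}"] in auto)
  with eventually_gt_at_top[of 0] have "\<forall>\<^sub>F N in sequentially. 0 < N \<and> N2 lborel (%s. gstep 0 v 0 N H s - indicator {0<..v} s *\<^sub>R H s) < ennreal ((1/16) ^ k)"
   by eventually_elim simp
  then obtain N where N: "0 < N" and app: "N2 lborel (%s. gstep 0 v 0 N H s - indicator {0<..v} s *\<^sub>R H s) < ennreal ((1/16) ^ k)"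
   unfolding eventually_sequentially by blast
  have hT: "indicator {0<..v} s *\<^sub>R H s = indicator {0<..v} s *\<^sub>R ?h s" for s
   using subsetD[OF v(2), of s] by (auto split: split_indicator)
  have gm: "gstep 0 v 0 N H \<in> borel_measurable borel" unfolding gstep_def by measurable
  have "N2 lborel (%s. gstep 0 v 0 N H s - ?h s) = N2 lborel (%s. (gstep 0 v 0 N H s - indicator {0<..v} s *\<^sub>R ?h s) + (- (indicator {v<..} s *\<^sub>R ?h s)))"
  proof (rule N2_AE_cong, use AE_lborel_singleton[of 0] in eventually_elim)
   case (elim s)
   then show ?case using v T0 by (cases "s \<in> T") (auto split: split_indicator)
  qed
  also have "... <= 2 * N2 lborel (%s. gstep 0 v 0 N H s - indicator {0<..v} s *\<^sub>R ?h s) + 2 * N2 lborel (%s. - (indicator {v<..} s *\<^sub>R ?h s))"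
  proof (rule N2_add)
   have m1: "(%s. indicator {0<..v} s *\<^sub>R ?h s) \<in> borel_measurable borel"
    by (rule borel_measurable_scaleR[OF _ hm]) simp
   have m2: "(%s. indicator {v<..} s *\<^sub>R ?h s) \<in> borel_measurable borel"
    by (rule borel_measurable_scaleR[OF _ hm]) simp
   show "(%s. gstep 0 v 0 N H s - indicator {0<..v} s *\<^sub>R ?h s) \<in> borel_measurable lborel"
    unfolding measurable_lborel2 by (rule borel_measurable_diff[OF gm m1])
   show "(%s. - (indicator {v<..} s *\<^sub>R ?h s)) \<in> borel_measurable lborel"
    unfolding measurable_lborel2 by (rule borel_measurable_uminus[OF m2])
  qed
  also have "N2 lborel (%s. gstep 0 v 0 N H s - indicator {0<..v} s *\<^sub>R ?h s) <= ennreal ((1/16) ^ k)"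
   using app unfolding hT by simp
  also have "N2 lborel (%s. - (indicator {v<..} s *\<^sub>R ?h s)) <= ennreal ((1/16) ^ k)" using tl N2_uminus[of lborel "%s. indicator {v<..} s *\<^sub>R ?h s"] by simp
  finally have "N2 lborel (%s. gstep 0 v 0 N H s - ?h s) <= 2 * ennreal ((1/16) ^ k) + 2 * ennreal ((1/16) ^ k)"
   by (simp add: add_mono mult_left_mono)
  also have "... = ennreal (2 * (1/16) ^ k + 2 * (1/16) ^ k)"
  proof -
   have "2 * ennreal ((1/16) ^ k) = ennreal (2 * (1/16) ^ k)" by (subst ennreal_mult) auto
   moreover have c: "0 <= 2 * (1/16::real) ^ k" by simp
   ultimately show ?thesis by (simp only: ennreal_plus[OF c c])
  qed
  also have "2 * (1/16) ^ k + 2 * (1/16) ^ k = 4 / (16::real) ^ k" by (simp add: power_divide)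
  finally show ?thesis using v N by blast
 qed
 then have "\<forall>k. \<exists>v N. v >= 0 \<and> {0..v} \<subseteq> T \<and> N > 0 \<and> N2 lborel (%s. gstep 0 v 0 N H s - ?h s) <= ennreal (4 / 16 ^ k)" by blast
 from choice[OF this] obtain v where "\<forall>k. \<exists>N. v k >= 0 \<and> {0..v k} \<subseteq> T \<and> N > 0 \<and> N2 lborel (%s. gstep 0 (v k) 0 N H s - ?h s) <= ennreal (4 / 16 ^ k)" by blast
 from choice[OF this] obtain N where vN: "\<forall>k. v k >= 0 \<and> {0..v k} \<subseteq> T \<and> N k > 0 \<and> N2 lborel (%s. gstep 0 (v k) 0 (N k) H s - ?h s) <= ennreal (4 / 16 ^ k)" by blast
 have v: "v k >= 0" "{0..v k} \<subseteq> T" and N: "N k > 0"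
  and app: "N2 lborel (%s. gstep 0 (v k) 0 (N k) H s - ?h s) <= ennreal (4 / 16 ^ k)" for k
  using vN[rule_format, of k] by blast+
 define \<tau> where "\<tau> k i = v k * real i / real (N k)" for k i
 define \<xi> where "\<xi> k i = (%w::'a. H (\<tau> k i))" for k i
 define S where "S k = simple_ito B (N k) (\<tau> k) (\<xi> k)" for k
 define G where "G k = gstep 0 (v k) 0 (N k) H" for k
 have Gm [measurable]: "G k \<in> borel_measurable borel" for k unfolding G_def gstep_def by measurable
 have tau_mono: "\<tau> k i <= \<tau> k (Suc i)" for k i unfolding \<tau>_def using v by (intro divide_right_mono mult_left_mono) auto
 have tau0: "0 <= \<tau> k i" for k i unfolding \<tau>_def using v by simp
 have tauT: "\<tau> k i \<in> T" if "i <= N k" for k i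
 proof -
  have "v k * (real i / real (N k)) <= v k * 1" using that N[of k] v by (intro mult_left_mono) auto
  then have "\<tau> k i \<in> {0..v k}" using tau0[of k i] by (simp add: \<tau>_def)
  then show ?thesis using v by blast
 qed
 have sp: "simple_process M F T (N k) (\<tau> k) (\<xi> k)" for k
 proof -
  have "bounded ((%_. c) ` X)" for c :: "real^'e^'d" and X :: "'a set" by (rule bounded_subset[of "{c}"]) auto
  then show ?thesis unfolding simple_process_def using tauT tau_mono by (auto simp: \<xi>_def)
 qed
 have val: "simple_value (N k) (\<tau> k) (\<xi> k) s w = G k s" for k s w
  by (simp add: simple_value_def G_def gstep_def \<xi>_def \<tau>_def)
 have wiS: "wi (%s. G k s $ i) (%w. S k w $ i)" for k i
 proof -
  let ?l = "grid (N k) (\<tau> k) (%m w. H (\<tau> k m) $ i)"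
  have "wi (%s. G k s $ i) (sint ?l)"
  proof (rule wi_sint)
   have "bounded ((%_. c) ` X)" for c :: "real^'e" and X :: "'a set" by (rule bounded_subset[of "{c}"]) auto
   then show "valid ?l" unfolding valid_grid using tau0 tau_mono by auto
   show "sval ?l w s = G k s $ i" for w s unfolding sval_grid G_def gstep_def \<tau>_def by simp
   show "(%s. G k s $ i) \<in> borel_measurable borel"
    using measurable_compose[OF Gm, of "%v. v $ i" borel k] by (simp add: borel_measurable_continuous_onI continuous_intros)
  qed
  moreover have "sint ?l = (%w. S k w $ i)"
   by (auto simp: fun_eq_iff sint_grid S_def simple_ito_def \<xi>_def matrix_vector_mult_def inner_vec_def)
  ultimately show ?thesis by simp
 qed
 have comp_le: "N2 lborel (%s. G k s $ i - ?h s $ i) <= ennreal (4 / 16 ^ k)" for k i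
 proof -
  have "N2 lborel (%s. G k s $ i - ?h s $ i) <= N2 lborel (%s. G k s - ?h s)"
   by (rule N2_mono) (metis Finite_Cartesian_Product.norm_nth_le vector_minus_component)
  then show ?thesis using app[of k] by (simp add: G_def)
 qed
 have hi [measurable]: "(%s. ?h s $ i) \<in> borel_measurable borel" for i
  using measurable_compose[OF hm, of "%v. v $ i" borel] by (simp add: borel_measurable_continuous_onI continuous_intros)
 have Gi: "(%s. G k s $ i) \<in> borel_measurable borel" for k i using wi_measurable(1)[OF wiS] .
 have Sm: "(%w. S k w $ i) \<in> borel_measurable M" for k i using wi_measurable(2)[OF wiS] .
 have conv: "AE w in M. convergent (%k. S k w $ i)" for i
 \<comment> \<open>Here \<open>64 = 4 * (2 * 4 + 2 * 4)\<close>: the constant of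
   \<open>wi_dist\<close> times the doubled errors of two consecutive approximations.\<close>
 proof (rule fast_cauchy_AE[where C = 64])
  fix k
  have "N2 M (%w. S (Suc k) w $ i - S k w $ i) <= 4 * N2 lborel (%s. G (Suc k) s $ i - G k s $ i)"
   by (rule wi_dist[OF wiS wiS])
  also have "N2 lborel (%s. G (Suc k) s $ i - G k s $ i) <= 2 * N2 lborel (%s. G (Suc k) s $ i - ?h s $ i) + 2 * N2 lborel (%s. ?h s $ i - G k s $ i)"
   using Gi hi by (intro N2_triangle) auto
  also have "... <= 2 * ennreal (4 / 16 ^ k) + 2 * ennreal (4 / 16 ^ k)"
  proof (intro add_mono mult_left_mono)
   have "ennreal (4 / 16 ^ Suc k) <= ennreal (4 / 16 ^ k)" by (intro ennreal_leI divide_left_mono) auto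
   then show "N2 lborel (%s. G (Suc k) s $ i - ?h s $ i) <= ennreal (4 / 16 ^ k)" using comp_le[of "Suc k" i] by (rule order_trans[rotated])
   show "N2 lborel (%s. ?h s $ i - G k s $ i) <= ennreal (4 / 16 ^ k)" using comp_le[of k i] by (subst N2_commute)
  qed auto
  also have "... = ennreal (16 / 16 ^ k)"
  proof -
   have "2 * ennreal (4 / 16 ^ k) = ennreal (2 * (4 / 16 ^ k))" by (subst ennreal_mult) auto
   moreover have c: "0 <= 2 * (4 / 16 ^ k :: real)" by simp
   ultimately have "2 * ennreal (4 / 16 ^ k) + 2 * ennreal (4 / 16 ^ k) = ennreal (2 * (4 / 16 ^ k) + 2 * (4 / 16 ^ k))"
    by (simp only: ennreal_plus[OF c c])
   then show ?thesis by simp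
  qed
  finally have "N2 M (%w. S (Suc k) w $ i - S k w $ i) <= 4 * ennreal (16 / 16 ^ k)" by (simp add: mult_left_mono)
  also have "... = ennreal (64 / 16 ^ k)" using ennreal_mult[of 4 "16 / 16 ^ k"] by simp
  finally show "N2 M (%w. S (Suc k) w $ i - S k w $ i) <= ennreal (64 / 16 ^ k)" .
 qed (use Sm in auto)
 define I where "I w = (\<chi> i. lim (%k. S k w $ i))" for w
 have Im1: "(%w. I w $ i) \<in> borel_measurable M" for i
  unfolding I_def vec_lambda_beta using Sm by (intro borel_measurable_lim_metric)
 have Im: "I \<in> borel_measurable M"
 proof (rule borel_measurable_euclidean_space[THEN iffD2, rule_format])
  fix b :: "real^'d" assume "b \<in> Basis"
  then obtain i where "b = axis i 1" by (auto simp: Basis_vec_def)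
  then show "(%x. I x \<bullet> b) \<in> borel_measurable M" using Im1[of i] by (simp add: inner_axis)
 qed
 have small0: "(%k. ennreal (C / 16 ^ k)) \<longlonglongrightarrow> 0" for C
 proof -
  have "(%k. C * (1/16::real) ^ k) \<longlonglongrightarrow> C * 0" by (intro tendsto_intros LIMSEQ_power_zero) simp
  then have "(%k. C / 16 ^ k :: real) \<longlonglongrightarrow> 0" by (simp add: power_divide)
  from tendsto_ennrealI[OF this] show ?thesis by simp
 qed
 have wiI: "wi (%s. ?h s $ i) (%w. I w $ i)" for i
 proof (rule wi_limit[OF wiS _ hi Im1])
  show "(%k. N2 lborel (%s. G k s $ i - ?h s $ i)) \<longlonglongrightarrow> 0"
   by (rule tendsto_sandwich[OF _ _ tendsto_const small0[of 4]]) (use comp_le in auto)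
  show "AE w in M. (%k. S k w $ i) \<longlonglongrightarrow> I w $ i"
   using conv[of i] by eventually_elim (simp add: I_def convergent_LIMSEQ_iff)
 qed
 have Sv: "S k \<in> borel_measurable M" for k
 proof (rule borel_measurable_euclidean_space[THEN iffD2, rule_format])
  fix b :: "real^'d" assume "b \<in> Basis"
  then obtain i where "b = axis i 1" by (auto simp: Basis_vec_def)
  then show "(%x. S k x \<bullet> b) \<in> borel_measurable M" using Sm[of k i] by (simp add: inner_axis)
 qed
 have SI: "(%k. N2 M (%w. S k w - I w)) \<longlonglongrightarrow> 0"
 proof -
  have "(%k. \<Sum>i\<in>UNIV. N2 M (%w. S k w $ i - I w $ i)) \<longlonglongrightarrow> (\<Sum>i\<in>(UNIV::'d set). 0)"
  proof (intro tendsto_sum)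
   fix i
   have "N2 M (%w. S k w $ i - I w $ i) <= ennreal (16 / 16 ^ k)" for k
   proof -
    have "N2 M (%w. S k w $ i - I w $ i) <= 4 * N2 lborel (%s. G k s $ i - ?h s $ i)" by (rule wi_dist[OF wiS wiI])
    also have "... <= 4 * ennreal (4 / 16 ^ k)" by (rule mult_left_mono[OF comp_le]) simp
    also have "... = ennreal (16 / 16 ^ k)" using ennreal_mult[of 4 "4 / 16 ^ k"] by simp
    finally show ?thesis .
   qed
   then show "(%k. N2 M (%w. S k w $ i - I w $ i)) \<longlonglongrightarrow> 0"
    by (intro tendsto_sandwich[OF _ _ tendsto_const small0[of 16]]) auto
  qed
  then show ?thesis using N2_vec[of "%w. S _ w - I w" M] Sv Im by simp
 qed
 have "has_ito_integral M F B T (%s _. H s) I"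
  unfolding has_ito_integral_def
 proof (intro conjI exI allI)
  have "(\<integral>\<^sup>+ w. (\<integral>\<^sup>+ s\<in>T. ennreal ((norm (H s))\<^sup>2) \<partial>lborel) \<partial>M) < \<infinity>" using fin by (simp add: emeasure_space_1)
  then show "ito_integrand M F T (%s _. H s)"
   unfolding ito_integrand_def using measurable_compose[OF measurable_fst hm, of M] by (simp add: case_prod_beta')
  show "I \<in> borel_measurable M" by (rule Im)
  show "simple_process M F T (N k) (\<tau> k) (\<xi> k)" for k by (rule sp)
  show "(%k. \<integral>\<^sup>+ w. ennreal ((norm (simple_ito B (N k) (\<tau> k) (\<xi> k) w - I w))\<^sup>2) \<partial>M) \<longlonglongrightarrow> 0"
   using SI by (simp add: N2_def S_def)
  show "(%k. \<integral>\<^sup>+ w. (\<integral>\<^sup>+ s\<in>T. ennreal ((norm (simple_value (N k) (\<tau> k) (\<xi> k) s w - H s))\<^sup>2) \<partial>lborel) \<partial>M) \<longlonglongrightarrow> 0"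
  proof (rule tendsto_sandwich[OF _ _ tendsto_const small0[of 4]])
   have "(\<integral>\<^sup>+ s\<in>T. ennreal ((norm (G k s - H s))\<^sup>2) \<partial>lborel) <= N2 lborel (%s. G k s - ?h s)" for k
    unfolding N2_def by (intro nn_integral_mono) (auto split: split_indicator)
   then have "(\<integral>\<^sup>+ s\<in>T. ennreal ((norm (G k s - H s))\<^sup>2) \<partial>lborel) <= ennreal (4 / 16 ^ k)" for k
    using app[of k] by (auto simp: G_def intro: order_trans)
   then show "\<forall>\<^sub>F k in sequentially. (\<integral>\<^sup>+ w. (\<integral>\<^sup>+ s\<in>T. ennreal ((norm (simple_value (N k) (\<tau> k) (\<xi> k) s w - H s))\<^sup>2) \<partial>lborel) \<partial>M) <= ennreal (4 / 16 ^ k)"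
    unfolding val by (auto simp: emeasure_space_1)
  qed auto
 qed
 then show ?thesis by blast
qed

lemma ito_integral_wi:
 fixes H :: "real => real^'e^'d"
 assumes cont: "continuous_on {0..} H" and T: "T = {0..} \<or> (\<exists>t\<ge>0. T = {0..t})"
  and fin: "(\<integral>\<^sup>+ s\<in>T. ennreal ((norm (H s))\<^sup>2) \<partial>lborel) < \<infinity>"
 shows "wi (%s. indicator T s *\<^sub>R (H s $ i)) (%w. ito_integral M F B T (%s _. H s) w $ i)"
proof -
 have "has_ito_integral M F B T (%s _. H s) (ito_integral M F B T (%s _. H s))"
  unfolding ito_integral_def using ito_integral_exists[OF assms] by (rule someI_ex)
 then show ?thesis
 proof (rule has_ito_wi[rotated 2])
  show "is_interval T" "T \<subseteq> {0..}" using T by (auto simp: is_interval_1)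
  have "T \<in> sets borel" "T \<subseteq> {0..}" using T by auto
  then show "(%s. indicator T s *\<^sub>R H s) \<in> borel_measurable borel"
   by (intro borel_measurable_continuous_on_indicator continuous_on_subset[OF cont])
 qed
qed

end

section \<open>Kolmogorov's inequality and almost sure convergence\<close>

lemma (in prob_space) kolmogorov_inequality:
 fixes S :: "nat => 'a => real"
 assumes m: "!!i. i <= m ==> S i \<in> borel_measurable M" and sq: "!!i. i <= m ==> integrable M (%w. (S i w)\<^sup>2)"
  and orth: "!!i. i <= m ==> has_bochner_integral M (%w. indicator {w\<in>space M. \<epsilon> <= \<bar>S i w\<bar> \<and> (\<forall>j<i. \<bar>S j w\<bar> < \<epsilon>)} w * S i w * (S m w - S i w)) 0"
  and e: "\<epsilon> > 0"
 shows "prob {w\<in>space M. \<exists>i\<le>m. \<epsilon> <= \<bar>S i w\<bar>} * \<epsilon>\<^sup>2 <= expectation (%w. (S m w)\<^sup>2)"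
proof -
 \<comment> \<open>\<open>A i\<close> is the event that the level \<epsilon> is reached for the
   first time at index \<open>i\<close>; these events are disjoint, and up to \<open>m\<close> their
   union is the event in question.\<close>
 define A where "A i = {w\<in>space M. \<epsilon> <= \<bar>S i w\<bar> \<and> (\<forall>j<i. \<bar>S j w\<bar> < \<epsilon>)}" for i
 have Am: "A i \<in> events" if "i <= m" for i
 proof -
  have [measurable]: "S i \<in> borel_measurable M" by (rule m[OF that])
  have 1: "{w\<in>space M. \<epsilon> <= \<bar>S i w\<bar>} \<in> events" by measurable
  have "{w\<in>space M. \<bar>S j w\<bar> < \<epsilon>} \<in> events" if "j < i" for j
  proof -
   have [measurable]: "S j \<in> borel_measurable M" by (rule m) (use that \<open>i <= m\<close> in simp)
   show ?thesis by measurable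
  qed
  then have "{w\<in>space M. \<forall>j\<in>{..<i}. \<bar>S j w\<bar> < \<epsilon>} \<in> events" by (intro sets.sets_Collect_finite_All) auto
  moreover have "A i = {w\<in>space M. \<epsilon> <= \<bar>S i w\<bar>} \<inter> {w\<in>space M. \<forall>j\<in>{..<i}. \<bar>S j w\<bar> < \<epsilon>}" by (auto simp: A_def)
  ultimately show ?thesis using 1 by auto
 qed
 have disj: "disjoint_family_on A {..m}"
 proof -
  have "A i \<inter> A j = {}" if "i < j" for i j using that by (auto simp: A_def not_le[symmetric])
  then have "A i \<inter> A j = {}" if "i \<noteq> j" for i j using that by (metis Int_commute nat_neq_iff)
  then show ?thesis by (auto simp: disjoint_family_on_def)
 qed
 have un: "{w\<in>space M. \<exists>i\<le>m. \<epsilon> <= \<bar>S i w\<bar>} = (\<Union>i\<in>{..m}. A i)"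
 proof (intro equalityI subsetI)
  fix w assume "w \<in> {w\<in>space M. \<exists>i\<le>m. \<epsilon> <= \<bar>S i w\<bar>}"
  then have w: "w \<in> space M" "\<exists>i. i <= m \<and> \<epsilon> <= \<bar>S i w\<bar>" by auto
  define i where "i = (LEAST i. i <= m \<and> \<epsilon> <= \<bar>S i w\<bar>)"
  have i: "i <= m \<and> \<epsilon> <= \<bar>S i w\<bar>" unfolding i_def by (rule LeastI_ex[OF w(2)])
  have "\<bar>S j w\<bar> < \<epsilon>" if "j < i" for j
  proof (rule ccontr)
   assume "\<not> \<bar>S j w\<bar> < \<epsilon>"
   then have "i <= j" unfolding i_def using that i by (intro Least_le) auto
   then show False using that by simp
  qed
  then show "w \<in> (\<Union>i\<in>{..m}. A i)" using i w by (auto simp: A_def)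
 qed (auto simp: A_def)
 have sqA: "integrable M (%w. indicator (A i) w * (S m w)\<^sup>2)" if "i <= m" for i
  using integrable_real_mult_indicator[OF Am[OF that] sq[of m]] by (simp add: mult.commute)
 \<comment> \<open>On \<open>A i\<close> the square of \<open>S m\<close> is at least
   \<open>(S i)\<^sup>2 + 2 * S i * (S m - S i)\<close>, and the cross term has expectation
   \<open>0\<close> by \<open>orth\<close>, which stands in for the martingale property.\<close>
 have step: "\<epsilon>\<^sup>2 * prob (A i) <= expectation (%w. indicator (A i) w * (S m w)\<^sup>2)" if i: "i <= m" for i
 proof -
  have o: "has_bochner_integral M (%w. 2 * (indicator (A i) w * S i w * (S m w - S i w))) (2 * 0)"
   unfolding A_def by (intro has_bochner_integral_mult_right orth i)
  have ind: "integrable M (%w. \<epsilon>\<^sup>2 * indicator (A i) w)"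
   using Am[OF i] by (auto simp: emeasure_eq_measure)
  have "\<epsilon>\<^sup>2 * prob (A i) = expectation (%w. \<epsilon>\<^sup>2 * indicator (A i) w + 2 * (indicator (A i) w * S i w * (S m w - S i w)))"
   using o ind Am[OF i] by (subst Bochner_Integration.integral_add) (auto simp: has_bochner_integral_iff)
  also have "... <= expectation (%w. indicator (A i) w * (S m w)\<^sup>2)"
  proof (rule integral_mono)
   show "integrable M (%w. \<epsilon>\<^sup>2 * indicator (A i) w + 2 * (indicator (A i) w * S i w * (S m w - S i w)))"
    using o ind by (auto simp: has_bochner_integral_iff)
   show "integrable M (%w. indicator (A i) w * (S m w)\<^sup>2)" by (rule sqA[OF i])
   fix w
   show "\<epsilon>\<^sup>2 * indicator (A i) w + 2 * (indicator (A i) w * S i w * (S m w - S i w)) <= indicator (A i) w * (S m w)\<^sup>2"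
   proof (cases "w \<in> A i")
    case True
    then have "\<epsilon> <= \<bar>S i w\<bar>" by (simp add: A_def)
    then have "\<epsilon>\<^sup>2 <= (S i w)\<^sup>2" using e by (metis abs_le_square_iff abs_of_pos)
    moreover have "0 <= (S m w - S i w)\<^sup>2" by simp
    ultimately show ?thesis using True by (simp add: power2_eq_square algebra_simps)
   qed simp
  qed
  finally show ?thesis .
 qed
 have "prob {w\<in>space M. \<exists>i\<le>m. \<epsilon> <= \<bar>S i w\<bar>} = (\<Sum>i\<le>m. prob (A i))"
  unfolding un by (rule finite_measure_finite_Union) (use Am disj in auto)
 then have "prob {w\<in>space M. \<exists>i\<le>m. \<epsilon> <= \<bar>S i w\<bar>} * \<epsilon>\<^sup>2 = (\<Sum>i\<le>m. \<epsilon>\<^sup>2 * prob (A i))"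
  by (simp add: sum_distrib_left mult.commute[of _ "\<epsilon>\<^sup>2"])
 also have "... <= (\<Sum>i\<le>m. expectation (%w. indicator (A i) w * (S m w)\<^sup>2))"
  by (intro sum_mono step) auto
 also have "... = expectation (%w. \<Sum>i\<le>m. indicator (A i) w * (S m w)\<^sup>2)"
  by (rule Bochner_Integration.integral_sum[symmetric]) (intro sqA, auto)
 also have "... <= expectation (%w. (S m w)\<^sup>2)"
 proof (rule integral_mono)
  show "integrable M (%w. \<Sum>i\<le>m. indicator (A i) w * (S m w)\<^sup>2)"
   by (intro Bochner_Integration.integrable_sum sqA) auto
  show "integrable M (%w. (S m w)\<^sup>2)" by (rule sq) simp
  fix w
  have "(\<Sum>i\<le>m. indicator (A i) w) = (indicator (\<Union>i\<in>{..m}. A i) w :: real)"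
   by (rule indicator_UN_disjoint[OF _ disj, symmetric]) simp
  then have "(\<Sum>i\<le>m. indicator (A i) w) <= (1::real)" by (simp add: indicator_def)
  then have "(\<Sum>i\<le>m. indicator (A i) w) * (S m w)\<^sup>2 <= 1 * (S m w)\<^sup>2" by (rule mult_right_mono) simp
  then show "(\<Sum>i\<le>m. indicator (A i) w * (S m w)\<^sup>2) <= (S m w)\<^sup>2" by (simp add: sum_distrib_right)
 qed
 finally show ?thesis .
qed

context brownian begin

lemma sint_sq_integrable: "valid l ==> integrable M (%w. (sint l w)\<^sup>2)"
 using step_covariance[of l l] by (auto simp: has_bochner_integral_iff power2_eq_square)

text \<open>Constant heights suffice for a deterministic integrand; they make the integral over a
  block measurable at time \<open>v\<close> and orthogonal to everything known at time
  \<open>u\<close>.\<close>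

definition steps_in :: "real => real => ('a, 'e) steps => bool" where
 "steps_in u v l \<longleftrightarrow> (\<forall>(a, b, \<xi>) \<in> set l. u <= a \<and> b <= v \<and> (\<exists>c. \<xi> = (%_. c)))"

lemma sint_adapted:
 assumes "valid l" "steps_in u v l" "0 <= v" shows "sint l \<in> borel_measurable (F v)"
 using assms
proof (induction l)
 case (Cons p l)
 obtain a b \<xi> where p: "p = (a, b, \<xi>)" by (cases p)
 have ab: "0 <= a" "a <= b" "b <= v" using Cons.prems by (auto simp: p steps_in_def)
 have [measurable]: "B a \<in> borel_measurable (F v)" "B b \<in> borel_measurable (F v)" using B_meas ab by auto
 have [measurable]: "sint l \<in> borel_measurable (F v)" using Cons by (auto simp: p steps_in_def)
 obtain c where "\<xi> = (%_. c)" using Cons.prems by (auto simp: p steps_in_def)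
 then have [measurable]: "\<xi> \<in> borel_measurable (F v)" by simp
 show ?case unfolding p sint_simps(2)[abs_def] by measurable
qed (simp add: sint_def[abs_def])

lemma past_sint:
 assumes l: "valid l" "steps_in u v l" and u: "0 <= u" and U: "U \<in> borel_measurable (F u)" "integrable M U"
 shows "has_bochner_integral M (%w. U w * sint l w) 0"
 using l
proof (induction l)
 case (Cons p l)
 obtain a b \<xi> where p: "p = (a, b, \<xi>)" by (cases p)
 have ab: "u <= a" "a <= b" using Cons.prems by (auto simp: p steps_in_def)
 obtain c where c: "\<xi> = (%_. c)" using Cons.prems by (auto simp: p steps_in_def)
 have "has_bochner_integral M (%w. \<Sum>k\<in>UNIV. c $ k * (U w * dB a b k w)) (\<Sum>k\<in>UNIV. c $ k * 0)"
  by (intro has_bochner_integral_sum has_bochner_integral_mult_right past_increment meas_F_mono[OF U(1) u ab(1)] U(2)) (use u ab in auto)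
 then have 1: "has_bochner_integral M (%w. U w * (\<xi> w \<bullet> (B b w - B a w))) 0"
  by (simp add: c inner_vec_def dB_def sum_distrib_left mult_ac)
 have "has_bochner_integral M (%w. U w * sint l w) 0" using Cons by (auto simp: p steps_in_def)
 from has_bochner_integral_add[OF 1 this] show ?case by (simp add: p distrib_left)
qed (simp add: has_bochner_integral_zero)

lemma N2_ge: 
 fixes X :: "'a => real"
 assumes "X \<in> borel_measurable M" "\<epsilon> > 0"
 shows "ennreal (\<epsilon>\<^sup>2) * emeasure M {w\<in>space M. \<epsilon> <= \<bar>X w\<bar>} <= N2 M X"
proof -
 note [measurable] = assms(1)
 have "ennreal (\<epsilon>\<^sup>2) * emeasure M {w\<in>space M. \<epsilon> <= \<bar>X w\<bar>} = (\<integral>\<^sup>+ w. ennreal (\<epsilon>\<^sup>2) * indicator {w\<in>space M. \<epsilon> <= \<bar>X w\<bar>} w \<partial>M)"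
  by (rule nn_integral_cmult_indicator[symmetric]) measurable
 also have "... <= N2 M X"
  unfolding N2_def
 proof (rule nn_integral_mono)
  fix w
  have "\<epsilon>\<^sup>2 <= (X w)\<^sup>2" if "\<epsilon> <= \<bar>X w\<bar>" using power_mono[OF that, of 2] assms(2) by simp
  then show "ennreal (\<epsilon>\<^sup>2) * indicator {w\<in>space M. \<epsilon> <= \<bar>X w\<bar>} w <= ennreal ((norm (X w))\<^sup>2)"
   by (auto split: split_indicator intro!: ennreal_leI)
 qed
 finally show ?thesis .
qed

text \<open>Block \<open>i\<close> lives between consecutive times, so the partial sums are adapted
  at these times and every later block is orthogonal to events of the past; this is the
  orthogonality that \<open>kolmogorov_inequality\<close> asks for.\<close>

lemma step_kolmogorov:
 assumes tau: "!!i. i <= m ==> 0 <= \<tau> i" "!!i j. i <= j ==> j <= m ==> \<tau> i <= \<tau> j"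
  and l: "!!i. i < m ==> valid (l i)" "!!i. i < m ==> steps_in (\<tau> i) (\<tau> (Suc i)) (l i)" and e: "\<epsilon> > 0"
 shows "ennreal (\<epsilon>\<^sup>2) * emeasure M {w\<in>space M. \<exists>i\<le>m. \<epsilon> <= \<bar>\<Sum>j<i. sint (l j) w\<bar>} <= N2 M (%w. \<Sum>j<m. sint (l j) w)"
proof -
 define S where "S i w = (\<Sum>j<i. sint (l j) w)" for i w
 define L where "L i = concat (map l [0..<i])" for i
 have LS: "sint (L i) w = S i w" for i w unfolding L_def S_def by (induction i) auto
 have Lv: "valid (L i)" if "i <= m" for i unfolding L_def using that by (induction i) (auto intro: l(1))
 have Sad: "S i \<in> borel_measurable (F (\<tau> i))" if i: "i <= m" for i
 proof -
  have "sint (l j) \<in> borel_measurable (F (\<tau> i))" if "j < i" for j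
  proof -
   have "sint (l j) \<in> borel_measurable (F (\<tau> (Suc j)))" by (rule sint_adapted[OF l]) (use tau(1)[of "Suc j"] i that in auto)
   then show ?thesis by (rule meas_F_mono) (use tau(1)[of "Suc j"] tau(2)[of "Suc j" i] i that in auto)
  qed
  then show ?thesis unfolding S_def[abs_def] by (intro borel_measurable_sum) auto
 qed
 have Sm: "S i \<in> borel_measurable M" if "i <= m" for i using meas_F_M[OF Sad[OF that] tau(1)[OF that]] .
 have sq: "integrable M (%w. (S i w)\<^sup>2)" if "i <= m" for i using sint_sq_integrable[OF Lv[OF that]] by (simp add: LS)
 have int: "integrable M (S i)" if "i <= m" for i by (rule square_integrable_imp_integrable[OF Sm[OF that] sq[OF that]])
 have orth: "has_bochner_integral M (%w. indicator {w\<in>space M. \<epsilon> <= \<bar>S i w\<bar> \<and> (\<forall>j<i. \<bar>S j w\<bar> < \<epsilon>)} w * S i w * (S m w - S i w)) 0"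
  if i: "i <= m" for i
 proof -
  let ?A = "{w\<in>space M. \<epsilon> <= \<bar>S i w\<bar> \<and> (\<forall>j<i. \<bar>S j w\<bar> < \<epsilon>)}"
  have spF: "space (F (\<tau> i)) = space M" by (rule space_F[OF tau(1)[OF i]])
  have A: "?A \<in> sets (F (\<tau> i))"
  proof -
   have [measurable]: "S i \<in> borel_measurable (F (\<tau> i))" by (rule Sad[OF i])
   have 1: "{w\<in>space (F (\<tau> i)). \<epsilon> <= \<bar>S i w\<bar>} \<in> sets (F (\<tau> i))" by measurable
   have "{w\<in>space (F (\<tau> i)). \<bar>S j w\<bar> < \<epsilon>} \<in> sets (F (\<tau> i))" if "j < i" for j
   proof -
    have [measurable]: "S j \<in> borel_measurable (F (\<tau> i))"
     by (rule meas_F_mono[OF Sad]) (use tau(1)[of j] tau(2)[of j i] i that in auto)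
    show ?thesis by measurable
   qed
   then have "{w\<in>space (F (\<tau> i)). \<forall>j\<in>{..<i}. \<bar>S j w\<bar> < \<epsilon>} \<in> sets (F (\<tau> i))" by (intro sets.sets_Collect_finite_All) auto
   moreover have "?A = {w\<in>space (F (\<tau> i)). \<epsilon> <= \<bar>S i w\<bar>} \<inter> {w\<in>space (F (\<tau> i)). \<forall>j\<in>{..<i}. \<bar>S j w\<bar> < \<epsilon>}" by (auto simp: spF)
   ultimately show ?thesis using 1 by auto
  qed
  have AM: "?A \<in> events" using A subalg_M[OF tau(1)[OF i]] by (auto simp: subalgebra_def)
  have Um: "(%w. indicator ?A w * S i w) \<in> borel_measurable (F (\<tau> i))"
   using A Sad[OF i] by (intro borel_measurable_times borel_measurable_indicator)
  have Ui: "integrable M (%w. indicator ?A w * S i w)"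
   using integrable_real_mult_indicator[OF AM int[OF i]] by (simp add: mult.commute)
  have "has_bochner_integral M (%w. \<Sum>j\<in>{i..<m}. (indicator ?A w * S i w) * sint (l j) w) (\<Sum>j\<in>{i..<m}. 0)"
  proof (intro has_bochner_integral_sum)
   fix j assume j: "j \<in> {i..<m}"
   show "has_bochner_integral M (%w. (indicator ?A w * S i w) * sint (l j) w) 0"
    by (rule past_sint[OF l]) (use j tau(1)[of j] tau(2)[of i j] tau(1)[OF i] meas_F_mono[OF Um] Ui in auto)
  qed
  moreover have "S m w - S i w = (\<Sum>j\<in>{i..<m}. sint (l j) w)" for w
  proof -
   have "{..<m} = {..<i} \<union> {i..<m}" "{..<i} \<inter> {i..<m} = {}" using i by auto
   then have "S m w = S i w + (\<Sum>j\<in>{i..<m}. sint (l j) w)" unfolding S_def by (simp add: sum.union_disjoint)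
   then show ?thesis by simp
  qed
  ultimately show ?thesis by (simp add: sum_distrib_left mult.assoc)
 qed
 have K: "prob {w\<in>space M. \<exists>i\<le>m. \<epsilon> <= \<bar>S i w\<bar>} * \<epsilon>\<^sup>2 <= expectation (%w. (S m w)\<^sup>2)"
  by (rule kolmogorov_inequality[OF Sm sq orth e])
 have "N2 M (S m) = ennreal (expectation (%w. (S m w)\<^sup>2))"
  unfolding N2_def using sq[of m] by (simp add: nn_integral_eq_integral)
 moreover have "ennreal (\<epsilon>\<^sup>2) * emeasure M {w\<in>space M. \<exists>i\<le>m. \<epsilon> <= \<bar>S i w\<bar>} = ennreal (prob {w\<in>space M. \<exists>i\<le>m. \<epsilon> <= \<bar>S i w\<bar>} * \<epsilon>\<^sup>2)"
  by (simp add: emeasure_eq_measure ennreal_mult mult.commute)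
 ultimately show ?thesis using ennreal_leI[OF K] unfolding S_def[abs_def] by simp
qed

end

text \<open>A crude constant growing with \<open>n\<close> is acceptable, because \<eta> is chosen
  after the number of summands.\<close>

lemma N2_sum_le:
 fixes f :: "nat => 'b => real"
 assumes "!!j. j < n ==> f j \<in> borel_measurable \<mu>" "!!j. j < n ==> N2 \<mu> (f j) <= ennreal \<eta>" "\<eta> >= 0"
 shows "N2 \<mu> (%x. \<Sum>j<n. f j x) <= ennreal (4 ^ n * \<eta>)"
 using assms
proof (induction n)
 case (Suc n)
 have "N2 \<mu> (%x. (\<Sum>j<n. f j x) + f n x) <= 2 * N2 \<mu> (%x. \<Sum>j<n. f j x) + 2 * N2 \<mu> (f n)"
  by (rule N2_add) (use Suc.prems in \<open>auto intro!: borel_measurable_sum\<close>)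
 also have "... <= 2 * ennreal (4 ^ n * \<eta>) + 2 * ennreal \<eta>"
  using Suc by (intro add_mono mult_left_mono) auto
 also have "... = ennreal (2 * (4 ^ n * \<eta>) + 2 * \<eta>)"
 proof -
  have "2 * ennreal (4 ^ n * \<eta>) = ennreal (2 * (4 ^ n * \<eta>))" "2 * ennreal \<eta> = ennreal (2 * \<eta>)"
   using \<open>\<eta> >= 0\<close> by (subst ennreal_mult; simp)+
  moreover have "0 <= 2 * (4 ^ n * \<eta>)" "0 <= 2 * \<eta>" using \<open>\<eta> >= 0\<close> by auto
  ultimately show ?thesis by (simp only: ennreal_plus)
 qed
 also have "... <= ennreal (4 ^ Suc n * \<eta>)"
 proof (rule ennreal_leI)
  have "1 * \<eta> <= 4 ^ n * \<eta>" using \<open>\<eta> >= 0\<close> by (intro mult_right_mono) auto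
  then have "2 * \<eta> <= 2 * (4 ^ n * \<eta>)" by linarith
  moreover have "4 ^ Suc n * \<eta> = 2 * (4 ^ n * \<eta>) + 2 * (4 ^ n * \<eta>)" by simp
  ultimately show "2 * (4 ^ n * \<eta>) + 2 * \<eta> <= 4 ^ Suc n * \<eta>" by linarith
 qed
 finally show ?case by simp
qed simp

lemma cauchy_at_top_real:
 fixes V :: "real => real"
 assumes "!!e. e > 0 ==> \<exists>n::nat. \<forall>t\<ge>real n. \<bar>V t - V (real n)\<bar> <= e"
 shows "\<exists>L. (V \<longlongrightarrow> L) at_top"
proof -
 have "Cauchy (%n. V (real n))"
 proof (rule metric_CauchyI)
  fix e :: real assume "e > 0"
  then obtain N :: nat where N: "!!t. t >= real N ==> \<bar>V t - V (real N)\<bar> <= e / 3" using assms[of "e / 3"] by auto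
  have "dist (V (real m)) (V (real n)) < e" if "m >= N" "n >= N" for m n
  proof -
   have tri: "\<bar>x - y\<bar> < e" if "\<bar>x - z\<bar> <= e / 3" "\<bar>y - z\<bar> <= e / 3" for x y z :: real
    using that \<open>e > 0\<close> by linarith
   show ?thesis unfolding dist_real_def by (rule tri[OF N N]) (use that in auto)
  qed
  then show "\<exists>M. \<forall>m\<ge>M. \<forall>n\<ge>M. dist (V (real m)) (V (real n)) < e" by blast
 qed
 then obtain L where L: "(%n. V (real n)) \<longlonglongrightarrow> L" using Cauchy_convergent convergent_def by blast
 have "(V \<longlongrightarrow> L) at_top"
 proof (rule tendstoI)
  fix e :: real assume "e > 0"
  then obtain N :: nat where N: "!!t. t >= real N ==> \<bar>V t - V (real N)\<bar> <= e / 3" using assms[of "e / 3"] by auto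
  have "(%n. \<bar>V (real n) - V (real N)\<bar>) \<longlonglongrightarrow> \<bar>L - V (real N)\<bar>" by (intro tendsto_intros L)
  then have "\<bar>L - V (real N)\<bar> <= e / 3"
   by (rule LIMSEQ_le_const2) (use N in \<open>auto intro!: exI[of _ N]\<close>)
  then have "dist (V t) L < e" if "t >= real N" for t
   using N[OF that] \<open>e > 0\<close> unfolding dist_real_def by linarith
  then show "\<forall>\<^sub>F t in at_top. dist (V t) L < e" unfolding eventually_at_top_linorder by blast
 qed
 then show ?thesis by blast
qed

context brownian begin

text \<open>One list serves every version \<open>I\<close> at once, because versions are compared
  with it only through \<open>wi_dist\<close>.\<close>

lemma approx_steps:
 assumes h: "continuous_on {0..} h" and uv: "0 <= u" "u <= v" and d: "\<delta> > 0"
 shows "\<exists>l. valid l \<and> steps_in u v l \<and> (\<forall>I. wi (%s. indicator {u<..v} s *\<^sub>R h s) I \<longrightarrow> N2 M (%w. I w - sint l w) <= ennreal \<delta>)"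
proof -
 have "\<forall>\<^sub>F N in sequentially. N2 lborel (%s. gstep u v 0 N h s - indicator {u<..v} s *\<^sub>R h s) < ennreal (\<delta> / 4)"
  by (rule order_tendstoD(2)[OF gstep_N2]) (use d uv continuous_on_subset[OF h, of "{u..v}"] in auto)
 then obtain N where app: "N2 lborel (%s. gstep u v 0 N h s - indicator {u<..v} s *\<^sub>R h s) < ennreal (\<delta> / 4)"
  unfolding eventually_sequentially by blast
 define \<tau> where "\<tau> i = u + (v - u) * real i / real N" for i
 define l where "l = grid N \<tau> (%i _. h (\<tau> i))"
 have tau_mono: "\<tau> i <= \<tau> (Suc i)" for i unfolding \<tau>_def using uv by (intro add_left_mono divide_right_mono mult_left_mono) auto
 have tau_u: "u <= \<tau> i" for i unfolding \<tau>_def using uv by simp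
 have tau_v: "\<tau> (Suc i) <= v" if "i < N" for i
 proof -
  have "(v - u) * (real (Suc i) / real N) <= (v - u) * 1" using that uv by (intro mult_left_mono) auto
  then show ?thesis by (simp add: \<tau>_def)
 qed
 have bc: "bounded ((%_. c) ` X)" for c :: "real^'e" and X :: "'a set" by (rule bounded_subset[of "{c}"]) auto
 have v: "valid l" unfolding l_def valid_grid using tau_mono order_trans[OF uv(1) tau_u] bc by auto
 have s: "steps_in u v l" unfolding l_def steps_in_def grid_def using tau_u tau_v by auto
 have sv: "sval l w s = gstep u v 0 N h s" for w s unfolding l_def sval_grid gstep_def \<tau>_def by simp
 have gm: "gstep u v 0 N h \<in> borel_measurable borel" unfolding gstep_def by measurable
 have w: "wi (gstep u v 0 N h) (sint l)" by (rule wi_sint[OF v sv gm])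
 have "N2 M (%w. I w - sint l w) <= ennreal \<delta>" if I: "wi (%s. indicator {u<..v} s *\<^sub>R h s) I" for I
 proof -
  have "N2 M (%w. I w - sint l w) <= 4 * N2 lborel (%s. indicator {u<..v} s *\<^sub>R h s - gstep u v 0 N h s)"
   by (rule wi_dist[OF I w])
  also have "... <= 4 * ennreal (\<delta> / 4)" using app by (subst N2_commute) (simp add: mult_left_mono)
  also have "... = ennreal \<delta>" using ennreal_mult[of 4 "\<delta> / 4"] d by simp
  finally show ?thesis .
 qed
 then show ?thesis using v s by blast
qed

lemma wi_interval:
 assumes W: "!!t. t >= 0 ==> wi (%s. indicator {0..t} s *\<^sub>R h s) (W t)" and ab: "0 <= a" "a <= b"
 shows "wi (%s. indicator {a<..b} s *\<^sub>R h s) (%w. W b w - W a w)"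
proof -
 have "wi (%s. indicator {0..b} s *\<^sub>R h s - indicator {0..a} s *\<^sub>R h s) (%w. W b w - W a w)"
  by (intro wi_diff W) (use ab in auto)
 moreover have "(%s. indicator {0..b} s *\<^sub>R h s - indicator {0..a} s *\<^sub>R h s) = (%s. indicator {a<..b} s *\<^sub>R h s)"
  using ab by (auto simp: fun_eq_iff split: split_indicator)
 ultimately show ?thesis by simp
qed

text \<open>Finitely many values of arbitrary versions are compared with step integrals, for which
  the maximal inequality is available. Exceeding \<open>2 * \<epsilon>\<close> forces either a step
  sum or one of the errors \<open>E i\<close> to reach \<epsilon>; the errors are made arbitrarily
  small, and the constant \<open>8 = 2 * 4\<close> remains.\<close>

lemma wi_maximal:
 fixes m :: nat and \<tau> :: "nat => real"
 assumes h: "continuous_on {0..} h" and W: "!!t. t >= 0 ==> wi (%s. indicator {0..t} s *\<^sub>R h s) (W t)"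
  and tau: "!!i. 0 <= \<tau> i" "!!i j. i <= j ==> \<tau> i <= \<tau> j" and e: "\<epsilon> > 0"
 shows "ennreal (\<epsilon>\<^sup>2) * emeasure M {w\<in>space M. \<exists>i\<le>m. 2 * \<epsilon> <= \<bar>W (\<tau> i) w - W (\<tau> 0) w\<bar>} <= 8 * N2 lborel (%s. indicator {\<tau> 0<..} s *\<^sub>R h s)"
proof (rule ennreal_le_epsilon)
 fix \<delta> :: real assume d: "\<delta> > 0"
 \<comment> \<open>The errors enter \<open>m + 3\<close> times, twice through \<open>E m\<close> and
   once for each of the \<open>m + 1\<close> exceptional events, and each costs at most
   \<open>4 ^ m * \<eta>\<close>.\<close>
 define \<eta> where "\<eta> = \<delta> / ((real m + 3) * 4 ^ m)"
 have eta: "\<eta> > 0" using d by (simp add: \<eta>_def)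
 have "\<forall>i. \<exists>l. valid l \<and> steps_in (\<tau> i) (\<tau> (Suc i)) l \<and> (\<forall>I. wi (%s. indicator {\<tau> i<..\<tau> (Suc i)} s *\<^sub>R h s) I \<longrightarrow> N2 M (%w. I w - sint l w) <= ennreal \<eta>)"
  by (intro allI approx_steps h tau eta) simp
 from choice[OF this] obtain l where l: "!!i. valid (l i)" "!!i. steps_in (\<tau> i) (\<tau> (Suc i)) (l i)"
  and ln: "!!i I. wi (%s. indicator {\<tau> i<..\<tau> (Suc i)} s *\<^sub>R h s) I ==> N2 M (%w. I w - sint (l i) w) <= ennreal \<eta>" by blast
 have Wm [measurable]: "W (\<tau> i) \<in> borel_measurable M" for i using wi_measurable(2)[OF W[OF tau(1)]] .
 have lm [measurable]: "sint (l i) \<in> borel_measurable M" for i by (rule sint_measurable[OF l(1)])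
 define S where "S i w = (\<Sum>j<i. sint (l j) w)" for i w
 define E where "E i w = W (\<tau> i) w - W (\<tau> 0) w - S i w" for i w
 have Sm [measurable]: "S i \<in> borel_measurable M" for i unfolding S_def[abs_def] by measurable
 have Em [measurable]: "E i \<in> borel_measurable M" for i unfolding E_def[abs_def] by measurable
 have D: "N2 M (%w. (W (\<tau> (Suc i)) w - W (\<tau> i) w) - sint (l i) w) <= ennreal \<eta>" for i
  by (intro ln wi_interval W tau) simp_all
 have EN: "N2 M (E i) <= ennreal (4 ^ m * \<eta>)" if "i <= m" for i
 proof -
  have "E i w = (\<Sum>j<i. (W (\<tau> (Suc j)) w - W (\<tau> j) w) - sint (l j) w)" for w
   using sum_lessThan_telescope[of "%j. W (\<tau> j) w" i] by (simp add: E_def S_def sum_subtractf)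
  then have "E i = (%w. \<Sum>j<i. (W (\<tau> (Suc j)) w - W (\<tau> j) w) - sint (l j) w)" by (rule ext)
  then have "N2 M (E i) <= ennreal (4 ^ i * \<eta>)" using N2_sum_le[OF _ D, of i] eta by simp
  also have "... <= ennreal (4 ^ m * \<eta>)" using that eta by (intro ennreal_leI mult_right_mono power_increasing) auto
  finally show ?thesis .
 qed
 let ?bad = "{w\<in>space M. \<exists>i\<le>m. 2 * \<epsilon> <= \<bar>W (\<tau> i) w - W (\<tau> 0) w\<bar>}"
 let ?A = "{w\<in>space M. \<exists>i\<le>m. \<epsilon> <= \<bar>S i w\<bar>}"
 let ?C = "%i. {w\<in>space M. \<epsilon> <= \<bar>E i w\<bar>}"
 have Ci: "?C i \<in> events" for i by measurable
 have Ae: "?A \<in> events" by measurable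
 have sub: "?bad \<subseteq> ?A \<union> (\<Union>i\<in>{..m}. ?C i)"
 proof
  fix w assume "w \<in> ?bad"
  then obtain i where i: "w \<in> space M" "i <= m" "2 * \<epsilon> <= \<bar>W (\<tau> i) w - W (\<tau> 0) w\<bar>" by auto
  have "W (\<tau> i) w - W (\<tau> 0) w = S i w + E i w" by (simp add: E_def)
  then have "\<epsilon> <= \<bar>S i w\<bar> \<or> \<epsilon> <= \<bar>E i w\<bar>" using i(3) by auto
  then show "w \<in> ?A \<union> (\<Union>i\<in>{..m}. ?C i)" using i by auto
 qed
 have "emeasure M ?bad <= emeasure M (?A \<union> (\<Union>i\<in>{..m}. ?C i))"
  using Ci Ae by (intro emeasure_mono sub) auto
 also have "... <= emeasure M ?A + emeasure M (\<Union>i\<in>{..m}. ?C i)"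
  using Ci Ae by (intro emeasure_subadditive) auto
 also have "emeasure M (\<Union>i\<in>{..m}. ?C i) <= (\<Sum>i\<in>{..m}. emeasure M (?C i))"
  using Ci by (intro emeasure_subadditive_finite) auto
 finally have "emeasure M ?bad <= emeasure M ?A + (\<Sum>i\<in>{..m}. emeasure M (?C i))" by (simp add: add_left_mono)
 then have "ennreal (\<epsilon>\<^sup>2) * emeasure M ?bad <= ennreal (\<epsilon>\<^sup>2) * emeasure M ?A + (\<Sum>i\<in>{..m}. ennreal (\<epsilon>\<^sup>2) * emeasure M (?C i))"
  by (simp only: distrib_left[symmetric] sum_distrib_left[symmetric]) (rule mult_left_mono, simp_all)
 also have "ennreal (\<epsilon>\<^sup>2) * emeasure M ?A <= N2 M (S m)"
  unfolding S_def[abs_def] by (rule step_kolmogorov[where \<tau> = \<tau>]) (auto intro: tau l e)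
 also have "N2 M (S m) <= 2 * N2 M (%w. W (\<tau> m) w - W (\<tau> 0) w) + 2 * N2 M (E m)"
  using N2_diff[of "%w. W (\<tau> m) w - W (\<tau> 0) w" M "E m"] by (simp add: E_def)
 also have "N2 M (%w. W (\<tau> m) w - W (\<tau> 0) w) <= 4 * N2 lborel (%s. indicator {\<tau> 0<..\<tau> m} s *\<^sub>R h s)"
  by (intro wi_bound wi_interval W tau) simp_all
 also have "N2 lborel (%s. indicator {\<tau> 0<..\<tau> m} s *\<^sub>R h s) <= N2 lborel (%s. indicator {\<tau> 0<..} s *\<^sub>R h s)"
  by (intro N2_mono) (auto split: split_indicator)
 also have "N2 M (E m) <= ennreal (4 ^ m * \<eta>)" by (rule EN) simp
 also have "(\<Sum>i\<in>{..m}. ennreal (\<epsilon>\<^sup>2) * emeasure M (?C i)) <= (\<Sum>i\<in>{..m}. ennreal (4 ^ m * \<eta>))"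
  by (intro sum_mono order_trans[OF N2_ge[OF Em e] EN]) auto
 finally have "ennreal (\<epsilon>\<^sup>2) * emeasure M ?bad <= 2 * (4 * N2 lborel (%s. indicator {\<tau> 0<..} s *\<^sub>R h s)) + 2 * ennreal (4 ^ m * \<eta>) + (\<Sum>i\<in>{..m}. ennreal (4 ^ m * \<eta>))"
  by (simp add: add_mono mult_left_mono)
 also have "... = 8 * N2 lborel (%s. indicator {\<tau> 0<..} s *\<^sub>R h s) + (2 * ennreal (4 ^ m * \<eta>) + (\<Sum>i\<in>{..m}. ennreal (4 ^ m * \<eta>)))"
  by (simp add: mult.assoc[symmetric] add.assoc)
 also have "2 * ennreal (4 ^ m * \<eta>) + (\<Sum>i\<in>{..m}. ennreal (4 ^ m * \<eta>)) = ennreal \<delta>"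
 proof -
  define z where "z = 4 ^ m * \<eta>"
  have z: "z >= 0" using eta by (simp add: z_def)
  have "2 * ennreal z = ennreal (2 * z)" using z by (subst ennreal_mult) auto
  moreover have "(\<Sum>i\<in>{..m}. ennreal z) = ennreal (\<Sum>i\<in>{..m}. z)" using z by (intro sum_ennreal) auto
  moreover have "0 <= 2 * z" "0 <= (\<Sum>i\<in>{..m}. z)" using z by (auto intro: sum_nonneg)
  ultimately have "2 * ennreal z + (\<Sum>i\<in>{..m}. ennreal z) = ennreal (2 * z + (\<Sum>i\<in>{..m}. z))" by (simp only: ennreal_plus)
  also have "2 * z + (\<Sum>i\<in>{..m}. z) = (real m + 3) * z" by (simp add: algebra_simps)
  also have "... = \<delta>" by (simp add: z_def \<eta>_def)
  finally show ?thesis by (simp add: z_def)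
 qed
 finally show "ennreal (\<epsilon>\<^sup>2) * emeasure M ?bad <= 8 * N2 lborel (%s. indicator {\<tau> 0<..} s *\<^sub>R h s) + ennreal \<delta>" .
qed

text \<open>The version \<open>V\<close> agrees with \<open>W\<close> almost surely at each time,
  hence almost surely at all points of countably many grids. The maximal inequality on grids
  controls the oscillation after time \<open>n\<close> by a tail of the integrand, and continuity of
  \<open>V\<close> extends this control to all times. The limit is identified with \<open>I\<close>
  in mean square along the integers.\<close>

theorem wi_converges:
 assumes h: "continuous_on {0..} h" and fin: "N2 lborel (%s. indicator {0..} s *\<^sub>R h s) < \<infinity>"
  and W: "!!t. t >= 0 ==> wi (%s. indicator {0..t} s *\<^sub>R h s) (W t)"
  and V: "AE w in M. continuous_on {0..} (%t. V t w)" "!!t. t >= 0 ==> AE w in M. V t w = W t w"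
  and I: "wi (%s. indicator {0..} s *\<^sub>R h s) I"
 shows "AE w in M. ((%t. V t w) \<longlongrightarrow> I w) at_top"
proof -
 let ?h = "%s. indicator {0..} s *\<^sub>R h s"
 have hm: "?h \<in> borel_measurable borel" by (rule wi_measurable(1)[OF I])
 have Wm [measurable]: "t >= 0 ==> W t \<in> borel_measurable M" for t using wi_measurable(2)[OF W] .
 have Im [measurable]: "I \<in> borel_measurable M" by (rule wi_measurable(2)[OF I])
 have tail: "(%n::nat. N2 lborel (%s. indicator {real n<..} s *\<^sub>R h s)) \<longlonglongrightarrow> 0"
 proof -
  have "(%s. indicator {real n<..} s *\<^sub>R ?h s) = (%s. indicator {real n<..} s *\<^sub>R h s)" for n :: nat
   by (auto simp: fun_eq_iff split: split_indicator)
  then show ?thesis using N2_indicator_tail[OF hm fin] by simp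
 qed
 \<comment> \<open>Level \<open>k\<close> covers \<open>[n, n + k]\<close> with mesh
   \<open>1 / 2 ^ k\<close>; both range and resolution grow, so that the bad events increase with
   \<open>k\<close>.\<close>
 define g where "g n k j = real n + real j / 2 ^ k" for n k j :: nat
 define bad where "bad \<epsilon> n k = {w\<in>space M. \<exists>j\<le>k * 2 ^ k. 2 * \<epsilon> <= \<bar>W (g n k j) w - W (g n k 0) w\<bar>}" for \<epsilon> n k
 have g0: "g n k j >= 0" for n k j by (simp add: g_def)
 have badm: "bad \<epsilon> n k \<in> events" for \<epsilon> n k
 proof -
  have [measurable]: "W (g n k j) \<in> borel_measurable M" for j using Wm[OF g0] .
  show ?thesis unfolding bad_def by measurable
 qed
 have bad_inc: "bad \<epsilon> n k \<subseteq> bad \<epsilon> n (Suc k)" for \<epsilon> n k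
 proof
  fix w assume "w \<in> bad \<epsilon> n k"
  then obtain j where j: "w \<in> space M" "j <= k * 2 ^ k" "2 * \<epsilon> <= \<bar>W (g n k j) w - W (g n k 0) w\<bar>" by (auto simp: bad_def)
  have "g n (Suc k) (2 * j) = g n k j" "g n (Suc k) 0 = g n k 0" by (auto simp: g_def)
  moreover have "2 * j <= Suc k * 2 ^ Suc k" using j(2) by simp
  ultimately show "w \<in> bad \<epsilon> n (Suc k)" using j unfolding bad_def by (intro CollectI conjI exI[of _ "2 * j"]) auto
 qed
 have bad_bound: "ennreal (\<epsilon>\<^sup>2) * emeasure M (\<Union>k. bad \<epsilon> n k) <= 8 * N2 lborel (%s. indicator {real n<..} s *\<^sub>R h s)" if e: "\<epsilon> > 0" for \<epsilon> n
 proof -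
  have "ennreal (\<epsilon>\<^sup>2) * emeasure M (bad \<epsilon> n k) <= 8 * N2 lborel (%s. indicator {g n k 0<..} s *\<^sub>R h s)" for k
   unfolding bad_def by (rule wi_maximal[OF h W]) (use e in \<open>auto simp: g_def divide_right_mono\<close>)
  then have b: "ennreal (\<epsilon>\<^sup>2) * emeasure M (bad \<epsilon> n k) <= 8 * N2 lborel (%s. indicator {real n<..} s *\<^sub>R h s)" for k
   by (simp add: g_def)
  have "(SUP k. emeasure M (bad \<epsilon> n k)) = emeasure M (\<Union>k. bad \<epsilon> n k)"
   by (rule SUP_emeasure_incseq) (use badm in auto, rule incseq_SucI, rule bad_inc)
  then have "ennreal (\<epsilon>\<^sup>2) * emeasure M (\<Union>k. bad \<epsilon> n k) = (SUP k. ennreal (\<epsilon>\<^sup>2) * emeasure M (bad \<epsilon> n k))"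
   by (metis SUP_mult_left_ennreal)
  also have "... <= 8 * N2 lborel (%s. indicator {real n<..} s *\<^sub>R h s)" by (intro SUP_least b)
  finally show ?thesis .
 qed
 \<comment> \<open>If every integer \<open>n\<close> is bad, the probability is controlled by each
   tail of the integrand, and these tend to \<open>0\<close>.\<close>
 have null: "emeasure M (\<Inter>n. \<Union>k. bad \<epsilon> n k) = 0" if e: "\<epsilon> > 0" for \<epsilon>
 proof -
  have "ennreal (\<epsilon>\<^sup>2) * emeasure M (\<Inter>n. \<Union>k. bad \<epsilon> n k) <= 8 * N2 lborel (%s. indicator {real n<..} s *\<^sub>R h s)" for n :: nat
  proof -
   have "emeasure M (\<Inter>n. \<Union>k. bad \<epsilon> n k) <= emeasure M (\<Union>k. bad \<epsilon> n k)"
    by (rule emeasure_mono) (use badm in auto)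
   then show ?thesis using bad_bound[OF e, of n] by (meson mult_left_mono order_trans zero_le)
  qed
  moreover have "(%n::nat. 8 * N2 lborel (%s. indicator {real n<..} s *\<^sub>R h s)) \<longlonglongrightarrow> 8 * 0"
   by (rule ennreal_tendsto_cmult[OF _ tail]) simp
  ultimately have "ennreal (\<epsilon>\<^sup>2) * emeasure M (\<Inter>n. \<Union>k. bad \<epsilon> n k) <= 8 * 0"
   by (intro LIMSEQ_le_const) auto
  then show ?thesis using e by (simp add: ennreal_eq_0_iff)
 qed
 have good: "AE w in M. \<exists>n. \<forall>k. w \<notin> bad (1 / real (Suc q)) n k" for q
 proof -
  have "(\<Inter>n. \<Union>k. bad (1 / real (Suc q)) n k) \<in> null_sets M"
   using null[of "1 / real (Suc q)"] badm by (intro null_setsI) auto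
  from AE_not_in[OF this] show ?thesis by eventually_elim auto
 qed
 then have "AE w in M. \<forall>q. \<exists>n. \<forall>k. w \<notin> bad (1 / real (Suc q)) n k" by (simp add: AE_all_countable)
 moreover have "AE w in M. \<forall>n k j. V (g n k j) w = W (g n k j) w"
  using V(2)[OF g0] by (simp add: AE_all_countable)
 ultimately have conv: "AE w in M. \<exists>L. ((%t. V t w) \<longlongrightarrow> L) at_top"
  using V(1) AE_space
 proof eventually_elim
  case (elim w)
  show ?case
  proof (rule cauchy_at_top_real)
   fix e :: real assume e: "e > 0"
   obtain q where "1 / real (Suc q) < e / 2" using nat_approx_posE[of "e / 2"] e by auto
   then have q: "2 * (1 / real (Suc q)) < e" by simp
   obtain n where n: "!!k. w \<notin> bad (1 / real (Suc q)) n k" using elim(1) by blast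
   have "\<bar>V t w - V (real n) w\<bar> <= e" if t: "t >= real n" for t
   proof -
    \<comment> \<open>\<open>j k\<close> is the index of the last grid point not after
      \<open>t\<close>, which is within \<open>1 / 2 ^ k\<close> of it.\<close>
    define j where "j k = nat \<lfloor>(t - real n) * 2 ^ k\<rfloor>" for k
    have jr: "real (j k) <= (t - real n) * 2 ^ k" "(t - real n) * 2 ^ k < real (j k) + 1" for k
    proof -
     have "0 <= (t - real n) * 2 ^ k" using t by simp
     then show "real (j k) <= (t - real n) * 2 ^ k" "(t - real n) * 2 ^ k < real (j k) + 1"
      unfolding j_def by linarith+
    qed
    have dist: "\<bar>g n k (j k) - t\<bar> <= (1/2) ^ k" for k
    proof -
     have "real (j k) / 2 ^ k <= t - real n" using jr(1)[of k] by (simp add: pos_divide_le_eq)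
     moreover have "t - real n < (real (j k) + 1) / 2 ^ k" using jr(2)[of k] by (simp add: pos_less_divide_eq)
     ultimately show ?thesis by (simp add: g_def abs_le_iff add_divide_distrib power_divide)
    qed
    have "(%k. g n k (j k) - t) \<longlonglongrightarrow> 0"
     by (rule Lim_null_comparison[OF _ LIMSEQ_power_zero[of "1/2::real"]]) (use dist in auto)
    then have gl: "(%k. g n k (j k)) \<longlonglongrightarrow> t" by (rule LIM_zero_cancel)
    have "(%k. V (g n k (j k)) w) \<longlonglongrightarrow> V t w"
     by (rule continuous_on_tendsto_compose[OF elim(3) gl]) (use t g0 in auto)
    then have lim: "(%k. \<bar>V (g n k (j k)) w - V (real n) w\<bar>) \<longlonglongrightarrow> \<bar>V t w - V (real n) w\<bar>" by (intro tendsto_intros)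
    obtain K :: nat where K: "t - real n <= real K" using real_arch_simple by blast
    have "\<bar>V (g n k (j k)) w - V (real n) w\<bar> <= e" if "k >= K" for k
    proof -
     have "(t - real n) * 2 ^ k <= real k * 2 ^ k" using K that by (intro mult_right_mono) auto
     with jr(1)[of k] have "real (j k) <= real k * 2 ^ k" by (rule order_trans)
     then have "real (j k) <= real (k * 2 ^ k)" by simp
     then have jk: "j k <= k * 2 ^ k" by (simp only: of_nat_le_iff)
     have "\<bar>W (g n k (j k)) w - W (g n k 0) w\<bar> < 2 * (1 / real (Suc q))"
     proof (rule ccontr)
      assume "\<not> \<bar>W (g n k (j k)) w - W (g n k 0) w\<bar> < 2 * (1 / real (Suc q))"
      then have "w \<in> bad (1 / real (Suc q)) n k"
       unfolding bad_def by (intro CollectI conjI exI[of _ "j k"] jk elim(4)) (simp only: not_less)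
      then show False using n by blast
     qed
     moreover have "g n k 0 = real n" by (simp add: g_def)
     ultimately show ?thesis using elim(2) q by (metis less_eq_real_def less_trans)
    qed
    then show ?thesis by (intro LIMSEQ_le_const2[OF lim]) blast
   qed
   then show "\<exists>n::nat. \<forall>t\<ge>real n. \<bar>V t w - V (real n) w\<bar> <= e" by blast
  qed
 qed
 \<comment> \<open>Taking the limit of the measurable \<open>W\<close> along the integers makes
   \<open>L\<close> measurable; of \<open>V\<close> only its paths and its values up to null sets
   are known.\<close>
 define L where "L w = lim (%n. W (real n) w)" for w
 have VW: "AE w in M. \<forall>n::nat. V (real n) w = W (real n) w" using V(2) by (simp add: AE_all_countable)
 have Lm [measurable]: "L \<in> borel_measurable M" unfolding L_def[abs_def] by (intro borel_measurable_lim_metric Wm) simp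
 have VL: "AE w in M. ((%t. V t w) \<longlongrightarrow> L w) at_top \<and> (%n. W (real n) w) \<longlonglongrightarrow> L w"
  using conv VW
 proof eventually_elim
  case (elim w)
  then obtain l where l: "((%t. V t w) \<longlongrightarrow> l) at_top" by blast
  have "(%n. V (real n) w) \<longlonglongrightarrow> l" by (rule filterlim_compose[OF l filterlim_real_sequentially])
  then have wl: "(%n. W (real n) w) \<longlonglongrightarrow> l" using elim(2) by simp
  then have "L w = l" unfolding L_def by (rule limI)
  then show ?case using l wl by simp
 qed
 have WI: "N2 M (%w. W (real n) w - I w) <= 4 * N2 lborel (%s. indicator {real n<..} s *\<^sub>R h s)" for n :: nat
 proof -
  have "(%s. indicator {0..real n} s *\<^sub>R h s - ?h s) = (%s. - (indicator {real n<..} s *\<^sub>R h s))"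
   by (auto simp: fun_eq_iff split: split_indicator)
  then show ?thesis using wi_dist[OF W I, of "real n"] N2_uminus[of lborel "%s. indicator {real n<..} s *\<^sub>R h s"] by simp
 qed
 have WI0: "(%n::nat. 4 * N2 lborel (%s. indicator {real n<..} s *\<^sub>R h s)) \<longlonglongrightarrow> 4 * 0"
  by (rule ennreal_tendsto_cmult[OF _ tail]) simp
 \<comment> \<open>Fatou along the integers: the values of \<open>W\<close> tend to \<open>L\<close>
   almost surely and to \<open>I\<close> in mean square.\<close>
 have "N2 M (%w. L w - I w) <= 0"
 proof (rule ennreal_le_epsilon)
  fix e :: real assume e: "e > 0"
  have "N2 M (%w. L w - I w) <= ennreal e"
  proof (rule N2_fatou)
   show "(%w. W (real n) w - I w) \<in> borel_measurable M" for n :: nat by measurable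
   show "AE w in M. (%n. W (real n) w - I w) \<longlonglongrightarrow> L w - I w"
    using VL by eventually_elim (intro tendsto_intros, simp)
   have "\<forall>\<^sub>F n in sequentially. 4 * N2 lborel (%s. indicator {real n<..} s *\<^sub>R h s) < ennreal e"
    by (rule order_tendstoD(2)[OF WI0]) (use e in simp)
   then show "\<forall>\<^sub>F n in sequentially. N2 M (%w. W (real n) w - I w) <= ennreal e"
    by eventually_elim (use WI in \<open>meson less_imp_le order_trans\<close>)
  qed
  then show "N2 M (%w. L w - I w) <= 0 + ennreal e" by simp
 qed
 then have "AE w in M. L w - I w = 0" by (subst N2_eq_0_iff[symmetric]) auto
 with VL show ?thesis by eventually_elim simp
qed

end

lemma N2_continuous_finite:
 fixes h :: "real => 'b::{real_normed_vector, second_countable_topology}"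
 assumes "continuous_on {0..t} h"
 shows "N2 lborel (%s. indicator {0..t} s *\<^sub>R h s) < \<infinity>"
proof -
 have "integrable lborel (%s. indicator {0..t} s *\<^sub>R (norm (h s))\<^sup>2)"
  by (rule borel_integrable_compact) (auto intro!: continuous_intros assms)
 then have "(\<integral>\<^sup>+ s. ennreal (norm (indicator {0..t} s *\<^sub>R (norm (h s))\<^sup>2)) \<partial>lborel) < \<infinity>"
  by (simp only: integrable_iff_bounded)
 moreover have "N2 lborel (%s. indicator {0..t} s *\<^sub>R h s) = (\<integral>\<^sup>+ s. ennreal (norm (indicator {0..t} s *\<^sub>R (norm (h s))\<^sup>2)) \<partial>lborel)"
  unfolding N2_def by (intro nn_integral_cong) (auto split: split_indicator)
 ultimately show ?thesis by simp
qed

section \<open>Integration by parts for a continuous version\<close>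

context brownian begin

text \<open>The same Riemann sums are read in two ways: along a path they converge by integration by
  parts, and as Wiener integrals of step multiples of \<open>h\<close> they have integrands that
  converge in mean square. Hence the pathwise limit is a version of the integral of
  \<open>\<phi> s *\<^sub>R h s\<close>.\<close>

lemma wi_by_parts:
 fixes \<phi> \<phi>' :: "real => real"
 assumes h: "continuous_on {0..} h" and J: "!!t. t >= 0 ==> wi (%s. indicator {0..t} s *\<^sub>R h s) (J t)"
  and Y: "AE w in M. continuous_on {0..} (%t. Y t w)" "!!t. t >= 0 ==> AE w in M. Y t w = J t w"
  and d: "!!x. (\<phi> has_real_derivative \<phi>' x) (at x)" and c: "continuous_on UNIV \<phi>'" and t: "0 <= t"
 shows "\<exists>W. wi (%s. indicator {0..t} s *\<^sub>R (\<phi> s *\<^sub>R h s)) W \<and>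
  (AE w in M. \<phi> t * Y t w - (LINT s:{0..t}|lborel. \<phi>' s * Y s w) = W w)"
proof -
 define \<tau> where "\<tau> N i = t * real i / real N" for N i
 have tau: "0 <= \<tau> N i" "\<tau> N i <= \<tau> N (Suc i)" for N i
  using t by (auto simp: \<tau>_def intro!: divide_right_mono mult_left_mono)
 define I where "I N w = (\<Sum>i<N. \<phi> (\<tau> N i) * (J (\<tau> N (Suc i)) w - J (\<tau> N i) w))" for N w
 define hN where "hN N s = (\<Sum>i<N. \<phi> (\<tau> N i) *\<^sub>R (indicator {\<tau> N i<..\<tau> N (Suc i)} s *\<^sub>R h s))" for N s
 have wI: "wi (hN N) (I N)" for N
  unfolding hN_def I_def by (intro wi_sum wi_scale wi_interval J tau)
 let ?h = "%s. indicator {0..t} s *\<^sub>R h s"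
 have hm: "?h \<in> borel_measurable borel" by (rule wi_measurable(1)[OF J[OF t]])
 have phic: "continuous_on UNIV \<phi>" using d by (meson DERIV_isCont continuous_at_imp_continuous_on)
 have phim [measurable]: "\<phi> \<in> borel_measurable borel" using phic by (rule borel_measurable_continuous_onI)
 have conv: "(%N. N2 lborel (%s. hN N s - indicator {0..t} s *\<^sub>R (\<phi> s *\<^sub>R h s))) \<longlonglongrightarrow> 0"
 proof (rule N2_tendsto_0[where h = ?h])
  show "?h \<in> borel_measurable lborel" using hm by simp
  show "N2 lborel ?h < \<infinity>" by (rule N2_continuous_finite) (use h continuous_on_subset in fastforce)
  fix e :: real assume e: "e > 0"
  have "\<forall>\<^sub>F N in sequentially. \<forall>s. norm (gstep 0 t 0 N \<phi> s - indicator {0<..t} s *\<^sub>R \<phi> s) <= e"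
   by (rule gstep_approx[OF _ t e]) (use phic continuous_on_subset in auto)
  then show "\<forall>\<^sub>F N in sequentially. AE s in lborel. norm (hN N s - indicator {0..t} s *\<^sub>R (\<phi> s *\<^sub>R h s)) <= e * norm (?h s)"
  proof eventually_elim
   case (elim N)
   show ?case using AE_lborel_singleton[of 0]
   proof eventually_elim
    case (elim s)
    have hs: "hN N s = gstep 0 t 0 N \<phi> s *\<^sub>R h s"
     unfolding hN_def gstep_def \<tau>_def scaleR_sum_left by (intro sum.cong refl) (simp add: mult.commute)
    show ?case
    proof (cases "s \<in> {0<..t}")
     case True
     have "norm (gstep 0 t 0 N \<phi> s *\<^sub>R h s - \<phi> s *\<^sub>R h s) = \<bar>gstep 0 t 0 N \<phi> s - \<phi> s\<bar> * norm (h s)"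
      by (simp add: scaleR_diff_left[symmetric])
     also have "... <= e * norm (h s)"
      using \<open>\<forall>s. norm (gstep 0 t 0 N \<phi> s - indicator {0<..t} s *\<^sub>R \<phi> s) <= e\<close>[rule_format, of s] True
      by (intro mult_right_mono) auto
     finally show ?thesis using True hs by simp
    next
     case False
     then have "gstep 0 t 0 N \<phi> s = 0" by (intro gstep_outside t) auto
     then show ?thesis using False elim hs e by (auto simp: indicator_def)
    qed
   qed
  qed
 qed
 define W where "W w = lim (%N. I N w)" for w
 have Wm: "W \<in> borel_measurable M"
  unfolding W_def[abs_def] by (intro borel_measurable_lim_metric wi_measurable(2)[OF wI])
 have "AE w in M. \<forall>N i. Y (\<tau> N i) w = J (\<tau> N i) w"
  using Y(2)[OF tau(1)] by (simp add: AE_all_countable)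
 \<comment> \<open>At time \<open>0\<close> the domain of integration is a single point, a null set,
   so the lower boundary term of the integration by parts disappears.\<close>
 moreover have "AE w in M. Y 0 w = 0"
 proof -
  have "AE s in lborel. indicator {0..0::real} s *\<^sub>R h s = 0"
   using AE_lborel_singleton[of 0] by eventually_elim auto
  from wi_unique[OF J wi_zero this] have "AE w in M. J 0 w = 0" by simp
  with Y(2)[of 0] show ?thesis by auto
 qed
 ultimately have lim: "AE w in M. (%N. I N w) \<longlonglongrightarrow> \<phi> t * Y t w - (LINT s:{0..t}|lborel. \<phi>' s * Y s w)"
  using Y(1)
 proof eventually_elim
  case (elim w)
  have "continuous_on {0..t} (%t. Y t w)" using elim(3) by (rule continuous_on_subset) auto
  from riemann_stieltjes_by_parts[OF t this d c]
  show ?case unfolding I_def using elim(1,2) unfolding \<tau>_def[symmetric] by simp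
 qed
 have W: "AE w in M. \<phi> t * Y t w - (LINT s:{0..t}|lborel. \<phi>' s * Y s w) = W w"
  using lim by eventually_elim (simp add: W_def limI)
 have "wi (%s. indicator {0..t} s *\<^sub>R (\<phi> s *\<^sub>R h s)) W"
 proof (rule wi_limit[OF wI conv _ Wm])
  have "(%s. \<phi> s *\<^sub>R ?h s) \<in> borel_measurable borel" using hm by measurable
  moreover have "(%s. \<phi> s *\<^sub>R ?h s) = (%s. indicator {0..t} s *\<^sub>R (\<phi> s *\<^sub>R h s))" by (auto simp: fun_eq_iff)
  ultimately show "(%s. indicator {0..t} s *\<^sub>R (\<phi> s *\<^sub>R h s)) \<in> borel_measurable borel" by simp
  show "AE w in M. (%k. I k w) \<longlonglongrightarrow> W w" using lim W by eventually_elim simp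
 qed
 with W show ?thesis by blast
qed

end

section \<open>The characteristic equation\<close>

lemma identity_measurable_halfline: "sets N = halfline_sets ==> (%s::real. s) \<in> borel_measurable N"
 using measurable_cong_sets[of N "restrict_space borel {0..}" borel borel] measurable_restrict_space1[of "%s::real. s" borel borel "{0..}"]
 by simp

text \<open>By Markov's inequality the sets where the weight \<open>exp (- a * s)\<close> is at
  least \<open>1 / n\<close> have finite measure; they exhaust the half-line because the weight is
  positive.\<close>

lemma sigma_finite_exp_weight:
 assumes sets: "sets N = halfline_sets" and fin: "(\<integral>\<^sup>+ s. ennreal (exp (- a * s)) \<partial>N) < \<infinity>"
 shows "sigma_finite_measure N"
proof
 let ?e = "%s::real. ennreal (exp (- a * s))"
 let ?A = "%n. {s\<in>space N. 1 <= of_nat n * ?e s}"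
 have [measurable]: "(%s::real. s) \<in> borel_measurable N"
  by (rule identity_measurable_halfline[OF sets])
 have "emeasure N (?A n) \<noteq> \<infinity>" for n
 proof -
  have "emeasure N (?A n) <= of_nat n * (\<integral>\<^sup>+ s. ?e s * indicator (space N) s \<partial>N)"
   by (rule nn_integral_Markov_inequality) auto
  also have "(\<integral>\<^sup>+ s. ?e s * indicator (space N) s \<partial>N) = (\<integral>\<^sup>+ s. ?e s \<partial>N)"
   by (intro nn_integral_cong) auto
  also have "of_nat n * (\<integral>\<^sup>+ s. ?e s \<partial>N) < \<infinity>" using fin by (simp add: ennreal_mult_less_top of_nat_less_top)
  finally show ?thesis by simp
 qed
 moreover have "(\<Union>n. ?A n) = space N"
 proof -
  have "\<exists>n. 1 <= of_nat n * ?e s" for s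
  proof -
   obtain n :: nat where "1 / exp (- a * s) <= real n" using real_arch_simple by blast
   then have "1 <= real n * exp (- a * s)" by (simp add: pos_divide_le_eq)
   then have "ennreal 1 <= ennreal (real n * exp (- a * s))" by (rule ennreal_leI)
   then show ?thesis by (intro exI[of _ n]) (simp add: ennreal_mult ennreal_of_nat_eq_real_of_nat)
  qed
  then show ?thesis by auto
 qed
 ultimately show "\<exists>A. countable A \<and> A \<subseteq> sets N \<and> \<Union> A = space N \<and> (\<forall>a\<in>A. emeasure N a \<noteq> \<infinity>)"
  by (intro exI[of _ "range ?A"]) auto
qed

lemma kern_upper_variation:
 fixes \<mu> :: "real set => real^'n^'m"
 assumes mu: "matrix_measure \<mu>" and c: "c = 1 \<or> c = -1"
  and fin: "(\<integral>\<^sup>+ s. ennreal (exp (- a * s)) \<partial>total_variation \<mu>) < \<infinity>"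
 shows "kern (upper_variation (%E. c * \<mu> E $ i $ j)) (%_. 1) a"
proof -
 let ?N = "upper_variation (%E. c * \<mu> E $ i $ j)"
 have le: "(\<integral>\<^sup>+ s. ennreal (exp (- a * s)) \<partial>?N) < \<infinity>"
  using nn_integral_mono_measure[OF _ emeasure_upper_variation_le[OF mu c, of i j], of "%s. ennreal (exp (- a * s))"] fin
  by (auto intro: le_less_trans)
 have [measurable]: "(%s::real. s) \<in> borel_measurable ?N"
  by (rule identity_measurable_halfline) simp
 have "integrable ?N (%s. exp (- a * s))"
  by (rule integrableI_nonneg) (use le in auto)
 then show ?thesis unfolding kern_def using sigma_finite_exp_weight[OF _ le] by auto
qed

definition pos_part :: "(real set => real^'n^'m) => 'm => 'n => real measure" where
 "pos_part \<mu> i j = upper_variation (%E. \<mu> E $ i $ j)"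

definition neg_part :: "(real set => real^'n^'m) => 'm => 'n => real measure" where
 "neg_part \<mu> i j = upper_variation (%E. - \<mu> E $ i $ j)"

definition lap_measure :: "(real set => real^'n^'m) => 'm => 'n => complex => complex" where
 "lap_measure \<mu> i j z = lapk (pos_part \<mu> i j) (%_. 1) z - lapk (neg_part \<mu> i j) (%_. 1) z"

lemma kern_parts:
 assumes "matrix_measure \<mu>" "(\<integral>\<^sup>+ s. ennreal (exp (- a * s)) \<partial>total_variation \<mu>) < \<infinity>"
 shows "kern (pos_part \<mu> i j) (%_. 1) a" "kern (neg_part \<mu> i j) (%_. 1) a"
 using kern_upper_variation[OF assms(1) _ assms(2), of 1] kern_upper_variation[OF assms(1) _ assms(2), of "-1"]
 by (simp_all add: pos_part_def neg_part_def)

lemma char_matrix_entry: "char_matrix \<mu> z $ i $ j = (if i = j then z else 0) - lap_measure \<mu> i j z"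
 by (simp add: char_matrix_def mat_def signed_integral_def lap_measure_def lapk_def pos_part_def neg_part_def)

lemma lapk_bound:
 assumes "kern N (%_. 1) a" "a <= Re z"
 shows "norm (lapk N (%_. 1) z) <= (LINT s|N. exp (- a * s))"
proof -
 have "norm (lapk N (%_. 1) z) <= (LINT s|N. norm (exp (- z * of_real s) * 1))" unfolding lapk_def by (rule Bochner_Integration.integral_norm_bound)
 also have "... <= (LINT s|N. exp (- a * s))"
 proof (rule integral_mono)
  show "integrable N (%s. norm (exp (- z * of_real s) * 1))" by (rule integrable_norm[OF kern_integrable_exp[OF assms]])
  show "integrable N (%s. exp (- a * s))" using assms by (simp add: kern_def)
  fix s assume "s \<in> space N"
  then have "s >= 0" using kern_space[OF assms(1)] by simp
  then have "a * s <= Re z * s" using assms(2) by (intro mult_right_mono)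
  then show "norm (exp (- z * of_real s) * 1) <= exp (- a * s)" by simp
 qed
 finally show ?thesis .
qed

section \<open>Conjugation symmetry and local orders of poles\<close>

lemma lapk_cnj: "lapk N (%_. 1) (cnj z) = cnj (lapk N (%_. 1) z)"
proof -
 have "lapk N (%_. 1) (cnj z) = (LINT s|N. cnj (exp (- z * of_real s) * 1))"
  unfolding lapk_def by (intro Bochner_Integration.integral_cong refl) (simp add: exp_cnj)
 then show ?thesis unfolding lapk_def by (simp only: Bochner_Integration.integral_cnj)
qed

lemma lap_measure_cnj: "lap_measure \<mu> i j (cnj z) = cnj (lap_measure \<mu> i j z)"
 by (simp add: lap_measure_def lapk_cnj)

lemma det_cnj: "det (\<chi> i j. cnj (A $ i $ j)) = cnj (det (A :: complex^'n^'n))"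
 by (simp add: det_def)

lemma matrix_inv_cnj:
 fixes A A' :: "complex^'n^'n"
 assumes "!!i j. A' $ i $ j = cnj (A $ i $ j)" and "det A \<noteq> 0"
 shows "matrix_inv A' $ i $ j = cnj (matrix_inv A $ i $ j)"
proof -
 have A': "A' = (\<chi> i j. cnj (A $ i $ j))" using assms by (simp add: vec_eq_iff)
 have "(\<chi> i' k. if k = i then axis j 1 $ i' else A' $ i' $ k) =
   (\<chi> i' k. cnj ((\<chi> i' k. if k = i then axis j 1 $ i' else A $ i' $ k) $ i' $ k))"
  by (simp add: vec_eq_iff assms axis_def)
 then have "det (\<chi> i' k. if k = i then axis j 1 $ i' else A' $ i' $ k) = cnj (det (\<chi> i' k. if k = i then axis j 1 $ i' else A $ i' $ k))"
  by (simp only: det_cnj)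
 moreover have "det A' = cnj (det A)" unfolding A' by (rule det_cnj)
 ultimately show ?thesis using assms(2) by (simp add: matrix_inv_cofactor)
qed

lemma filterlim_cnj_at: "filterlim cnj (at (cnj l)) (at l)"
proof -
 have "(cnj \<longlongrightarrow> cnj l) (at l)" by (intro tendsto_intros)
 moreover have "\<forall>\<^sub>F z in at l. cnj z \<noteq> cnj l" by (simp add: eventually_at_filter)
 ultimately show ?thesis by (simp add: filterlim_at)
qed

lemma local_order_raise:
 assumes "g analytic_on {l}" "\<forall>\<^sub>F z in at l. f z = g z / (z - l) ^ k" "k <= m"
 shows "\<exists>g. g analytic_on {l} \<and> (\<forall>\<^sub>F z in at l. f z = g z / (z - l) ^ m)"
proof (intro exI[of _ "%z. g z * (z - l) ^ (m - k)"] conjI)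
 show "(%z. g z * (z - l) ^ (m - k)) analytic_on {l}" by (intro analytic_intros assms)
 have "\<forall>\<^sub>F z in at l. z \<noteq> l" by (simp add: eventually_at_filter)
 with assms(2) show "\<forall>\<^sub>F z in at l. f z = g z * (z - l) ^ (m - k) / (z - l) ^ m"
 proof eventually_elim
  case (elim z)
  have "(z - l) ^ m = (z - l) ^ k * (z - l) ^ (m - k)" using assms(3) by (simp add: power_add[symmetric])
  then show ?case using elim by simp
 qed
qed

text \<open>Orders are prescribed only for roots in the closed upper half-plane; the reflection
  \<open>cnj (g (cnj z))\<close> carries the local form to the conjugate root.\<close>

lemma local_form_cnj:
 assumes g: "g analytic_on {l}" and ev: "\<forall>\<^sub>F z in at l. f z = g z / (z - l) ^ k"
  and f: "\<forall>\<^sub>F z in at l. f' (cnj z) = cnj (f z)"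
 shows "\<exists>g. g analytic_on {cnj l} \<and> (\<forall>\<^sub>F z in at (cnj l). f' z = g z / (z - cnj l) ^ k)"
proof (intro exI[of _ "%z. cnj (g (cnj z))"] conjI)
 obtain S where S: "open S" "l \<in> S" "g holomorphic_on S" using g analytic_at by blast
 have op: "open (cnj ` S)"
 proof -
  have "cnj ` S = cnj -` S"
  proof (intro equalityI subsetI)
   fix z assume "z \<in> cnj -` S"
   then show "z \<in> cnj ` S" by (intro image_eqI[of _ _ "cnj z"]) auto
  qed auto
  then show ?thesis using continuous_open_vimage[OF S(1), of cnj] by (simp add: isCont_cnj)
 qed
 have "cnj ` cnj ` S = S" by (simp add: image_image)
 then have "(cnj \<circ> g \<circ> cnj) holomorphic_on cnj ` S"
  using op S(3) by (intro holomorphic_on_compose_cnj_cnj) auto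
 then show "(%z. cnj (g (cnj z))) analytic_on {cnj l}"
  unfolding analytic_at using S(2) op by (intro exI[of _ "cnj ` S"]) (auto simp: o_def)
 have c: "filterlim cnj (at l) (at (cnj l))" using filterlim_cnj_at[of "cnj l"] by simp
 from eventually_conj[OF ev f] have "\<forall>\<^sub>F z in at (cnj l). f (cnj z) = g (cnj z) / (cnj z - l) ^ k \<and> f' (cnj (cnj z)) = cnj (f (cnj z))"
  by (rule eventually_compose_filterlim[OF _ c])
 then show "\<forall>\<^sub>F z in at (cnj l). f' z = cnj (g (cnj z)) / (z - cnj l) ^ k"
  by eventually_elim simp
qed

lemma matrix_inv_inverse_left:
 fixes A :: "'a::field^'n^'n"
 assumes "det A \<noteq> 0"
 shows "A ** matrix_inv A = mat 1" "matrix_inv A ** A = mat 1"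
proof -
 show "A ** matrix_inv A = mat 1" using assms by (intro matrix_inv_inverse) (simp add: invertible_det_nz)
 then show "matrix_inv A ** A = mat 1" by (simp only: matrix_left_right_inverse)
qed

locale char_equation =
 fixes \<mu> :: "real set => real^'d^'d" and a :: real
 assumes mu: "matrix_measure \<mu>" and fin: "(\<integral>\<^sup>+ s. ennreal (exp (- a * s)) \<partial>total_variation \<mu>) < \<infinity>"
begin

definition inv_entry :: "'d => 'd => complex => complex" where
 "inv_entry i j z = matrix_inv (char_matrix \<mu> z) $ i $ j"

lemma lap_measure_holomorphic: "lap_measure \<mu> i j holomorphic_on {z. a < Re z}"
 unfolding lap_measure_def[abs_def] by (intro holomorphic_on_diff lapk_one_holomorphic kern_parts mu fin)

lemma char_entry_holomorphic: "(%z. char_matrix \<mu> z $ i $ j) holomorphic_on {z. a < Re z}"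
 unfolding char_matrix_entry by (cases "i = j") (auto intro!: holomorphic_intros lap_measure_holomorphic)

lemma det_char_holomorphic: "(%z. det (char_matrix \<mu> z)) holomorphic_on {z. a < Re z}"
 by (intro det_holomorphic char_entry_holomorphic)

lemma halfplane_open_connected: "open {z. a < Re z}" "connected {z. a < Re z}"
 by (simp add: open_halfspace_Re_gt) (intro convex_connected convex_halfspace_Re_gt)

definition cofactor :: "'d => 'd => complex => complex" where
 "cofactor i j z = det (\<chi> i' k. if k = i then axis j 1 $ i' else char_matrix \<mu> z $ i' $ k)"

lemma cofactor_holomorphic: "cofactor i j holomorphic_on {z. a < Re z}"
 unfolding cofactor_def[abs_def]
proof (rule det_holomorphic)
 fix i' k
 show "(%z. (\<chi> i' k. if k = i then axis j 1 $ i' else char_matrix \<mu> z $ i' $ k) $ i' $ k) holomorphic_on {z. a < Re z}"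
  by (cases "k = i") (simp_all add: char_entry_holomorphic)
qed

lemma inv_entry_cofactor: "det (char_matrix \<mu> z) \<noteq> 0 ==> inv_entry i j z = cofactor i j z / det (char_matrix \<mu> z)"
 unfolding inv_entry_def cofactor_def by (rule matrix_inv_cofactor)

lemma large_regular:
 obtains m where "m >= 0" "!!z. a <= Re z ==> norm z > m ==> det (char_matrix \<mu> z) \<noteq> 0"
  "!!z i j. a <= Re z ==> norm z > m ==> norm (inv_entry i j z) <= 1 / (norm z - m)"
proof -
 define b where "b i j = (LINT s|pos_part \<mu> i j. exp (- a * s)) + (LINT s|neg_part \<mu> i j. exp (- a * s))" for i j
 define m0 where "m0 = (\<Sum>i\<in>UNIV. \<Sum>j\<in>UNIV. b i j)"
 have b0: "b i j >= 0" for i j unfolding b_def by (intro add_nonneg_nonneg Bochner_Integration.integral_nonneg) auto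
 have bm: "norm (lap_measure \<mu> i j z) <= m0" if "a <= Re z" for i j z
 proof -
  have "norm (lap_measure \<mu> i j z) <= b i j" unfolding lap_measure_def b_def
   by (rule order_trans[OF norm_triangle_ineq4 add_mono[OF lapk_bound lapk_bound]]) (use that kern_parts[OF mu fin] in auto)
  also have "... <= (\<Sum>j\<in>UNIV. b i j)" by (rule member_le_sum) (auto simp: b0)
  also have "... <= m0" unfolding m0_def by (rule member_le_sum) (auto simp: b0 sum_nonneg)
  finally show ?thesis .
 qed
 show thesis
 proof (rule that[of "of_nat CARD('d) * m0"])
  show "0 <= of_nat CARD('d) * m0" unfolding m0_def by (intro mult_nonneg_nonneg sum_nonneg b0) simp
  show "det (char_matrix \<mu> z) \<noteq> 0" if "a <= Re z" "norm z > of_nat CARD('d) * m0" for z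
   by (rule shifted_matrix_inv(1)[where M = "%i j. lap_measure \<mu> i j z" and z = z and m = m0]) (use that bm in \<open>auto simp: char_matrix_entry\<close>)
  show "norm (inv_entry i j z) <= 1 / (norm z - of_nat CARD('d) * m0)" if "a <= Re z" "norm z > of_nat CARD('d) * m0" for z i j
   unfolding inv_entry_def
   by (rule shifted_matrix_inv(2)[where M = "%i j. lap_measure \<mu> i j z" and z = z and m = m0]) (use that bm in \<open>auto simp: char_matrix_entry\<close>)
 qed
qed

lemma det_not_constant: "\<not> (%z. det (char_matrix \<mu> z)) constant_on {z. a < Re z}" if "det (char_matrix \<mu> z0) = 0" "a < Re z0"
proof
 assume "(%z. det (char_matrix \<mu> z)) constant_on {z. a < Re z}"
 then obtain y where y: "!!z. a < Re z ==> det (char_matrix \<mu> z) = y" unfolding constant_on_def by auto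
 obtain m where m: "m >= 0" "!!z. a <= Re z ==> norm z > m ==> det (char_matrix \<mu> z) \<noteq> 0" using large_regular by metis
 have "norm (complex_of_real (\<bar>a\<bar> + m + 1)) = \<bar>a\<bar> + m + 1" using m(1) by (simp only: norm_of_real)
 then have "norm (complex_of_real (\<bar>a\<bar> + m + 1)) > m" using abs_ge_zero[of a] by linarith
 then have "det (char_matrix \<mu> (of_real (\<bar>a\<bar> + m + 1))) \<noteq> 0" by (rule m(2)[rotated]) (use m(1) in auto)
 moreover have "a < Re (complex_of_real (\<bar>a\<bar> + m + 1))" using abs_ge_self[of a] m(1) unfolding Re_complex_of_real by linarith
 ultimately show False using y[of z0] y that by metis
qed

text \<open>The zeros with \<open>Re z >= b\<close> lie in a disc by \<open>large_regular\<close>,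
  hence in a compact part of the open half-plane in which the determinant is holomorphic and, if it
  has a zero at all, not constant.\<close>

lemma finite_roots:
 assumes "a < b" shows "finite {z. b <= Re z \<and> det (char_matrix \<mu> z) = 0}"
proof (cases "\<exists>z. a < Re z \<and> det (char_matrix \<mu> z) = 0")
 case True
 then obtain z0 where z0: "a < Re z0" "det (char_matrix \<mu> z0) = 0" by blast
 obtain m where m: "m >= 0" "!!z. a <= Re z ==> norm z > m ==> det (char_matrix \<mu> z) \<noteq> 0" using large_regular by metis
 let ?K = "cball 0 m \<inter> {z. b <= Re z}"
 have "finite {z\<in>?K. det (char_matrix \<mu> z) = 0}"
 proof (rule holomorphic_compact_finite_zeros[OF det_char_holomorphic halfplane_open_connected])
  show "compact ?K" by (intro compact_Int_closed compact_cball closed_halfspace_Re_ge)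
  show "?K \<subseteq> {z. a < Re z}" using assms by auto
  show "\<not> (%z. det (char_matrix \<mu> z)) constant_on {z. a < Re z}" by (rule det_not_constant[OF z0(2,1)])
 qed
 moreover have "{z. b <= Re z \<and> det (char_matrix \<mu> z) = 0} = {z\<in>?K. det (char_matrix \<mu> z) = 0}"
  using m(2) assms by (force simp: not_le[symmetric])
 ultimately show ?thesis by simp
next
 case False
 then have "{z. b <= Re z \<and> det (char_matrix \<mu> z) = 0} = {}" using assms by force
 then show ?thesis by (simp only: finite.emptyI)
qed

lemma eventually_regular:
 assumes "a < Re l" shows "\<forall>\<^sub>F z in at l. a < Re z \<and> det (char_matrix \<mu> z) \<noteq> 0"
proof -
 define b where "b = (a + Re l) / 2"
 have b: "a < b" "b < Re l" using assms by (auto simp: b_def)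
 have "\<forall>\<^sub>F z in at l. z \<notin> {z. b <= Re z \<and> det (char_matrix \<mu> z) = 0}"
  using islimpt_finite[OF finite_roots[OF b(1)], of l] unfolding islimpt_iff_eventually by simp
 moreover have "\<forall>\<^sub>F z in at l. z \<in> {z. b < Re z}"
  by (rule eventually_at_in_open') (use b open_halfspace_Re_gt in auto)
 ultimately show ?thesis by eventually_elim (use b in auto)
qed

text \<open>Cramer's rule bounds the pole order of every entry by the order of the zero of the
  determinant. Without some admissible exponent the \<open>LEAST\<close> in
  \<open>matrix_pole_order\<close> would carry no information.\<close>

lemma root_order_exists:
 assumes "a < Re l" "det (char_matrix \<mu> l) = 0"
 shows "\<exists>k. \<forall>i j. \<exists>g. g analytic_on {l} \<and> (\<forall>\<^sub>F z in at l. inv_entry i j z = g z / (z - l) ^ k)"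
proof -
 have l: "l \<in> {z. a < Re z}" using assms by simp
 obtain q r k where q: "0 < k" "0 < r" "ball l r \<subseteq> {z. a < Re z}" "q holomorphic_on ball l r"
  "!!w. w \<in> ball l r ==> det (char_matrix \<mu> w) = (w - l) ^ k * q w" "!!w. w \<in> ball l r ==> q w \<noteq> 0"
  using holomorphic_factor_zero_nonconstant[OF det_char_holomorphic halfplane_open_connected l assms(2) det_not_constant[OF assms(2,1)]]
  by metis
 have "\<exists>g. g analytic_on {l} \<and> (\<forall>\<^sub>F z in at l. inv_entry i j z = g z / (z - l) ^ k)" for i j
 proof (intro exI[of _ "%z. cofactor i j z / q z"] conjI)
  have "(%z. cofactor i j z / q z) holomorphic_on ball l r"
   by (intro holomorphic_on_divide holomorphic_on_subset[OF cofactor_holomorphic] q)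
  then show "(%z. cofactor i j z / q z) analytic_on {l}" using q(2) analytic_at_ball by blast
  have "\<forall>\<^sub>F z in at l. z \<in> ball l r - {l}" by (rule eventually_at_in_open) (use q(2) in auto)
  then show "\<forall>\<^sub>F z in at l. inv_entry i j z = cofactor i j z / q z / (z - l) ^ k"
  proof eventually_elim
   case (elim z)
   then have "det (char_matrix \<mu> z) = (z - l) ^ k * q z" "det (char_matrix \<mu> z) \<noteq> 0" using q(5,6)[of z] by auto
   then show ?case using inv_entry_cofactor[of z i j] by (simp add: field_simps)
  qed
 qed
 then show ?thesis by blast
qed

lemma root_order_form:
 assumes "a < Re l" "det (char_matrix \<mu> l) = 0"
 shows "\<exists>g. g analytic_on {l} \<and> (\<forall>\<^sub>F z in at l. inv_entry i j z = g z / (z - l) ^ root_order \<mu> l)"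
proof -
 have "\<forall>i j. \<exists>g. g analytic_on {l} \<and> (\<forall>\<^sub>F z in at l. matrix_inv (char_matrix \<mu> z) $ i $ j = g z / (z - l) ^ root_order \<mu> l)"
  unfolding root_order_def matrix_pole_order_def
  by (rule LeastI_ex) (use root_order_exists[OF assms] in \<open>simp add: inv_entry_def\<close>)
 then show ?thesis unfolding inv_entry_def by blast
qed

lemma inv_entry_cnj: "det (char_matrix \<mu> z) \<noteq> 0 ==> inv_entry i j (cnj z) = cnj (inv_entry i j z)"
 unfolding inv_entry_def by (rule matrix_inv_cnj) (simp_all add: char_matrix_entry lap_measure_cnj)

lemma det_char_cnj: "det (char_matrix \<mu> (cnj z)) = cnj (det (char_matrix \<mu> z))"
proof -
 have "char_matrix \<mu> (cnj z) = (\<chi> i j. cnj (char_matrix \<mu> z $ i $ j))"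
  by (simp add: vec_eq_iff char_matrix_entry lap_measure_cnj)
 then show ?thesis by (simp only: det_cnj)
qed

end

section \<open>Splitting the spectrum at the dominant line\<close>

lemma tendsto_top_coeff:
 fixes f g :: "complex => complex"
 assumes g: "g analytic_on {l}" and ev: "\<forall>\<^sub>F z in at l. f z = g z / (z - l) ^ k"
 shows "((%z. f z * (z - l) ^ k) \<longlongrightarrow> g l) (at l)"
proof -
 have "isCont g l" using g by (rule analytic_at_imp_isCont)
 then have "(g \<longlongrightarrow> g l) (at l)" by (simp add: isCont_def)
 moreover have "\<forall>\<^sub>F z in at l. g z = f z * (z - l) ^ k"
 proof -
  have "\<forall>\<^sub>F z in at l. z \<noteq> l" by (simp add: eventually_at_filter)
  with ev show ?thesis by eventually_elim simp
 qed
 ultimately show ?thesis by (rule Lim_transform_eventually)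
qed

text \<open>The analytic facts that a single path needs. \<open>G\<close> is the inverse
  characteristic matrix, \<open>c i j l m\<close> are the coefficients of its principal parts and
  \<open>H\<close> is the remainder; \<open>lau\<close>, \<open>zero\<close> and \<open>cc\<close>
  determine the top coefficients at upper roots, at upper roots that are not leading, and at
  conjugates.\<close>

locale spectral_split =
 fixes \<mu> :: "real set => real^'d^'d" and \<alpha> :: real and n :: nat and a \<gamma>0 \<gamma> p :: real and \<Lambda> :: "complex set"
  and H :: "'d => 'd => complex => complex" and C :: "'d => 'd => real"
  and G :: "'d => 'd => complex => complex" and c :: "'d => 'd => complex => nat => complex"
 assumes kp: "!!i j. kern (pos_part \<mu> i j) (%_. 1) a" and km: "!!i j. kern (neg_part \<mu> i j) (%_. 1) a"
  and num: "a <= \<alpha>" "\<gamma>0 < \<gamma>" "\<gamma> < \<alpha>" "p < \<gamma>" and fin: "finite \<Lambda>" and re: "!!l. l \<in> \<Lambda> ==> Re l = \<alpha>"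
  and H: "!!i j. H i j holomorphic_on {z. \<gamma>0 < Re z}"
  and Hb: "!!i j z. Re z >= \<gamma> ==> norm (H i j z) <= C i j / norm (z - of_real p)"
  and dec: "!!i j. \<forall>\<^sub>F w in at_top. G i j (of_real w) = (\<Sum>l\<in>\<Lambda>. \<Sum>m\<le>n. c i j l m / (of_real w - l) ^ Suc m) + H i j (of_real w)"
  and inv: "!!i k. \<forall>\<^sub>F w in at_top. (\<Sum>j\<in>UNIV. G i j (of_real w) * ((if j = k then of_real w else 0) - lap_measure \<mu> j k (of_real w))) = (if i = k then 1 else 0)"
  and res: "!!l i k. l \<in> \<Lambda> ==> (\<Sum>j\<in>UNIV. lap_measure \<mu> i j l * c j k l n) = l * c i k l n"
  and cl: "!!l. l \<in> \<Lambda> ==> cnj l \<in> \<Lambda>" and cc: "!!i j l. l \<in> \<Lambda> ==> c i j (cnj l) n = cnj (c i j l n)"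
  and lead: "leading_roots \<mu> \<subseteq> \<Lambda>" "!!l. l \<in> leading_roots \<mu> ==> 0 <= Im l"
  and zero: "!!i j l. l \<in> \<Lambda> ==> 0 <= Im l ==> l \<notin> leading_roots \<mu> ==> c i j l n = 0"
  and lau: "!!i j l. l \<in> \<Lambda> ==> 0 <= Im l ==> c i j l n = fact n * laurent_matrix \<mu> l n $ i $ j"

text \<open>Only finitely many zeros lie to the right of a line strictly between the integrability
  abscissa and \<alpha>, so those with real part \<alpha> are separated from the others by a strip;
  \<open>\<gamma>0\<close> is the left edge of this strip and \<open>\<gamma>\<close> its
  middle.\<close>

theorem spectral_decomposition:
 fixes \<mu> :: "real set => real^'d^'d"
 assumes mu: "matrix_measure \<mu>" and gap: "laplace_abscissa \<mu> < spectral_abscissa \<mu>"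
  and al: "\<alpha> = real_of_ereal (spectral_abscissa \<mu>)" and n: "n = max_root_order \<mu> - 1"
 obtains a \<gamma>0 \<gamma> p \<Lambda> H C G c where "spectral_split \<mu> \<alpha> n a \<gamma>0 \<gamma> p \<Lambda> H C G c"
proof -
 let ?D = "%z. det (char_matrix \<mu> z)"
 obtain a where fin: "(\<integral>\<^sup>+ s. ennreal (exp (- a * s)) \<partial>total_variation \<mu>) < \<infinity>" and a1: "ereal a < spectral_abscissa \<mu>"
  using gap unfolding laplace_abscissa_def Inf_less_iff by auto
 interpret char_equation \<mu> a by unfold_locales (rule mu, rule fin)
 have lapa: "laplace_abscissa \<mu> <= ereal a" unfolding laplace_abscissa_def by (rule Inf_lower) (use fin in auto)
 have root: "z \<in> char_roots \<mu> \<longleftrightarrow> ?D z = 0" if "a < Re z" for z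
  using le_less_trans[OF lapa, of "ereal (Re z)"] that by (simp add: char_roots_def)
 obtain m where m: "m >= 0" "!!z. a <= Re z ==> norm z > m ==> ?D z \<noteq> 0"
  "!!z i j. a <= Re z ==> norm z > m ==> norm (inv_entry i j z) <= 1 / (norm z - m)" using large_regular by metis
 have le: "ereal (Re z) <= spectral_abscissa \<mu>" if "z \<in> char_roots \<mu>" for z
  unfolding spectral_abscissa_def using that by (intro Sup_upper) auto
 \<comment> \<open>The supremum is finite: zeros with real part beyond \<open>a\<close> have modulus
   at most \<open>m\<close>.\<close>
 have "spectral_abscissa \<mu> <= ereal (max a m)"
  unfolding spectral_abscissa_def
 proof (rule Sup_least)
  fix x assume "x \<in> (%z. ereal (Re z)) ` char_roots \<mu>"
  then obtain z where z: "x = ereal (Re z)" "z \<in> char_roots \<mu>" by auto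
  have "Re z <= m" if "a < Re z"
  proof -
   have "norm z <= m" using m(2)[of z] root[OF that] z(2) that by (meson less_imp_le not_le)
   then show ?thesis using complex_Re_le_cmod[of z] by linarith
  qed
  then have "Re z <= max a m" by (cases "a < Re z") auto
  then show "x <= ereal (max a m)" unfolding z(1) by (simp only: ereal_less_eq)
 qed
 then have sa: "spectral_abscissa \<mu> = ereal \<alpha>" using a1 al by (cases "spectral_abscissa \<mu>") (auto simp: max_def split: if_splits)
 have aa: "a < \<alpha>" using a1 sa by simp
 define b where "b = (a + \<alpha>) / 2"
 have b: "a < b" "b < \<alpha>" using aa by (auto simp: b_def)
 define R where "R = {z. b <= Re z \<and> ?D z = 0}"
 have R: "finite R" unfolding R_def by (rule finite_roots[OF b(1)])
 have Rle: "Re z <= \<alpha>" if "z \<in> R" for z using le[of z] root[of z] that b sa by (auto simp: R_def)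
 define \<Lambda> where "\<Lambda> = {z \<in> R. Re z = \<alpha>}"
 define \<gamma>0 where "\<gamma>0 = Max (insert b (Re ` (R - \<Lambda>)))"
 have g0: "\<gamma>0 < \<alpha>" unfolding \<gamma>0_def using R b(2) Rle by (subst Max_less_iff) (auto simp: \<Lambda>_def less_le)
 have bg: "b <= \<gamma>0" unfolding \<gamma>0_def by (rule Max_ge) (use R in auto)
 have gR: "z \<in> \<Lambda>" if "\<gamma>0 < Re z" "?D z = 0" for z
 proof (rule ccontr)
  assume "z \<notin> \<Lambda>"
  then have "z \<in> R - \<Lambda>" using that bg by (auto simp: R_def)
  then have "Re z <= \<gamma>0" unfolding \<gamma>0_def by (intro Max_ge) (use R in auto)
  then show False using that by simp
 qed
 define \<gamma> where "\<gamma> = (\<gamma>0 + \<alpha>) / 2"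
 define p where "p = \<gamma> - 1"
 have "\<gamma>0 < \<gamma>" "\<gamma> < \<alpha>" using g0 by (auto simp: \<gamma>_def)
 moreover have "p < \<gamma>" by (simp add: p_def)
 ultimately have gam: "\<gamma>0 < \<gamma>" "\<gamma> < \<alpha>" "p < \<gamma>" by auto
 have L: "finite \<Lambda>" "!!l. l \<in> \<Lambda> ==> Re l = \<alpha>" "!!l. l \<in> \<Lambda> ==> ?D l = 0"
  using finite_subset[OF _ R, of \<Lambda>] by (auto simp: \<Lambda>_def R_def)
 have Lcnj: "cnj l \<in> \<Lambda>" if "l \<in> \<Lambda>" for l using that det_char_cnj[of l] by (simp add: \<Lambda>_def R_def)
 have upper: "upper_dominant_roots \<mu> = {l \<in> \<Lambda>. 0 <= Im l}"
  unfolding upper_dominant_roots_def sa using root b by (auto simp: \<Lambda>_def R_def)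
 have leadL: "leading_roots \<mu> \<subseteq> \<Lambda>" "!!l. l \<in> leading_roots \<mu> ==> 0 <= Im l"
  unfolding leading_roots_def upper by auto
 have ord: "root_order \<mu> l <= max_root_order \<mu>" if "l \<in> \<Lambda>" "0 <= Im l" for l
  unfolding max_root_order_def upper by (rule Max_ge) (use that L(1) in auto)
 have La: "a < Re l" if "l \<in> \<Lambda>" for l using L(2)[OF that] aa by simp
 have form_up: "\<exists>g. g analytic_on {l} \<and> (\<forall>\<^sub>F z in at l. inv_entry i j z = g z / (z - l) ^ Suc n)" if l: "l \<in> \<Lambda>" "0 <= Im l" for l i j
 proof -
  obtain g where g: "g analytic_on {l}" "\<forall>\<^sub>F z in at l. inv_entry i j z = g z / (z - l) ^ root_order \<mu> l"
   using root_order_form[OF La L(3)] l by blast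
  \<comment> \<open>\<open>root_order \<mu> l <= max_root_order \<mu> <= Suc n\<close>, where the
    second inequality is safe under truncated subtraction.\<close>
  show ?thesis by (rule local_order_raise[OF g]) (use ord[OF l] n in linarith)
 qed
 have form: "\<exists>g. g analytic_on {l} \<and> (\<forall>\<^sub>F z in at l. inv_entry i j z = g z / (z - l) ^ Suc n)" if l: "l \<in> \<Lambda>" for l i j
 proof (cases "0 <= Im l")
  case False
  obtain g where g: "g analytic_on {cnj l}" "\<forall>\<^sub>F z in at (cnj l). inv_entry i j z = g z / (z - cnj l) ^ Suc n"
   using form_up[OF Lcnj[OF l]] False by auto
  have "\<forall>\<^sub>F z in at (cnj l). inv_entry i j (cnj z) = cnj (inv_entry i j z)"
   using eventually_regular[OF La[OF Lcnj[OF l]]] by eventually_elim (simp add: inv_entry_cnj)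
  from local_form_cnj[OF g this] show ?thesis by simp
 qed (rule form_up[OF l])
 have hol: "inv_entry i j holomorphic_on {z. \<gamma>0 < Re z} - \<Lambda>" for i j
 proof -
  have sub: "{z. \<gamma>0 < Re z} - \<Lambda> \<subseteq> {z. a < Re z}" using bg b by auto
  have "(%z. cofactor i j z / ?D z) holomorphic_on {z. \<gamma>0 < Re z} - \<Lambda>"
   by (intro holomorphic_on_divide holomorphic_on_subset[OF cofactor_holomorphic sub] holomorphic_on_subset[OF det_char_holomorphic sub]) (use gR in auto)
  then show ?thesis
  proof (rule holomorphic_transform)
   fix z assume "z \<in> {z. \<gamma>0 < Re z} - \<Lambda>"
   then have "?D z \<noteq> 0" using gR by auto
   then show "cofactor i j z / ?D z = inv_entry i j z" by (rule inv_entry_cofactor[symmetric])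
  qed
 qed
 \<comment> \<open>Indices and results are packed into pairs so that one use of
   \<open>choice\<close> selects \<open>c\<close> and \<open>H\<close> for all entries.\<close>
 have "\<exists>cH. snd cH holomorphic_on {z. \<gamma>0 < Re z} \<and>
   (\<forall>z \<in> {z. \<gamma>0 < Re z} - \<Lambda>. inv_entry (fst ij) (snd ij) z = (\<Sum>l\<in>\<Lambda>. \<Sum>m\<le>n. fst cH l m / (z - l) ^ Suc m) + snd cH z) \<and>
   (\<forall>l\<in>\<Lambda>. ((%z. inv_entry (fst ij) (snd ij) z * (z - l) ^ Suc n) \<longlongrightarrow> fst cH l n) (at l))" for ij :: "'d \<times> 'd"
 proof -
  obtain c H where "H holomorphic_on {z. \<gamma>0 < Re z}"
   "!!z. z \<in> {z. \<gamma>0 < Re z} - \<Lambda> ==> inv_entry (fst ij) (snd ij) z = (\<Sum>l\<in>\<Lambda>. \<Sum>m\<le>n. c l m / (z - l) ^ Suc m) + H z"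
   "!!l. l \<in> \<Lambda> ==> ((%z. inv_entry (fst ij) (snd ij) z * (z - l) ^ Suc n) \<longlongrightarrow> c l n) (at l)"
  proof (rule partial_fractions[OF _ L(1) _ hol[of "fst ij" "snd ij"] form[of _ "fst ij" "snd ij"]])
   show "open {z. \<gamma>0 < Re z}" by (rule open_halfspace_Re_gt)
   show "\<Lambda> \<subseteq> {z. \<gamma>0 < Re z}" using L(2) g0 by auto
  qed (assumption, rule that, assumption, assumption, assumption)
  then show ?thesis by (intro exI[of _ "(c, H)"]) simp
 qed
 then have "\<forall>ij. \<exists>cH. snd cH holomorphic_on {z. \<gamma>0 < Re z} \<and>
   (\<forall>z \<in> {z. \<gamma>0 < Re z} - \<Lambda>. inv_entry (fst ij) (snd ij) z = (\<Sum>l\<in>\<Lambda>. \<Sum>m\<le>n. fst cH l m / (z - l) ^ Suc m) + snd cH z) \<and>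
   (\<forall>l\<in>\<Lambda>. ((%z. inv_entry (fst ij) (snd ij) z * (z - l) ^ Suc n) \<longlongrightarrow> fst cH l n) (at l))" ..
 from choice[OF this] obtain cH where cH: "\<forall>ij. snd (cH ij) holomorphic_on {z. \<gamma>0 < Re z} \<and>
   (\<forall>z \<in> {z. \<gamma>0 < Re z} - \<Lambda>. inv_entry (fst ij) (snd ij) z = (\<Sum>l\<in>\<Lambda>. \<Sum>m\<le>n. fst (cH ij) l m / (z - l) ^ Suc m) + snd (cH ij) z) \<and>
   (\<forall>l\<in>\<Lambda>. ((%z. inv_entry (fst ij) (snd ij) z * (z - l) ^ Suc n) \<longlongrightarrow> fst (cH ij) l n) (at l))" by blast
 define c where "c i j = fst (cH (i, j))" for i j
 define H where "H i j = snd (cH (i, j))" for i j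
 have Hh: "H i j holomorphic_on {z. \<gamma>0 < Re z}"
  and dec: "!!z. z \<in> {z. \<gamma>0 < Re z} - \<Lambda> ==> inv_entry i j z = (\<Sum>l\<in>\<Lambda>. \<Sum>m\<le>n. c i j l m / (z - l) ^ Suc m) + H i j z"
  and top: "!!l. l \<in> \<Lambda> ==> ((%z. inv_entry i j z * (z - l) ^ Suc n) \<longlongrightarrow> c i j l n) (at l)" for i j
  using cH[rule_format, of "(i, j)"] unfolding c_def H_def by auto
 have "\<exists>C. \<forall>z. Re z >= \<gamma> \<longrightarrow> norm (H i j z) <= C / norm (z - of_real p)" for i j
 proof (rule remainder_bound[OF Hh gam(1,3) L(1) dec])
  fix z assume z: "Re z >= \<gamma>" "norm z >= 2 * m + 1"
  have "norm (inv_entry i j z) <= 1 / (norm z - m)" by (rule m(3)) (use z m(1) gam bg b in auto)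
  also have "... <= 2 / norm z" using z m(1) by (simp add: divide_simps)
  finally show "norm (inv_entry i j z) <= 2 / norm z" .
 qed
 then have "\<forall>i j. \<exists>C. \<forall>z. Re z >= \<gamma> \<longrightarrow> norm (H i j z) <= C / norm (z - of_real p)" by blast
 from this[unfolded choice_iff] obtain C where C: "!!i j z. Re z >= \<gamma> ==> norm (H i j z) <= C i j / norm (z - of_real p)" by blast
 have big: "\<forall>\<^sub>F w in at_top. a < w \<and> \<gamma>0 < w \<and> ?D (of_real w) \<noteq> 0 \<and> complex_of_real w \<notin> \<Lambda>"
  using eventually_gt_at_top[of "\<bar>a\<bar> + m + \<bar>\<alpha>\<bar>"] 
 proof eventually_elim
  case (elim w)
  have w: "a < w" "m < w" "\<alpha> < w" using elim m(1) by linarith+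
  have "?D (of_real w) \<noteq> 0" by (rule m(2)) (use w in auto)
  moreover have "complex_of_real w \<notin> \<Lambda>" using L(2)[of "of_real w"] w by auto
  ultimately show ?case using w g0 by auto
 qed
 \<comment> \<open>Both sides are limits of the same function at \<open>l\<close>, by the
   conjugation symmetry of the entries; uniqueness of limits passes the symmetry on to the top
   coefficients.\<close>
 have cc: "c i j (cnj l) n = cnj (c i j l n)" if l: "l \<in> \<Lambda>" for i j l
 proof -
  have t1: "((%z. inv_entry i j (cnj z) * (cnj z - cnj l) ^ Suc n) \<longlongrightarrow> c i j (cnj l) n) (at l)"
   by (rule filterlim_compose[OF top[OF Lcnj[OF l]] filterlim_cnj_at])
  have t2: "((%z. cnj (inv_entry i j z * (z - l) ^ Suc n)) \<longlongrightarrow> cnj (c i j l n)) (at l)"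
   by (intro tendsto_cnj top l)
  have ev: "\<forall>\<^sub>F z in at l. cnj (inv_entry i j z * (z - l) ^ Suc n) = inv_entry i j (cnj z) * (cnj z - cnj l) ^ Suc n"
   using eventually_regular[OF La[OF l]] by eventually_elim (simp add: inv_entry_cnj)
  show ?thesis by (rule tendsto_unique[OF at_neq_bot t1 Lim_transform_eventually[OF t2 ev]])
 qed
 have lau: "c i j l n = fact n * laurent_matrix \<mu> l n $ i $ j" if l: "l \<in> \<Lambda>" "0 <= Im l" for i j l
 proof -
  obtain g where g: "g analytic_on {l}" "\<forall>\<^sub>F z in at l. inv_entry i j z = g z / (z - l) ^ Suc n" using form[OF l(1)] by blast
  have "c i j l n = g l" using tendsto_unique[OF at_neq_bot top[OF l(1)] tendsto_top_coeff[OF g]] .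
  moreover have "fls_nth (laurent_expansion (inv_entry i j) l) (- int (n + 1)) = g l" by (rule laurent_coeff_top[OF g])
  ultimately show ?thesis by (simp add: laurent_matrix_def inv_entry_def[abs_def])
 qed
 \<comment> \<open>A root of smaller order satisfies the local form with exponent \<open>n\<close>,
   and the additional factor \<open>z - l\<close> sends the limit to \<open>0\<close>.\<close>
 have zero: "c i j l n = 0" if l: "l \<in> \<Lambda>" "0 <= Im l" "l \<notin> leading_roots \<mu>" for i j l
 proof -
  have "root_order \<mu> l < max_root_order \<mu>" using ord[OF l(1,2)] l by (auto simp: leading_roots_def upper)
  then have o: "root_order \<mu> l <= n" using n by linarith
  obtain g0 where g0: "g0 analytic_on {l}" "\<forall>\<^sub>F z in at l. inv_entry i j z = g0 z / (z - l) ^ root_order \<mu> l"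
   using root_order_form[OF La L(3)] l by blast
  obtain g where g: "g analytic_on {l}" "\<forall>\<^sub>F z in at l. inv_entry i j z = g z / (z - l) ^ n"
   using local_order_raise[OF g0 o] by blast
  have "((%z. inv_entry i j z * (z - l) ^ n * (z - l)) \<longlongrightarrow> g l * (l - l)) (at l)"
   by (intro tendsto_mult tendsto_top_coeff[OF g] tendsto_diff tendsto_ident_at tendsto_const)
  then have "((%z. inv_entry i j z * (z - l) ^ Suc n) \<longlongrightarrow> 0) (at l)" by (simp add: mult_ac)
  then show ?thesis using tendsto_unique[OF at_neq_bot top[OF l(1)]] by blast
 qed
 \<comment> \<open>The characteristic matrix times its inverse is the identity; multiplied by
   \<open>(z - l) ^ Suc n\<close> it tends to \<open>0\<close>, so the columns of the top
   coefficient lie in the kernel of the characteristic matrix.\<close>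
 have res: "(\<Sum>j\<in>UNIV. lap_measure \<mu> i j l * c j k l n) = l * c i k l n" if l: "l \<in> \<Lambda>" for i k l
 proof -
  have "((%z. \<Sum>j\<in>UNIV. char_matrix \<mu> z $ i $ j * (inv_entry j k z * (z - l) ^ Suc n)) \<longlongrightarrow> (\<Sum>j\<in>UNIV. char_matrix \<mu> l $ i $ j * c j k l n)) (at l)"
  proof (intro tendsto_sum tendsto_mult top l)
   fix j
   have "continuous_on {z. a < Re z} (%z. char_matrix \<mu> z $ i $ j)" by (rule holomorphic_on_imp_continuous_on[OF char_entry_holomorphic])
   then have "isCont (%z. char_matrix \<mu> z $ i $ j) l"
    using continuous_on_eq_continuous_at[OF halfplane_open_connected(1)] La[OF l] by blast
   then show "((%z. char_matrix \<mu> z $ i $ j) \<longlongrightarrow> char_matrix \<mu> l $ i $ j) (at l)" by (simp add: isCont_def)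
  qed
  moreover have "\<forall>\<^sub>F z in at l. (\<Sum>j\<in>UNIV. char_matrix \<mu> z $ i $ j * (inv_entry j k z * (z - l) ^ Suc n)) = (if i = k then 1 else 0) * (z - l) ^ Suc n"
   using eventually_regular[OF La[OF l]]
  proof eventually_elim
   case (elim z)
   have "(char_matrix \<mu> z ** matrix_inv (char_matrix \<mu> z)) $ i $ k = (mat 1 :: complex^'d^'d) $ i $ k"
    using matrix_inv_inverse_left(1) elim by metis
   then have "(\<Sum>j\<in>UNIV. char_matrix \<mu> z $ i $ j * inv_entry j k z) = (if i = k then 1 else 0)"
    by (simp add: matrix_matrix_mult_def mat_def inv_entry_def)
   then show ?case by (simp only: mult.assoc[symmetric] sum_distrib_right[symmetric])
  qed
  ultimately have "((%z. (if i = k then 1 else 0) * (z - l) ^ Suc n) \<longlongrightarrow> (\<Sum>j\<in>UNIV. char_matrix \<mu> l $ i $ j * c j k l n)) (at l)"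
   by (rule Lim_transform_eventually)
  moreover have "((%z. (if i = k then 1 else 0) * (z - l) ^ Suc n) \<longlongrightarrow> (if i = k then 1 else 0) * (l - l) ^ Suc n) (at l)"
   by (intro tendsto_intros)
  ultimately have "(\<Sum>j\<in>UNIV. char_matrix \<mu> l $ i $ j * c j k l n) = 0"
   using tendsto_unique[OF at_neq_bot] by fastforce
  then show ?thesis
   by (simp add: char_matrix_entry left_diff_distrib sum_subtractf if_distrib[of "%y. y * _"] cong: if_cong)
 qed
 have "spectral_split \<mu> \<alpha> n a \<gamma>0 \<gamma> p \<Lambda> H C inv_entry c"
 proof unfold_locales
  fix i j k l
  show "kern (pos_part \<mu> i j) (%_. 1) a" "kern (neg_part \<mu> i j) (%_. 1) a" by (rule kern_parts[OF mu fin])+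
  show "\<forall>\<^sub>F w in at_top. inv_entry i j (of_real w) = (\<Sum>l\<in>\<Lambda>. \<Sum>m\<le>n. c i j l m / (of_real w - l) ^ Suc m) + H i j (of_real w)"
   using big by eventually_elim (rule dec, simp)
  show "\<forall>\<^sub>F w in at_top. (\<Sum>j\<in>UNIV. inv_entry i j (of_real w) * ((if j = k then of_real w else 0) - lap_measure \<mu> j k (of_real w))) = (if i = k then 1 else 0)"
   using big
  proof eventually_elim
   case (elim w)
   have "(matrix_inv (char_matrix \<mu> (of_real w)) ** char_matrix \<mu> (of_real w)) $ i $ k = (mat 1 :: complex^'d^'d) $ i $ k"
    using matrix_inv_inverse_left(2) elim by metis
   then show ?case by (simp add: matrix_matrix_mult_def mat_def inv_entry_def char_matrix_entry)
  qed
 qed (use aa gam L Hh C Lcnj cc leadL zero lau res in auto)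
 then show thesis by (rule that)
qed

section \<open>Pathwise reduction\<close>

lemma continuous_on_halfline:
 fixes f :: "real => 'b::topological_space"
 assumes "!!T. T >= 0 ==> continuous_on {0..T} f"
 shows "continuous_on {0..} f"
 unfolding continuous_on_eq_continuous_within
proof
 fix t :: real assume t: "t \<in> {0..}"
 have "continuous (at t within {0..t + 1}) f" using assms[of "t + 1"] t by (simp add: continuous_on_eq_continuous_within)
 moreover have "at t within {0..} = at t within {0..t + 1}"
  by (rule at_within_nhd[of t "{..<t + 1}"]) (use t in auto)
 ultimately show "continuous (at t within {0..}) f" by simp
qed

lemma running_integral_continuous:
 fixes G :: "real => 'b::euclidean_space"
 assumes G: "!!T. set_integrable lborel {0..T} G"
 shows "continuous_on {0..} (%t. LINT u:{0..t}|lborel. G u)"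
proof (rule continuous_on_halfline)
 fix T :: real
 have "continuous_on {0..T} (%t. integral {0..t} G)"
  by (rule indefinite_integral_continuous_1[OF set_borel_integral_eq_integral(1)[OF G]])
 then show "continuous_on {0..T} (%t. LINT u:{0..t}|lborel. G u)"
  by (simp only: set_borel_integral_eq_integral(2)[OF G])
qed

lemma set_integrable_halfline_continuous:
 fixes G :: "real => 'b::{banach, second_countable_topology}"
 shows "continuous_on {0..} G ==> set_integrable lborel {0..T} G"
 by (rule borel_integrable_atLeastAtMost') (auto intro: continuous_on_subset)

lemma conv_causal:
 assumes D: "!!u. u < 0 ==> D u = 0"
 shows "conv HL \<kappa> D t = (LINT u:{0..t}|lborel. \<kappa> (t - u) * D u)"
proof -
 have "(LINT u:{0..t}|lborel. \<kappa> (t - u) * D u) = \<bar>-1\<bar> *\<^sub>R (LINT s|lborel. indicator {0..t} (t + -1 * s) *\<^sub>R (\<kappa> (t - (t + -1 * s)) * D (t + -1 * s)))"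
  unfolding set_lebesgue_integral_def by (rule lborel_integral_real_affine) simp
 also have "... = (LINT s|lborel. indicator {0..} s *\<^sub>R (\<kappa> s * D (t - s)))"
  unfolding abs_minus_cancel abs_one scaleR_one
  by (intro Bochner_Integration.integral_cong refl) (auto simp: D split: split_indicator)
 also have "... = conv HL \<kappa> D t" unfolding conv_def by (rule integral_restrict_space[symmetric]) simp
 finally show ?thesis by simp
qed

definition causal :: "(real => real^'d) => 'd => real => complex" where
 "causal x i t = (if t < 0 then 0 else of_real (x t $ i))"

lemma causal_continuous: "continuous_on {0..} x ==> continuous_on {0..} (causal x i)"
proof -
 assume "continuous_on {0..} x"
 then have "continuous_on {0..} (%t. complex_of_real (x t $ i))" by (intro continuous_intros)
 then show ?thesis by (rule continuous_on_eq) (auto simp: causal_def)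
qed

text \<open>The cut-off at \<open>u\<close> inside \<open>delay_term\<close> and the extension of
  the path by \<open>0\<close> to negative times have the same effect, since the measures live on
  the half-line.\<close>

lemma delay_term_conv:
 fixes \<mu> :: "real set => real^'d^'d"
 assumes kp: "!!i j. kern (pos_part \<mu> i j) (%_. 1) a" and km: "!!i j. kern (neg_part \<mu> i j) (%_. 1) a"
 shows "complex_of_real (delay_term \<mu> x u $ i) =
  (\<Sum>j\<in>UNIV. conv (pos_part \<mu> i j) (%_. 1) (causal x j) u - conv (neg_part \<mu> i j) (%_. 1) (causal x j) u)"
proof -
 have "conv N (%_. 1) (causal x j) u = of_real (LINT s|N. indicator {0..u} s *\<^sub>R (x (u - s) $ j))" if N: "space N = {0..}" for N j
 proof -
  have "conv N (%_. 1) (causal x j) u = (LINT s|N. complex_of_real (indicator {0..u} s *\<^sub>R (x (u - s) $ j)))"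
   unfolding conv_def by (intro Bochner_Integration.integral_cong refl) (auto simp: N causal_def split: split_indicator)
  then show ?thesis by (simp only: integral_complex_of_real)
 qed
 from this[OF kern_space[OF kp]] this[OF kern_space[OF km]]
 have c: "conv (pos_part \<mu> i j) (%_. 1) (causal x j) u = of_real (LINT s|pos_part \<mu> i j. indicator {0..u} s *\<^sub>R (x (u - s) $ j))"
  "conv (neg_part \<mu> i j) (%_. 1) (causal x j) u = of_real (LINT s|neg_part \<mu> i j. indicator {0..u} s *\<^sub>R (x (u - s) $ j))" for j by blast+
 show ?thesis unfolding c delay_term_def signed_integral_def
  by (simp add: pos_part_def neg_part_def)
qed

lemma integrable_vec:
 fixes f :: "'b => real^'d"
 assumes "!!i. integrable N (%x. f x $ i)" shows "integrable N f"
proof -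
 have "integrable N (%x. \<Sum>i\<in>UNIV. f x $ i *\<^sub>R (axis i 1 :: real^'d))"
  by (intro Bochner_Integration.integrable_sum integrable_scaleR_left assms)
 moreover have "(%x. \<Sum>i\<in>UNIV. f x $ i *\<^sub>R (axis i 1 :: real^'d)) = f"
  by (rule ext) (metis (no_types, lifting) basis_expansion scalar_mult_eq_scaleR sum.cong)
 ultimately show ?thesis by simp
qed

lemma set_integral_vec_nth:
 fixes f :: "'b => real^'d"
 assumes "set_integrable N A f"
 shows "(LINT s:A|N. f s) $ i = (LINT s:A|N. f s $ i)" "set_integrable N A (%s. f s $ i)"
 using integral_bounded_linear[OF bounded_linear_vec_nth, of N "%s. indicator A s *\<^sub>R f s" i] 
  integrable_bounded_linear[OF bounded_linear_vec_nth, of N "%s. indicator A s *\<^sub>R f s" i] assms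
 unfolding set_integrable_def set_lebesgue_integral_def by simp_all

text \<open>Used before any growth bound for the path is known, hence the truncation at
  \<open>T\<close>. Atoms of \<open>N\<close> may make the convolution discontinuous, so
  integrability is drawn from boundedness and measurability.\<close>

lemma conv_one_locally_bounded:
 assumes k: "kern N (%_. 1) a" and y: "continuous_on {0..} y" "!!t. t < 0 ==> y t = 0"
 shows "set_integrable lborel {0..T} (conv N (%_. 1) y)"
proof (cases "T < 0")
 case False
 note ym = causal_measurable[OF y]
 have "bounded (y ` {0..T})" by (intro compact_imp_bounded compact_continuous_image compact_Icc continuous_on_subset[OF y(1)]) auto
 then obtain K where K: "K > 0" "!!t. t \<in> {0..T} ==> norm (y t) <= K" unfolding bounded_pos by auto
 define c where "c = max a 0"
 have b: "norm (y s) <= K * exp (c * s)" if "0 <= s" "s <= T" for s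
 proof -
  have "K * 1 <= K * exp (c * s)" using K(1) that by (intro mult_left_mono) (auto simp: c_def)
  then show ?thesis using K(2)[of s] that by simp
 qed
 let ?y' = "%t. if t <= T then y t else 0"
 have K0: "0 <= K" using K by simp
 have e: "expb ?y'" "norm (?y' t) <= K * exp (c * t)" for t
  using truncate_expb[OF ym y(2) K0 b] by auto
 let ?I = "LINT s|N. exp (- a * s) * norm (1::complex)"
 have I0: "?I >= 0" by (intro Bochner_Integration.integral_nonneg) auto
 have bd: "norm (conv N (%_. 1) y t) <= K * exp (c * T) * ?I" if "t \<in> {0..T}" for t
 proof -
  have "norm (conv N (%_. 1) ?y' t) <= K * exp (c * t) * ?I"
   by (rule conv_bound(2)[OF k e(1) K0 e(2)]) (simp add: c_def)
  also have "... <= K * exp (c * T) * ?I" using that I0 K0 by (intro mult_right_mono mult_left_mono) (auto simp: c_def mult_left_mono)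
  finally show ?thesis using conv_truncate[OF k, of t T y] that by simp
 qed
 show ?thesis unfolding set_integrable_def
 proof (rule integrableI_bounded_set_indicator[where B = "K * exp (c * T) * ?I"])
  show "AE x in lborel. x \<in> {0..T} \<longrightarrow> norm (conv N (%_. 1) y x) <= K * exp (c * T) * ?I" using bd by simp
 qed (use conv_measurable[OF k ym] False in auto)
qed (simp add: set_integrable_def)

lemma delay_integrable:
 fixes \<mu> :: "real set => real^'d^'d"
 assumes kp: "!!i j. kern (pos_part \<mu> i j) (%_. 1) a" and km: "!!i j. kern (neg_part \<mu> i j) (%_. 1) a"
  and x: "continuous_on {0..} x"
 shows "set_integrable lborel {0..T} (delay_term \<mu> x)"
 unfolding set_integrable_def
proof (rule integrable_vec)
 fix i
 have "set_integrable lborel {0..T} (%u. conv (pos_part \<mu> i j) (%_. 1) (causal x j) u - conv (neg_part \<mu> i j) (%_. 1) (causal x j) u)" for j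
  by (intro set_integral_diff conv_one_locally_bounded[OF kp] conv_one_locally_bounded[OF km] causal_continuous x)
   (auto simp: causal_def)
 then have "set_integrable lborel {0..T} (%u. \<Sum>j\<in>UNIV. conv (pos_part \<mu> i j) (%_. 1) (causal x j) u - conv (neg_part \<mu> i j) (%_. 1) (causal x j) u)"
  unfolding set_integrable_def scaleR_sum_right by (intro Bochner_Integration.integrable_sum)
 then have "set_integrable lborel {0..T} (%u. complex_of_real (delay_term \<mu> x u $ i))"
  by (simp only: delay_term_conv[OF kp km])
 then show "integrable lborel (%u. (indicator {0..T} u *\<^sub>R delay_term \<mu> x u) $ i)"
 proof -
  have e: "indicator {0..T} u *\<^sub>R complex_of_real (delay_term \<mu> x u $ i) = complex_of_real ((indicator {0..T} u *\<^sub>R delay_term \<mu> x u) $ i)" for u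
   by (simp split: split_indicator)
  show ?thesis
   using \<open>set_integrable lborel {0..T} (%u. complex_of_real (delay_term \<mu> x u $ i))\<close>
   unfolding set_integrable_def e complex_of_real_integrable_eq .
 qed
qed

text \<open>\<open>Y\<close> is the residual of the equation, so along each continuous path the
  Volterra equation is an identity for all times, with no exceptional null set; that
  \<open>Y\<close> is a stochastic integral enters elsewhere. Its continuity comes from that of the
  path and of running integrals.\<close>

lemma path_volterra:
 fixes \<mu> :: "real set => real^'d^'d" and x f :: "real => real^'d"
 assumes kp: "!!i j. kern (pos_part \<mu> i j) (%_. 1) a" and km: "!!i j. kern (neg_part \<mu> i j) (%_. 1) a"
  and x: "continuous_on {0..} x" and f: "continuous_on {0..} f"
  and Y: "!!t. Y t = x t - x0 - (LINT u:{0..t}|lborel. f u + delay_term \<mu> x u)"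
 shows "continuous_on {0..} Y"
  and "causal x i t = causal (%t. x0 + (LINT u:{0..t}|lborel. f u) + Y t) i t + conv HL (%_. 1)
   (%u. \<Sum>j\<in>UNIV. conv (pos_part \<mu> i j) (%_. 1) (causal x j) u - conv (neg_part \<mu> i j) (%_. 1) (causal x j) u) t"
proof -
 note di = delay_integrable[OF kp km x]
 note fi = set_integrable_halfline_continuous[OF f]
 show "continuous_on {0..} Y" unfolding Y
  by (intro continuous_intros x running_integral_continuous set_integral_add fi di)
 have cv: "conv HL (%_. 1) (%u. complex_of_real (delay_term \<mu> x u $ i)) t = (LINT u:{0..t}|lborel. complex_of_real (delay_term \<mu> x u $ i))"
 proof (subst conv_causal)
  fix u :: real assume "u < 0"
  then show "complex_of_real (delay_term \<mu> x u $ i) = 0" by (simp add: delay_term_def signed_integral_def)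
 qed simp
 show "causal x i t = causal (%t. x0 + (LINT u:{0..t}|lborel. f u) + Y t) i t + conv HL (%_. 1)
   (%u. \<Sum>j\<in>UNIV. conv (pos_part \<mu> i j) (%_. 1) (causal x j) u - conv (neg_part \<mu> i j) (%_. 1) (causal x j) u) t"
  unfolding delay_term_conv[OF kp km, symmetric] cv
 proof (cases "t < 0")
  case False
  have "(LINT u:{0..t}|lborel. f u + delay_term \<mu> x u) = (LINT u:{0..t}|lborel. f u) + (LINT u:{0..t}|lborel. delay_term \<mu> x u)"
   by (rule set_integral_add(2)[OF fi di])
  then have "x t = x0 + (LINT u:{0..t}|lborel. f u) + Y t + (LINT u:{0..t}|lborel. delay_term \<mu> x u)" using Y[of t] by simp
  then have "x t $ i = (x0 + (LINT u:{0..t}|lborel. f u) + Y t) $ i + (LINT u:{0..t}|lborel. delay_term \<mu> x u $ i)"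
   unfolding set_integral_vec_nth(1)[OF di, symmetric] by (metis vector_add_component)
  then show "causal x i t = causal (%t. x0 + (LINT u:{0..t}|lborel. f u) + Y t) i t + (LINT u:{0..t}|lborel. complex_of_real (delay_term \<mu> x u $ i))"
   using False unfolding set_integral_complex_of_real by (simp only: causal_def if_False of_real_add)
 qed (simp add: causal_def set_lebesgue_integral_def)
qed

text \<open>The function \<open>W\<close> of the locale \<open>volterra\<close>, available here
  before the forcing is known to be exponentially bounded, which that locale presupposes.\<close>

definition weighted :: "complex => (real => complex) => real => complex" where
 "weighted l g t = g t + l * conv HL (%s. exp (l * of_real s)) g t"

lemma weighted_integral:
 assumes "!!u. u < 0 ==> g u = 0"
 shows "exp (- l * of_real t) * weighted l g t = exp (- l * of_real t) * g t + l * (LINT u:{0..t}|lborel. exp (- l * of_real u) * g u)"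
proof -
 have "exp (- l * of_real t) * conv HL (%s. exp (l * of_real s)) g t = (LINT u:{0..t}|lborel. exp (- l * of_real t) * (exp (l * of_real (t - u)) * g u))"
  using conv_causal[of g "%s. exp (l * of_real s)" t] assms by simp
 also have "... = (LINT u:{0..t}|lborel. exp (- l * of_real u) * g u)"
 proof -
  have "exp (- l * of_real t) * (exp (l * of_real (t - u)) * y) = exp (- l * of_real u) * y" for u :: real and y
   by (simp add: mult.assoc[symmetric] exp_add[symmetric] right_diff_distrib)
  then show ?thesis by (simp only:)
 qed
 finally show ?thesis unfolding weighted_def by (simp add: distrib_left mult.left_commute)
qed

text \<open>The definition of \<open>weighted\<close> is a Volterra equation for \<open>g\<close>
  with kernel \<open>\<alpha> * exp (\<alpha> * s)\<close>. Convergence bounds the weighted function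
  by \<open>K * exp (\<alpha> * t)\<close>, and \<open>self_bound\<close> solves the equation for
  \<open>g\<close>.\<close>

lemma weighted_bounded_imp_expb:
 assumes g: "continuous_on {0..} g" "!!u. u < 0 ==> g u = 0"
  and lim: "((%t. exp (- complex_of_real \<alpha> * of_real t) * weighted (of_real \<alpha>) g t) \<longlongrightarrow> L) at_top"
 shows "expb g"
proof -
 let ?h = "%t. exp (- complex_of_real \<alpha> * of_real t) * weighted (of_real \<alpha>) g t"
 have eq: "?h t = exp (- complex_of_real \<alpha> * of_real t) * g t + of_real \<alpha> * (LINT u:{0..t}|lborel. exp (- complex_of_real \<alpha> * of_real u) * g u)" for t
  by (rule weighted_integral) (rule g(2))
 have "continuous_on {0..} ?h" unfolding eq
  by (intro continuous_intros g running_integral_continuous set_integrable_halfline_continuous)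
 moreover obtain T where T: "!!t. t >= T ==> norm (?h t) < norm L + 1"
  using order_tendstoD(2)[OF tendsto_norm[OF lim], of "norm L + 1"] unfolding eventually_at_top_linorder by auto
 ultimately have "bounded (?h ` {0..max T 0})"
  by (intro compact_imp_bounded compact_continuous_image compact_Icc) (auto intro: continuous_on_subset)
 then obtain K0 where K0: "!!t. t \<in> {0..max T 0} ==> norm (?h t) <= K0" unfolding bounded_iff by blast
 define K where "K = max K0 (norm L + 1)"
 have K: "norm (?h t) <= K" if "t >= 0" for t
 proof (cases "t <= max T 0")
  case True
  then have "norm (?h t) <= K0" using that by (intro K0) simp
  then show ?thesis unfolding K_def by linarith
 next
  case False
  then have "norm (?h t) < norm L + 1" by (intro T) simp
  then show ?thesis unfolding K_def by linarith
 qed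
 have Kn: "K >= 0" unfolding K_def using norm_ge_zero[of L] by linarith
 have Wb: "norm (weighted (of_real \<alpha>) g t) <= K * exp (\<alpha> * t)" if "t >= 0" for t
 proof -
  have "exp (complex_of_real \<alpha> * of_real t) * exp (- complex_of_real \<alpha> * of_real t) = 1" by (simp add: exp_add[symmetric])
  then have "weighted (of_real \<alpha>) g t = exp (complex_of_real \<alpha> * of_real t) * ?h t" by (simp only: mult.assoc[symmetric] mult_1)
  moreover have "norm (exp (complex_of_real \<alpha> * of_real t) * y) = exp (\<alpha> * t) * norm y" for y
   by (simp add: norm_mult)
  ultimately have "norm (weighted (of_real \<alpha>) g t) = exp (\<alpha> * t) * norm (?h t)" by metis
  then show ?thesis using mult_left_mono[OF K[OF that], of "exp (\<alpha> * t)"] by (simp add: mult.commute)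
 qed
 \<comment> \<open>Makes \<open>\<bar>\<alpha>\<bar> / (c - \<alpha>)\<close>, the norm of the
   convolution term at rate \<open>c\<close>, at most one half, also for negative \<alpha>.\<close>
 define c where "c = \<alpha> + 2 * \<bar>\<alpha>\<bar> + 1"
 have c: "c > \<alpha>" "\<bar>\<alpha>\<bar> / (c - \<alpha>) <= 1 / 2" by (auto simp: c_def divide_simps)
 have k: "kern HL (%s. exp (complex_of_real \<alpha> * of_real s)) c" by (rule kern_exp) (use c in simp)
 note gm = causal_measurable[OF g]
 have "norm (g t) <= 2 * K * exp (c * t)" if "t >= 0" for t
 proof (rule self_bound[OF _ _ _ that])
  show "continuous_on {0..} (%t. norm (g t))" by (intro continuous_intros g)
  fix T m t :: real assume m: "m >= 0" and le: "!!s. 0 <= s ==> s <= T ==> norm (g s) <= m * exp (c * s)"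
   and t: "0 <= t" "t <= T"
  let ?\<kappa> = "%s. exp (complex_of_real \<alpha> * of_real s)" and ?g' = "%t. if t <= T then g t else 0"
  have e: "expb ?g'" "norm (?g' t) <= m * exp (c * t)" for t
   using truncate_expb[OF gm g(2) m le] by auto
  have "norm (conv HL ?\<kappa> g t) <= m * exp (c * t) * (LINT s|HL. exp (- c * s) * norm (?\<kappa> s))"
   by (subst conv_truncate[OF k t(2)], rule conv_bound(2)[OF k e(1) m e(2)]) simp
  also have "(LINT s|HL. exp (- c * s) * norm (?\<kappa> s)) = (LINT s|HL. exp (- (c - \<alpha>) * s))"
   by (intro Bochner_Integration.integral_cong refl) (simp add: exp_add[symmetric] algebra_simps)
  also have "... = 1 / (c - \<alpha>)" by (rule integral_exp_HL) (use c in simp)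
  finally have "\<bar>\<alpha>\<bar> * norm (conv HL ?\<kappa> g t) <= \<bar>\<alpha>\<bar> * (m * exp (c * t) * (1 / (c - \<alpha>)))" by (rule mult_left_mono) simp
  also have "... = \<bar>\<alpha>\<bar> / (c - \<alpha>) * (m * exp (c * t))" by simp
  also have "... <= 1 / 2 * (m * exp (c * t))" using c(2) m by (intro mult_right_mono) auto
  finally have 1: "norm (of_real \<alpha> * conv HL ?\<kappa> g t) <= m / 2 * exp (c * t)" by (simp add: norm_mult)
  have "K * exp (\<alpha> * t) <= K * exp (c * t)" using Kn t c by (intro mult_left_mono) (auto intro: mult_right_mono)
  then have 2: "norm (weighted (of_real \<alpha>) g t) <= K * exp (c * t)" using Wb[OF t(1)] by linarith
  have "g t = weighted (of_real \<alpha>) g t - of_real \<alpha> * conv HL ?\<kappa> g t" by (simp add: weighted_def)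
  then have "norm (g t) <= norm (weighted (of_real \<alpha>) g t) + norm (of_real \<alpha> * conv HL ?\<kappa> g t)" by (metis norm_triangle_ineq4)
  also have "... <= K * exp (c * t) + m / 2 * exp (c * t)" using 1 2 by (rule add_mono[rotated])
  finally show "norm (g t) <= (K + m / 2) * exp (c * t)" by (simp add: distrib_right)
 qed simp
 then have "norm (g t) <= 2 * K * exp (c * t)" for t using g(2)[of t] Kn by (cases "t < 0") auto
 then show ?thesis unfolding expb_def using gm g(2) by blast
qed

text \<open>Integration by parts: weighting the antiderivative of \<open>f\<close> leaves the
  initial value and the weighted integral of \<open>f\<close> itself. Convergence on the line
  \<open>Re l = \<alpha>\<close> is thus a matter of integrability of \<open>f\<close> against
  \<open>exp (- \<alpha> * t)\<close>.\<close>

lemma weighted_antiderivative: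
 fixes f :: "real => complex"
 assumes f: "continuous_on {0..} f" and t: "t >= 0"
 shows "exp (- l * of_real t) * (x0 + (LINT u:{0..t}|lborel. f u)) + l * (LINT s:{0..t}|lborel. exp (- l * of_real s) * (x0 + (LINT u:{0..s}|lborel. f u)))
  = x0 + (LINT u:{0..t}|lborel. exp (- l * of_real u) * f u)"
proof -
 define G where "G s = x0 + (LINT u:{0..s}|lborel. f u)" for s
 have Gc: "continuous_on {0..} G" unfolding G_def[abs_def]
  by (intro continuous_intros running_integral_continuous set_integrable_halfline_continuous f)
 have fc: "continuous_on {0..t} f" using f by (rule continuous_on_subset) auto
 have Gd: "(G has_vector_derivative f s) (at s within {0..t})" if "s \<in> {0..t}" for s
 proof -
  have "((%s. x0 + integral {0..s} f) has_vector_derivative 0 + f s) (at s within {0..t})"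
   by (intro derivative_intros integral_has_vector_derivative fc that)
  moreover have "(%s. x0 + integral {0..s} f) = G"
   by (simp add: fun_eq_iff G_def set_borel_integral_eq_integral(2)[OF set_integrable_halfline_continuous[OF f]])
  ultimately show ?thesis by simp
 qed
 let ?e = "%s. exp (- l * complex_of_real s)"
 have ed: "(?e has_vector_derivative - l * ?e s) (at s within {0..t})" for s
  by (rule has_vector_derivative_real_field[of "%z. exp (- l * z)"]) (auto intro!: derivative_eq_intros)
 have "(LINT s|lborel. indicator {0..t} s *\<^sub>R (?e s * f s - l * ?e s * G s)) = ?e t * G t - ?e 0 * G 0"
 proof (rule integral_FTC_atLeastAtMost[OF t])
  fix s assume "0 <= s" "s <= t"
  then show "((%s. ?e s * G s) has_vector_derivative ?e s * f s - l * ?e s * G s) (at s within {0..t})"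
   using has_vector_derivative_mult[OF ed Gd, of s] by simp
 next
  show "continuous_on {0..t} (%s. ?e s * f s - l * ?e s * G s)"
   by (intro continuous_intros fc continuous_on_subset[OF Gc]) auto
 qed
 moreover have "(LINT s|lborel. indicator {0..t} s *\<^sub>R (?e s * f s - l * ?e s * G s)) = (LINT s:{0..t}|lborel. ?e s * f s) - (LINT s:{0..t}|lborel. l * (?e s * G s))"
  unfolding set_lebesgue_integral_def[symmetric] mult.assoc
  by (rule set_integral_diff(2); intro set_integrable_halfline_continuous continuous_intros f Gc)
 moreover have "(LINT s:{0..t}|lborel. l * (?e s * G s)) = l * (LINT s:{0..t}|lborel. ?e s * G s)" by simp
 moreover have "G 0 = x0"
 proof -
  have "(LINT u:{0..0::real}|lborel. f u) = integral {0..0} f"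
   by (rule set_borel_integral_eq_integral(2)[OF set_integrable_halfline_continuous[OF f]])
  then show ?thesis by (simp add: G_def)
 qed
 ultimately have "?e t * G t - ?e 0 * x0 = (LINT s:{0..t}|lborel. ?e s * f s) - l * (LINT s:{0..t}|lborel. ?e s * G s)"
  by (simp only:)
 moreover have "u + v = x + y" if "u - x = y - v" for u v x y :: complex
  using that by (simp add: diff_eq_eq)
 ultimately have "?e t * G t + l * (LINT s:{0..t}|lborel. ?e s * G s) = ?e 0 * x0 + (LINT s:{0..t}|lborel. ?e s * f s)"
  by blast
 then show ?thesis unfolding G_def by simp
qed

section \<open>Limits along a single path\<close>

context spectral_split begin

text \<open>\<open>D\<close> and \<open>U\<close> are the limits of the deterministic and the
  stochastic part of the weighted forcing. The real point \<alpha> is added to \<Lambda> because it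
  yields the exponential bound of the forcing and carries the remainder term.\<close>

lemma path_limit:
 fixes x f Y :: "real => real^'d"
 assumes x: "continuous_on {0..} x" and f: "continuous_on {0..} f"
  and Y: "!!t. Y t = x t - x0 - (LINT u:{0..t}|lborel. f u + delay_term \<mu> x u)"
  and Ylim: "!!l i. l \<in> insert (of_real \<alpha>) \<Lambda> ==> ((%t. exp (- l * of_real t) * of_real (Y t $ i)
    + l * (LINT u:{0..t}|lborel. exp (- l * of_real u) * of_real (Y u $ i))) \<longlongrightarrow> U l i) at_top"
  and flim: "!!l i. l \<in> insert (of_real \<alpha>) \<Lambda> ==> ((%t. LINT u:{0..t}|lborel. exp (- l * of_real u) * of_real (f u $ i)) \<longlongrightarrow> D l i) at_top"
 shows "asym n \<alpha> \<Lambda> (%l. (\<Sum>j\<in>UNIV. c i j l n * (of_real (x0 $ j) + D l j + U l j)) / fact n) (causal x i)"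
proof -
 define g where "g = (%i. causal (%t. x0 + (LINT u:{0..t}|lborel. f u) + Y t) i)"

 have Yc: "continuous_on {0..} Y" by (rule path_volterra(1)[OF kp km x f Y])
 have gc: "continuous_on {0..} (g i)" for i unfolding g_def
  by (intro causal_continuous continuous_intros running_integral_continuous set_integrable_halfline_continuous f Yc)
 have g0: "g i u = 0" if "u < 0" for i u using that by (simp add: g_def causal_def)
 have Wlim: "((%t. exp (- l * of_real t) * weighted l (g i) t) \<longlongrightarrow> of_real (x0 $ i) + D l i + U l i) at_top"
  if l: "l \<in> insert (of_real \<alpha>) \<Lambda>" for l i
 proof -
  define fi where "fi u = complex_of_real (f u $ i)" for u
  define Gi where "Gi t = complex_of_real (x0 $ i) + (LINT u:{0..t}|lborel. fi u)" for t
  define Yi where "Yi t = complex_of_real (Y t $ i)" for t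
  have fic: "continuous_on {0..} fi" and Yic: "continuous_on {0..} Yi"
   unfolding fi_def[abs_def] Yi_def[abs_def] by (intro continuous_intros f Yc)+
  have Gic: "continuous_on {0..} Gi" unfolding Gi_def[abs_def]
   by (intro continuous_intros running_integral_continuous set_integrable_halfline_continuous fic)
  have gG: "g i t = Gi t + Yi t" if "t >= 0" for t
   using that set_integral_vec_nth(1)[OF set_integrable_halfline_continuous[OF f], of t i]
   unfolding g_def causal_def Gi_def Yi_def fi_def set_integral_complex_of_real by simp
  have "exp (- l * of_real t) * weighted l (g i) t = of_real (x0 $ i) + (LINT u:{0..t}|lborel. exp (- l * of_real u) * fi u)
    + (exp (- l * of_real t) * Yi t + l * (LINT u:{0..t}|lborel. exp (- l * of_real u) * Yi u))" if t: "t >= 0" for t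
  proof -
   have "exp (- l * of_real t) * weighted l (g i) t = exp (- l * of_real t) * g i t + l * (LINT u:{0..t}|lborel. exp (- l * of_real u) * g i u)"
    by (rule weighted_integral) (rule g0)
   also have "(LINT u:{0..t}|lborel. exp (- l * of_real u) * g i u) = (LINT u:{0..t}|lborel. exp (- l * of_real u) * Gi u + exp (- l * of_real u) * Yi u)"
    by (rule set_lebesgue_integral_cong) (auto simp: gG distrib_left)
   also have "... = (LINT u:{0..t}|lborel. exp (- l * of_real u) * Gi u) + (LINT u:{0..t}|lborel. exp (- l * of_real u) * Yi u)"
    by (rule set_integral_add(2); intro set_integrable_halfline_continuous continuous_intros Gic Yic)
   also have "exp (- l * of_real t) * g i t + l * ... = (exp (- l * of_real t) * Gi t + l * (LINT u:{0..t}|lborel. exp (- l * of_real u) * Gi u))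
     + (exp (- l * of_real t) * Yi t + l * (LINT u:{0..t}|lborel. exp (- l * of_real u) * Yi u))"
    by (simp only: gG[OF t] distrib_left add_ac)
   also have "exp (- l * of_real t) * Gi t + l * (LINT u:{0..t}|lborel. exp (- l * of_real u) * Gi u)
     = of_real (x0 $ i) + (LINT u:{0..t}|lborel. exp (- l * of_real u) * fi u)"
    unfolding Gi_def by (rule weighted_antiderivative[OF fic t])
   finally show ?thesis .
  qed
  then have "\<forall>\<^sub>F t in at_top. of_real (x0 $ i) + (LINT u:{0..t}|lborel. exp (- l * of_real u) * fi u)
    + (exp (- l * of_real t) * Yi t + l * (LINT u:{0..t}|lborel. exp (- l * of_real u) * Yi u)) = exp (- l * of_real t) * weighted l (g i) t"
   by (intro eventually_at_top_linorderI[of 0]) simp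
  moreover have "((%t. of_real (x0 $ i) + (LINT u:{0..t}|lborel. exp (- l * of_real u) * fi u)
    + (exp (- l * of_real t) * Yi t + l * (LINT u:{0..t}|lborel. exp (- l * of_real u) * Yi u))) \<longlongrightarrow> of_real (x0 $ i) + D l i + U l i) at_top"
   unfolding fi_def Yi_def by (intro tendsto_add tendsto_const flim[OF l] Ylim[OF l])
  ultimately show ?thesis by (rule Lim_transform_eventually[rotated])
 qed
 have ge: "expb (g i)" for i
  by (rule weighted_bounded_imp_expb[OF gc g0 Wlim]) auto
 interpret volterra "pos_part \<mu>" "neg_part \<mu>" a "causal x" g
 proof
  show "causal x i t = 0" if "t < 0" for i t using that by (simp add: causal_def)
  show "causal x i t = g i t + conv HL (%_. 1) (%u. \<Sum>j\<in>UNIV. conv (pos_part \<mu> i j) (%_. 1) (causal x j) u - conv (neg_part \<mu> i j) (%_. 1) (causal x j) u) t" for i t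
   unfolding g_def by (rule path_volterra(2)[OF kp km x f Y])
 qed (intro kp km ge gc causal_continuous x)+
 have W: "W l i t = weighted l (g i) t" for l i t by (simp add: W_def weighted_def)
 have Mh: "Mh i j z = lap_measure \<mu> i j z" for i j z by (simp add: Mh_def lap_measure_def)
 show ?thesis
  by (rule asymptotics[OF num fin re H Hb dec])
   (use inv res Wlim in \<open>simp_all only: Mh W\<close>)
qed

end

lemma norm_matrix_combination_le:
 fixes A A' :: "real^'d^'m"
 obtains K where "K >= 0" "!!x y r (S :: real^'e^'d). \<bar>x\<bar> <= r ==> \<bar>y\<bar> <= r ==> norm ((x *\<^sub>R A + y *\<^sub>R A') ** S) <= K * (r * norm S)"
proof -
 have "linear (%S :: real^'e^'d. A ** S)" for A :: "real^'d^'m"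
  by (rule linearI) (simp_all add: vec_eq_iff matrix_matrix_mult_def sum_distrib_left mult.left_commute distrib_left sum.distrib)
 then obtain k k' where k: "!!S :: real^'e^'d. norm (A ** S) <= k * norm S" "!!S :: real^'e^'d. norm (A' ** S) <= k' * norm S"
  using linear_bounded by metis
 show thesis
 proof (rule that[of "\<bar>k\<bar> + \<bar>k'\<bar>"])
  fix x y r :: real and S :: "real^'e^'d" assume xy: "\<bar>x\<bar> <= r" "\<bar>y\<bar> <= r"
  have "(x *\<^sub>R A + y *\<^sub>R A') ** S = x *\<^sub>R (A ** S) + y *\<^sub>R (A' ** S)"
   by (simp add: vec_eq_iff matrix_matrix_mult_def distrib_right sum.distrib sum_distrib_left mult.assoc)
  then have "norm ((x *\<^sub>R A + y *\<^sub>R A') ** S) <= \<bar>x\<bar> * norm (A ** S) + \<bar>y\<bar> * norm (A' ** S)"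
   using norm_triangle_ineq[of "x *\<^sub>R (A ** S)" "y *\<^sub>R (A' ** S)"] by simp
  also have "... <= r * (\<bar>k\<bar> * norm S) + r * (\<bar>k'\<bar> * norm S)"
  proof (intro add_mono mult_mono xy)
   show "norm (A ** S) <= \<bar>k\<bar> * norm S" "norm (A' ** S) <= \<bar>k'\<bar> * norm S"
    by (rule order_trans[OF k(1)] order_trans[OF k(2)], intro mult_right_mono; simp)+
  qed (use xy in auto)
  finally show "norm ((x *\<^sub>R A + y *\<^sub>R A') ** S) <= (\<bar>k\<bar> + \<bar>k'\<bar>) * (r * norm S)" by (simp add: algebra_simps)
 qed simp
qed

lemma weighted_square_finite:
 fixes S :: "real => 'b::real_normed_vector" and H :: "real => 'c::real_normed_vector"
 assumes S: "set_integrable lborel {0..} (%t. exp (- 2 * \<alpha> * t) * (norm (S t))\<^sup>2)"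
  and H: "!!s. s >= 0 ==> norm (H s) <= K * (exp (- \<alpha> * s) * norm (S s))"
 shows "(\<integral>\<^sup>+ s\<in>{0..}. ennreal ((norm (H s))\<^sup>2) \<partial>lborel) < \<infinity>"
proof -
 have "integrable lborel (%s. K\<^sup>2 * (indicator {0..} s *\<^sub>R (exp (- 2 * \<alpha> * s) * (norm (S s))\<^sup>2)))"
  using S unfolding set_integrable_def by (rule integrable_mult_right)
 then have fin: "(\<integral>\<^sup>+ s. ennreal (norm (K\<^sup>2 * (indicator {0..} s *\<^sub>R (exp (- 2 * \<alpha> * s) * (norm (S s))\<^sup>2)))) \<partial>lborel) < \<infinity>"
  unfolding integrable_iff_bounded by blast
 have "ennreal ((norm (H s))\<^sup>2) * indicator {0..} s <= ennreal (norm (K\<^sup>2 * (indicator {0..} s *\<^sub>R (exp (- 2 * \<alpha> * s) * (norm (S s))\<^sup>2))))" for s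
 proof (cases "s >= 0")
  case True
  have "(norm (H s))\<^sup>2 <= (K * (exp (- \<alpha> * s) * norm (S s)))\<^sup>2" by (rule power_mono[OF H[OF True]]) simp
  also have "... = K\<^sup>2 * (exp (- 2 * \<alpha> * s) * (norm (S s))\<^sup>2)"
   by (simp add: power_mult_distrib exp_double[symmetric] mult_ac)
  finally show ?thesis using True by (simp add: ennreal_leI)
 qed simp
 then have "(\<integral>\<^sup>+ s\<in>{0..}. ennreal ((norm (H s))\<^sup>2) \<partial>lborel) <= (\<integral>\<^sup>+ s. ennreal (norm (K\<^sup>2 * (indicator {0..} s *\<^sub>R (exp (- 2 * \<alpha> * s) * (norm (S s))\<^sup>2)))) \<partial>lborel)"
  by (rule nn_integral_mono)
 then show ?thesis using fin by (rule le_less_trans)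
qed

section \<open>Almost sure limits and linearity of the stochastic integrals\<close>

context brownian begin

text \<open>Integration by parts identifies the pathwise expression with a Wiener integral at each
  time, and \<open>wi_converges\<close> gives its limit over the half-line. The exceptional set
  depends on the weight \<phi>, so the weights are later restricted to a finite family.\<close>

lemma wi_path_limit:
 fixes S :: "real => real^'e^'d" and Y :: "real => 'a => real^'d" and \<phi> \<phi>' :: "real => real"
 assumes S: "continuous_on {0..} S" "set_integrable lborel {0..} (%t. exp (- 2 * \<alpha> * t) * (norm (S t))\<^sup>2)"
  and Y: "AE w in M. continuous_on {0..} (%t. Y t w)" "!!t. t >= 0 ==> AE w in M. Y t w = ito_integral M F B {0..t} (%s _. S s) w"
  and d: "!!x. (\<phi> has_real_derivative \<phi>' x) (at x)" and c: "continuous_on UNIV \<phi>'" and b: "!!s. \<bar>\<phi> s\<bar> <= exp (- \<alpha> * s)"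
 shows "AE w in M. ((%t. \<phi> t * Y t w $ i - (LINT s:{0..t}|lborel. \<phi>' s * Y s w $ i)) \<longlongrightarrow>
  ito_integral M F B {0..} (%s _. \<phi> s *\<^sub>R S s) w $ i) at_top"
proof -
 let ?h = "%s. S s $ i" and ?J = "%t w. ito_integral M F B {0..t} (%s _. S s) w $ i"
 let ?V = "%t w. \<phi> t * Y t w $ i - (LINT s:{0..t}|lborel. \<phi>' s * Y s w $ i)"
 have phic: "continuous_on X \<phi>" for X using d by (meson DERIV_isCont continuous_at_imp_continuous_on)
 have hc: "continuous_on {0..} ?h" by (intro continuous_intros S)
 have J: "wi (%s. indicator {0..t} s *\<^sub>R ?h s) (?J t)" if "t >= 0" for t
 proof (rule ito_integral_wi[OF S(1)])
  have "N2 lborel (%s. indicator {0..t} s *\<^sub>R S s) < \<infinity>" by (rule N2_continuous_finite) (rule continuous_on_subset[OF S(1)], auto)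
  moreover have "(\<integral>\<^sup>+ s\<in>{0..t}. ennreal ((norm (S s))\<^sup>2) \<partial>lborel) = N2 lborel (%s. indicator {0..t} s *\<^sub>R S s)"
   unfolding N2_def by (intro nn_integral_cong) (auto split: split_indicator)
  ultimately show "(\<integral>\<^sup>+ s\<in>{0..t}. ennreal ((norm (S s))\<^sup>2) \<partial>lborel) < \<infinity>" by simp
 qed (use that in auto)
 have Yi: "AE w in M. continuous_on {0..} (%t. Y t w $ i)" using Y(1) by eventually_elim (intro continuous_intros)
 have YJ: "AE w in M. Y t w $ i = ?J t w" if "t >= 0" for t using Y(2)[OF that] by eventually_elim simp
 have "\<forall>t. \<exists>W. t >= 0 \<longrightarrow> wi (%s. indicator {0..t} s *\<^sub>R (\<phi> s *\<^sub>R ?h s)) W \<and> (AE w in M. ?V t w = W w)"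
  using wi_by_parts[OF hc J Yi YJ d c] by blast
 from choice[OF this] obtain W where W: "\<forall>t. t >= 0 \<longrightarrow> wi (%s. indicator {0..t} s *\<^sub>R (\<phi> s *\<^sub>R ?h s)) (W t) \<and> (AE w in M. ?V t w = W t w)" by blast
 have fin: "(\<integral>\<^sup>+ s\<in>{0..}. ennreal ((norm (\<phi> s *\<^sub>R S s))\<^sup>2) \<partial>lborel) < \<infinity>"
  by (rule weighted_square_finite[OF S(2), where K = 1]) (simp only: norm_scaleR real_norm_def mult_1, rule mult_right_mono[OF b norm_ge_zero])
 show ?thesis
 proof (rule wi_converges[where h = "%s. \<phi> s *\<^sub>R ?h s" and W = W and V = ?V])
  show "continuous_on {0..} (%s. \<phi> s *\<^sub>R ?h s)" by (intro continuous_intros phic hc)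
  have "N2 lborel (%s. indicator {0..} s *\<^sub>R (\<phi> s *\<^sub>R ?h s)) <= N2 lborel (%s. indicator {0..} s *\<^sub>R (\<phi> s *\<^sub>R S s))"
   by (rule N2_mono) (auto intro!: mult_left_mono Finite_Cartesian_Product.norm_nth_le split: split_indicator)
  also have "... = (\<integral>\<^sup>+ s\<in>{0..}. ennreal ((norm (\<phi> s *\<^sub>R S s))\<^sup>2) \<partial>lborel)"
   unfolding N2_def by (intro nn_integral_cong) (auto split: split_indicator)
  finally show "N2 lborel (%s. indicator {0..} s *\<^sub>R (\<phi> s *\<^sub>R ?h s)) < \<infinity>" using fin by (rule le_less_trans)
  show "AE w in M. continuous_on {0..} (%t. ?V t w)"
   using Yi
  proof eventually_elim
   case (elim w)
   show ?case
    by (intro continuous_on_diff continuous_on_mult phic running_integral_continuous set_integrable_halfline_continuous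
      elim continuous_on_subset[OF c]) auto
  qed
  have "wi (%s. indicator {0..} s *\<^sub>R ((\<phi> s *\<^sub>R S s) $ i)) (%w. ito_integral M F B {0..} (%s _. \<phi> s *\<^sub>R S s) w $ i)"
   by (rule ito_integral_wi[OF _ _ fin]) (auto intro!: continuous_intros phic S)
  then show "wi (%s. indicator {0..} s *\<^sub>R (\<phi> s *\<^sub>R ?h s)) (%w. ito_integral M F B {0..} (%s _. \<phi> s *\<^sub>R S s) w $ i)"
   by (simp only: vector_scaleR_component)
 qed (use W in blast)+
qed

text \<open>Each of the three integrals selects its own version, so linearity holds only almost
  surely; it follows component by component from \<open>wi_unique\<close>.\<close>

lemma ito_integral_combination:
 fixes S :: "real => real^'e^'d" and A A' :: "real^'d^'m" and \<phi> \<psi> :: "real => real"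
 assumes S: "continuous_on {0..} S" "set_integrable lborel {0..} (%t. exp (- 2 * \<alpha> * t) * (norm (S t))\<^sup>2)"
  and phi: "continuous_on {0..} \<phi>" "!!s. \<bar>\<phi> s\<bar> <= exp (- \<alpha> * s)" and psi: "continuous_on {0..} \<psi>" "!!s. \<bar>\<psi> s\<bar> <= exp (- \<alpha> * s)"
 shows "AE w in M. ito_integral M F B {0..} (%s _. (\<phi> s *\<^sub>R A + \<psi> s *\<^sub>R A') ** S s) w
  = A *v ito_integral M F B {0..} (%s _. \<phi> s *\<^sub>R S s) w + A' *v ito_integral M F B {0..} (%s _. \<psi> s *\<^sub>R S s) w"
proof -
 let ?I = "%H. ito_integral M F B {0..} (%s _. H s)"
 let ?H = "%s. (\<phi> s *\<^sub>R A + \<psi> s *\<^sub>R A') ** S s"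
 have entry: "?H s $ i = (\<Sum>j\<in>UNIV. (A $ i $ j * \<phi> s + A' $ i $ j * \<psi> s) *\<^sub>R S s $ j)" for s i
  by (simp add: vec_eq_iff matrix_matrix_mult_def mult.commute)
 have Hc: "continuous_on {0..} ?H"
 proof -
  have "continuous_on {0..} (%s. ?H s $ i $ k)" for i k unfolding entry
   by (simp add: sum_component) (intro continuous_intros S phi psi)
  then have "continuous_on {0..} (%s. \<chi> i k. ?H s $ i $ k)" by (intro continuous_on_vec_lambda)
  then show ?thesis by simp
 qed
 obtain K where K: "K >= 0" "!!x y r (S :: real^'e^'d). \<bar>x\<bar> <= r ==> \<bar>y\<bar> <= r ==> norm ((x *\<^sub>R A + y *\<^sub>R A') ** S) <= K * (r * norm S)"
  using norm_matrix_combination_le[of A A'] by blast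
 have w1: "wi (%s. indicator {0..} s *\<^sub>R (?H s $ i)) (%w. ?I ?H w $ i)" for i
  by (rule ito_integral_wi[OF Hc _ weighted_square_finite[OF S(2), where K = K]]) (simp, rule K(2)[OF phi(2) psi(2)])
 have w2: "wi (%s. indicator {0..} s *\<^sub>R ((\<phi> s *\<^sub>R S s) $ j)) (%w. ?I (%s. \<phi> s *\<^sub>R S s) w $ j)" for j
  by (rule ito_integral_wi[OF _ _ weighted_square_finite[OF S(2), where K = 1]])
   (intro continuous_intros S phi, simp, simp only: norm_scaleR real_norm_def mult_1, rule mult_right_mono[OF phi(2) norm_ge_zero])
 have w3: "wi (%s. indicator {0..} s *\<^sub>R ((\<psi> s *\<^sub>R S s) $ j)) (%w. ?I (%s. \<psi> s *\<^sub>R S s) w $ j)" for j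
  by (rule ito_integral_wi[OF _ _ weighted_square_finite[OF S(2), where K = 1]])
   (intro continuous_intros S psi, simp, simp only: norm_scaleR real_norm_def mult_1, rule mult_right_mono[OF psi(2) norm_ge_zero])
 have "AE w in M. ?I ?H w $ i = (\<Sum>j\<in>UNIV. A $ i $ j * ?I (%s. \<phi> s *\<^sub>R S s) w $ j + A' $ i $ j * ?I (%s. \<psi> s *\<^sub>R S s) w $ j)" for i
 proof (rule wi_unique[OF w1 wi_sum[OF wi_add[OF wi_scale[OF w2] wi_scale[OF w3]]]])
  have "indicator {0..} s *\<^sub>R ?H s $ i = (\<Sum>j\<in>UNIV. A $ i $ j *\<^sub>R (indicator {0..} s *\<^sub>R (\<phi> s *\<^sub>R S s) $ j) + A' $ i $ j *\<^sub>R (indicator {0..} s *\<^sub>R (\<psi> s *\<^sub>R S s) $ j))" for s :: real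
   unfolding entry scaleR_sum_right by (intro sum.cong refl) (simp add: algebra_simps)
  then show "AE s in lborel. indicator {0..} s *\<^sub>R ?H s $ i = (\<Sum>j\<in>UNIV. A $ i $ j *\<^sub>R (indicator {0..} s *\<^sub>R (\<phi> s *\<^sub>R S s) $ j) + A' $ i $ j *\<^sub>R (indicator {0..} s *\<^sub>R (\<psi> s *\<^sub>R S s) $ j))"
   by simp
 qed
 then have "AE w in M. \<forall>i. ?I ?H w $ i = (\<Sum>j\<in>UNIV. A $ i $ j * ?I (%s. \<phi> s *\<^sub>R S s) w $ j + A' $ i $ j * ?I (%s. \<psi> s *\<^sub>R S s) w $ j)"
  by (intro eventually_all_finite)
 then show ?thesis
  by eventually_elim (simp add: vec_eq_iff matrix_vector_mult_def sum.distrib)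
qed

end

text \<open>Real and, up to sign, imaginary parts of the damped exponentials: stochastic integrals
  have real integrands here, so complex weights are handled through these two.\<close>

definition dcos :: "real => real => real => real" where "dcos \<alpha> b s = exp (- \<alpha> * s) * cos (b * s)"
definition dsin :: "real => real => real => real" where "dsin \<alpha> b s = exp (- \<alpha> * s) * sin (b * s)"

lemma dcos_le: "\<bar>dcos \<alpha> b s\<bar> <= exp (- \<alpha> * s)" and dsin_le: "\<bar>dsin \<alpha> b s\<bar> <= exp (- \<alpha> * s)"
 unfolding dcos_def dsin_def by (auto simp: abs_mult intro!: mult_left_le)

lemma dcos_deriv: "(dcos \<alpha> b has_real_derivative - \<alpha> * dcos \<alpha> b s - b * dsin \<alpha> b s) (at s)"
 and dsin_deriv: "(dsin \<alpha> b has_real_derivative - \<alpha> * dsin \<alpha> b s + b * dcos \<alpha> b s) (at s)"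
 unfolding dcos_def[abs_def] dsin_def[abs_def] by (auto intro!: derivative_eq_intros simp: algebra_simps)

lemma dcos_continuous: "continuous_on S (dcos \<alpha> b)" and dsin_continuous: "continuous_on S (dsin \<alpha> b)"
 unfolding dcos_def[abs_def] dsin_def[abs_def] by (intro continuous_intros)+

text \<open>Absolute value and sign separate the frequency from its orientation, so conjugate roots
  share the same two stochastic integrals.\<close>

lemma exp_dcos_dsin:
 "Re l = \<alpha> ==> exp (- l * of_real s) = of_real (dcos \<alpha> \<bar>Im l\<bar> s) - \<i> * of_real (sgn (Im l) * dsin \<alpha> \<bar>Im l\<bar> s)"
 by (auto simp: complex_eq_iff Re_exp Im_exp dcos_def dsin_def abs_if sgn_if)

text \<open>Multiplication by \<open>l\<close> turns the weight \<open>exp (- l * s)\<close> into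
  minus its derivative, which brings the weighted path into the form of the integration by parts
  formula, separately for the two real weights.\<close>

lemma exp_kernel_path:
 fixes y :: "real => real"
 assumes y: "continuous_on {0..} y" and l: "Re l = \<alpha>"
 shows "exp (- l * of_real t) * of_real (y t) + l * (LINT u:{0..t}|lborel. exp (- l * of_real u) * of_real (y u)) =
  of_real (dcos \<alpha> \<bar>Im l\<bar> t * y t - (LINT s:{0..t}|lborel. (- \<alpha> * dcos \<alpha> \<bar>Im l\<bar> s - \<bar>Im l\<bar> * dsin \<alpha> \<bar>Im l\<bar> s) * y s))
  - \<i> * of_real (sgn (Im l)) * of_real (dsin \<alpha> \<bar>Im l\<bar> t * y t - (LINT s:{0..t}|lborel. (- \<alpha> * dsin \<alpha> \<bar>Im l\<bar> s + \<bar>Im l\<bar> * dcos \<alpha> \<bar>Im l\<bar> s) * y s))"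
proof -
 let ?b = "\<bar>Im l\<bar>" and ?\<sigma> = "complex_of_real (sgn (Im l))"
 let ?C = "%s. (- \<alpha> * dcos \<alpha> ?b s - ?b * dsin \<alpha> ?b s) * y s" and ?S = "%s. (- \<alpha> * dsin \<alpha> ?b s + ?b * dcos \<alpha> ?b s) * y s"
 have i: "set_integrable lborel {0..t} (%s. complex_of_real (?C s))" "set_integrable lborel {0..t} (%s. complex_of_real (?S s))"
  by (intro set_integrable_halfline_continuous continuous_intros y dcos_continuous dsin_continuous)+
 have i': "set_integrable lborel {0..t} (%s. \<i> * ?\<sigma> * complex_of_real (?S s))" by (intro set_integrable_mult_right i(2))
 have e: "l * (exp (- l * of_real s) * of_real (y s)) = \<i> * ?\<sigma> * of_real (?S s) - of_real (?C s)" for s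
  unfolding exp_dcos_dsin[OF l] using l by (auto simp: complex_eq_iff sgn_if abs_if algebra_simps)
 have "l * (LINT u:{0..t}|lborel. exp (- l * of_real u) * of_real (y u)) = (LINT u:{0..t}|lborel. l * (exp (- l * of_real u) * of_real (y u)))"
  by (rule set_integral_mult_right[symmetric])
 also have "... = (LINT u:{0..t}|lborel. \<i> * ?\<sigma> * of_real (?S u)) - (LINT u:{0..t}|lborel. of_real (?C u))"
  unfolding e by (rule set_integral_diff(2)[OF i' i(1)])
 also have "(LINT u:{0..t}|lborel. \<i> * ?\<sigma> * of_real (?S u)) = \<i> * ?\<sigma> * of_real (LINT u:{0..t}|lborel. ?S u)"
  unfolding set_integral_complex_of_real[symmetric] by (rule set_integral_mult_right)
 also have "(LINT u:{0..t}|lborel. complex_of_real (?C u)) = of_real (LINT u:{0..t}|lborel. ?C u)" by (rule set_integral_complex_of_real)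
 finally have A: "l * (LINT u:{0..t}|lborel. exp (- l * of_real u) * of_real (y u)) = \<i> * ?\<sigma> * of_real (LINT u:{0..t}|lborel. ?S u) - of_real (LINT u:{0..t}|lborel. ?C u)" .
 define IS where "IS = (LINT u:{0..t}|lborel. ?S u)"
 define IC where "IC = (LINT u:{0..t}|lborel. ?C u)"
 show ?thesis unfolding A unfolding exp_dcos_dsin[OF l, of t] IS_def[symmetric] IC_def[symmetric] by (simp add: algebra_simps)
qed

lemma set_integral_at_top:
 fixes g :: "real => 'b::{banach, second_countable_topology}"
 assumes "set_integrable lborel {0..} g"
 shows "((%t. LINT u:{0..t}|lborel. g u) \<longlongrightarrow> (LINT u:{0..}|lborel. g u)) at_top"
proof -
 have e: "indicator {..t} x *\<^sub>R (indicator {0..} x *\<^sub>R g x) = indicator {0..t} x *\<^sub>R g x" for t x :: real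
  by (auto split: split_indicator)
 show ?thesis
  using tendsto_integral_at_top[of lborel "%x. indicator {0..} x *\<^sub>R g x"] assms
  unfolding set_integrable_def set_lebesgue_integral_def e by simp
qed

lemma set_integrable_dominated_halfline:
 fixes g :: "real => 'b::{banach, second_countable_topology}" and \<phi> :: "real => real"
 assumes g: "continuous_on {0..} g" and \<phi>: "continuous_on {0..} \<phi>" "!!s. \<bar>\<phi> s\<bar> <= w s"
  and i: "set_integrable lborel {0..} (%t. w t * norm (g t))"
 shows "set_integrable lborel {0..} (%s. \<phi> s *\<^sub>R g s)"
 unfolding set_integrable_def
proof (rule Bochner_Integration.integrable_bound)
 show "integrable lborel (%t. indicator {0..} t *\<^sub>R (w t * norm (g t)))" using i by (simp only: set_integrable_def)
 have "(%s. indicator {0..} s *\<^sub>R (\<phi> s *\<^sub>R g s)) \<in> borel_measurable borel"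
  by (rule borel_measurable_continuous_on_indicator) (auto intro!: continuous_intros g \<phi>)
 then show "(%s. indicator {0..} s *\<^sub>R (\<phi> s *\<^sub>R g s)) \<in> borel_measurable lborel" by simp
 have "\<bar>\<phi> s\<bar> * norm (g s) <= \<bar>w s * norm (g s)\<bar>" for s
  by (rule order_trans[OF mult_right_mono[OF \<phi>(2) norm_ge_zero] abs_ge_self])
 then show "AE s in lborel. norm (indicator {0..} s *\<^sub>R (\<phi> s *\<^sub>R g s)) <= norm (indicator {0..} s *\<^sub>R (w s * norm (g s)))"
  by (auto split: split_indicator)
qed

lemma set_integral_matrix_combination:
 fixes A A' :: "real^'d^'m" and g h :: "real => real^'d"
 assumes "set_integrable N X g" "set_integrable N X h"
 shows "(LINT s:X|N. A *v g s + A' *v h s) = A *v (LINT s:X|N. g s) + A' *v (LINT s:X|N. h s)"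
proof -
 have i: "set_integrable N X (%s. A *v g s)" "(LINT s:X|N. A *v g s) = A *v (LINT s:X|N. g s)" if "set_integrable N X g" for A :: "real^'d^'m" and g
 proof -
  have "bounded_linear ((*v) A)" by (rule matrix_vector_mul_bounded_linear)
  moreover have "indicator X s *\<^sub>R (A *v g s) = A *v (indicator X s *\<^sub>R g s)" for s by (auto split: split_indicator)
  ultimately show "set_integrable N X (%s. A *v g s)" "(LINT s:X|N. A *v g s) = A *v (LINT s:X|N. g s)"
   using that integrable_bounded_linear[of "(*v) A" N "%s. indicator X s *\<^sub>R g s"] integral_bounded_linear[of "(*v) A" N "%s. indicator X s *\<^sub>R g s"]
   unfolding set_integrable_def set_lebesgue_integral_def by simp_all
 qed
 show ?thesis using set_integral_add(2)[OF i(1)[OF assms(1)] i(1)[OF assms(2)]] i(2) assms by simp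
qed

text \<open>The terms of conjugate roots have equal real parts, so each pair counts as twice its
  upper member and a real root counts once. This is the origin of the factor \<open>2\<close> in
  \<open>P_star\<close> and \<open>Q_star\<close>.\<close>

lemma sum_cnj_pairs:
 fixes T :: "complex => complex"
 assumes fin: "finite \<Lambda>" and cl: "!!l. l \<in> \<Lambda> ==> cnj l \<in> \<Lambda>" and T: "!!l. l \<in> \<Lambda> ==> Re (T (cnj l)) = Re (T l)"
 shows "Re (\<Sum>l\<in>\<Lambda>. T l) = (\<Sum>l\<in>{l\<in>\<Lambda>. 0 <= Im l}. (if Im l = 0 then 1 else 2) * Re (T l))"
proof -
 let ?U = "{l\<in>\<Lambda>. 0 <= Im l}" and ?P = "{l\<in>\<Lambda>. 0 < Im l}" and ?N = "{l\<in>\<Lambda>. Im l < 0}"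
 have "(\<Sum>l\<in>\<Lambda>. Re (T l)) = (\<Sum>l\<in>?U. Re (T l)) + (\<Sum>l\<in>?N. Re (T l))"
  by (subst sum.union_disjoint[symmetric]) (use fin in \<open>auto intro!: sum.cong\<close>)
 also have "(\<Sum>l\<in>?N. Re (T l)) = (\<Sum>l\<in>?P. Re (T l))"
  by (rule sum.reindex_bij_witness[of _ cnj cnj]) (use cl T in auto)
 also have "(\<Sum>l\<in>?P. Re (T l)) = (\<Sum>l\<in>?U. if Im l = 0 then 0 else Re (T l))"
  by (rule sum.mono_neutral_cong_left) (use fin in auto)
 also have "(\<Sum>l\<in>?U. Re (T l)) + ... = (\<Sum>l\<in>?U. (if Im l = 0 then 1 else 2) * Re (T l))"
  by (subst sum.distrib[symmetric]) (intro sum.cong refl, auto)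
 finally show ?thesis by simp
qed

text \<open>\<open>R\<close> and \<open>V\<close> stand for the data weighted with cosine and sine
  at a frequency. Roots outside \<open>leading_roots\<close> drop out by \<open>zero\<close>, the
  division by \<open>fact n\<close> cancels the normalisation in \<open>lau\<close>, and the real
  part of the remaining product is the combination of sine and cosine.\<close>

lemma (in spectral_split) dominant_term_sum:
 fixes R V :: "real => real^'d"
 shows "Re (\<Sum>l\<in>\<Lambda>. (\<Sum>j\<in>UNIV. c i j l n * (of_real (R \<bar>Im l\<bar> $ j) - \<i> * of_real (sgn (Im l) * V \<bar>Im l\<bar> $ j))) / fact n * cis (Im l * t))
  = (\<Sum>z\<in>leading_roots \<mu>. sin (Im z * t) *\<^sub>R (Q_star \<mu> n z *v R (Im z) + P_star \<mu> n z *v V (Im z))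
    + cos (Im z * t) *\<^sub>R (P_star \<mu> n z *v R (Im z) - Q_star \<mu> n z *v V (Im z))) $ i"
proof -
 let ?L = "%l j. complex_of_real (R \<bar>Im l\<bar> $ j) - \<i> * of_real (sgn (Im l) * V \<bar>Im l\<bar> $ j)"
 define T where "T l = (\<Sum>j\<in>UNIV. c i j l n * ?L l j) / fact n * cis (Im l * t)" for l
 have Tc: "T (cnj l) = cnj (T l)" if "l \<in> \<Lambda>" for l
  unfolding T_def by (simp add: cc[OF that] cis_cnj sgn_minus)
 have "Re (\<Sum>l\<in>\<Lambda>. T l) = (\<Sum>l\<in>{l\<in>\<Lambda>. 0 <= Im l}. (if Im l = 0 then 1 else 2) * Re (T l))"
  by (rule sum_cnj_pairs[OF fin cl]) (simp_all add: Tc)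
 also have "... = (\<Sum>l\<in>leading_roots \<mu>. (if Im l = 0 then 1 else 2) * Re (T l))"
  by (rule sum.mono_neutral_right) (use fin lead zero in \<open>auto simp: T_def\<close>)
 also have "... = (\<Sum>z\<in>leading_roots \<mu>. (sin (Im z * t) *\<^sub>R (Q_star \<mu> n z *v R (Im z) + P_star \<mu> n z *v V (Im z))
    + cos (Im z * t) *\<^sub>R (P_star \<mu> n z *v R (Im z) - Q_star \<mu> n z *v V (Im z))) $ i)"
 proof (rule sum.cong[OF refl])
  fix z assume z: "z \<in> leading_roots \<mu>"
  then have zL: "z \<in> \<Lambda>" "0 <= Im z" using lead by auto
  define K where "K j = laurent_matrix \<mu> z n $ i $ j" for j
  define w :: real where "w = (if Im z = 0 then 1 else 2)"
  have "T z = (\<Sum>j\<in>UNIV. K j * ?L z j) * cis (Im z * t)"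
   unfolding T_def lau[OF zL] K_def mult.assoc sum_distrib_left[symmetric] by simp
  then have "w * Re (T z) = (\<Sum>j\<in>UNIV. w * Re (K j * ?L z j * cis (Im z * t)))"
   by (simp only: sum_distrib_right Re_sum sum_distrib_left)
  also have "... = (\<Sum>j\<in>UNIV. sin (Im z * t) * (Q_star \<mu> n z $ i $ j * R (Im z) $ j + P_star \<mu> n z $ i $ j * V (Im z) $ j)
    + cos (Im z * t) * (P_star \<mu> n z $ i $ j * R (Im z) $ j - Q_star \<mu> n z $ i $ j * V (Im z) $ j))"
  proof (rule sum.cong[OF refl])
   fix j
   show "w * Re (K j * ?L z j * cis (Im z * t)) = sin (Im z * t) * (Q_star \<mu> n z $ i $ j * R (Im z) $ j + P_star \<mu> n z $ i $ j * V (Im z) $ j)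
    + cos (Im z * t) * (P_star \<mu> n z $ i $ j * R (Im z) $ j - Q_star \<mu> n z $ i $ j * V (Im z) $ j)"
    using zL(2) by (cases "Im z = 0") (simp_all add: w_def K_def P_star_def Q_star_def algebra_simps)
  qed
  also have "... = (sin (Im z * t) *\<^sub>R (Q_star \<mu> n z *v R (Im z) + P_star \<mu> n z *v V (Im z))
    + cos (Im z * t) *\<^sub>R (P_star \<mu> n z *v R (Im z) - Q_star \<mu> n z *v V (Im z))) $ i"
   by (simp add: matrix_vector_mult_def sum.distrib sum_subtractf sum_distrib_left right_diff_distrib distrib_left)
  finally show "(if Im z = 0 then 1 else 2) * Re (T z) = (sin (Im z * t) *\<^sub>R (Q_star \<mu> n z *v R (Im z) + P_star \<mu> n z *v V (Im z))
    + cos (Im z * t) *\<^sub>R (P_star \<mu> n z *v R (Im z) - Q_star \<mu> n z *v V (Im z))) $ i"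
   unfolding w_def by simp
 qed
 finally show ?thesis unfolding T_def by (simp only: sum_component)
qed

theorem theorem7:
  fixes M :: "'a measure" and F :: "real \<Rightarrow> 'a measure"
    and B :: "real \<Rightarrow> 'a \<Rightarrow> real^'e"
    and \<mu> :: "real set \<Rightarrow> real^'d^'d"
    and f :: "real \<Rightarrow> real^'d" and \<Sigma> :: "real \<Rightarrow> real^'e^'d"
    and X0 :: "'a \<Rightarrow> real^'d" and X :: "real \<Rightarrow> 'a \<Rightarrow> real^'d"
    and \<alpha> :: real and n :: nat
    and P Q :: "complex \<Rightarrow> real^'d^'d"
    and M1 M2 :: "complex \<Rightarrow> 'a \<Rightarrow> real^'d"
  assumes "prob_space M" and "complete_measure M"
    and "time_filtration M F"
    and "brownian_motion M F B"
    and "matrix_measure \<mu>"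
    and "laplace_abscissa \<mu> < spectral_abscissa \<mu>"
    and \<alpha>_eq: "\<alpha> = real_of_ereal (spectral_abscissa \<mu>)"
    and n_eq: "n = max_root_order \<mu> - 1"
    and P_eq: "P = P_star \<mu> n" and Q_eq: "Q = Q_star \<mu> n"
    and "continuous_on {0..} f"
    and "set_integrable lborel {0..} (\<lambda>t. exp (- \<alpha> * t) * norm (f t))"
    and "continuous_on {0..} \<Sigma>"
    and "set_integrable lborel {0..} (\<lambda>t. exp (- 2 * \<alpha> * t) * (norm (\<Sigma> t))\<^sup>2)"
    and "X0 \<in> borel_measurable (F 0)"
    and "integrable M (\<lambda>\<omega>. (norm (X0 \<omega>))\<^sup>2)"
    and "sfde_solution M F B \<mu> f \<Sigma> X0 X"
    and M1_eq: "M1 = (\<lambda>z \<omega>.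
          ito_integral M F B {0..}
            (\<lambda>s _. exp (- \<alpha> * s) *\<^sub>R ((sin (Im z * s) *\<^sub>R P z + cos (Im z * s) *\<^sub>R Q z) ** \<Sigma> s)) \<omega>
          + (LINT s:{0..}|lborel.
               exp (- \<alpha> * s) *\<^sub>R ((sin (Im z * s) *\<^sub>R P z + cos (Im z * s) *\<^sub>R Q z) *v f s)))"
    and M2_eq: "M2 = (\<lambda>z \<omega>.
          ito_integral M F B {0..}
            (\<lambda>s _. exp (- \<alpha> * s) *\<^sub>R ((cos (Im z * s) *\<^sub>R P z - sin (Im z * s) *\<^sub>R Q z) ** \<Sigma> s)) \<omega>
          + (LINT s:{0..}|lborel.
               exp (- \<alpha> * s) *\<^sub>R ((cos (Im z * s) *\<^sub>R P z - sin (Im z * s) *\<^sub>R Q z) *v f s)))"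
  shows "AE \<omega> in M.
    ((\<lambda>t. X t \<omega> /\<^sub>R (t ^ n * exp (\<alpha> * t))
          - (\<Sum>z\<in>leading_roots \<mu>.
               sin (Im z * t) *\<^sub>R (Q z *v X0 \<omega> + M1 z \<omega>)
             + cos (Im z * t) *\<^sub>R (P z *v X0 \<omega> + M2 z \<omega>))) \<longlongrightarrow> 0) at_top"
proof -
 interpret brownian M F B using assms(1,3,4) by (simp add: brownian_def brownian_axioms_def)
 note fc = assms(11) and fi = assms(12) and Sc = assms(13) and S2 = assms(14) and sol = assms(17)
 obtain a \<gamma>0 \<gamma> p \<Lambda> H C G c where "spectral_split \<mu> \<alpha> n a \<gamma>0 \<gamma> p \<Lambda> H C G c"
  by (rule spectral_decomposition[OF assms(5-8)])
 then interpret S: spectral_split \<mu> \<alpha> n a \<gamma>0 \<gamma> p \<Lambda> H C G c .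
 define J1 where "J1 b = ito_integral M F B {0..} (%s _. dcos \<alpha> b s *\<^sub>R \<Sigma> s)" for b
 define J2 where "J2 b = ito_integral M F B {0..} (%s _. dsin \<alpha> b s *\<^sub>R \<Sigma> s)" for b
 define D1 where "D1 b = (LINT s:{0..}|lborel. dcos \<alpha> b s *\<^sub>R f s)" for b
 define D2 where "D2 b = (LINT s:{0..}|lborel. dsin \<alpha> b s *\<^sub>R f s)" for b
 have D1i: "set_integrable lborel {0..} (%s. dcos \<alpha> b s *\<^sub>R f s)" and D2i: "set_integrable lborel {0..} (%s. dsin \<alpha> b s *\<^sub>R f s)" for b
  by (rule set_integrable_dominated_halfline[OF fc dcos_continuous dcos_le fi] set_integrable_dominated_halfline[OF fc dsin_continuous dsin_le fi])+
 \<comment> \<open>The residual is continuous on every path on which \<open>X\<close> is, while at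
   each fixed time it agrees almost surely with the selected version of the stochastic
   integral.\<close>
 define Y where "Y t w = X t w - X0 w - (LINT u:{0..t}|lborel. f u + delay_term \<mu> (%s. X s w) u)" for t w
 have Xc: "AE w in M. continuous_on {0..} (%t. X t w)" using sol by (simp add: sfde_solution_def)
 have Yc: "AE w in M. continuous_on {0..} (%t. Y t w)"
  using Xc by eventually_elim (rule path_volterra(1)[OF S.kp S.km _ fc Y_def])
 have Yito: "AE w in M. Y t w = ito_integral M F B {0..t} (%s _. \<Sigma> s) w" if "t >= 0" for t
 proof -
  have "AE w in M. X t w = X0 w + (LINT u:{0..t}|lborel. f u + delay_term \<mu> (%s. X s w) u) + ito_integral M F B {0..t} (%s _. \<Sigma> s) w"
   using sol that by (simp add: sfde_solution_def)
  then show ?thesis by eventually_elim (simp add: Y_def)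
 qed
 \<comment> \<open>A finite set of frequencies, including \<open>0\<close> from the point \<alpha>,
   so that the almost sure statements can be intersected.\<close>
 let ?B = "(%l. \<bar>Im l\<bar>) ` insert (complex_of_real \<alpha>) \<Lambda>"
 have cont: "continuous_on UNIV (%s. - \<alpha> * dcos \<alpha> b s - b * dsin \<alpha> b s)" "continuous_on UNIV (%s. - \<alpha> * dsin \<alpha> b s + b * dcos \<alpha> b s)" for b
  by (intro continuous_intros dcos_continuous dsin_continuous)+
 have "AE w in M. \<forall>b\<in>?B. \<forall>i. ((%t. dcos \<alpha> b t * Y t w $ i - (LINT s:{0..t}|lborel. (- \<alpha> * dcos \<alpha> b s - b * dsin \<alpha> b s) * Y s w $ i)) \<longlongrightarrow> J1 b w $ i) at_top"
  unfolding J1_def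
  by (intro eventually_ball_finite ballI eventually_all_finite wi_path_limit[OF Sc S2 Yc Yito dcos_deriv cont(1) dcos_le]) (use S.fin in simp_all)
 moreover have "AE w in M. \<forall>b\<in>?B. \<forall>i. ((%t. dsin \<alpha> b t * Y t w $ i - (LINT s:{0..t}|lborel. (- \<alpha> * dsin \<alpha> b s + b * dcos \<alpha> b s) * Y s w $ i)) \<longlongrightarrow> J2 b w $ i) at_top"
  unfolding J2_def
  by (intro eventually_ball_finite ballI eventually_all_finite wi_path_limit[OF Sc S2 Yc Yito dsin_deriv cont(2) dsin_le]) (use S.fin in simp_all)
 moreover have "AE w in M. \<forall>z\<in>leading_roots \<mu>. M1 z w = (P z *v J2 (Im z) w + Q z *v J1 (Im z) w) + (P z *v D2 (Im z) + Q z *v D1 (Im z))"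
 proof (intro eventually_ball_finite ballI)
  fix z
  have e: "(%s (_::'a). exp (- \<alpha> * s) *\<^sub>R ((sin (Im z * s) *\<^sub>R P z + cos (Im z * s) *\<^sub>R Q z) ** \<Sigma> s))
    = (%s _. (dsin \<alpha> (Im z) s *\<^sub>R P z + dcos \<alpha> (Im z) s *\<^sub>R Q z) ** \<Sigma> s)"
   by (simp add: fun_eq_iff vec_eq_iff matrix_matrix_mult_def dcos_def dsin_def sum_distrib_left algebra_simps)
  have e': "exp (- \<alpha> * s) *\<^sub>R ((sin (Im z * s) *\<^sub>R P z + cos (Im z * s) *\<^sub>R Q z) *v f s) = P z *v (dsin \<alpha> (Im z) s *\<^sub>R f s) + Q z *v (dcos \<alpha> (Im z) s *\<^sub>R f s)" for s
   by (simp add: vec_eq_iff matrix_vector_mult_def dcos_def dsin_def sum_distrib_left sum.distrib[symmetric] algebra_simps)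
  from ito_integral_combination[OF Sc S2 dsin_continuous dsin_le dcos_continuous dcos_le, of "Im z" "P z" "Im z" "Q z"]
  show "AE w in M. M1 z w = (P z *v J2 (Im z) w + Q z *v J1 (Im z) w) + (P z *v D2 (Im z) + Q z *v D1 (Im z))"
   unfolding M1_eq e e' J1_def J2_def D1_def D2_def set_integral_matrix_combination[OF D2i D1i]
   by eventually_elim simp
 qed (use finite_subset[OF S.lead(1) S.fin] in simp)
 \<comment> \<open>The minus sign is moved into the matrix, so that the combination lemmas apply to
   \<open>M2\<close> as they do to \<open>M1\<close>.\<close>
 moreover have "AE w in M. \<forall>z\<in>leading_roots \<mu>. M2 z w = (P z *v J1 (Im z) w + (- Q z) *v J2 (Im z) w) + (P z *v D1 (Im z) + (- Q z) *v D2 (Im z))"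
 proof (intro eventually_ball_finite ballI)
  fix z
  have e: "(%s (_::'a). exp (- \<alpha> * s) *\<^sub>R ((cos (Im z * s) *\<^sub>R P z - sin (Im z * s) *\<^sub>R Q z) ** \<Sigma> s))
    = (%s _. (dcos \<alpha> (Im z) s *\<^sub>R P z + dsin \<alpha> (Im z) s *\<^sub>R (- Q z)) ** \<Sigma> s)"
   by (simp add: fun_eq_iff vec_eq_iff matrix_matrix_mult_def dcos_def dsin_def sum_distrib_left algebra_simps)
  have e': "exp (- \<alpha> * s) *\<^sub>R ((cos (Im z * s) *\<^sub>R P z - sin (Im z * s) *\<^sub>R Q z) *v f s) = P z *v (dcos \<alpha> (Im z) s *\<^sub>R f s) + (- Q z) *v (dsin \<alpha> (Im z) s *\<^sub>R f s)" for s
   by (simp add: vec_eq_iff matrix_vector_mult_def dcos_def dsin_def sum_distrib_left sum.distrib[symmetric] algebra_simps)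
  from ito_integral_combination[OF Sc S2 dcos_continuous dcos_le dsin_continuous dsin_le, of "Im z" "P z" "Im z" "- Q z"]
  show "AE w in M. M2 z w = (P z *v J1 (Im z) w + (- Q z) *v J2 (Im z) w) + (P z *v D1 (Im z) + (- Q z) *v D2 (Im z))"
   unfolding M2_eq e e' J1_def J2_def D1_def D2_def set_integral_matrix_combination[OF D1i D2i]
   by eventually_elim simp
 qed (use finite_subset[OF S.lead(1) S.fin] in simp)
 ultimately show ?thesis
  using Xc Yc
 proof eventually_elim
  case (elim w)
  \<comment> \<open>\<open>R\<close> gathers the initial value and everything integrated against the
    damped cosine, \<open>V\<close> everything integrated against the damped sine.\<close>
  define R where "R b = X0 w + D1 b + J1 b w" for b
  define V where "V b = D2 b + J2 b w" for b
  let ?S = "%t. \<Sum>z\<in>leading_roots \<mu>. sin (Im z * t) *\<^sub>R (Q z *v X0 w + M1 z w) + cos (Im z * t) *\<^sub>R (P z *v X0 w + M2 z w)"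
  let ?A = "%l j. complex_of_real (R \<bar>Im l\<bar> $ j) - \<i> * of_real (sgn (Im l) * V \<bar>Im l\<bar> $ j)"
  have reA: "Re l = \<alpha>" if "l \<in> insert (complex_of_real \<alpha>) \<Lambda>" for l using that S.re by auto
  have neg: "(- A) *v x = - (A *v x)" for A :: "real^'d^'d" and x by (simp add: vec_eq_iff matrix_vector_mult_def sum_negf)
  have SRV: "?S t = (\<Sum>z\<in>leading_roots \<mu>. sin (Im z * t) *\<^sub>R (Q_star \<mu> n z *v R (Im z) + P_star \<mu> n z *v V (Im z))
    + cos (Im z * t) *\<^sub>R (P_star \<mu> n z *v R (Im z) - Q_star \<mu> n z *v V (Im z)))" for t
  proof (rule sum.cong[OF refl])
   fix z assume "z \<in> leading_roots \<mu>"
   then have m: "M1 z w = (P z *v J2 (Im z) w + Q z *v J1 (Im z) w) + (P z *v D2 (Im z) + Q z *v D1 (Im z))"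
    "M2 z w = (P z *v J1 (Im z) w + (- Q z) *v J2 (Im z) w) + (P z *v D1 (Im z) + (- Q z) *v D2 (Im z))"
    using elim(3,4) by blast+
   have "Q z *v X0 w + M1 z w = Q z *v R (Im z) + P z *v V (Im z)" "P z *v X0 w + M2 z w = P z *v R (Im z) - Q z *v V (Im z)"
    unfolding m R_def V_def neg by (simp_all add: matrix_vector_right_distrib)
   then show "sin (Im z * t) *\<^sub>R (Q z *v X0 w + M1 z w) + cos (Im z * t) *\<^sub>R (P z *v X0 w + M2 z w) =
     sin (Im z * t) *\<^sub>R (Q_star \<mu> n z *v R (Im z) + P_star \<mu> n z *v V (Im z)) + cos (Im z * t) *\<^sub>R (P_star \<mu> n z *v R (Im z) - Q_star \<mu> n z *v V (Im z))"
    by (simp only: P_eq Q_eq)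
  qed
  have dts: "Re (\<Sum>l\<in>\<Lambda>. (\<Sum>j\<in>UNIV. c i j l n * ?A l j) / fact n * cis (Im l * t)) = ?S t $ i" for i t
   unfolding SRV
   by (rule S.dominant_term_sum)
  have Ylim: "((%t. exp (- l * of_real t) * of_real (Y t w $ i) + l * (LINT u:{0..t}|lborel. exp (- l * of_real u) * of_real (Y u w $ i)))
    \<longlongrightarrow> of_real (J1 \<bar>Im l\<bar> w $ i) - \<i> * of_real (sgn (Im l)) * of_real (J2 \<bar>Im l\<bar> w $ i)) at_top"
   if l: "l \<in> insert (complex_of_real \<alpha>) \<Lambda>" for l i
  proof -
   have yc: "continuous_on {0..} (%t. Y t w $ i)" using elim(6) by (intro continuous_intros)
   show ?thesis unfolding exp_kernel_path[OF yc reA[OF l]]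
    using elim(1,2) l by (intro tendsto_diff tendsto_mult tendsto_const tendsto_of_real) blast+
  qed
  have flim: "((%t. LINT u:{0..t}|lborel. exp (- l * of_real u) * of_real (f u $ i)) \<longlongrightarrow>
    of_real (D1 \<bar>Im l\<bar> $ i) - \<i> * of_real (sgn (Im l)) * of_real (D2 \<bar>Im l\<bar> $ i)) at_top"
   if l: "l \<in> insert (complex_of_real \<alpha>) \<Lambda>" for l i
  proof -
   let ?b = "\<bar>Im l\<bar>"
   have c1: "continuous_on {0..} (%s. dcos \<alpha> ?b s *\<^sub>R f s)" and c2: "continuous_on {0..} (%s. dsin \<alpha> ?b s *\<^sub>R f s)"
    by (intro continuous_intros dcos_continuous dsin_continuous fc)+
   have "(LINT u:{0..t}|lborel. exp (- l * of_real u) * of_real (f u $ i)) =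
     of_real ((LINT u:{0..t}|lborel. dcos \<alpha> ?b u *\<^sub>R f u) $ i) - \<i> * of_real (sgn (Im l)) * of_real ((LINT u:{0..t}|lborel. dsin \<alpha> ?b u *\<^sub>R f u) $ i)" for t
   proof -
    have i: "set_integrable lborel {0..t} (%u. complex_of_real ((dcos \<alpha> ?b u *\<^sub>R f u) $ i))"
     "set_integrable lborel {0..t} (%u. \<i> * of_real (sgn (Im l)) * complex_of_real ((dsin \<alpha> ?b u *\<^sub>R f u) $ i))"
     by (intro set_integrable_halfline_continuous continuous_intros dcos_continuous dsin_continuous fc)+
    have e: "exp (- l * of_real u) * of_real (f u $ i) = of_real ((dcos \<alpha> ?b u *\<^sub>R f u) $ i) - \<i> * of_real (sgn (Im l)) * of_real ((dsin \<alpha> ?b u *\<^sub>R f u) $ i)" for u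
     unfolding exp_dcos_dsin[OF reA[OF l]] by (simp add: algebra_simps)
    show ?thesis unfolding e set_integral_diff(2)[OF i] set_integral_mult_right set_integral_complex_of_real
     by (simp only: set_integral_vec_nth(1)[OF set_integrable_halfline_continuous[OF c1]] set_integral_vec_nth(1)[OF set_integrable_halfline_continuous[OF c2]])
   qed
   then show ?thesis unfolding D1_def D2_def
    by (simp only:) (intro tendsto_diff tendsto_mult tendsto_const tendsto_of_real tendsto_vec_nth set_integral_at_top D1i D2i)
  qed
  have "((%t. (X t w /\<^sub>R (t ^ n * exp (\<alpha> * t)) - ?S t) $ i) \<longlongrightarrow> 0 $ i) at_top" for i
  proof -
   have "asym n \<alpha> \<Lambda> (%l. (\<Sum>j\<in>UNIV. c i j l n * (of_real (X0 w $ j)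
     + (of_real (D1 \<bar>Im l\<bar> $ j) - \<i> * of_real (sgn (Im l)) * of_real (D2 \<bar>Im l\<bar> $ j))
     + (of_real (J1 \<bar>Im l\<bar> w $ j) - \<i> * of_real (sgn (Im l)) * of_real (J2 \<bar>Im l\<bar> w $ j)))) / fact n) (causal (%t. X t w) i)"
    by (rule S.path_limit[OF elim(5) fc Y_def Ylim flim])
   moreover have "of_real (X0 w $ j) + (of_real (D1 \<bar>Im l\<bar> $ j) - \<i> * of_real (sgn (Im l)) * of_real (D2 \<bar>Im l\<bar> $ j))
     + (of_real (J1 \<bar>Im l\<bar> w $ j) - \<i> * of_real (sgn (Im l)) * of_real (J2 \<bar>Im l\<bar> w $ j)) = ?A l j" for l j
    by (simp add: R_def V_def algebra_simps)
   ultimately have "asym n \<alpha> \<Lambda> (%l. (\<Sum>j\<in>UNIV. c i j l n * ?A l j) / fact n) (causal (%t. X t w) i)"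
    by (simp only:)
   then have "((%t. Re (causal (%t. X t w) i t / of_real (t ^ n * exp (\<alpha> * t))
     - (\<Sum>l\<in>\<Lambda>. (\<Sum>j\<in>UNIV. c i j l n * ?A l j) / fact n * cis (Im l * t)))) \<longlongrightarrow> Re 0) at_top"
    unfolding asym_def by (rule tendsto_Re)
   moreover have "Re (causal (%t. X t w) i t / of_real (t ^ n * exp (\<alpha> * t))
     - (\<Sum>l\<in>\<Lambda>. (\<Sum>j\<in>UNIV. c i j l n * ?A l j) / fact n * cis (Im l * t))) = (X t w /\<^sub>R (t ^ n * exp (\<alpha> * t)) - ?S t) $ i" if "t >= 0" for t
   proof -
    have "causal (%t. X t w) i t / of_real (t ^ n * exp (\<alpha> * t)) = of_real (X t w $ i / (t ^ n * exp (\<alpha> * t)))"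
     using that by (simp add: causal_def)
    then have "Re (causal (%t. X t w) i t / of_real (t ^ n * exp (\<alpha> * t))) = (X t w /\<^sub>R (t ^ n * exp (\<alpha> * t))) $ i"
     by (simp only: Re_complex_of_real vector_scaleR_component real_scaleR_def divide_inverse mult.commute)
    then show ?thesis
     unfolding minus_complex.simps vector_minus_component dts by simp
   qed
   then have "\<forall>\<^sub>F t in at_top. Re (causal (%t. X t w) i t / of_real (t ^ n * exp (\<alpha> * t))
     - (\<Sum>l\<in>\<Lambda>. (\<Sum>j\<in>UNIV. c i j l n * ?A l j) / fact n * cis (Im l * t))) = (X t w /\<^sub>R (t ^ n * exp (\<alpha> * t)) - ?S t) $ i"
    by (rule eventually_at_top_linorderI)
   ultimately show ?thesis
    using Lim_transform_eventually[of "%t. Re (causal (%t. X t w) i t / of_real (t ^ n * exp (\<alpha> * t))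
     - (\<Sum>l\<in>\<Lambda>. (\<Sum>j\<in>UNIV. c i j l n * ?A l j) / fact n * cis (Im l * t)))"] by simp
  qed
  then show ?case by (rule vec_tendstoI)
 qed
qed

end
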